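(* Let $\alpha>-1$, $\sigma>0$ and $1\le p,q\le\infty$. (a) If $\alpha\ge-1/2$, then $I_D^{\alpha,\sigma}$ is bounded from $L^p(dw_\alpha)$ to $L^q(dw_\alpha)$ if and only if $$\frac1p-\frac{\sigma}{\alpha+1}\le\frac1q<\frac1p+\frac{\sigma}{\alpha+1}\quad\text{and}\quad\Big(\frac1p,\frac1q\Big)\notin\Big\{\Big(\frac{\sigma}{\alpha+1},0\Big),\Big(1,1-\frac{\sigma}{\alpha+1}\Big)\Big\}.$$ (b) If $\alpha<-1/2$, then $I_D^{\alpha,\sigma}$ is bounded from $L^p(dw_\alpha)$ to $L^q(dw_\alpha)$ if and only if $$\frac1p+\frac{\sigma}{\alpha}\le\frac1q<\frac1p+\frac{\sigma}{\alpha+1}.$$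
   Context: For $\alpha>-1$, let $w_\alpha$ be the measure $dw_\alpha(x)=|x|^{2\alpha+1}dx$ on $\mathbb{R}$. Let $I_\nu$ (one index) denote the modified Bessel function of the first kind of order $\nu$ and let $$\Phi_\alpha(u)=|u|^{-\alpha}\big[I_\alpha(|u|)+\operatorname{sgn}(u)I_{\alpha+1}(|u|)\big],\qquad u\in\mathbb{R},$$ with $\Phi_\alpha(0)=2^{-\alpha}/\Gamma(\alpha+1)$ (the limiting value). The Dunkl–Laguerre heat kernel is $$G_t^{\alpha,D}(x,y)=\frac12(\sinh 2t)^{-\alpha-1}\exp\Big(-\frac12\coth(2t)(x^2+y^2)\Big)\Phi_\alpha\Big(\frac{xy}{\sinh 2t}\Big),\qquad x,y\in\mathbb{R},\ t>0.$$ For $\sigma>0$ the potential kernel is $$K_D^{\alpha,\sigma}(x,y)=\frac1{\Gamma(\sigma)}\int_0^\infty G_t^{\alpha,D}(x,y)\,t^{\sigma-1}\,dt,\qquad x,y\in\mathbb{R},$$ and the potential operator is $$I_D^{\alpha,\sigma}f(x)=\int_{-\infty}^\infty K_D^{\alpha,\sigma}(x,y)f(y)\,dw_\alpha(y),\qquad x\in\mathbb{R},$$ on its natural domain (functions $f$ for which the integral converges for a.e. $x$). Boundedness from $L^p$ to $L^q$ means that $L^p$ is contained in the domain and $\|I_D^{\alpha,\sigma}f\|_{L^q(dw_\alpha)}\le C\|f\|_{L^p(dw_\alpha)}$ for all $f\in L^p(dw_\alpha)$ with $C$ independent of $f$. Convention: $1/\infty=0$. *)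

theory Defs
  imports "HOL-Probability.Essential_Supremum"
begin

text \<open>The power series of the modified Bessel function of the first kind of order \<open>\<nu>\<close>.
  For real \<open>\<nu>\<close> it is meant for \<open>z > 0\<close> only, because \<open>powr\<close> vanishes at base 0.\<close>

definition bessel_I :: "real \<Rightarrow> real \<Rightarrow> real" where
  "bessel_I \<nu> z = (\<Sum>k. (z / 2) powr (2 * real k + \<nu>) / (fact k * Gamma (real k + \<nu> + 1)))"

definition dunkl_measure :: "real \<Rightarrow> real measure" where
  "dunkl_measure \<alpha> = density lborel (\<lambda>x. ennreal (\<bar>x\<bar> powr (2 * \<alpha> + 1)))"

definition dunkl_Phi :: "real \<Rightarrow> real \<Rightarrow> real" where
  "dunkl_Phi \<alpha> u =
     (if u = 0 then 2 powr (-\<alpha>) / Gamma (\<alpha> + 1)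
      else \<bar>u\<bar> powr (-\<alpha>) * (bessel_I \<alpha> \<bar>u\<bar> + sgn u * bessel_I (\<alpha> + 1) \<bar>u\<bar>))"

definition dunkl_heat_kernel :: "real \<Rightarrow> real \<Rightarrow> real \<Rightarrow> real \<Rightarrow> real" where
  "dunkl_heat_kernel \<alpha> t x y =
     1 / 2 * sinh (2 * t) powr (-\<alpha> - 1)
       * exp (- (1 / 2) * (cosh (2 * t) / sinh (2 * t)) * (x\<^sup>2 + y\<^sup>2))
       * dunkl_Phi \<alpha> (x * y / sinh (2 * t))"

text \<open>The integral defining the kernel converges absolutely whenever \<open>x \<noteq> y\<close>. On the diagonal it
  may be \<open>+\<infinity>\<close>, where the Bochner integral returns 0 instead; for every \<open>x\<close> this concerns
  at most the single point \<open>y = x\<close>, which is a null set of \<open>dunkl_measure \<alpha>\<close>, so neither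
  the domain nor the values of the potential operator are affected.\<close>

definition dunkl_potential_kernel :: "real \<Rightarrow> real \<Rightarrow> real \<Rightarrow> real \<Rightarrow> real" where
  "dunkl_potential_kernel \<alpha> \<sigma> x y =
     1 / Gamma \<sigma> * (LBINT t:{0<..}. dunkl_heat_kernel \<alpha> t x y * t powr (\<sigma> - 1))"

definition dunkl_potential :: "real \<Rightarrow> real \<Rightarrow> (real \<Rightarrow> complex) \<Rightarrow> real \<Rightarrow> complex" where
  "dunkl_potential \<alpha> \<sigma> f x =
     (\<integral>y. dunkl_potential_kernel \<alpha> \<sigma> x y *\<^sub>R f y \<partial>dunkl_measure \<alpha>)"

definition dunkl_potential_domain :: "real \<Rightarrow> real \<Rightarrow> (real \<Rightarrow> complex) set" where
  "dunkl_potential_domain \<alpha> \<sigma> =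
     {f \<in> borel_measurable (dunkl_measure \<alpha>).
        AE x in dunkl_measure \<alpha>.
          integrable (dunkl_measure \<alpha>) (\<lambda>y. dunkl_potential_kernel \<alpha> \<sigma> x y *\<^sub>R f y)}"

text \<open>The extended-valued \<open>L\<^sup>p\<close> norm for \<open>1 \<le> p \<le> \<infinity>\<close>. The inner case distinction extends
  \<open>s \<mapsto> s powr (1 / p)\<close> to \<open>s = \<infinity>\<close>.\<close>

definition Lp_norm :: "ereal \<Rightarrow> 'a measure \<Rightarrow> ('a \<Rightarrow> 'b::real_normed_vector) \<Rightarrow> ennreal" where
  "Lp_norm p M f =
     (if p = \<infinity> then esssup M (\<lambda>x. ennreal (norm (f x)))
      else let s = \<integral>\<^sup>+x. ennreal (norm (f x) powr real_of_ereal p) \<partial>M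
           in if s = \<infinity> then \<infinity> else ennreal (enn2real s powr (1 / real_of_ereal p)))"

definition Lp_space :: "ereal \<Rightarrow> 'a measure \<Rightarrow> ('a \<Rightarrow> 'b::real_normed_vector) set" where
  "Lp_space p M = {f \<in> borel_measurable M. Lp_norm p M f < \<infinity>}"

definition dunkl_potential_bounded :: "real \<Rightarrow> real \<Rightarrow> ereal \<Rightarrow> ereal \<Rightarrow> bool" where
  "dunkl_potential_bounded \<alpha> \<sigma> p q \<longleftrightarrow>
     Lp_space p (dunkl_measure \<alpha>) \<subseteq> dunkl_potential_domain \<alpha> \<sigma> \<and>
     (\<exists>C::real. \<forall>f \<in> Lp_space p (dunkl_measure \<alpha>).
        Lp_norm q (dunkl_measure \<alpha>) (dunkl_potential \<alpha> \<sigma> f)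
          \<le> ennreal C * Lp_norm p (dunkl_measure \<alpha>) f)"

end

theory Submission
  imports Defs
begin

text \<open>
  Put \<open>a = 1/p\<close> and \<open>b = 1 - 1/q\<close>. A function in the unit ball of \<open>L\<^sup>p\<close> is dominated by \<open>\<phi>\<^sup>a\<close> for a
  density \<open>\<phi>\<close>, and dually for \<open>q\<close>. For a positive kernel, boundedness from \<open>L\<^sup>p\<close> to \<open>L\<^sup>q\<close> therefore means that the form
  \<open>\<integral> t\<^sup>\<sigma>\<^sup>-\<^sup>1 \<integral>\<integral> H(t,x,y) \<phi>(y)\<^sup>a \<psi>(x)\<^sup>b dw(y) dw(x) dt\<close> is bounded uniformly over densities \<open>\<phi>\<close> and \<open>\<psi>\<close>.
  Here \<open>H\<close> is the even part of the heat kernel, without its constant factor. The odd part of the Bessel factor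
  never dominates the even part (\<open>bessel_odd_le_even\<close>), so the heat kernel is at most a multiple of \<open>H\<close> in
  absolute value; and for \<open>x, y > 0\<close> it is at least a multiple of \<open>H\<close>. Hence an upper bound of the form for
  all densities gives boundedness (\<open>dunkl_potential_bounded_if_form_bounded\<close>), and boundedness gives an
  upper bound of the form for even densities (\<open>even_form_bounded_if_dunkl_potential_bounded\<close>). The exponents
  \<open>1\<close> and \<open>\<infinity>\<close> are covered by the powers \<open>1\<close> and \<open>0\<close>.

  Sufficiency. The Bessel series integrates term by term against Gaussians, which gives the marginals of \<open>H\<close>
  in closed form. Upper bounds of the form come from pointwise inequalities for \<open>\<phi>\<^sup>a \<psi>\<^sup>b\<close> followed by
  Tonelli's theorem.

  \<^item> If \<open>a + b \<le> 1\<close>, the inequality of weighted means is applied to \<open>\<phi>\<close>, \<open>\<psi>\<close> and \<open>sinh(2t)\<^sup>\<alpha>\<^sup>+\<^sup>1\<close>; what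
    remains is \<open>\<integral> t\<^sup>\<sigma>\<^sup>-\<^sup>1 sinh(2t)\<^sup>-\<^sup>k dt\<close> with \<open>k = (\<alpha>+1)(1-a-b)\<close>, which converges for
    \<open>0 < k < \<sigma>\<close>; for \<open>k = 0\<close> the exponential decay of the marginals of \<open>H\<close> suffices
    (\<open>form_bounded_if_q_le_p\<close>).

  \<^item> If \<open>a + b > 1\<close>, weighted means of \<open>\<phi>\<psi>L\<^sup>1\<^sup>-\<^sup>\<theta>\<close>, \<open>\<phi>L\<^sup>-\<^sup>\<theta>\<close> and \<open>\<psi>L\<^sup>-\<^sup>\<theta>\<close> are used, with \<open>\<theta> = a+b-1\<close> and \<open>1/L\<close>
    an upper bound of \<open>H\<close> (\<open>form_bounded_if_p_less_q\<close>). For \<open>\<alpha> \<ge> -1/2\<close> one can take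
    \<open>L = sinh(2t)\<^sup>\<alpha>\<^sup>+\<^sup>1\<close>. For \<open>\<alpha> < -1/2\<close> the kernel grows along the diagonal: near \<open>|x| = |y|\<close> it has size
    \<open>t\<^sup>-\<^sup>1\<^sup>/\<^sup>2 |x|\<^sup>-\<^sup>2\<^sup>\<alpha>\<^sup>-\<^sup>1\<close> until the Gaussian decay sets in at \<open>x\<^sup>2 = 1/t\<close>, where the size is \<open>t\<^sup>\<alpha>\<close>. This is why
    \<open>-\<alpha>\<close> takes the place of \<open>\<alpha>+1\<close> in the condition. The extremal region moves with \<open>t\<close>, so at fixed
    \<open>x\<close> the time integral converges on the boundary line as well (\<open>form_bounded_small_order\<close>).

  \<^item> For \<open>\<alpha> \<ge> -1/2\<close> the boundary line \<open>(\<alpha>+1)(a+b-1) = \<sigma>\<close> is of Hardy--Littlewood--Sobolev type. The splitting of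
    \<open>\<phi>\<^sup>a \<psi>\<^sup>b\<close> then has to depend on how \<open>t\<^sup>\<alpha>\<^sup>+\<^sup>1\<close> compares with \<open>1/\<phi>\<close> and \<open>1/\<psi>\<close>. The elementary inequality
    \<open>powr_product_le_tents\<close> makes every term decay away from the balanced scale, so that the scale-invariant
    integral over \<open>dt/t\<close> converges. The decay rate is \<open>min (1-a) (min (1-b) (a+b-1))\<close>, which vanishes exactly
    at the excluded points \<open>a = 1\<close> and \<open>b = 1\<close>.

  Necessity. Test densities show that every condition is sharp: concentrating Gaussians for the boundary line,
  the densities \<open>(1+x\<^sup>2)\<^sup>-\<^sup>\<alpha>\<^sup>-\<^sup>1\<^sup>-\<^sup>\<delta>\<close> with \<open>\<delta> \<rightarrow> 0\<close> for the strict inequality, densities with an almost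
  nonintegrable singularity at the origin against a concentrated Gaussian for the two excluded points (two
  concentrated Gaussians when these points coincide), and for
  \<open>\<alpha> < -1/2\<close> normalized indicators of \<open>R \<le> |x| \<le> R + 1/R\<close> with \<open>R \<rightarrow> \<infinity>\<close>. The first three families are
  compared at each time with suitable Gaussians (\<open>potential_form_ge_Gaussians\<close>).
\<close>

section \<open>Elementary inequalities\<close>

text \<open>Each logarithm is bounded by its tangent line at the weighted mean \<open>m\<close>; the weights then combine these
  bounds to \<open>ln m\<close>. Three factors suffice for all the splittings below.\<close>

lemma weighted_am_gm:
  fixes x y z a b c :: real
  assumes "x > 0" "y > 0" "z > 0" "a \<ge> 0" "b \<ge> 0" "c \<ge> 0" "a + b + c = 1"
  shows "x powr a * y powr b * z powr c \<le> a * x + b * y + c * z"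
proof -
  define m where "m = a * x + b * y + c * z"
  have "a > 0 \<or> b > 0 \<or> c > 0" using assms by linarith
  hence m: "m > 0"
    using assms mult_nonneg_nonneg[of a x] mult_nonneg_nonneg[of b y] mult_nonneg_nonneg[of c z]
      mult_pos_pos[of a x] mult_pos_pos[of b y] mult_pos_pos[of c z] unfolding m_def by argo
  have l: "ln u \<le> u / m - 1 + ln m" if "u > 0" for u
    using ln_le_minus_one[of "u / m"] that m by (simp add: ln_div)
  have "a * ln x + b * ln y + c * ln z
      \<le> a * (x / m - 1 + ln m) + b * (y / m - 1 + ln m) + c * (z / m - 1 + ln m)"
    using assms by (intro add_mono mult_left_mono l) auto
  also have "\<dots> = (a * x + b * y + c * z) / m + (a + b + c) * (ln m - 1)"
    by (simp add: algebra_simps add_divide_distrib)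
  also have "\<dots> = ln m" using m assms by (simp add: m_def[symmetric])
  finally have "exp (a * ln x + b * ln y + c * ln z) \<le> m" using m by (simp add: ln_ge_iff)
  thus ?thesis using assms by (simp add: powr_def exp_add m_def)
qed

text \<open>The point \<open>(a, b)\<close> lies inside the triangle with vertices \<open>(1,0)\<close>, \<open>(0,1)\<close>, \<open>(1,1)\<close>, and \<open>d\<close> bounds its
  barycentric coordinates \<open>1-b\<close>, \<open>1-a\<close>, \<open>a+b-1\<close> from below. Hence \<open>af + bh\<close> is a convex combination of
  \<open>f\<close>, \<open>h\<close>, \<open>f+h\<close> and stays below their maximum by at least \<open>d\<close> times the sum of the three gaps. That sum
  is at least \<open>|f|\<close> and at least \<open>|h|\<close>.\<close>

lemma log_triangle_gap:
  fixes f h a b d :: real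
  assumes "0 < d" "d \<le> 1 - a" "d \<le> 1 - b" "d \<le> a + b - 1"
  shows "a * f + b * h \<le> f - d * \<bar>f\<bar> \<or> a * f + b * h \<le> h - d * \<bar>h\<bar> \<or> a * f + b * h \<le> f + h - d * \<bar>f\<bar>"
proof -
  define M where "M = max f (max h (f + h))"
  have M: "M \<ge> f" "M \<ge> h" "M \<ge> f + h" by (auto simp: M_def)
  have "a * f + b * h = (a + b - 1) * (f + h) + (1 - b) * f + (1 - a) * h" by (simp add: algebra_simps)
  moreover have "M = (a + b - 1) * M + (1 - b) * M + (1 - a) * M" by (simp add: algebra_simps)
  ultimately have "M - (a * f + b * h) = (a + b - 1) * (M - (f + h)) + (1 - b) * (M - f) + (1 - a) * (M - h)"
    by (simp add: algebra_simps)
  also have "\<dots> \<ge> d * (M - (f + h)) + d * (M - f) + d * (M - h)"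
    using assms M by (intro add_mono mult_right_mono) auto
  finally have g: "M - (a * f + b * h) \<ge> d * ((M - (f + h)) + (M - f) + (M - h))" by (simp add: algebra_simps)
  have "(M - (f + h)) + (M - f) + (M - h) \<ge> \<bar>f\<bar>" "(M - (f + h)) + (M - f) + (M - h) \<ge> \<bar>h\<bar>"
    using M by linarith+
  hence "d * ((M - (f + h)) + (M - f) + (M - h)) \<ge> d * \<bar>f\<bar>" "d * ((M - (f + h)) + (M - f) + (M - h)) \<ge> d * \<bar>h\<bar>"
    using assms by (simp_all add: mult_left_mono)
  with g have "a * f + b * h \<le> M - d * \<bar>f\<bar>" "a * f + b * h \<le> M - d * \<bar>h\<bar>" by linarith+
  moreover have "M = f \<or> M = h \<or> M = f + h" by (auto simp: M_def max_def)
  ultimately show ?thesis by auto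
qed

text \<open>A bump at \<open>1\<close> on the multiplicative half-line: its powers decay exponentially in \<open>\<bar>ln x\<bar>\<close>, so they are
  integrable over all scales.\<close>

definition tent :: "real \<Rightarrow> real" where "tent x = min x (1 / x)"

lemma tent_powr: "x > 0 \<Longrightarrow> d > 0 \<Longrightarrow> tent x powr d = exp (- d * \<bar>ln x\<bar>)"
proof -
  assume x: "x > 0" "d > 0"
  show ?thesis
  proof (cases "x \<le> 1")
    case True
    hence "tent x = x" using x by (auto simp: tent_def min_def field_simps mult_le_one)
    thus ?thesis using x True by (simp add: powr_def ln_le_zero_iff)
  next
    case False
    hence "1 / x < x" using x by (simp add: field_simps less_1_mult)
    hence "tent x = 1 / x" by (auto simp: tent_def)
    thus ?thesis using x False by (simp add: powr_def ln_div)
  qed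
qed

text \<open>This is the exponential of the previous inequality with \<open>f = ln F\<close> and \<open>h = ln P\<close>. It takes the place of
  interpolation at the critical exponents: for \<open>F = \<phi>(y) \<tau>\<close> and \<open>P = \<psi>(x) \<tau>\<close>, each summand is small unless the
  scale \<open>\<tau>\<close> is comparable with \<open>1 / \<phi>(y)\<close> or \<open>1 / \<psi>(x)\<close>.\<close>

lemma powr_product_le_tents:
  fixes F P a b d :: real
  assumes "F > 0" "P > 0" "0 < d" "d \<le> 1 - a" "d \<le> 1 - b" "d \<le> a + b - 1"
  shows "F powr a * P powr b \<le> F * tent F powr d + P * tent P powr d + F * P * tent F powr d"
proof -
  have eq: "F powr a * P powr b = exp (a * ln F + b * ln P)"
    "F * tent F powr d = exp (ln F - d * \<bar>ln F\<bar>)" "P * tent P powr d = exp (ln P - d * \<bar>ln P\<bar>)"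
    "F * P * tent F powr d = exp (ln F + ln P - d * \<bar>ln F\<bar>)"
    using assms by (simp_all add: powr_def tent_powr[unfolded powr_def] tent_powr exp_add exp_diff exp_minus field_simps)
  have "0 \<le> exp u" for u :: real by simp
  thus ?thesis unfolding eq
    using log_triangle_gap[OF assms(3-6), of "ln F" "ln P"]
    by (smt (verit) exp_le_cancel_iff)
qed

section \<open>The even part of the Bessel kernel\<close>

text \<open>The entire even function \<open>(u/2)\<^sup>-\<^sup>\<nu> I\<^sub>\<nu>(u)\<close>. The singular power at the origin has been divided out, and the
  function makes sense for arguments of both signs.\<close>

definition bessel_even :: "real \<Rightarrow> real \<Rightarrow> real" where
  "bessel_even \<nu> u = (\<Sum>k. (u / 2) ^ (2 * k) / (fact k * Gamma (real k + \<nu> + 1)))"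

lemma Gamma_shift: 
  assumes "(z::real) > 0" shows "Gamma (real k + z) = Gamma z * pochhammer z k"
proof -
  have "z \<notin> \<int>\<^sub>\<le>\<^sub>0" using assms by auto
  thus ?thesis using pochhammer_Gamma[of z k] Gamma_real_pos[OF assms] by (simp add: add.commute)
qed

lemma pochhammer_lower:
  assumes "(z::real) > 0" shows "pochhammer z k \<ge> min 1 z"
proof (induction k)
  case (Suc k)
  show ?case
  proof (cases k)
    case (Suc j)
    have "pochhammer z k * 1 \<le> pochhammer z k * (z + real k)"
      using assms Suc by (intro mult_left_mono) (auto intro: less_imp_le pochhammer_pos)
    thus ?thesis using Suc.IH by (simp add: pochhammer_Suc)
  qed simp
qed simp

lemma bessel_even_summable:
  assumes "\<nu> > -1"
  shows "summable (\<lambda>k. (u / 2) ^ (2 * k) / (fact k * Gamma (real k + \<nu> + 1)))"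
proof (rule summable_comparison_test')
  define c where "c = Gamma (\<nu> + 1) * min 1 (\<nu> + 1)"
  have c: "c > 0" using assms by (auto simp: c_def)
  have *: "Gamma (real k + \<nu> + 1) \<ge> c" for k
    using Gamma_shift[of "\<nu> + 1" k] pochhammer_lower[of "\<nu> + 1" k] assms Gamma_real_pos[of "\<nu> + 1"]
    by (simp add: c_def add.assoc mult_left_mono)
  show "summable (\<lambda>k. (1 / c) * (inverse (fact k) * ((u / 2)\<^sup>2) ^ k))"
    by (intro summable_mult summable_exp)
  show "norm ((u / 2) ^ (2 * k) / (fact k * Gamma (real k + \<nu> + 1))) 
      \<le> (1 / c) * (inverse (fact k) * ((u / 2)\<^sup>2) ^ k)" for k
  proof -
    have "fact k * c \<le> fact k * Gamma (real k + \<nu> + 1)" using * by (intro mult_left_mono) auto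
    hence "((u / 2)\<^sup>2) ^ k / (fact k * Gamma (real k + \<nu> + 1)) \<le> ((u / 2)\<^sup>2) ^ k / (fact k * c)"
      using c * by (intro divide_left_mono) (auto intro!: mult_pos_pos less_le_trans[OF c *])
    moreover have "norm ((u / 2) ^ (2 * k) / (fact k * Gamma (real k + \<nu> + 1))) = ((u / 2)\<^sup>2) ^ k / (fact k * Gamma (real k + \<nu> + 1))"
      using less_le_trans[OF c *[of k]] by (simp add: power_mult)
    moreover have "((u / 2)\<^sup>2) ^ k / (fact k * c) = (1 / c) * (inverse (fact k) * ((u / 2)\<^sup>2) ^ k)" by (simp add: field_simps)
    ultimately show ?thesis by linarith
  qed
qed

lemma bessel_even_term_nonneg:
  assumes "\<nu> > -1" shows "(u / 2) ^ (2 * k) / (fact k * Gamma (real k + \<nu> + 1)) \<ge> 0"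
  using assms by (intro divide_nonneg_pos mult_pos_pos Gamma_real_pos) (auto simp: power_mult)

lemma bessel_even_pos:
  assumes "\<nu> > -1" shows "bessel_even \<nu> u > 0"
  unfolding bessel_even_def
  using bessel_even_summable[OF assms] bessel_even_term_nonneg[OF assms]
  by (rule suminf_pos2[where i = 0]) (use assms in auto)

lemma bessel_even_abs: "bessel_even \<nu> \<bar>u\<bar> = bessel_even \<nu> u"
  by (simp add: bessel_even_def power_mult power_divide)

lemma borel_measurable_bessel_even [measurable]:
  "bessel_even \<nu> \<in> borel_measurable borel"
  unfolding bessel_even_def by measurable

text \<open>Both summands of the Bessel factor are restored to entire functions, one even and one odd; the prescribed
  value at \<open>0\<close> is the value of this formula.\<close>

lemma dunkl_Phi_eq:
  assumes "\<nu> > -1"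
  shows "dunkl_Phi \<nu> u = 2 powr (-\<nu>) * (bessel_even \<nu> u + (u / 2) * bessel_even (\<nu> + 1) u)"
proof (cases "u = 0")
  case True
  have "(\<lambda>k. (0::real) ^ (2 * k) / (fact k * Gamma (real k + \<nu> + 1))) = (\<lambda>k. if k = 0 then 1 / Gamma (\<nu> + 1) else 0)"
    by (auto simp: fun_eq_iff power_0_left)
  hence "bessel_even \<nu> 0 = 1 / Gamma (\<nu> + 1)"
    unfolding bessel_even_def using sums_unique[OF sums_single[of 0 "\<lambda>_. 1 / Gamma (\<nu> + 1)"]] by simp
  thus ?thesis using True by (simp add: dunkl_Phi_def)
next
  case False
  have I: "bessel_I \<mu> \<bar>u\<bar> = (\<bar>u\<bar> / 2) powr \<mu> * bessel_even \<mu> u" if "\<mu> > -1" for \<mu>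
  proof -
    have "bessel_I \<mu> \<bar>u\<bar> = (\<Sum>k. (\<bar>u\<bar> / 2) powr \<mu> * ((u / 2) ^ (2 * k) / (fact k * Gamma (real k + \<mu> + 1))))"
      unfolding bessel_I_def
    proof (rule suminf_cong)
      fix k
      have "(\<bar>u\<bar> / 2) powr (2 * real k) = (\<bar>u\<bar> / 2) ^ (2 * k)"
        using False powr_realpow[of "\<bar>u\<bar> / 2" "2 * k"] by simp
      also have "\<dots> = (u / 2) ^ (2 * k)" by (simp add: power_mult power_divide)
      finally show "(\<bar>u\<bar> / 2) powr (2 * real k + \<mu>) / (fact k * Gamma (real k + \<mu> + 1)) 
         = (\<bar>u\<bar> / 2) powr \<mu> * ((u / 2) ^ (2 * k) / (fact k * Gamma (real k + \<mu> + 1)))"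
        by (simp add: powr_add)
    qed
    also have "\<dots> = (\<bar>u\<bar> / 2) powr \<mu> * bessel_even \<mu> u"
      unfolding bessel_even_def by (rule suminf_mult[OF bessel_even_summable[OF that]])
    finally show ?thesis .
  qed
  have p: "\<bar>u\<bar> powr (-\<nu>) * (\<bar>u\<bar> / 2) powr \<nu> = 2 powr (-\<nu>)"
    using False by (simp add: powr_divide powr_minus field_simps)
  have "dunkl_Phi \<nu> u = \<bar>u\<bar> powr (-\<nu>) * ((\<bar>u\<bar> / 2) powr \<nu> * bessel_even \<nu> u 
      + sgn u * ((\<bar>u\<bar> / 2) powr (\<nu> + 1) * bessel_even (\<nu> + 1) u))"
    using False assms by (simp add: dunkl_Phi_def I)
  also have "\<dots> = (\<bar>u\<bar> powr (-\<nu>) * (\<bar>u\<bar> / 2) powr \<nu>) * (bessel_even \<nu> u + sgn u * (\<bar>u\<bar> / 2) * bessel_even (\<nu> + 1) u)"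
    using False by (simp add: powr_add algebra_simps)
  also have "sgn u * (\<bar>u\<bar> / 2) = u / 2" by (simp add: sgn_mult_abs)
  finally show ?thesis by (simp add: p)
qed

text \<open>The series of the odd part interleaves with that of the even part: up to a constant, its \<open>k\<close>-th term is the
  geometric mean of the \<open>k\<close>-th and \<open>(k+1)\<close>-st terms of the even series, and so at most their arithmetic
  mean.\<close>

lemma bessel_odd_le_even:
  assumes "\<nu> > -1"
  obtains C where "C > 0" "\<And>u. u \<ge> 0 \<Longrightarrow> (u / 2) * bessel_even (\<nu> + 1) u \<le> C * bessel_even \<nu> u"
proof -
  define r where "r = min 1 (\<nu> + 1)"
  have r: "r > 0" "r \<le> 1" "r \<le> \<nu> + 1" using assms by (auto simp: r_def)
  define T where "T w k = w ^ (2 * k) / (fact k * Gamma (real k + \<nu> + 1))" for w :: real and k :: nat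
  have main: "(u / 2) * bessel_even (\<nu> + 1) u \<le> (2 / r) * bessel_even \<nu> u" if u: "u \<ge> 0" for u
  proof -
    define w where "w = u / 2"
    have w: "w \<ge> 0" using u by (simp add: w_def)
    have sT: "summable (T w)" using bessel_even_summable[OF assms, of u] by (simp add: T_def[abs_def] w_def)
    hence sT': "summable (\<lambda>k. T w (Suc k))" by (simp add: summable_Suc_iff)
    have T0: "T w k \<ge> 0" for k unfolding T_def w_def by (rule bessel_even_term_nonneg[OF assms])
    \<comment> \<open>The inequality of means for \<open>n\<close> and \<open>w\<^sup>2/n\<close>; the factor \<open>r\<close> pays for replacing \<open>n = k+1\<close> by \<open>m = k+\<nu>+1\<close>.\<close>
    have ptw: "w * (w ^ (2 * k) / (fact k * Gamma (real k + (\<nu> + 1) + 1))) \<le> (1 / r) * (T w k + T w (Suc k))" for k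
    proof -
      define m where "m = real k + \<nu> + 1"
      define n where "n = real k + 1"
      have m: "m > 0" "n > 0" "m \<ge> r * n" using assms r mult_left_le_one_le[of "real k" r]
        by (auto simp: m_def n_def algebra_simps)
      have G: "Gamma (real k + (\<nu> + 1) + 1) = m * Gamma m" "Gamma (real (Suc k) + \<nu> + 1) = m * Gamma m"
        using Gamma_shift[of m 1] m by (simp_all add: m_def add_ac)
      have Gm: "Gamma m > 0" using m by simp
      have "2 * w * n \<le> n\<^sup>2 + w\<^sup>2" using sum_squares_bound[of n w] by (simp add: power2_eq_square algebra_simps)
      hence "2 * w \<le> n + w\<^sup>2 / n" using m by (simp add: field_simps power2_eq_square)
      hence "r * w \<le> r * (n + w\<^sup>2 / n)" using r w by (intro mult_left_mono) auto
      also have "\<dots> \<le> m + w\<^sup>2 / n"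
      proof -
        have "r * (w\<^sup>2 / n) \<le> w\<^sup>2 / n" using r m by (intro mult_left_le_one_le) auto
        thus ?thesis using m by (simp add: algebra_simps)
      qed
      finally have k1: "w \<le> (1 / r) * (m + w\<^sup>2 / n)" using r by (simp add: field_simps)
      have "T w k + T w (Suc k) = (m + w\<^sup>2 / n) * (w ^ (2 * k) / (fact k * (m * Gamma m)))"
      proof -
        have "T w k = m * (w ^ (2 * k) / (fact k * (m * Gamma m)))" using m by (simp add: T_def m_def)
        moreover have "T w (Suc k) = (w\<^sup>2 / n) * (w ^ (2 * k) / (fact k * (m * Gamma m)))"
          unfolding T_def G by (simp add: n_def power2_eq_square algebra_simps)
        ultimately show ?thesis by (simp only: distrib_right)
      qed
      moreover have "w * (w ^ (2 * k) / (fact k * (m * Gamma m))) \<le> (1 / r) * (m + w\<^sup>2 / n) * (w ^ (2 * k) / (fact k * (m * Gamma m)))"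
        using k1 m Gm w by (intro mult_right_mono) auto
      ultimately show ?thesis unfolding G by (simp only: mult.assoc)
    qed
    have "w * bessel_even (\<nu> + 1) u = (\<Sum>k. w * (w ^ (2 * k) / (fact k * Gamma (real k + (\<nu> + 1) + 1))))"
      unfolding bessel_even_def w_def using assms
      by (intro suminf_mult[symmetric] bessel_even_summable) auto
    also have "\<dots> \<le> (\<Sum>k. (1 / r) * (T w k + T w (Suc k)))"
      using assms bessel_even_summable[of "\<nu> + 1" u]
      by (intro suminf_le ptw summable_mult summable_add sT sT') (auto simp: w_def)
    also have "\<dots> = (1 / r) * ((\<Sum>k. T w k) + (\<Sum>k. T w (Suc k)))"
      by (simp only: suminf_mult[OF summable_add[OF sT sT']] suminf_add[OF sT sT', symmetric])
    also have "\<dots> \<le> (1 / r) * ((\<Sum>k. T w k) + (\<Sum>k. T w k))"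
      using suminf_split_head[OF sT] T0[of 0] r by (intro mult_left_mono add_left_mono) auto
    also have "(\<Sum>k. T w k) = bessel_even \<nu> u" by (simp add: T_def w_def bessel_even_def)
    finally show ?thesis using r by (simp add: w_def)
  qed
  show ?thesis by (rule that[of "2 / r"]) (use r main in auto)
qed

lemma cosh_series: "(\<lambda>k. (u::real) ^ (2 * k) / fact (2 * k)) sums cosh u"
proof -
  have "(\<lambda>n. (\<lambda>n. if even n then u ^ n /\<^sub>R fact n else 0) (2 * n)) sums cosh u \<longleftrightarrow>
     (\<lambda>n. if even n then u ^ n /\<^sub>R fact n else 0) sums cosh u"
    by (rule sums_mono_reindex) (auto simp: strict_mono_def elim!: evenE)
  thus ?thesis using cosh_converges[of u] by (simp add: field_simps)
qed

text \<open>For \<open>\<nu> = -1/2\<close> the series is that of the hyperbolic cosine up to a constant. For other orders its terms are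
  those of \<open>cosh u\<close> weighted by a ratio of Pochhammer symbols, and this ratio decides the growth.\<close>

lemma bessel_even_eq_cosh_type:
  assumes "\<nu> > -1"
  shows "(u / 2) ^ (2 * k) / (fact k * Gamma (real k + \<nu> + 1)) =
     (1 / Gamma (\<nu> + 1)) * (u ^ (2 * k) / fact (2 * k) * (pochhammer (1/2) k / pochhammer (\<nu> + 1) k))"
proof -
  have g: "Gamma (real k + \<nu> + 1) = Gamma (\<nu> + 1) * pochhammer (\<nu> + 1) k"
    using Gamma_shift[of "\<nu> + 1" k] assms by (simp add: add.assoc)
  have "pochhammer (1/2) k > (0::real)" by (rule pochhammer_pos) simp
  thus ?thesis unfolding g fact_double by (simp add: power_divide)
qed

text \<open>The Pochhammer ratio is at most \<open>1\<close> for these orders.\<close>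

lemma bessel_even_le_exp:
  assumes "\<nu> \<ge> -1/2"
  shows "bessel_even \<nu> u \<le> exp \<bar>u\<bar> / Gamma (\<nu> + 1)"
proof -
  have \<nu>: "\<nu> > -1" using assms by linarith
  have "bessel_even \<nu> u \<le> (\<Sum>k. (1 / Gamma (\<nu> + 1)) * (u ^ (2 * k) / fact (2 * k)))"
    unfolding bessel_even_def
  proof (rule suminf_le[OF _ bessel_even_summable[OF \<nu>]])
    show "summable (\<lambda>k. (1 / Gamma (\<nu> + 1)) * (u ^ (2 * k) / fact (2 * k)))"
      using cosh_series by (intro summable_mult) (auto simp: sums_iff)
    fix k
    have "pochhammer (1/2) k \<le> pochhammer (\<nu> + 1) k"
      unfolding pochhammer_prod using assms by (intro prod_mono) auto
    moreover have "pochhammer (\<nu> + 1) k > 0" using \<nu> by (intro pochhammer_pos) auto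
    ultimately have "u ^ (2 * k) / fact (2 * k) * (pochhammer (1/2) k / pochhammer (\<nu> + 1) k) \<le> u ^ (2 * k) / fact (2 * k) * 1"
      by (intro mult_left_mono) (auto simp: power_mult)
    thus "(u / 2) ^ (2 * k) / (fact k * Gamma (real k + \<nu> + 1)) \<le> 1 / Gamma (\<nu> + 1) * (u ^ (2 * k) / fact (2 * k))"
      unfolding bessel_even_eq_cosh_type[OF \<nu>] using \<nu> by (intro mult_left_mono) (auto simp: less_imp_le)
  qed
  also have "\<dots> = (1 / Gamma (\<nu> + 1)) * cosh u"
    using cosh_series[of u] by (subst suminf_mult) (auto simp: sums_iff)
  also have "\<dots> \<le> (1 / Gamma (\<nu> + 1)) * exp \<bar>u\<bar>"
  proof (rule mult_left_mono)
    have "exp u \<le> exp \<bar>u\<bar>" "exp (-u) \<le> exp \<bar>u\<bar>" by simp_all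
    hence "exp u + exp (-u) \<le> exp \<bar>u\<bar> * 2" by linarith
    thus "cosh u \<le> exp \<bar>u\<bar>" by (simp add: cosh_field_def)
  qed (use \<nu> in \<open>auto simp: less_imp_le\<close>)
  finally show ?thesis by simp
qed

text \<open>Euler's limit formula for the Gamma function shows that the ratio is asymptotic to a constant multiple of
  \<open>k\<^sup>1\<^sup>/\<^sup>2\<^sup>-\<^sup>z\<close>; writing \<open>1 + k\<close> for \<open>k\<close> includes the first term.\<close>

lemma pochhammer_ratio_bounds:
  assumes "(z::real) > 0" "z < 1/2"
  obtains c C where "c > 0" "C > 0" 
    "\<And>k. c * (1 + real k) powr (1/2 - z) \<le> pochhammer (1/2) k / pochhammer z k"
    "\<And>k. pochhammer (1/2) k / pochhammer z k \<le> C * (1 + real k) powr (1/2 - z)"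
proof -
  \<comment> \<open>The normalizing factors of the two Gamma sequences differ exactly by the power \<open>k\<^sup>1\<^sup>/\<^sup>2\<^sup>-\<^sup>z\<close>.\<close>
  define X where "X = (\<lambda>n. Gamma_series' z n / Gamma_series' (1/2 :: real) n)"
  have G: "Gamma z > 0" "Gamma (1/2::real) > 0" using assms by (auto intro: Gamma_real_pos)
  have nz: "z \<notin> \<int>\<^sub>\<le>\<^sub>0" using assms by auto
  have X: "X \<longlonglongrightarrow> Gamma z / Gamma (1/2)"
    unfolding X_def by (intro tendsto_divide Gamma_series'_LIMSEQ) (use G in linarith)
  have "convergent X" "convergent (\<lambda>n. inverse (X n))"
    using X tendsto_inverse[OF X] G by (auto simp: convergent_def)
  then obtain K L where KL: "\<And>n. norm (X n) \<le> K" "K > 0" "\<And>n. norm (inverse (X n)) \<le> L" "L > 0"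
    by (meson convergent_imp_Bseq Bseq_def)
  define r where "r = (\<lambda>k. pochhammer (1/2) k / pochhammer z k)"
  have pp: "pochhammer z k > 0" "pochhammer (1/2) k > (0::real)" for k using assms by (auto intro: pochhammer_pos)
  have rX: "r k = real k powr (1/2 - z) * X k" if "k > 0" for k
    using pp[of k] that by (simp add: r_def X_def Gamma_series'_def powr_def exp_diff left_diff_distrib)
  have Xpos: "X k > 0" if "k > 0" for k
    using pp[of k] that by (simp add: X_def Gamma_series'_def)
  have e: "1/2 - z > 0" "1/2 - z \<le> 1" using assms by auto
  have up: "r k \<le> (max 1 K) * (1 + real k) powr (1/2 - z)" for k
  proof (cases "k = 0")
    case False
    have "real k powr (1/2 - z) * X k \<le> (1 + real k) powr (1/2 - z) * K"
      using KL(1)[of k] KL(2) Xpos[of k] False e by (intro mult_mono powr_mono2) auto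
    also have "\<dots> \<le> (1 + real k) powr (1/2 - z) * max 1 K" by (intro mult_left_mono) auto
    finally show ?thesis using rX False by (simp add: mult.commute)
  qed (simp add: r_def)
  have low: "min 1 (1 / (2 * L)) * (1 + real k) powr (1/2 - z) \<le> r k" for k
  proof (cases "k = 0")
    case False
    have a: "(1 + real k) powr (1/2 - z) \<le> 2 * real k powr (1/2 - z)"
    proof -
      have "(1 + real k) powr (1/2 - z) \<le> (2 * real k) powr (1/2 - z)" using False e by (intro powr_mono2) auto
      also have "\<dots> = 2 powr (1/2 - z) * real k powr (1/2 - z)" by (simp add: powr_mult)
      also have "\<dots> \<le> 2 powr 1 * real k powr (1/2 - z)" using e by (intro mult_right_mono powr_mono) auto
      finally show ?thesis by simp
    qed
    have b: "1 / L \<le> X k" using KL(3)[of k] KL(4) Xpos[of k] False by (simp add: field_simps)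
    have "min 1 (1 / (2 * L)) * (1 + real k) powr (1/2 - z) \<le> (1 / (2 * L)) * (2 * real k powr (1/2 - z))"
      using a KL by (intro mult_mono) auto
    also have "\<dots> = real k powr (1/2 - z) * (1 / L)" by simp
    also have "\<dots> \<le> real k powr (1/2 - z) * X k" using b by (intro mult_left_mono) auto
    finally show ?thesis using rX False by simp
  qed (simp add: r_def)
  show ?thesis by (rule that[of "min 1 (1 / (2 * L))" "max 1 K"]) (use up low KL in \<open>auto simp: r_def\<close>)
qed

text \<open>With respect to the weights \<open>u\<^sup>2\<^sup>k / (2k)!\<close> the index \<open>k\<close> concentrates near \<open>u/2\<close>. Its first two moments are
  enough to convert factors \<open>(1+k)\<^sup>e\<close> inside the series into \<open>(1+u)\<^sup>e\<close> in front of it.\<close>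

lemma cosh_series_first_moment: "(\<lambda>k. real k * ((u::real) ^ (2 * k) / fact (2 * k))) sums (u / 2 * sinh u)"
proof -
  have "(\<lambda>n. (\<lambda>n. if even n then 0 else u ^ n /\<^sub>R fact n) (2 * n + 1)) sums sinh u \<longleftrightarrow>
     (\<lambda>n. if even n then 0 else u ^ n /\<^sub>R fact n) sums sinh u"
    by (rule sums_mono_reindex) (auto simp: strict_mono_def elim!: oddE)
  hence "(\<lambda>k. u ^ (2 * k + 1) / fact (2 * k + 1)) sums sinh u" using sinh_converges[of u] by (simp add: field_simps)
  hence "(\<lambda>k. u / 2 * (u ^ (2 * k + 1) / fact (2 * k + 1))) sums (u / 2 * sinh u)" by (rule sums_mult)
  moreover have "u / 2 * (u ^ (2 * k + 1) / fact (2 * k + 1)) = real (Suc k) * (u ^ (2 * Suc k) / fact (2 * Suc k))" for k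
    by (simp add: divide_simps)
  ultimately have "(\<lambda>k. real (Suc k) * (u ^ (2 * Suc k) / fact (2 * Suc k))) sums (u / 2 * sinh u)" by simp
  thus ?thesis by (subst (asm) sums_Suc_iff) simp
qed

lemma cosh_series_second_moment:
  "(\<lambda>k. (real k)\<^sup>2 * ((u::real) ^ (2 * k) / fact (2 * k))) sums ((u\<^sup>2 * cosh u + u * sinh u) / 4)"
proof -
  define w where "w k = u ^ (2 * k) / fact (2 * k)" for k
  have "(\<lambda>k. u\<^sup>2 * w k) sums (u\<^sup>2 * cosh u)" unfolding w_def by (intro sums_mult cosh_series)
  moreover have "u\<^sup>2 * w k = (2 * real (Suc k)) * (2 * real (Suc k) - 1) * w (Suc k)" for k
    unfolding w_def by (simp add: divide_simps power2_eq_square)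
  ultimately have "(\<lambda>k. (2 * real (Suc k)) * (2 * real (Suc k) - 1) * w (Suc k)) sums (u\<^sup>2 * cosh u)" by simp
  hence "(\<lambda>k. (2 * real k) * (2 * real k - 1) * w k) sums (u\<^sup>2 * cosh u)"
    by (subst (asm) sums_Suc_iff) simp
  hence "(\<lambda>k. (1 / 4) * ((2 * real k) * (2 * real k - 1) * w k) + (1/2) * (real k * w k)) 
      sums ((1 / 4) * (u\<^sup>2 * cosh u) + (1 / 2) * (u / 2 * sinh u))"
    unfolding w_def by (intro sums_add sums_mult cosh_series_first_moment)
  thus ?thesis by (simp add: w_def power2_eq_square algebra_simps add_divide_distrib)
qed

text \<open>With \<open>r = (1+k)/(1+u)\<close> and \<open>0 < e < 1\<close>, the bound \<open>r\<^sup>e \<le> 1 + r\<close> reduces the weighted series to the first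
  moment.\<close>

lemma bessel_even_le_powr_exp:
  assumes "\<nu> > -1" "\<nu> < -1/2"
  obtains C where "C > 0" "\<And>u. u \<ge> 0 \<Longrightarrow> bessel_even \<nu> u \<le> C * (1 + u) powr (-\<nu> - 1/2) * exp u"
proof -
  have z: "\<nu> + 1 > 0" "\<nu> + 1 < 1/2" using assms by auto
  obtain C where C: "C > 0"
    "\<And>k. pochhammer (1/2) k / pochhammer (\<nu> + 1) k \<le> C * (1 + real k) powr (1/2 - (\<nu> + 1))"
    using pochhammer_ratio_bounds[OF z] by metis
  define e where "e = -\<nu> - 1/2"
  have e: "0 < e" "e < 1" "1/2 - (\<nu> + 1) = e" using assms by (auto simp: e_def)
  have main: "bessel_even \<nu> u \<le> (3 * C / Gamma (\<nu> + 1)) * (1 + u) powr e * exp u" if u: "u \<ge> 0" for u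
  proof -
    define w where "w k = u ^ (2 * k) / fact (2 * k)" for k
    have w0: "w k \<ge> 0" for k unfolding w_def by (simp add: power_mult)
    define D where "D = C * (1 + u) powr e / Gamma (\<nu> + 1)"
    have G: "Gamma (\<nu> + 1) > 0" using assms by simp
    have s: "(\<lambda>k. D * (w k + (1 / (1 + u)) * (w k + real k * w k))) sums (D * (cosh u + (1 / (1 + u)) * (cosh u + u / 2 * sinh u)))"
      unfolding w_def by (intro sums_add sums_mult cosh_series_first_moment cosh_series)
    have "bessel_even \<nu> u \<le> D * (cosh u + (1 / (1 + u)) * (cosh u + u / 2 * sinh u))"
      unfolding bessel_even_def
    proof (rule sums_le[OF _ summable_sums[OF bessel_even_summable] s])
      fix k
      have "(1 + real k) powr e \<le> (1 + u) powr e * (1 + (1 + real k) / (1 + u))"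
      proof -
        have "((1 + real k) / (1 + u)) powr e \<le> 1 + (1 + real k) / (1 + u)"
        proof (cases "(1 + real k) / (1 + u) \<le> 1")
          case True
          hence "((1 + real k) / (1 + u)) powr e \<le> 1" using e u by (intro powr_le1) auto
          moreover have "(1 + real k) / (1 + u) \<ge> 0" using u by auto
          ultimately show ?thesis by linarith
        next
          case False
          hence "((1 + real k) / (1 + u)) powr e \<le> ((1 + real k) / (1 + u)) powr 1" using e by (intro powr_mono) auto
          thus ?thesis using u by simp
        qed
        thus ?thesis using u by (simp add: powr_divide field_simps)
      qed
      hence "C * (1 + real k) powr e \<le> C * ((1 + u) powr e * (1 + (1 + real k) / (1 + u)))" using C by (intro mult_left_mono) auto
      hence "pochhammer (1/2) k / pochhammer (\<nu> + 1) k \<le> C * ((1 + u) powr e * (1 + (1 + real k) / (1 + u)))"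
        using C(2)[of k] by (simp only: e(3))
      hence "1 / Gamma (\<nu> + 1) * (w k * (pochhammer (1/2) k / pochhammer (\<nu> + 1) k)) 
         \<le> 1 / Gamma (\<nu> + 1) * (w k * (C * ((1 + u) powr e * (1 + (1 + real k) / (1 + u)))))"
        using G w0 by (intro mult_left_mono) auto
      also have "\<dots> = D * (w k + (1 / (1 + u)) * (w k + real k * w k))"
        using u G by (simp add: D_def field_simps)
      finally show "(u / 2) ^ (2 * k) / (fact k * Gamma (real k + \<nu> + 1)) \<le> D * (w k + (1 / (1 + u)) * (w k + real k * w k))"
        unfolding bessel_even_eq_cosh_type[OF assms(1)] w_def .
    qed (use assms in auto)
    also have "\<dots> \<le> D * (3 * exp u)"
    proof (rule mult_left_mono)
      have ch: "cosh u \<le> exp u" "sinh u \<le> exp u" "0 \<le> cosh u" "0 \<le> sinh u"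
        using u cosh_plus_sinh[of u] by (auto simp: cosh_real_nonneg) (smt (verit) cosh_real_nonneg sinh_real_nonneg_iff)+
      have "cosh u + u / 2 * sinh u \<le> (2 * exp u) * (1 + u)"
      proof -
        have "u / 2 * sinh u \<le> u * exp u" using ch u by (intro mult_mono) auto
        moreover have "(2 * exp u) * (1 + u) = 2 * exp u + 2 * (u * exp u)" by (simp add: algebra_simps)
        ultimately show ?thesis using ch u mult_nonneg_nonneg[of u "exp u"] by linarith
      qed
      hence "(1 / (1 + u)) * (cosh u + u / 2 * sinh u) \<le> 2 * exp u" using u by (simp add: pos_divide_le_eq)
      thus "cosh u + (1 / (1 + u)) * (cosh u + u / 2 * sinh u) \<le> 3 * exp u" using ch by linarith
    qed (use C G in \<open>auto simp: D_def\<close>)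
    finally show ?thesis by (simp add: D_def mult_ac)
  qed
  show ?thesis by (rule that[of "3 * C / Gamma (\<nu> + 1)"]) (use main C assms in \<open>auto simp: e_def\<close>)
qed

text \<open>The lower bound \<open>r\<^sup>e \<ge> r - r\<^sup>2/4\<close> is quadratic in the index, so that the first two moments of the hyperbolic
  cosine series determine the resulting sum. For \<open>u \<ge> 1\<close> the sum is dominated by its positive part, because
  \<open>sinh u\<close> is then at least half of \<open>cosh u\<close>.\<close>

lemma bessel_even_ge_powr_exp:
  assumes "\<nu> > -1" "\<nu> < -1/2"
  obtains c where "c > 0" "\<And>u. u \<ge> 1 \<Longrightarrow> bessel_even \<nu> u \<ge> c * (1 + u) powr (-\<nu> - 1/2) * exp u"
proof -
  have z: "\<nu> + 1 > 0" "\<nu> + 1 < 1/2" using assms by auto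
  obtain c where C: "c > 0"
    "\<And>k. c * (1 + real k) powr (1/2 - (\<nu> + 1)) \<le> pochhammer (1/2) k / pochhammer (\<nu> + 1) k"
    using pochhammer_ratio_bounds[OF z] by metis
  define e where "e = -\<nu> - 1/2"
  have e: "0 < e" "e < 1" "1/2 - (\<nu> + 1) = e" using assms by (auto simp: e_def)
  have main: "bessel_even \<nu> u \<ge> (c * (3 / 32) / Gamma (\<nu> + 1)) * (1 + u) powr e * exp u" if u: "u \<ge> 1" for u
  proof -
    define w where "w k = u ^ (2 * k) / fact (2 * k)" for k
    have w0: "w k \<ge> 0" for k unfolding w_def by (simp add: power_mult)
    define D where "D = c * (1 + u) powr e / Gamma (\<nu> + 1)"
    have G: "Gamma (\<nu> + 1) > 0" using assms by simp
    have D: "D \<ge> 0" using G C by (auto simp: D_def)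
    \<comment> \<open>The value of the series of \<open>r - r\<^sup>2/4\<close> against the weights \<open>w k\<close>.\<close>
    define S where "S = (1 / (1 + u)) * (cosh u + u / 2 * sinh u) - (1 / (4 * (1 + u)\<^sup>2)) * (cosh u + 2 * (u / 2 * sinh u) + (u\<^sup>2 * cosh u + u * sinh u) / 4)"
    have s: "(\<lambda>k. D * ((1 / (1 + u)) * (w k + real k * w k) - (1 / (4 * (1 + u)\<^sup>2)) * (w k + 2 * (real k * w k) + (real k)\<^sup>2 * w k))) sums (D * S)"
      unfolding w_def S_def by (intro sums_add sums_diff sums_mult cosh_series_first_moment cosh_series cosh_series_second_moment)
    have "D * S \<le> bessel_even \<nu> u"
      unfolding bessel_even_def
    proof (rule sums_le[OF _ s summable_sums[OF bessel_even_summable]])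
      fix k
      define r where "r = (1 + real k) / (1 + u)"
      have r0: "r > 0" using u by (simp add: r_def)
      have "r - r\<^sup>2 / 4 \<le> r powr e"
      proof (cases "r \<le> 1")
        case True
        have "r powr 1 \<le> r powr e" using True r0 e by (intro powr_mono') auto
        hence "r \<le> r powr e" using r0 by simp
        moreover have "r\<^sup>2 \<ge> 0" by simp
        ultimately show ?thesis by linarith
      next
        case False
        hence "1 \<le> r powr e" using e by (intro ge_one_powr_ge_zero) auto
        moreover have "r - r\<^sup>2 / 4 \<le> 1" using zero_le_power2[of "r / 2 - 1"] by (simp add: power2_eq_square algebra_simps)
        ultimately show ?thesis by linarith
      qed
      hence "(1 + u) powr e * (r - r\<^sup>2 / 4) \<le> (1 + u) powr e * r powr e" by (intro mult_left_mono) auto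
      also have "\<dots> = (1 + real k) powr e" using u by (simp add: r_def powr_divide)
      finally have "c * ((1 + u) powr e * (r - r\<^sup>2 / 4)) \<le> c * (1 + real k) powr e" using C by (intro mult_left_mono) auto
      hence "c * ((1 + u) powr e * (r - r\<^sup>2 / 4)) \<le> pochhammer (1/2) k / pochhammer (\<nu> + 1) k"
        using C(2)[of k] by (simp only: e(3))
      hence "1 / Gamma (\<nu> + 1) * (w k * (c * ((1 + u) powr e * (r - r\<^sup>2 / 4)))) \<le> 1 / Gamma (\<nu> + 1) * (w k * (pochhammer (1/2) k / pochhammer (\<nu> + 1) k))"
        using G w0 by (intro mult_left_mono) auto
      moreover have "1 / Gamma (\<nu> + 1) * (w k * (c * ((1 + u) powr e * (r - r\<^sup>2 / 4)))) = D * ((1 / (1 + u)) * (w k + real k * w k) - (1 / (4 * (1 + u)\<^sup>2)) * (w k + 2 * (real k * w k) + (real k)\<^sup>2 * w k))"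
      proof -
        have "w k * r = (1 / (1 + u)) * (w k + real k * w k)" by (simp add: r_def algebra_simps add_divide_distrib)
        moreover have "w k * (r\<^sup>2 / 4) = (1 / (4 * (1 + u)\<^sup>2)) * (w k + 2 * (real k * w k) + (real k)\<^sup>2 * w k)"
          by (simp add: r_def power_divide) (simp add: power2_eq_square algebra_simps add_divide_distrib)
        moreover have "1 / Gamma (\<nu> + 1) * (w k * (c * ((1 + u) powr e * (r - r\<^sup>2 / 4)))) = D * (w k * r - w k * (r\<^sup>2 / 4))"
          by (simp add: D_def right_diff_distrib mult_ac diff_divide_distrib)
        ultimately show ?thesis by (simp only:)
      qed
      ultimately show "D * ((1 / (1 + u)) * (w k + real k * w k) - (1 / (4 * (1 + u)\<^sup>2)) * (w k + 2 * (real k * w k) + (real k)\<^sup>2 * w k)) 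
        \<le> (u / 2) ^ (2 * k) / (fact k * Gamma (real k + \<nu> + 1))"
        unfolding bessel_even_eq_cosh_type[OF assms(1)] w_def by linarith
    qed (use assms in auto)
    moreover have "D * ((3 / 32) * exp u) \<le> D * S"
    proof (rule mult_left_mono[OF _ D])
      have ch: "cosh u \<ge> exp u / 2" by (simp add: cosh_field_def)
      have "exp (2 * u) \<ge> 3" using exp_ge_add_one_self[of "2 * u"] u by linarith
      hence "exp u * exp u \<ge> 3" by (simp add: exp_add[symmetric])
      hence "exp u \<ge> 3 * exp (-u)" by (simp add: exp_minus field_simps)
      hence sh: "sinh u \<ge> cosh u / 2" by (simp add: cosh_field_def sinh_field_def)
      have "(1 + u)\<^sup>2 * S = (1 + u) * (cosh u + u / 2 * sinh u) - (1 / 4) * (cosh u + 2 * (u / 2 * sinh u) + (u\<^sup>2 * cosh u + u * sinh u) / 4)"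
        unfolding S_def using u by (simp add: right_diff_distrib power2_eq_square)
      also have "\<dots> = (3 / 4 + u - u\<^sup>2 / 16) * cosh u + (u\<^sup>2 / 2 + 3 / 16 * u) * sinh u"
        by (simp add: power2_eq_square field_simps)
      also have "\<dots> \<ge> (3 / 4 + u - u\<^sup>2 / 16) * cosh u + (u\<^sup>2 / 2 + 3 / 16 * u) * (cosh u / 2)"
        using sh u by (intro add_left_mono mult_left_mono) auto
      also have "(3 / 4 + u - u\<^sup>2 / 16) * cosh u + (u\<^sup>2 / 2 + 3 / 16 * u) * (cosh u / 2) = (3 / 4 + u + 3 / 32 * u + 3 / 16 * u\<^sup>2) * cosh u"
        by (simp add: algebra_simps)
      finally have 1: "(1 + u)\<^sup>2 * S \<ge> (3 / 4 + u + 3 / 32 * u + 3 / 16 * u\<^sup>2) * cosh u" .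
      have "(3 / 16 * (1 + u)\<^sup>2) * (exp u / 2) \<le> (3 / 4 + u + 3 / 32 * u + 3 / 16 * u\<^sup>2) * cosh u"
      proof (rule mult_mono)
        have "3 / 16 * (1 + u)\<^sup>2 = 3 / 16 + 3 / 8 * u + 3 / 16 * u\<^sup>2" by (simp add: power2_eq_square algebra_simps)
        thus "3 / 16 * (1 + u)\<^sup>2 \<le> 3 / 4 + u + 3 / 32 * u + 3 / 16 * u\<^sup>2" using u by linarith
      qed (use ch u in auto)
      moreover have "(1 + u)\<^sup>2 * (3 / 32 * exp u) = (3 / 16 * (1 + u)\<^sup>2) * (exp u / 2)" by simp
      ultimately have "(1 + u)\<^sup>2 * (3 / 32 * exp u) \<le> (1 + u)\<^sup>2 * S" using 1 by linarith
      thus "3 / 32 * exp u \<le> S" using u by (simp add: mult_le_cancel_left_pos)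
    qed
    ultimately show ?thesis by (simp add: D_def mult_ac)
  qed
  show ?thesis by (rule that[of "c * (3 / 32) / Gamma (\<nu> + 1)"]) (use main C assms in \<open>auto simp: e_def\<close>)
qed

section \<open>Gaussian integrals against the Dunkl measure\<close>

lemma sets_dunkl_measure [simp, measurable_cong]: "sets (dunkl_measure \<alpha>) = sets borel"
  by (simp add: dunkl_measure_def)

lemma space_dunkl_measure [simp]: "space (dunkl_measure \<alpha>) = UNIV"
  by (simp add: dunkl_measure_def)

lemma sigma_finite_dunkl_measure: "sigma_finite_measure (dunkl_measure \<alpha>)"
  unfolding dunkl_measure_def by (subst sigma_finite_measure.sigma_finite_iff_density_finite[OF sigma_finite_lborel]) auto

lemma nn_integral_dunkl_measure:
  assumes "f \<in> borel_measurable borel"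
  shows "(\<integral>\<^sup>+x. f x \<partial>dunkl_measure \<alpha>) = (\<integral>\<^sup>+x. ennreal (\<bar>x\<bar> powr (2 * \<alpha> + 1)) * f x \<partial>lborel)"
  unfolding dunkl_measure_def using assms by (intro nn_integral_density) auto

lemma nn_integral_Gamma_scaled:
  assumes z: "z > 0" and c: "c > 0"
  shows "(\<integral>\<^sup>+t. ennreal (t powr (z - 1) * exp (- c * t)) * indicator {0<..} t \<partial>lborel) = ennreal (Gamma z / c powr z)"
proof -
  have "ennreal (Gamma z) = (\<integral>\<^sup>+t. ennreal (indicator {0..} t * t powr (z - 1) / exp t) \<partial>lborel)"
    by (rule Gamma_conv_nn_integral_real[OF z])
  also have "\<dots> = ennreal c * (\<integral>\<^sup>+t. ennreal (indicator {0..} (0 + c * t) * (0 + c * t) powr (z - 1) / exp (0 + c * t)) \<partial>lborel)"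
    using c by (subst nn_integral_real_affine[where c = c and t = 0]) auto
  also have "(\<integral>\<^sup>+t. ennreal (indicator {0..} (0 + c * t) * (0 + c * t) powr (z - 1) / exp (0 + c * t)) \<partial>lborel)
     = (\<integral>\<^sup>+t. ennreal (c powr (z - 1)) * (ennreal (t powr (z - 1) * exp (- c * t)) * indicator {0<..} t) \<partial>lborel)"
    using c by (intro nn_integral_cong)
      (auto simp: indicator_def powr_mult exp_minus divide_inverse ennreal_mult[symmetric] mult.assoc zero_le_mult_iff)
  also have "\<dots> = ennreal (c powr (z - 1)) * (\<integral>\<^sup>+t. ennreal (t powr (z - 1) * exp (- c * t)) * indicator {0<..} t \<partial>lborel)"
    by (rule nn_integral_cmult) auto
  finally have "ennreal (Gamma z) = ennreal (c powr z) * (\<integral>\<^sup>+t. ennreal (t powr (z - 1) * exp (- c * t)) * indicator {0<..} t \<partial>lborel)"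
    using c by (simp add: mult.assoc[symmetric] ennreal_mult[symmetric] powr_diff)
  hence "ennreal (1 / c powr z) * ennreal (Gamma z) = ennreal (1 / c powr z) * ennreal (c powr z) * (\<integral>\<^sup>+t. ennreal (t powr (z - 1) * exp (- c * t)) * indicator {0<..} t \<partial>lborel)"
    by (simp add: mult.assoc)
  moreover have "ennreal (1 / c powr z) * ennreal (c powr z) = 1" using c by (subst ennreal_mult[symmetric]) auto
  moreover have "ennreal (1 / c powr z) * ennreal (Gamma z) = ennreal (Gamma z / c powr z)"
    using Gamma_real_pos[OF z] by (subst ennreal_mult[symmetric]) auto
  ultimately show ?thesis by simp
qed

lemma nn_integral_even:
  fixes G :: "real \<Rightarrow> ennreal"
  assumes [measurable]: "G \<in> borel_measurable borel" and even: "\<And>x. G (- x) = G x"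
  shows "(\<integral>\<^sup>+x. G x \<partial>lborel) = 2 * (\<integral>\<^sup>+x. G x * indicator {0<..} x \<partial>lborel)"
proof -
  have "(\<integral>\<^sup>+x. G x \<partial>lborel) = (\<integral>\<^sup>+x. G x * indicator {0<..} x + G x * indicator {..<0} x \<partial>lborel)"
    using AE_lborel_singleton[of "0::real"]
    by (intro nn_integral_cong_AE, eventually_elim) (auto simp: indicator_def)
  also have "\<dots> = (\<integral>\<^sup>+x. G x * indicator {0<..} x \<partial>lborel) + (\<integral>\<^sup>+x. G x * indicator {..<0} x \<partial>lborel)"
    by (rule nn_integral_add) auto
  also have "(\<integral>\<^sup>+x. G x * indicator {..<0} x \<partial>lborel) = (\<integral>\<^sup>+x. G x * indicator {0<..} x \<partial>lborel)"
    by (subst nn_integral_real_affine[where c = "-1" and t = 0])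
       (auto simp: even indicator_def intro!: nn_integral_cong)
  finally show ?thesis by (simp add: mult_2)
qed

lemma nn_integral_dunkl_even:
  fixes G :: "real \<Rightarrow> ennreal"
  assumes [measurable]: "G \<in> borel_measurable borel" and even: "\<And>x. G (- x) = G x"
  shows "(\<integral>\<^sup>+x. G x \<partial>dunkl_measure \<alpha>) = 2 * (\<integral>\<^sup>+x. G x * indicator {0<..} x \<partial>dunkl_measure \<alpha>)"
  by (simp add: nn_integral_dunkl_measure nn_integral_even even mult.assoc)

lemma nn_integral_Gaussian_half_line:
  assumes z: "z > 0" and A: "A > 0"
  shows "(\<integral>\<^sup>+x. ennreal (x powr (2 * z - 1) * exp (- A * x\<^sup>2)) * indicator {0<..} x \<partial>lborel) = ennreal (Gamma z / (2 * A powr z))"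
proof -
  define f where "f u = u powr (z - 1) * exp (- A * u)" for u
  define I where "I = Gamma z / A powr z"
  have I0: "I \<ge> 0" using z by (simp add: I_def Gamma_real_pos less_imp_le)
  have "((\<lambda>u. f u * indicator {0<..} u) has_integral I) UNIV"
  proof (rule nn_integral_has_integral)
    show "(\<integral>\<^sup>+u. ennreal (f u * indicator {0<..} u) \<partial>lborel) = ennreal I"
      unfolding I_def f_def nn_integral_Gamma_scaled[OF z A, symmetric]
      by (intro nn_integral_cong) (auto simp: indicator_def)
  qed (auto simp: f_def I0)
  moreover have "(\<lambda>u. f u * indicator {0<..} u) = (\<lambda>u. if u \<in> {0<..} then f u else 0)" by (auto simp: indicator_def)
  ultimately have hf: "(f has_integral I) {0<..}" using has_integral_restrict_UNIV[of "{0<..}" f I] by simp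
  have img: "(\<lambda>x. x\<^sup>2) ` {0::real<..} = {0<..}"
  proof (intro equalityI subsetI)
    fix y :: real assume "y \<in> {0<..}"
    thus "y \<in> (\<lambda>x. x\<^sup>2) ` {0<..}" by (intro image_eqI[of _ _ "sqrt y"]) auto
  qed auto
  have "f absolutely_integrable_on {0<..}"
    using hf by (intro nonnegative_absolutely_integrable_1) (auto simp: f_def has_integral_integrable)
  hence "f absolutely_integrable_on ((\<lambda>x. x\<^sup>2) ` {0<..}) \<and> integral ((\<lambda>x. x\<^sup>2) ` {0<..}) f = I"
    using hf img by (simp add: integral_unique)
  hence "(\<lambda>x. \<bar>2 * x\<bar> * f (x\<^sup>2)) absolutely_integrable_on {0<..} \<and> integral {0<..} (\<lambda>x. \<bar>2 * x\<bar> * f (x\<^sup>2)) = I"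
    by (subst has_absolute_integral_change_of_variables_1')
       (auto intro!: derivative_eq_intros inj_onI simp: power2_eq_iff)
  hence "((\<lambda>x. \<bar>2 * x\<bar> * f (x\<^sup>2)) has_integral I) {0<..}"
    using set_lebesgue_integral_eq_integral(1) by (metis integrable_integral)
  hence "(\<integral>\<^sup>+x. ennreal (\<bar>2 * x\<bar> * f (x\<^sup>2)) * indicator {0<..} x \<partial>lborel) = ennreal I"
    by (intro nn_integral_has_integral_lebesgue') (auto simp: f_def)
  also have "(\<integral>\<^sup>+x. ennreal (\<bar>2 * x\<bar> * f (x\<^sup>2)) * indicator {0<..} x \<partial>lborel)
      = (\<integral>\<^sup>+x. 2 * (ennreal (x powr (2 * z - 1) * exp (- A * x\<^sup>2)) * indicator {0<..} x) \<partial>lborel)"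
  proof (intro nn_integral_cong)
    fix x :: real
    have eq: "\<bar>2 * x\<bar> * f (x\<^sup>2) = 2 * (x powr (2 * z - 1) * exp (- A * x\<^sup>2))" if "x > 0"
    proof -
      have "(x\<^sup>2) powr (z - 1) = x powr (2 * (z - 1))" using that powr_powr[of x 2 "z - 1"] by simp
      hence "x * (x\<^sup>2) powr (z - 1) = x powr (2 * z - 1)"
        using that powr_add[of x 1 "2 * (z - 1)"] by (simp add: algebra_simps)
      thus ?thesis using that by (simp add: f_def algebra_simps)
    qed
    have two: "ennreal (2 * W) = 2 * ennreal W" for W using ennreal_mult'[of 2 W] by simp
    show "ennreal (\<bar>2 * x\<bar> * f (x\<^sup>2)) * indicator {0<..} x = 2 * (ennreal (x powr (2 * z - 1) * exp (- A * x\<^sup>2)) * indicator {0<..} x)"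
    proof (cases "x > 0")
      case True
      thus ?thesis by (simp only: eq two mult.assoc)
    qed simp
  qed
  also have "\<dots> = 2 * (\<integral>\<^sup>+x. ennreal (x powr (2 * z - 1) * exp (- A * x\<^sup>2)) * indicator {0<..} x \<partial>lborel)"
    by (rule nn_integral_cmult) auto
  finally have e: "2 * (\<integral>\<^sup>+x. ennreal (x powr (2 * z - 1) * exp (- A * x\<^sup>2)) * indicator {0<..} x \<partial>lborel) = ennreal I" .
  have "ennreal (1/2) * (2 * (\<integral>\<^sup>+x. ennreal (x powr (2 * z - 1) * exp (- A * x\<^sup>2)) * indicator {0<..} x \<partial>lborel)) 
    = (ennreal (1/2) * ennreal 2) * (\<integral>\<^sup>+x. ennreal (x powr (2 * z - 1) * exp (- A * x\<^sup>2)) * indicator {0<..} x \<partial>lborel)"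
    by (simp add: mult.assoc)
  also have "ennreal (1/2) * ennreal 2 = 1" by (subst ennreal_mult[symmetric]) auto
  finally have "(\<integral>\<^sup>+x. ennreal (x powr (2 * z - 1) * exp (- A * x\<^sup>2)) * indicator {0<..} x \<partial>lborel) = ennreal (1/2) * ennreal I"
    unfolding e by simp
  also have "\<dots> = ennreal (1/2 * I)" by (rule ennreal_mult'[symmetric]) simp
  finally show ?thesis by (simp add: I_def)
qed

lemma nn_integral_dunkl_Gaussian_moment:
  assumes \<alpha>: "\<alpha> > -1" and A: "A > 0" and k: "k > -(\<alpha> + 1)"
  shows "(\<integral>\<^sup>+x. ennreal (\<bar>x\<bar> powr (2 * k) * exp (- A * x\<^sup>2)) \<partial>dunkl_measure \<alpha>) = ennreal (Gamma (k + \<alpha> + 1) / A powr (k + \<alpha> + 1))"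
proof -
  have "(\<integral>\<^sup>+x. ennreal (\<bar>x\<bar> powr (2 * k) * exp (- A * x\<^sup>2)) \<partial>dunkl_measure \<alpha>)
     = 2 * (\<integral>\<^sup>+x. ennreal (\<bar>x\<bar> powr (2 * k) * exp (- A * x\<^sup>2)) * indicator {0<..} x \<partial>dunkl_measure \<alpha>)"
    by (rule nn_integral_dunkl_even) auto
  also have "(\<integral>\<^sup>+x. ennreal (\<bar>x\<bar> powr (2 * k) * exp (- A * x\<^sup>2)) * indicator {0<..} x \<partial>dunkl_measure \<alpha>)
     = (\<integral>\<^sup>+x. ennreal (x powr (2 * (k + \<alpha> + 1) - 1) * exp (- A * x\<^sup>2)) * indicator {0<..} x \<partial>lborel)"
    by (subst nn_integral_dunkl_measure)
       (auto intro!: nn_integral_cong simp: indicator_def ennreal_mult[symmetric] powr_add[symmetric] mult.assoc[symmetric] algebra_simps)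
  also have "\<dots> = ennreal (Gamma (k + \<alpha> + 1) / (2 * A powr (k + \<alpha> + 1)))"
    using k A by (intro nn_integral_Gaussian_half_line) auto
  also have "2 * ennreal (Gamma (k + \<alpha> + 1) / (2 * A powr (k + \<alpha> + 1))) = ennreal (Gamma (k + \<alpha> + 1) / A powr (k + \<alpha> + 1))"
    using k by (subst ennreal_numeral[symmetric], subst ennreal_mult[symmetric]) (auto simp: Gamma_real_pos less_imp_le)
  finally show ?thesis .
qed

lemma nn_integral_dunkl_Gaussian_power:
  assumes \<alpha>: "\<alpha> > -1" and A: "A > 0"
  shows "(\<integral>\<^sup>+x. ennreal (x ^ (2 * k) * exp (- A * x\<^sup>2)) \<partial>dunkl_measure \<alpha>) = ennreal (Gamma (real k + \<alpha> + 1) / A powr (real k + \<alpha> + 1))"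
proof -
  have "x ^ (2 * k) = \<bar>x\<bar> powr (2 * real k)" if "x \<noteq> 0" for x :: real
    using that powr_realpow[of "\<bar>x\<bar>" "2 * k"] by (simp add: power_mult)
  moreover have "AE x in dunkl_measure \<alpha>. x \<noteq> 0"
    unfolding dunkl_measure_def using AE_lborel_singleton[of "0::real"] by (subst AE_density) auto
  ultimately have "(\<integral>\<^sup>+x. ennreal (x ^ (2 * k) * exp (- A * x\<^sup>2)) \<partial>dunkl_measure \<alpha>) = (\<integral>\<^sup>+x. ennreal (\<bar>x\<bar> powr (2 * real k) * exp (- A * x\<^sup>2)) \<partial>dunkl_measure \<alpha>)"
    by (intro nn_integral_cong_AE) auto
  thus ?thesis using nn_integral_dunkl_Gaussian_moment[OF \<alpha> A, of "real k"] \<alpha> by simp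
qed

text \<open>Integrating term by term, the Gamma factor of the Gaussian moment cancels the one in the Bessel coefficient,
  and an exponential series remains. The extra factor \<open>x\<^sup>2\<close> shifts the Gamma argument by one and produces the
  first moment of that exponential series.\<close>

lemma nn_integral_bessel_Gaussian:
  assumes \<alpha>: "\<alpha> > -1" and A: "A > 0"
  shows "(\<integral>\<^sup>+x. ennreal (bessel_even \<alpha> (x * v) * exp (- A * x\<^sup>2)) \<partial>dunkl_measure \<alpha>) = ennreal (A powr (- \<alpha> - 1) * exp (v\<^sup>2 / (4 * A)))"
    and "(\<integral>\<^sup>+x. ennreal (x\<^sup>2 * bessel_even \<alpha> (x * v) * exp (- A * x\<^sup>2)) \<partial>dunkl_measure \<alpha>) = ennreal (A powr (- \<alpha> - 2) * ((v\<^sup>2 / (4 * A) + \<alpha> + 1) * exp (v\<^sup>2 / (4 * A))))"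
proof -
  define c where "c k = (v / 2) ^ (2 * k) / (fact k * Gamma (real k + \<alpha> + 1))" for k
  have c0: "c k \<ge> 0" for k unfolding c_def by (rule bessel_even_term_nonneg[OF \<alpha>])
  have ser: "ennreal (x ^ (2 * j) * bessel_even \<alpha> (x * v) * exp (- A * x\<^sup>2)) = (\<Sum>k. ennreal (c k) * ennreal (x ^ (2 * (k + j)) * exp (- A * x\<^sup>2)))" for x j
  proof -
    have s: "(\<lambda>k. (x * v / 2) ^ (2 * k) / (fact k * Gamma (real k + \<alpha> + 1))) sums bessel_even \<alpha> (x * v)"
      unfolding bessel_even_def by (rule summable_sums[OF bessel_even_summable[OF \<alpha>]])
    hence "(\<lambda>k. (x ^ (2 * j) * exp (- A * x\<^sup>2)) * ((x * v / 2) ^ (2 * k) / (fact k * Gamma (real k + \<alpha> + 1)))) sums ((x ^ (2 * j) * exp (- A * x\<^sup>2)) * bessel_even \<alpha> (x * v))"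
      by (rule sums_mult)
    moreover have "(x ^ (2 * j) * exp (- A * x\<^sup>2)) * ((x * v / 2) ^ (2 * k) / (fact k * Gamma (real k + \<alpha> + 1))) = c k * (x ^ (2 * (k + j)) * exp (- A * x\<^sup>2))" for k
      by (simp add: c_def power_divide power_mult_distrib power_add distrib_left)
    ultimately have "(\<lambda>k. c k * (x ^ (2 * (k + j)) * exp (- A * x\<^sup>2))) sums (x ^ (2 * j) * bessel_even \<alpha> (x * v) * exp (- A * x\<^sup>2))" by (simp add: mult_ac)
    moreover have "c k * (x ^ (2 * (k + j)) * exp (- A * x\<^sup>2)) \<ge> 0" for k using c0[of k] by (intro mult_nonneg_nonneg zero_le_even_power') auto
    ultimately have "(\<Sum>k. ennreal (c k * (x ^ (2 * (k + j)) * exp (- A * x\<^sup>2)))) = ennreal (x ^ (2 * j) * bessel_even \<alpha> (x * v) * exp (- A * x\<^sup>2))"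
      by (intro suminf_ennreal_eq)
    thus ?thesis by (simp only: ennreal_mult'[OF c0])
  qed
  have int: "(\<integral>\<^sup>+x. ennreal (x ^ (2 * j) * bessel_even \<alpha> (x * v) * exp (- A * x\<^sup>2)) \<partial>dunkl_measure \<alpha>)
     = (\<Sum>k. ennreal (c k * (Gamma (real (k + j) + \<alpha> + 1) / A powr (real (k + j) + \<alpha> + 1))))" for j
  proof -
    have "(\<integral>\<^sup>+x. ennreal (x ^ (2 * j) * bessel_even \<alpha> (x * v) * exp (- A * x\<^sup>2)) \<partial>dunkl_measure \<alpha>)
     = (\<Sum>k. \<integral>\<^sup>+x. ennreal (c k) * ennreal (x ^ (2 * (k + j)) * exp (- A * x\<^sup>2)) \<partial>dunkl_measure \<alpha>)"
      unfolding ser by (rule nn_integral_suminf) measurable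
    also have "\<dots> = (\<Sum>k. ennreal (c k) * (\<integral>\<^sup>+x. ennreal (x ^ (2 * (k + j)) * exp (- A * x\<^sup>2)) \<partial>dunkl_measure \<alpha>))"
      by (intro suminf_cong nn_integral_cmult) measurable
    also have "\<dots> = (\<Sum>k. ennreal (c k * (Gamma (real (k + j) + \<alpha> + 1) / A powr (real (k + j) + \<alpha> + 1))))"
      by (simp only: nn_integral_dunkl_Gaussian_power[OF \<alpha> A] ennreal_mult'[OF c0])
    finally show ?thesis .
  qed
  define q where "q = v\<^sup>2 / (4 * A)"
  have cG: "c k * (Gamma (real k + \<alpha> + 1) / A powr (real k + \<alpha> + 1)) = A powr (- \<alpha> - 1) * (q ^ k /\<^sub>R fact k)" for k
  proof -
    have "Gamma (real k + \<alpha> + 1) > 0" using \<alpha> by (intro Gamma_real_pos) auto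
    moreover have "A powr (real k + \<alpha> + 1) = A ^ k * A powr (\<alpha> + 1)" using A by (simp add: powr_add powr_realpow)
    moreover have "A powr (- \<alpha> - 1) = 1 / A powr (\<alpha> + 1)" using A powr_minus[of A "\<alpha> + 1"] by (simp add: divide_inverse)
    moreover have "q ^ k = (v / 2) ^ (2 * k) / A ^ k"
    proof -
      have "q = (v / 2)\<^sup>2 / A" by (simp add: q_def power_divide)
      thus ?thesis by (simp only: power_divide power_mult)
    qed
    ultimately show ?thesis unfolding c_def by (simp add: field_simps)
  qed
  have cpos: "c k * (Gamma (real (k + j) + \<alpha> + 1) / A powr (real (k + j) + \<alpha> + 1)) \<ge> 0" for k j
    using c0[of k] \<alpha> by (intro mult_nonneg_nonneg divide_nonneg_nonneg less_imp_le[OF Gamma_real_pos]) auto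
  have "(\<lambda>k. A powr (- \<alpha> - 1) * (q ^ k /\<^sub>R fact k)) sums (A powr (- \<alpha> - 1) * exp q)"
    by (intro sums_mult exp_converges)
  hence "(\<lambda>k. c k * (Gamma (real (k + 0) + \<alpha> + 1) / A powr (real (k + 0) + \<alpha> + 1))) sums (A powr (- \<alpha> - 1) * exp q)" by (simp only: cG add_0_right)
  from suminf_ennreal_eq[OF cpos this] int[of 0] 
  show "(\<integral>\<^sup>+x. ennreal (bessel_even \<alpha> (x * v) * exp (- A * x\<^sup>2)) \<partial>dunkl_measure \<alpha>) = ennreal (A powr (- \<alpha> - 1) * exp (v\<^sup>2 / (4 * A)))"
    by (simp add: q_def)
  have cG1: "c k * (Gamma (real (k + 1) + \<alpha> + 1) / A powr (real (k + 1) + \<alpha> + 1)) = A powr (- \<alpha> - 2) * ((real k + (\<alpha> + 1)) * (q ^ k /\<^sub>R fact k))" for k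
  proof -
    have "Gamma (real (k + 1) + \<alpha> + 1) = (real k + \<alpha> + 1) * Gamma (real k + \<alpha> + 1)"
      using Gamma_shift[of "real k + \<alpha> + 1" 1] \<alpha> by (simp add: add_ac)
    moreover have "A powr (real (k + 1) + \<alpha> + 1) = A * A powr (real k + \<alpha> + 1)"
      using A powr_add[of A 1 "real k + \<alpha> + 1"] by (simp add: add_ac)
    ultimately have "c k * (Gamma (real (k + 1) + \<alpha> + 1) / A powr (real (k + 1) + \<alpha> + 1)) = ((real k + (\<alpha> + 1)) / A) * (c k * (Gamma (real k + \<alpha> + 1) / A powr (real k + \<alpha> + 1)))"
      by (simp add: add.assoc)
    also have "\<dots> = ((real k + (\<alpha> + 1)) / A) * (A powr (- \<alpha> - 1) * (q ^ k /\<^sub>R fact k))" by (simp only: cG)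
    also have "A powr (- \<alpha> - 1) / A = A powr (- \<alpha> - 2)" using A powr_diff[of A "-\<alpha> - 1" 1] by (simp add: diff_diff_eq)
    hence "((real k + (\<alpha> + 1)) / A) * (A powr (- \<alpha> - 1) * (q ^ k /\<^sub>R fact k)) = A powr (- \<alpha> - 2) * ((real k + (\<alpha> + 1)) * (q ^ k /\<^sub>R fact k))"
      by (metis (no_types, lifting) mult.commute mult.left_commute times_divide_eq_left)
    finally show ?thesis .
  qed
  have fm: "(\<lambda>k. real k * (q ^ k /\<^sub>R fact k)) sums (q * exp q)"
  proof -
    have "(\<lambda>k. q * (q ^ k /\<^sub>R fact k)) sums (q * exp q)" by (intro sums_mult exp_converges)
    moreover have "q * (q ^ k /\<^sub>R fact k) = real (Suc k) * (q ^ Suc k /\<^sub>R fact (Suc k))" for k by (simp add: divide_simps)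
    ultimately have "(\<lambda>k. real (Suc k) * (q ^ Suc k /\<^sub>R fact (Suc k))) sums (q * exp q)" by (simp only:)
    thus ?thesis by (subst (asm) sums_Suc_iff) simp
  qed
  have "(\<lambda>k. A powr (- \<alpha> - 2) * (real k * (q ^ k /\<^sub>R fact k) + (\<alpha> + 1) * (q ^ k /\<^sub>R fact k))) sums (A powr (- \<alpha> - 2) * (q * exp q + (\<alpha> + 1) * exp q))"
    by (intro sums_mult sums_add exp_converges fm)
  hence "(\<lambda>k. c k * (Gamma (real (k + 1) + \<alpha> + 1) / A powr (real (k + 1) + \<alpha> + 1))) sums (A powr (- \<alpha> - 2) * ((q + \<alpha> + 1) * exp q))"
    unfolding cG1 by (simp add: algebra_simps)
  from suminf_ennreal_eq[OF cpos this] int[of 1] 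
  show "(\<integral>\<^sup>+x. ennreal (x\<^sup>2 * bessel_even \<alpha> (x * v) * exp (- A * x\<^sup>2)) \<partial>dunkl_measure \<alpha>) = ennreal (A powr (- \<alpha> - 2) * ((v\<^sup>2 / (4 * A) + \<alpha> + 1) * exp (v\<^sup>2 / (4 * A))))"
    by (simp add: q_def)
qed

section \<open>The Laguerre heat kernel\<close>

text \<open>The even part of the Dunkl heat kernel without the factor \<open>2\<^sup>-\<^sup>\<alpha>\<^sup>-\<^sup>1\<close>. It is a multiple of the Laguerre heat
  kernel and positive on the whole plane for every order, whereas the full kernel may change sign.\<close>

definition laguerre_kernel :: "real \<Rightarrow> real \<Rightarrow> real \<Rightarrow> real \<Rightarrow> real" where
  "laguerre_kernel \<alpha> t x y = sinh (2 * t) powr (- \<alpha> - 1)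
     * exp (- (1 / 2) * (cosh (2 * t) / sinh (2 * t)) * (x\<^sup>2 + y\<^sup>2)) * bessel_even \<alpha> (x * y / sinh (2 * t))"

lemma borel_measurable_sinh [measurable (raw)]:
  fixes f :: "'a \<Rightarrow> real"
  shows "f \<in> borel_measurable M \<Longrightarrow> (\<lambda>x. sinh (f x)) \<in> borel_measurable M"
  by (rule measurable_compose[where g = sinh]) (auto intro!: borel_measurable_continuous_onI continuous_intros)

lemma borel_measurable_cosh [measurable (raw)]:
  fixes f :: "'a \<Rightarrow> real"
  shows "f \<in> borel_measurable M \<Longrightarrow> (\<lambda>x. cosh (f x)) \<in> borel_measurable M"
  by (rule measurable_compose[where g = cosh]) (auto intro!: borel_measurable_continuous_onI continuous_intros)

lemma borel_measurable_laguerre_kernel [measurable (raw)]: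
  assumes [measurable]: "f \<in> borel_measurable M" "g \<in> borel_measurable M" "h \<in> borel_measurable M"
  shows "(\<lambda>w. laguerre_kernel \<alpha> (f w) (g w) (h w)) \<in> borel_measurable M"
  unfolding laguerre_kernel_def by measurable

lemma borel_measurable_dunkl_heat_kernel [measurable (raw)]:
  assumes [measurable]: "f \<in> borel_measurable M" "g \<in> borel_measurable M" "h \<in> borel_measurable M"
  shows "(\<lambda>w. dunkl_heat_kernel \<alpha> (f w) (g w) (h w)) \<in> borel_measurable M"
proof -
  have [measurable]: "bessel_I \<nu> \<in> borel_measurable borel" for \<nu>
    unfolding bessel_I_def by measurable
  have [measurable]: "dunkl_Phi \<alpha> \<in> borel_measurable borel"
    unfolding dunkl_Phi_def by measurable
  show ?thesis unfolding dunkl_heat_kernel_def by measurable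
qed

lemma laguerre_kernel_commute: "laguerre_kernel \<alpha> t x y = laguerre_kernel \<alpha> t y x"
  by (simp add: laguerre_kernel_def mult.commute add.commute)

lemma laguerre_kernel_abs: "laguerre_kernel \<alpha> t \<bar>x\<bar> \<bar>y\<bar> = laguerre_kernel \<alpha> t x y"
  unfolding laguerre_kernel_def
  using bessel_even_abs[of \<alpha> "x * y / sinh (2 * t)"] bessel_even_abs[of \<alpha> "\<bar>x\<bar> * \<bar>y\<bar> / sinh (2 * t)"]
  by (simp add: abs_mult)

lemma laguerre_kernel_nonneg: "\<alpha> > -1 \<Longrightarrow> laguerre_kernel \<alpha> t x y \<ge> 0"
  using bessel_even_pos by (simp add: laguerre_kernel_def less_imp_le)

text \<open>The odd part is written as the even part times \<open>u/2\<close> times a quotient of Bessel factors. This quotient is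
  positive and, by \<open>bessel_odd_le_even\<close>, its product with \<open>u/2\<close> is bounded, so both comparisons below can be read
  off.\<close>

lemma dunkl_heat_kernel_eq:
  assumes "\<alpha> > -1" "t > 0"
  shows "dunkl_heat_kernel \<alpha> t x y = 2 powr (- \<alpha> - 1) * (laguerre_kernel \<alpha> t x y + (x * y / sinh (2 * t)) / 2 * laguerre_kernel \<alpha> t x y
     * (bessel_even (\<alpha> + 1) (x * y / sinh (2 * t)) / bessel_even \<alpha> (x * y / sinh (2 * t))))"
proof -
  define u S X E E' where "u = x * y / sinh (2 * t)" and "S = sinh (2 * t) powr (- \<alpha> - 1)"
    and "X = exp (- (1 / 2) * (cosh (2 * t) / sinh (2 * t)) * (x\<^sup>2 + y\<^sup>2))"
    and "E = bessel_even \<alpha> u" and "E' = bessel_even (\<alpha> + 1) u"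
  define P where "P = 2 powr (- \<alpha> - 1)"
  have P: "2 powr (- \<alpha>) = 2 * P" by (simp add: P_def powr_diff)
  have E: "E > 0" using bessel_even_pos[OF assms(1)] by (simp add: E_def)
  have "1 / 2 * S * X * (2 * P * (E + u / 2 * E')) = P * (S * X * E + u / 2 * (S * X * E) * (E' / E))"
    using E by (simp add: field_simps)
  thus ?thesis
    unfolding dunkl_heat_kernel_def dunkl_Phi_eq[OF assms(1)] laguerre_kernel_def P
    by (simp only: u_def S_def X_def E_def E'_def P_def)
qed

lemma dunkl_heat_kernel_ge:
  assumes "\<alpha> > -1" "t > 0" "x > 0" "y > 0"
  shows "dunkl_heat_kernel \<alpha> t x y \<ge> 2 powr (- \<alpha> - 1) * laguerre_kernel \<alpha> t x y"
proof -
  have "0 \<le> (x * y / sinh (2 * t)) / 2 * laguerre_kernel \<alpha> t x y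
     * (bessel_even (\<alpha> + 1) (x * y / sinh (2 * t)) / bessel_even \<alpha> (x * y / sinh (2 * t)))"
    using assms bessel_even_pos[of \<alpha>] bessel_even_pos[of "\<alpha> + 1"] laguerre_kernel_nonneg
    by (intro mult_nonneg_nonneg divide_nonneg_nonneg) (auto simp: less_imp_le)
  thus ?thesis by (subst dunkl_heat_kernel_eq[OF assms(1,2)]) (intro mult_left_mono, auto)
qed

lemma dunkl_heat_kernel_abs_le:
  assumes "\<alpha> > -1"
  obtains C where "C > 0" "\<And>t x y. t > 0 \<Longrightarrow> \<bar>dunkl_heat_kernel \<alpha> t x y\<bar> \<le> C * laguerre_kernel \<alpha> t x y"
proof -
  obtain C where C: "C > 0" "\<And>u. u \<ge> 0 \<Longrightarrow> (u / 2) * bessel_even (\<alpha> + 1) u \<le> C * bessel_even \<alpha> u"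
    using bessel_odd_le_even[OF assms] by blast
  have "\<bar>dunkl_heat_kernel \<alpha> t x y\<bar> \<le> (2 powr (- \<alpha> - 1) * (1 + C)) * laguerre_kernel \<alpha> t x y" if t: "t > 0" for t x y
  proof -
    define u where "u = x * y / sinh (2 * t)"
    define H where "H = laguerre_kernel \<alpha> t x y"
    have H: "H \<ge> 0" using laguerre_kernel_nonneg[OF assms] by (simp add: H_def)
    have E: "bessel_even \<alpha> u > 0" "bessel_even (\<alpha> + 1) u > 0" using bessel_even_pos assms by auto
    have "\<bar>u / 2 * H * (bessel_even (\<alpha> + 1) u / bessel_even \<alpha> u)\<bar> = H * ((\<bar>u\<bar> / 2) * bessel_even (\<alpha> + 1) u / bessel_even \<alpha> u)"
      using E H by (simp add: abs_mult)
    also have "\<dots> \<le> H * C"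
      using C(2)[of "\<bar>u\<bar>"] E H by (intro mult_left_mono) (auto simp: bessel_even_abs divide_le_eq)
    finally have "\<bar>u / 2 * H * (bessel_even (\<alpha> + 1) u / bessel_even \<alpha> u)\<bar> \<le> H * C" .
    moreover have "(1 + C) * H = H + H * C" by (simp add: algebra_simps)
    ultimately have "\<bar>H + u / 2 * H * (bessel_even (\<alpha> + 1) u / bessel_even \<alpha> u)\<bar> \<le> (1 + C) * H"
      using H by linarith
    hence "2 powr (- \<alpha> - 1) * \<bar>H + u / 2 * H * (bessel_even (\<alpha> + 1) u / bessel_even \<alpha> u)\<bar> \<le> 2 powr (- \<alpha> - 1) * ((1 + C) * H)"
      by (intro mult_left_mono) auto
    moreover have "\<bar>dunkl_heat_kernel \<alpha> t x y\<bar> = 2 powr (- \<alpha> - 1) * \<bar>H + u / 2 * H * (bessel_even (\<alpha> + 1) u / bessel_even \<alpha> u)\<bar>"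
      unfolding dunkl_heat_kernel_eq[OF assms t] abs_mult by (simp add: H_def u_def)
    ultimately show ?thesis by (simp only: H_def mult.assoc)
  qed
  thus ?thesis using C(1) that[of "2 powr (- \<alpha> - 1) * (1 + C)"] by simp
qed

text \<open>The Bessel factor grows like \<open>exp \<bar>u\<bar>\<close>. Since \<open>coth(2t) - 1/sinh(2t) = tanh t\<close>, combining that growth
  with the Gaussian factor separates the decay off the diagonal from the decay at infinity.\<close>

lemma laguerre_kernel_exponent:
  fixes t x y :: real
  assumes "t > 0"
  shows "- (1 / 2) * (cosh (2 * t) / sinh (2 * t)) * (x\<^sup>2 + y\<^sup>2) + \<bar>x * y\<bar> / sinh (2 * t) 
    = - (\<bar>x\<bar> - \<bar>y\<bar>)\<^sup>2 / (2 * sinh (2 * t)) - tanh t / 2 * (x\<^sup>2 + y\<^sup>2)"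
proof -
  have s: "sinh t > 0" using assms by simp
  have c1: "cosh (2 * t) - 1 = 2 * sinh t ^ 2" using cosh_double_cosh[of t] cosh_square_eq[of t] by simp
  have "cosh (2 * t) / sinh (2 * t) - 1 / sinh (2 * t) = tanh t"
    unfolding diff_divide_distrib[symmetric] c1 sinh_double tanh_def using s by (simp add: power2_eq_square)
  hence c2: "cosh (2 * t) / sinh (2 * t) = 1 / sinh (2 * t) + tanh t" by simp
  have "(\<bar>x\<bar> - \<bar>y\<bar>)\<^sup>2 = x\<^sup>2 + y\<^sup>2 - 2 * \<bar>x * y\<bar>" by (simp add: power2_diff abs_mult)
  hence "- (\<bar>x\<bar> - \<bar>y\<bar>)\<^sup>2 / (2 * sinh (2 * t)) = - (1 / 2) * (1 / sinh (2 * t)) * (x\<^sup>2 + y\<^sup>2) + \<bar>x * y\<bar> / sinh (2 * t)"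
    by (simp only:) (simp add: divide_simps)
  thus ?thesis unfolding c2 by (simp add: algebra_simps)
qed

lemma laguerre_kernel_le:
  assumes "\<alpha> \<ge> -1/2" "t > 0"
  shows "laguerre_kernel \<alpha> t x y \<le> sinh (2 * t) powr (- \<alpha> - 1) / Gamma (\<alpha> + 1)"
proof -
  have s: "sinh (2 * t) > 0" using assms by simp
  have G: "Gamma (\<alpha> + 1) > 0" using assms by simp
  have "exp (- (1 / 2) * (cosh (2 * t) / sinh (2 * t)) * (x\<^sup>2 + y\<^sup>2)) * bessel_even \<alpha> (x * y / sinh (2 * t))
     \<le> exp (- (1 / 2) * (cosh (2 * t) / sinh (2 * t)) * (x\<^sup>2 + y\<^sup>2)) * (exp \<bar>x * y / sinh (2 * t)\<bar> / Gamma (\<alpha> + 1))"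
    by (rule mult_left_mono[OF bessel_even_le_exp[OF assms(1)]]) simp
  also have "\<dots> = exp (- (\<bar>x\<bar> - \<bar>y\<bar>)\<^sup>2 / (2 * sinh (2 * t)) - tanh t / 2 * (x\<^sup>2 + y\<^sup>2)) / Gamma (\<alpha> + 1)"
    using s unfolding laguerre_kernel_exponent[OF assms(2), symmetric] exp_add by simp
  also have "\<dots> \<le> 1 / Gamma (\<alpha> + 1)"
  proof (intro divide_right_mono)
    have "0 \<le> (\<bar>x\<bar> - \<bar>y\<bar>)\<^sup>2 / (2 * sinh (2 * t))" "0 \<le> tanh t / 2 * (x\<^sup>2 + y\<^sup>2)" using s assms by auto
    thus "exp (- (\<bar>x\<bar> - \<bar>y\<bar>)\<^sup>2 / (2 * sinh (2 * t)) - tanh t / 2 * (x\<^sup>2 + y\<^sup>2)) \<le> 1" by simp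
  qed (use G in auto)
  finally have "exp (- (1 / 2) * (cosh (2 * t) / sinh (2 * t)) * (x\<^sup>2 + y\<^sup>2)) * bessel_even \<alpha> (x * y / sinh (2 * t)) \<le> 1 / Gamma (\<alpha> + 1)" .
  from mult_left_mono[OF this, of "sinh (2 * t) powr (- \<alpha> - 1)"] show ?thesis
    unfolding laguerre_kernel_def by (simp only: mult.assoc powr_ge_zero simp_thms times_divide_eq_right mult_1_right)
qed

text \<open>For these orders the Bessel factor exceeds \<open>exp \<bar>u\<bar>\<close> by the positive power \<open>(1+\<bar>u\<bar>)\<^sup>-\<^sup>\<alpha>\<^sup>-\<^sup>1\<^sup>/\<^sup>2\<close>, so a bound
  uniform in \<open>x\<close> and \<open>y\<close> would lose the position of the maximum, which is where \<open>x\<^sup>2+y\<^sup>2\<close> is comparable with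
  \<open>1/tanh t\<close>. The dependence on \<open>x\<^sup>2+y\<^sup>2\<close> is therefore kept.\<close>

lemma laguerre_kernel_le_small_order:
  assumes "\<alpha> > -1" "\<alpha> < -1/2"
  obtains C where "C > 0" "\<And>t x y. t > 0 \<Longrightarrow> laguerre_kernel \<alpha> t x y \<le> 
     C * (sinh (2 * t) powr (-1/2) * (sinh (2 * t) + (x\<^sup>2 + y\<^sup>2)) powr (- \<alpha> - 1/2)) * exp (- tanh t / 2 * (x\<^sup>2 + y\<^sup>2))"
proof -
  obtain C where C: "C > 0" "\<And>u. u \<ge> 0 \<Longrightarrow> bessel_even \<alpha> u \<le> C * (1 + u) powr (-\<alpha> - 1/2) * exp u"
    using bessel_even_le_powr_exp[OF assms] by blast
  have "laguerre_kernel \<alpha> t x y \<le> 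
     C * (sinh (2 * t) powr (-1/2) * (sinh (2 * t) + (x\<^sup>2 + y\<^sup>2)) powr (- \<alpha> - 1/2)) * exp (- tanh t / 2 * (x\<^sup>2 + y\<^sup>2))" if t: "t > 0" for t x y
  proof -
    define s where "s = sinh (2 * t)"
    have s: "s > 0" using t by (simp add: s_def)
    have xy: "\<bar>x * y\<bar> \<le> x\<^sup>2 + y\<^sup>2"
      using sum_squares_bound[of "\<bar>x\<bar>" "\<bar>y\<bar>"] abs_ge_zero[of "x * y"] unfolding abs_mult power2_abs by linarith
    have "laguerre_kernel \<alpha> t x y = s powr (- \<alpha> - 1) * exp (- (1 / 2) * (cosh (2 * t) / s) * (x\<^sup>2 + y\<^sup>2)) * bessel_even \<alpha> (\<bar>x * y\<bar> / s)"
      using bessel_even_abs[of \<alpha> "x * y / s"] s by (simp add: laguerre_kernel_def s_def)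
    also have "\<dots> \<le> s powr (- \<alpha> - 1) * exp (- (1 / 2) * (cosh (2 * t) / s) * (x\<^sup>2 + y\<^sup>2)) * (C * (1 + \<bar>x * y\<bar> / s) powr (-\<alpha> - 1/2) * exp (\<bar>x * y\<bar> / s))"
      using s by (intro mult_left_mono C(2)) auto
    also have "\<dots> = C * (s powr (- \<alpha> - 1) * (1 + \<bar>x * y\<bar> / s) powr (-\<alpha> - 1/2)) * exp (- (1 / 2) * (cosh (2 * t) / s) * (x\<^sup>2 + y\<^sup>2) + \<bar>x * y\<bar> / s)"
      by (simp only: exp_add mult_ac)
    also have "s powr (- \<alpha> - 1) * (1 + \<bar>x * y\<bar> / s) powr (-\<alpha> - 1/2) = s powr (-1/2) * (s + \<bar>x * y\<bar>) powr (- \<alpha> - 1/2)"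
    proof -
      have "s powr (- \<alpha> - 1) = s powr (-1/2) * s powr (-\<alpha> - 1/2)"
        using powr_add[of s "-1/2" "-\<alpha> - 1/2"] by (simp add: algebra_simps)
      moreover have "s powr (-\<alpha> - 1/2) * (1 + \<bar>x * y\<bar> / s) powr (-\<alpha> - 1/2) = (s + \<bar>x * y\<bar>) powr (-\<alpha> - 1/2)"
        using s by (subst powr_mult[symmetric]) (auto simp: distrib_left)
      ultimately show ?thesis by (simp add: mult.assoc)
    qed
    also have "exp (- (1 / 2) * (cosh (2 * t) / s) * (x\<^sup>2 + y\<^sup>2) + \<bar>x * y\<bar> / s) = exp (- (\<bar>x\<bar> - \<bar>y\<bar>)\<^sup>2 / (2 * s) - tanh t / 2 * (x\<^sup>2 + y\<^sup>2))"
      using laguerre_kernel_exponent[OF t, of x y] by (simp only: s_def)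
    also have "C * (s powr (-1/2) * (s + \<bar>x * y\<bar>) powr (- \<alpha> - 1/2)) * exp (- (\<bar>x\<bar> - \<bar>y\<bar>)\<^sup>2 / (2 * s) - tanh t / 2 * (x\<^sup>2 + y\<^sup>2))
       \<le> C * (s powr (-1/2) * (s + (x\<^sup>2 + y\<^sup>2)) powr (- \<alpha> - 1/2)) * exp (- tanh t / 2 * (x\<^sup>2 + y\<^sup>2))"
      using xy s C(1) assms by (intro mult_mono powr_mono2 mult_left_mono) auto
    finally show ?thesis by (simp only: s_def)
  qed
  thus ?thesis using C(1) that by blast
qed

text \<open>A formula of Mehler type: the heat kernel maps Gaussians to Gaussians, because the Gaussian factor of the kernel
  and the test Gaussian combine to a single one against which the Bessel factor is integrated.\<close>

lemma nn_integral_laguerre_kernel_Gaussian: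
  assumes \<alpha>: "\<alpha> > -1" and t: "t > 0" and B: "B \<ge> 0"
  defines "s \<equiv> sinh (2 * t)" and "c \<equiv> cosh (2 * t)"
  shows "(\<integral>\<^sup>+x. ennreal (laguerre_kernel \<alpha> t x y * exp (- B * x\<^sup>2)) \<partial>dunkl_measure \<alpha>)
     = ennreal ((c / 2 + B * s) powr (- \<alpha> - 1) * exp (- (c / (2 * s) - 1 / (4 * s * (c / 2 + B * s))) * y\<^sup>2))"
proof -
  have s: "s > 0" "c > 0" using t by (auto simp: s_def c_def cosh_real_pos)
  \<comment> \<open>The combined coefficient of \<open>x\<^sup>2\<close> in the exponent.\<close>
  define A where "A = c / (2 * s) + B"
  have A: "A > 0" using s B by (simp add: A_def add_pos_nonneg)
  have sA: "s * A = c / 2 + B * s" using s by (simp add: A_def field_simps)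
  define K where "K = s powr (- \<alpha> - 1) * exp (- (c / (2 * s)) * y\<^sup>2)"
  have K0: "K \<ge> 0" by (simp add: K_def)
  have eq: "laguerre_kernel \<alpha> t x y * exp (- B * x\<^sup>2) = K * (bessel_even \<alpha> (x * (y / s)) * exp (- A * x\<^sup>2))" for x
  proof -
    have "- (1 / 2) * (c / s) * (x\<^sup>2 + y\<^sup>2) + - B * x\<^sup>2 = - (c / (2 * s)) * y\<^sup>2 + - A * x\<^sup>2"
      using s by (simp add: A_def field_simps)
    hence "exp (- (1 / 2) * (c / s) * (x\<^sup>2 + y\<^sup>2)) * exp (- B * x\<^sup>2) = exp (- (c / (2 * s)) * y\<^sup>2) * exp (- A * x\<^sup>2)"
      by (simp only: exp_add[symmetric])
    thus ?thesis by (simp add: laguerre_kernel_def K_def s_def[symmetric] c_def[symmetric])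
  qed
  have "(\<integral>\<^sup>+x. ennreal (laguerre_kernel \<alpha> t x y * exp (- B * x\<^sup>2)) \<partial>dunkl_measure \<alpha>) 
     = (\<integral>\<^sup>+x. ennreal K * ennreal (bessel_even \<alpha> (x * (y / s)) * exp (- A * x\<^sup>2)) \<partial>dunkl_measure \<alpha>)"
    by (simp only: eq ennreal_mult'[OF K0])
  also have "\<dots> = ennreal K * ennreal (A powr (- \<alpha> - 1) * exp ((y / s)\<^sup>2 / (4 * A)))"
    by (simp only: nn_integral_bessel_Gaussian(1)[OF \<alpha> A, symmetric]) (rule nn_integral_cmult, measurable)
  also have "\<dots> = ennreal (K * (A powr (- \<alpha> - 1) * exp ((y / s)\<^sup>2 / (4 * A))))"
    by (rule ennreal_mult'[symmetric]) (simp add: K_def)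
  also have "K * (A powr (- \<alpha> - 1) * exp ((y / s)\<^sup>2 / (4 * A))) = (s * A) powr (- \<alpha> - 1) * exp (- (c / (2 * s)) * y\<^sup>2 + (y / s)\<^sup>2 / (4 * A))"
    unfolding K_def exp_add using s A by (simp add: powr_mult)
  also have "- (c / (2 * s)) * y\<^sup>2 + (y / s)\<^sup>2 / (4 * A) = - (c / (2 * s) - 1 / (4 * s * (s * A))) * y\<^sup>2"
    using s A by (simp add: power_divide field_simps power2_eq_square)
  finally show ?thesis by (simp only: sA)
qed

lemma nn_integral_laguerre_kernel:
  assumes \<alpha>: "\<alpha> > -1" and t: "t > 0"
  shows "(\<integral>\<^sup>+x. ennreal (laguerre_kernel \<alpha> t x y) \<partial>dunkl_measure \<alpha>)
     = ennreal ((cosh (2 * t) / 2) powr (- \<alpha> - 1) * exp (- (tanh (2 * t) / 2) * y\<^sup>2))"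
proof -
  have s: "sinh (2 * t) > 0" "cosh (2 * t) > 0" using t by (auto simp: cosh_real_pos)
  have "cosh (2 * t) / (2 * sinh (2 * t)) - 1 / (4 * sinh (2 * t) * (cosh (2 * t) / 2)) = ((cosh (2 * t))\<^sup>2 - 1) / (2 * sinh (2 * t) * cosh (2 * t))"
    using s by (simp add: field_simps power2_eq_square)
  also have "(cosh (2 * t))\<^sup>2 - 1 = (sinh (2 * t))\<^sup>2" by (simp add: cosh_square_eq)
  finally have eq: "cosh (2 * t) / (2 * sinh (2 * t)) - 1 / (4 * sinh (2 * t) * (cosh (2 * t) / 2)) = tanh (2 * t) / 2"
    using s by (simp add: tanh_def power2_eq_square)
  show ?thesis using nn_integral_laguerre_kernel_Gaussian[OF \<alpha> t, of 0 y]
    by (simp only: mult_zero_left add_0_right minus_zero exp_zero mult_1_right eq order_refl)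
qed

text \<open>Relative to the total mass, the mean of \<open>x\<^sup>2\<close> under the kernel at \<open>y\<close> is at most of order \<open>y\<^sup>2 + sinh(2t)\<close>. This
  controls weights that grow with \<open>x\<^sup>2\<close>.\<close>

lemma nn_integral_laguerre_kernel_second_moment:
  assumes \<alpha>: "\<alpha> > -1" and t: "t > 0"
  shows "(\<integral>\<^sup>+x. ennreal (x\<^sup>2 * laguerre_kernel \<alpha> t x y) \<partial>dunkl_measure \<alpha>)
     = ennreal ((cosh (2 * t) / 2) powr (- \<alpha> - 1) * exp (- (tanh (2 * t) / 2) * y\<^sup>2) * (y\<^sup>2 / (cosh (2 * t))\<^sup>2 + 2 * (\<alpha> + 1) * tanh (2 * t)))"
proof -
  define s where "s = sinh (2 * t)"
  define c where "c = cosh (2 * t)"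
  have s: "s > 0" "c > 0" using t by (auto simp: s_def c_def cosh_real_pos)
  define A where "A = c / (2 * s)"
  have A: "A > 0" using s by (simp add: A_def)
  have sA: "s * A = c / 2" using s by (simp add: A_def field_simps)
  define K where "K = s powr (- \<alpha> - 1) * exp (- (c / (2 * s)) * y\<^sup>2)"
  have K0: "K \<ge> 0" by (simp add: K_def)
  have eq: "x\<^sup>2 * laguerre_kernel \<alpha> t x y = K * (x\<^sup>2 * bessel_even \<alpha> (x * (y / s)) * exp (- A * x\<^sup>2))" for x
  proof -
    have "- (1 / 2) * (c / s) * (x\<^sup>2 + y\<^sup>2) = - (c / (2 * s)) * y\<^sup>2 + - A * x\<^sup>2"
      using s by (simp add: A_def field_simps)
    hence "exp (- (1 / 2) * (c / s) * (x\<^sup>2 + y\<^sup>2)) = exp (- (c / (2 * s)) * y\<^sup>2) * exp (- A * x\<^sup>2)"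
      by (simp only: exp_add[symmetric])
    thus ?thesis by (simp add: laguerre_kernel_def K_def s_def[symmetric] c_def[symmetric])
  qed
  have "(\<integral>\<^sup>+x. ennreal (x\<^sup>2 * laguerre_kernel \<alpha> t x y) \<partial>dunkl_measure \<alpha>) 
     = (\<integral>\<^sup>+x. ennreal K * ennreal (x\<^sup>2 * bessel_even \<alpha> (x * (y / s)) * exp (- A * x\<^sup>2)) \<partial>dunkl_measure \<alpha>)"
    by (simp only: eq ennreal_mult'[OF K0])
  also have "\<dots> = ennreal K * ennreal (A powr (- \<alpha> - 2) * (((y / s)\<^sup>2 / (4 * A) + \<alpha> + 1) * exp ((y / s)\<^sup>2 / (4 * A))))"
    by (simp only: nn_integral_bessel_Gaussian(2)[OF \<alpha> A, symmetric]) (rule nn_integral_cmult, measurable)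
  also have "\<dots> = ennreal (K * (A powr (- \<alpha> - 2) * (((y / s)\<^sup>2 / (4 * A) + \<alpha> + 1) * exp ((y / s)\<^sup>2 / (4 * A)))))"
    by (rule ennreal_mult'[symmetric]) (simp add: K_def)
  also have "A powr (- \<alpha> - 2) = A powr (- \<alpha> - 1) / A" using A powr_diff[of A "-\<alpha> - 1" 1] by (simp add: diff_diff_eq)
  also have "K * (A powr (- \<alpha> - 1) / A * (((y / s)\<^sup>2 / (4 * A) + \<alpha> + 1) * exp ((y / s)\<^sup>2 / (4 * A)))) 
      = (s * A) powr (- \<alpha> - 1) * exp (- (c / (2 * s)) * y\<^sup>2 + (y / s)\<^sup>2 / (4 * A)) * (((y / s)\<^sup>2 / (4 * A) + \<alpha> + 1) / A)"
    unfolding K_def exp_add using s A by (simp add: powr_mult)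
  also have "- (c / (2 * s)) * y\<^sup>2 + (y / s)\<^sup>2 / (4 * A) = - (tanh (2 * t) / 2) * y\<^sup>2"
  proof -
    have "(y / s)\<^sup>2 / (4 * A) = y\<^sup>2 / (2 * s * c)" using s by (simp add: A_def power_divide field_simps power2_eq_square)
    hence "- (c / (2 * s)) * y\<^sup>2 + (y / s)\<^sup>2 / (4 * A) = - (c / (2 * s)) * y\<^sup>2 + y\<^sup>2 / (2 * s * c)" by simp
    also have "\<dots> = - ((c\<^sup>2 - 1) / (2 * s * c)) * y\<^sup>2"
      using s by (simp add: field_simps power2_eq_square)
    also have "c\<^sup>2 - 1 = s\<^sup>2" by (simp add: c_def s_def cosh_square_eq)
    finally show ?thesis using s by (simp add: tanh_def s_def[symmetric] c_def[symmetric] power2_eq_square)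
  qed
  also have "((y / s)\<^sup>2 / (4 * A) + \<alpha> + 1) / A = y\<^sup>2 / c\<^sup>2 + 2 * (\<alpha> + 1) * tanh (2 * t)"
  proof -
    have th: "tanh (2 * t) = s / c" by (simp add: tanh_def s_def c_def)
    have i: "1 / A = 2 * s / c" using s by (simp add: A_def)
    have "(y / s)\<^sup>2 / (4 * A) = (y / s)\<^sup>2 / 4 * (1 / A)" by simp
    also have "\<dots> = y\<^sup>2 / (2 * s * c)" unfolding i using s by (simp add: power_divide field_simps power2_eq_square)
    finally have "((y / s)\<^sup>2 / (4 * A) + \<alpha> + 1) / A = (y\<^sup>2 / (2 * s * c) + \<alpha> + 1) * (2 * s / c)"
      by (simp only: i[symmetric] times_divide_eq_right mult_1_right)
    also have "\<dots> = y\<^sup>2 / c\<^sup>2 + 2 * (\<alpha> + 1) * (s / c)" using s by (simp add: field_simps power2_eq_square)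
    finally show ?thesis by (simp only: th)
  qed
  finally show ?thesis by (simp only: sA c_def)
qed

text \<open>The exact value from which the lower bounds of the form by Gaussian minorants are obtained.\<close>

lemma nn_integral_laguerre_kernel_two_Gaussians:
  assumes \<alpha>: "\<alpha> > -1" and t: "t > 0" and A: "A > 0" and B: "B > 0"
  shows "(\<integral>\<^sup>+y. (\<integral>\<^sup>+x. ennreal (laguerre_kernel \<alpha> t x y * exp (- B * x\<^sup>2) * exp (- A * y\<^sup>2)) \<partial>dunkl_measure \<alpha>) \<partial>dunkl_measure \<alpha>)
     = ennreal (Gamma (\<alpha> + 1) * (sinh (2 * t) * (1 / 4 + A * B) + (A + B) * cosh (2 * t) / 2) powr (- \<alpha> - 1))"
proof -
  define s where "s = sinh (2 * t)"
  define c where "c = cosh (2 * t)"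
  have s: "s > 0" "c > 0" using t by (auto simp: s_def c_def cosh_real_pos)
  have cs: "c\<^sup>2 = s\<^sup>2 + 1" by (simp add: c_def s_def cosh_square_eq)
  define P where "P = c / 2 + B * s"
  have P: "P > 0" using s B by (simp add: P_def add_pos_pos)
  define D where "D = c / (2 * s) - 1 / (4 * s * P) + A"
  have PD: "P * D = s * (1 / 4 + A * B) + (A + B) * c / 2"
  proof -
    have "P * D = P * (c / (2 * s)) - 1 / (4 * s) + P * A" using P s by (simp add: D_def field_simps)
    also have "P * (c / (2 * s)) = c\<^sup>2 / (4 * s) + B * c / 2" using s by (simp add: P_def field_simps power2_eq_square)
    also have "c\<^sup>2 / (4 * s) = s / 4 + 1 / (4 * s)" unfolding cs using s by (simp add: field_simps power2_eq_square)
    finally show ?thesis by (simp add: P_def algebra_simps)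
  qed
  have D: "D > 0"
  proof -
    have "P * D > 0" unfolding PD using s A B by (intro add_pos_pos mult_pos_pos) (auto intro: add_pos_pos)
    thus ?thesis using P by (simp add: zero_less_mult_iff)
  qed
  have "(\<integral>\<^sup>+x. ennreal (laguerre_kernel \<alpha> t x y * exp (- B * x\<^sup>2) * exp (- A * y\<^sup>2)) \<partial>dunkl_measure \<alpha>)
     = ennreal (P powr (- \<alpha> - 1)) * ennreal (y ^ (2 * 0) * exp (- D * y\<^sup>2))" for y
  proof -
    have "(\<integral>\<^sup>+x. ennreal (laguerre_kernel \<alpha> t x y * exp (- B * x\<^sup>2) * exp (- A * y\<^sup>2)) \<partial>dunkl_measure \<alpha>)
      = (\<integral>\<^sup>+x. ennreal (laguerre_kernel \<alpha> t x y * exp (- B * x\<^sup>2)) \<partial>dunkl_measure \<alpha>) * ennreal (exp (- A * y\<^sup>2))"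
      by (simp add: ennreal_mult'' nn_integral_multc)
    also have "\<dots> = ennreal (P powr (- \<alpha> - 1) * exp (- (c / (2 * s) - 1 / (4 * s * P)) * y\<^sup>2)) * ennreal (exp (- A * y\<^sup>2))"
      using nn_integral_laguerre_kernel_Gaussian[OF \<alpha> t, of B y] B by (simp only: P_def s_def c_def less_imp_le)
    also have "\<dots> = ennreal (P powr (- \<alpha> - 1) * (exp (- (c / (2 * s) - 1 / (4 * s * P)) * y\<^sup>2) * exp (- A * y\<^sup>2)))"
      by (simp add: ennreal_mult'[symmetric] mult.assoc)
    also have "exp (- (c / (2 * s) - 1 / (4 * s * P)) * y\<^sup>2) * exp (- A * y\<^sup>2) = exp (- D * y\<^sup>2)"
      by (simp add: exp_add[symmetric] D_def algebra_simps)
    finally show ?thesis by (simp add: ennreal_mult')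
  qed
  hence "(\<integral>\<^sup>+y. (\<integral>\<^sup>+x. ennreal (laguerre_kernel \<alpha> t x y * exp (- B * x\<^sup>2) * exp (- A * y\<^sup>2)) \<partial>dunkl_measure \<alpha>) \<partial>dunkl_measure \<alpha>)
      = ennreal (P powr (- \<alpha> - 1)) * ennreal (Gamma (\<alpha> + 1) / D powr (\<alpha> + 1))"
    using nn_integral_dunkl_Gaussian_power[OF \<alpha> D, of 0] by (simp add: nn_integral_cmult)
  also have "\<dots> = ennreal (Gamma (\<alpha> + 1) * (P * D) powr (- \<alpha> - 1))"
  proof -
    have "D powr (- \<alpha> - 1) = 1 / D powr (\<alpha> + 1)" using powr_minus[of D "\<alpha> + 1"] by (simp add: divide_inverse)
    thus ?thesis using P D by (simp add: ennreal_mult'[symmetric] powr_mult mult_ac)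
  qed
  finally show ?thesis by (simp only: PD s_def c_def)
qed

section \<open>The potential as a trilinear form\<close>

interpretation dunkl_pair: pair_sigma_finite "dunkl_measure \<alpha>" "dunkl_measure \<alpha>" for \<alpha>
  by (intro pair_sigma_finite.intro sigma_finite_dunkl_measure)

interpretation time_dunkl_pair: pair_sigma_finite lborel "dunkl_measure \<alpha>" for \<alpha>
  by (intro pair_sigma_finite.intro sigma_finite_dunkl_measure sigma_finite_lborel)

definition potential_weight :: "real \<Rightarrow> real \<Rightarrow> real \<Rightarrow> real \<Rightarrow> real \<Rightarrow> ennreal" where
  "potential_weight \<alpha> \<sigma> t x y = ennreal (t powr (\<sigma> - 1) * laguerre_kernel \<alpha> t x y) * indicator {0<..} t"

lemma borel_measurable_potential_weight [measurable (raw)]: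
  assumes [measurable]: "f \<in> borel_measurable M" "g \<in> borel_measurable M" "h \<in> borel_measurable M"
  shows "(\<lambda>w. potential_weight \<alpha> \<sigma> (f w) (g w) (h w)) \<in> borel_measurable M"
  unfolding potential_weight_def by measurable

lemma potential_weight_commute: "potential_weight \<alpha> \<sigma> t x y = potential_weight \<alpha> \<sigma> t y x"
  by (simp add: potential_weight_def laguerre_kernel_commute[of \<alpha> t x y])

text \<open>Joint measurability in the time and both space variables, which makes the order of integration irrelevant.\<close>

definition measurable3 :: "(real \<Rightarrow> real \<Rightarrow> real \<Rightarrow> ennreal) \<Rightarrow> bool" where
  "measurable3 W \<longleftrightarrow> (\<lambda>(t, x, y). W t x y) \<in> borel_measurable (borel \<Otimes>\<^sub>M borel \<Otimes>\<^sub>M borel)"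

lemma measurable3_compose:
  assumes W: "measurable3 W" and "f \<in> borel_measurable M" "g \<in> borel_measurable M" "h \<in> borel_measurable M"
  shows "(\<lambda>w. W (f w) (g w) (h w)) \<in> borel_measurable M"
proof -
  have "(\<lambda>w. (f w, g w, h w)) \<in> M \<rightarrow>\<^sub>M borel \<Otimes>\<^sub>M borel \<Otimes>\<^sub>M borel" using assms by measurable
  from measurable_compose[OF this W[unfolded measurable3_def]] show ?thesis by simp
qed

text \<open>The time variable is kept inside the integrand: the pointwise inequalities used for the upper bounds split the
  integrand differently at different times.\<close>

definition potential_form :: "real \<Rightarrow> real \<Rightarrow> (real \<Rightarrow> real \<Rightarrow> real \<Rightarrow> ennreal) \<Rightarrow> ennreal" where
  "potential_form \<alpha> \<sigma> W = (\<integral>\<^sup>+t. \<integral>\<^sup>+x. \<integral>\<^sup>+y. potential_weight \<alpha> \<sigma> t x y * W t x y \<partial>dunkl_measure \<alpha> \<partial>dunkl_measure \<alpha> \<partial>lborel)"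

lemma potential_form_mono:
  assumes "\<And>t x y. t > 0 \<Longrightarrow> W t x y \<le> V t x y"
  shows "potential_form \<alpha> \<sigma> W \<le> potential_form \<alpha> \<sigma> V"
  unfolding potential_form_def
proof (intro nn_integral_mono)
  fix t x y
  show "potential_weight \<alpha> \<sigma> t x y * W t x y \<le> potential_weight \<alpha> \<sigma> t x y * V t x y"
    by (cases "t > 0") (auto simp: potential_weight_def intro!: mult_left_mono assms)
qed

lemma potential_form_add:
  assumes W: "measurable3 W" and V: "measurable3 V"
  shows "potential_form \<alpha> \<sigma> (\<lambda>t x y. W t x y + V t x y) = potential_form \<alpha> \<sigma> W + potential_form \<alpha> \<sigma> V"
proof -
  note [measurable (raw)] = measurable3_compose[OF W] measurable3_compose[OF V]
  show ?thesis unfolding potential_form_def distrib_left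
    by (simp add: nn_integral_add)
qed

lemma potential_form_swap_y:
  assumes W: "measurable3 W"
  shows "potential_form \<alpha> \<sigma> W = (\<integral>\<^sup>+y. \<integral>\<^sup>+t. \<integral>\<^sup>+x. potential_weight \<alpha> \<sigma> t x y * W t x y \<partial>dunkl_measure \<alpha> \<partial>lborel \<partial>dunkl_measure \<alpha>)"
proof -
  note [measurable (raw)] = measurable3_compose[OF W]
  have "potential_form \<alpha> \<sigma> W = (\<integral>\<^sup>+t. \<integral>\<^sup>+y. \<integral>\<^sup>+x. potential_weight \<alpha> \<sigma> t x y * W t x y \<partial>dunkl_measure \<alpha> \<partial>dunkl_measure \<alpha> \<partial>lborel)"
    unfolding potential_form_def by (intro nn_integral_cong dunkl_pair.Fubini') measurable
  also have "\<dots> = (\<integral>\<^sup>+y. \<integral>\<^sup>+t. \<integral>\<^sup>+x. potential_weight \<alpha> \<sigma> t x y * W t x y \<partial>dunkl_measure \<alpha> \<partial>lborel \<partial>dunkl_measure \<alpha>)"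
    by (intro time_dunkl_pair.Fubini'[symmetric]) measurable
  finally show ?thesis .
qed

lemma potential_form_swap_x:
  assumes W: "measurable3 W"
  shows "potential_form \<alpha> \<sigma> W = (\<integral>\<^sup>+x. \<integral>\<^sup>+t. \<integral>\<^sup>+y. potential_weight \<alpha> \<sigma> t x y * W t x y \<partial>dunkl_measure \<alpha> \<partial>lborel \<partial>dunkl_measure \<alpha>)"
proof -
  note [measurable (raw)] = measurable3_compose[OF W]
  show ?thesis unfolding potential_form_def by (intro time_dunkl_pair.Fubini'[symmetric]) measurable
qed

lemma potential_form_swap_xy:
  assumes W: "measurable3 W"
  shows "potential_form \<alpha> \<sigma> W = (\<integral>\<^sup>+x. \<integral>\<^sup>+y. \<integral>\<^sup>+t. potential_weight \<alpha> \<sigma> t x y * W t x y \<partial>lborel \<partial>dunkl_measure \<alpha> \<partial>dunkl_measure \<alpha>)"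
proof -
  note [measurable (raw)] = measurable3_compose[OF W]
  show ?thesis unfolding potential_form_swap_x[OF W] 
    by (intro nn_integral_cong time_dunkl_pair.Fubini'[symmetric]) measurable
qed

text \<open>A Schur test: integrate first over the variables on which \<open>f\<close> does not depend. The next two statements are the
  analogues for a function of \<open>x\<close> and for a product of functions of both variables.\<close>

lemma potential_form_le_y:
  assumes W: "measurable3 W" and [measurable]: "f \<in> borel_measurable borel"
    and b: "\<And>y. (\<integral>\<^sup>+t. \<integral>\<^sup>+x. potential_weight \<alpha> \<sigma> t x y * W t x y \<partial>dunkl_measure \<alpha> \<partial>lborel) \<le> C"
  shows "potential_form \<alpha> \<sigma> (\<lambda>t x y. W t x y * f y) \<le> C * (\<integral>\<^sup>+y. f y \<partial>dunkl_measure \<alpha>)"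
proof -
  note [measurable (raw)] = measurable3_compose[OF W]
  have W': "measurable3 (\<lambda>t x y. W t x y * f y)" unfolding measurable3_def by measurable
  have "potential_form \<alpha> \<sigma> (\<lambda>t x y. W t x y * f y)
    = (\<integral>\<^sup>+y. (\<integral>\<^sup>+t. \<integral>\<^sup>+x. potential_weight \<alpha> \<sigma> t x y * W t x y \<partial>dunkl_measure \<alpha> \<partial>lborel) * f y \<partial>dunkl_measure \<alpha>)"
    unfolding potential_form_swap_y[OF W'] by (simp add: nn_integral_multc mult.assoc[symmetric])
  also have "\<dots> \<le> (\<integral>\<^sup>+y. C * f y \<partial>dunkl_measure \<alpha>)"
    by (intro nn_integral_mono mult_right_mono b) auto
  also have "\<dots> = C * (\<integral>\<^sup>+y. f y \<partial>dunkl_measure \<alpha>)" by (rule nn_integral_cmult) measurable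
  finally show ?thesis .
qed

lemma potential_form_le_x:
  assumes W: "measurable3 W" and [measurable]: "f \<in> borel_measurable borel"
    and b: "\<And>x. (\<integral>\<^sup>+t. \<integral>\<^sup>+y. potential_weight \<alpha> \<sigma> t x y * W t x y \<partial>dunkl_measure \<alpha> \<partial>lborel) \<le> C"
  shows "potential_form \<alpha> \<sigma> (\<lambda>t x y. W t x y * f x) \<le> C * (\<integral>\<^sup>+x. f x \<partial>dunkl_measure \<alpha>)"
proof -
  note [measurable (raw)] = measurable3_compose[OF W]
  have W': "measurable3 (\<lambda>t x y. W t x y * f x)" unfolding measurable3_def by measurable
  have "potential_form \<alpha> \<sigma> (\<lambda>t x y. W t x y * f x)
    = (\<integral>\<^sup>+x. (\<integral>\<^sup>+t. \<integral>\<^sup>+y. potential_weight \<alpha> \<sigma> t x y * W t x y \<partial>dunkl_measure \<alpha> \<partial>lborel) * f x \<partial>dunkl_measure \<alpha>)"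
    unfolding potential_form_swap_x[OF W'] by (simp add: nn_integral_multc mult.assoc[symmetric])
  also have "\<dots> \<le> (\<integral>\<^sup>+x. C * f x \<partial>dunkl_measure \<alpha>)"
    by (intro nn_integral_mono mult_right_mono b) auto
  also have "\<dots> = C * (\<integral>\<^sup>+x. f x \<partial>dunkl_measure \<alpha>)" by (rule nn_integral_cmult) measurable
  finally show ?thesis .
qed

lemma potential_form_le_xy:
  assumes W: "measurable3 W" and [measurable]: "f \<in> borel_measurable borel" "g \<in> borel_measurable borel"
    and b: "\<And>x y. f y * g x * (\<integral>\<^sup>+t. potential_weight \<alpha> \<sigma> t x y * W t x y \<partial>lborel) \<le> C * (f y * g x)"
  shows "potential_form \<alpha> \<sigma> (\<lambda>t x y. W t x y * (f y * g x)) \<le> C * ((\<integral>\<^sup>+y. f y \<partial>dunkl_measure \<alpha>) * (\<integral>\<^sup>+x. g x \<partial>dunkl_measure \<alpha>))"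
proof -
  note [measurable (raw)] = measurable3_compose[OF W]
  have W': "measurable3 (\<lambda>t x y. W t x y * (f y * g x))" unfolding measurable3_def by measurable
  have "potential_form \<alpha> \<sigma> (\<lambda>t x y. W t x y * (f y * g x))
    = (\<integral>\<^sup>+x. \<integral>\<^sup>+y. (\<integral>\<^sup>+t. potential_weight \<alpha> \<sigma> t x y * W t x y \<partial>lborel) * (f y * g x) \<partial>dunkl_measure \<alpha> \<partial>dunkl_measure \<alpha>)"
    unfolding potential_form_swap_xy[OF W'] by (simp add: nn_integral_multc mult.assoc[symmetric])
  also have "\<dots> \<le> (\<integral>\<^sup>+x. \<integral>\<^sup>+y. C * (f y * g x) \<partial>dunkl_measure \<alpha> \<partial>dunkl_measure \<alpha>)"
    using b by (intro nn_integral_mono) (simp add: mult.commute)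
  also have "\<dots> = C * ((\<integral>\<^sup>+y. f y \<partial>dunkl_measure \<alpha>) * (\<integral>\<^sup>+x. g x \<partial>dunkl_measure \<alpha>))"
    by (simp add: nn_integral_cmult nn_integral_multc)
  finally show ?thesis .
qed

section \<open>Duality in Lebesgue spaces\<close>

text \<open>A strictly positive probability density. It is added to other functions to make them positive.\<close>

definition reference_density :: "real \<Rightarrow> real \<Rightarrow> real" where
  "reference_density \<alpha> x = exp (- x\<^sup>2) / Gamma (\<alpha> + 1)"

lemma borel_measurable_reference_density [measurable]: "reference_density \<alpha> \<in> borel_measurable borel"
  unfolding reference_density_def by measurable

lemma reference_density_pos: "\<alpha> > -1 \<Longrightarrow> reference_density \<alpha> x > 0"
  by (simp add: reference_density_def)

lemma nn_integral_exp_square: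
  assumes "\<alpha> > -1" "A > 0"
  shows "(\<integral>\<^sup>+x. ennreal (exp (- A * x\<^sup>2)) \<partial>dunkl_measure \<alpha>) = ennreal (Gamma (\<alpha> + 1) / A powr (\<alpha> + 1))"
  using nn_integral_dunkl_Gaussian_power[OF assms, of 0] by simp

lemma nn_integral_reference_density:
  assumes "\<alpha> > -1"
  shows "(\<integral>\<^sup>+x. ennreal (reference_density \<alpha> x) \<partial>dunkl_measure \<alpha>) = 1"
proof -
  have G: "Gamma (\<alpha> + 1) > 0" using assms by simp
  have "(\<integral>\<^sup>+x. ennreal (reference_density \<alpha> x) \<partial>dunkl_measure \<alpha>) = (\<integral>\<^sup>+x. ennreal (1 / Gamma (\<alpha> + 1)) * ennreal (exp (- 1 * x\<^sup>2)) \<partial>dunkl_measure \<alpha>)"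
    using G by (intro nn_integral_cong) (simp add: reference_density_def ennreal_mult'[symmetric])
  also have "\<dots> = ennreal (1 / Gamma (\<alpha> + 1)) * ennreal (Gamma (\<alpha> + 1) / 1 powr (\<alpha> + 1))"
    using nn_integral_exp_square[OF assms, of 1] by (simp add: nn_integral_cmult)
  also have "\<dots> = 1" using G by (simp add: ennreal_mult'[symmetric])
  finally show ?thesis .
qed

text \<open>Positivity ensures \<open>\<phi> x powr 0 = 1\<close>, so that the exponent \<open>0\<close> represents \<open>L\<^sup>\<infinity>\<close>. The bound \<open>2\<close> on the
  mass leaves room for the reference density next to a normalized function.\<close>

definition positive_density :: "real \<Rightarrow> (real \<Rightarrow> real) \<Rightarrow> bool" where
  "positive_density \<alpha> \<phi> \<longleftrightarrow> \<phi> \<in> borel_measurable borel \<and> (\<forall>x. \<phi> x > 0) \<and> (\<integral>\<^sup>+x. ennreal (\<phi> x) \<partial>dunkl_measure \<alpha>) \<le> 2"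

lemma positive_density_reference: "\<alpha> > -1 \<Longrightarrow> positive_density \<alpha> (reference_density \<alpha>)"
  by (simp add: positive_density_def reference_density_pos nn_integral_reference_density)

lemma positive_density_normalized:
  assumes \<alpha>: "\<alpha> > -1" and [measurable]: "w \<in> borel_measurable borel" and w: "\<And>x. w x \<ge> 0" and N: "N > 0"
    and i: "(\<integral>\<^sup>+x. ennreal (w x) \<partial>dunkl_measure \<alpha>) \<le> ennreal N"
  shows "positive_density \<alpha> (\<lambda>x. w x / N + reference_density \<alpha> x)"
  unfolding positive_density_def
proof (intro conjI allI)
  have "(\<integral>\<^sup>+x. ennreal (w x / N + reference_density \<alpha> x) \<partial>dunkl_measure \<alpha>) = (\<integral>\<^sup>+x. ennreal (1 / N) * ennreal (w x) + ennreal (reference_density \<alpha> x) \<partial>dunkl_measure \<alpha>)"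
    using w N reference_density_pos[OF \<alpha>] by (intro nn_integral_cong) (simp add: ennreal_mult'[symmetric] less_imp_le)
  also have "\<dots> = ennreal (1 / N) * (\<integral>\<^sup>+x. ennreal (w x) \<partial>dunkl_measure \<alpha>) + 1"
    by (simp add: nn_integral_add nn_integral_cmult nn_integral_reference_density[OF \<alpha>])
  also have "\<dots> \<le> ennreal (1 / N) * ennreal N + 1" by (intro add_right_mono mult_left_mono i) simp
  also have "\<dots> = 2" using N by (simp add: ennreal_mult'[symmetric] one_add_one)
  finally show "(\<integral>\<^sup>+x. ennreal (w x / N + reference_density \<alpha> x) \<partial>dunkl_measure \<alpha>) \<le> 2" .
  show "w x / N + reference_density \<alpha> x > 0" for x using reference_density_pos[OF \<alpha>] w N by (simp add: add_nonneg_pos)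
qed measurable

text \<open>The exponent \<open>p\<close> with \<open>1/p = a\<close>, including \<open>p = \<infinity>\<close> for \<open>a = 0\<close>.\<close>

definition Lebesgue_exponent :: "real \<Rightarrow> ereal" where
  "Lebesgue_exponent a = (if a = 0 then \<infinity> else ereal (1 / a))"

lemma Lp_norm_0: "Lp_norm (Lebesgue_exponent 0) M f = esssup M (\<lambda>x. ennreal (norm (f x)))"
  by (simp add: Lp_norm_def Lebesgue_exponent_def)

lemma Lp_norm_le_iff:
  assumes a: "0 < a" and C: "C \<ge> 0"
  shows "Lp_norm (Lebesgue_exponent a) M f \<le> ennreal C \<longleftrightarrow> (\<integral>\<^sup>+x. ennreal (norm (f x) powr (1 / a)) \<partial>M) \<le> ennreal (C powr (1 / a))"
proof (cases "(\<integral>\<^sup>+x. ennreal (norm (f x) powr (1 / a)) \<partial>M)")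
  case (real r)
  have "(r powr a \<le> C) = (r \<le> C powr (1 / a))"
  proof
    assume "r powr a \<le> C"
    hence "(r powr a) powr (1 / a) \<le> C powr (1 / a)" using a by (intro powr_mono2) auto
    thus "r \<le> C powr (1 / a)" using a real by (simp add: powr_powr)
  next
    assume "r \<le> C powr (1 / a)"
    hence "r powr a \<le> (C powr (1 / a)) powr a" using a real by (intro powr_mono2) auto
    thus "r powr a \<le> C" using a C by (simp add: powr_powr)
  qed
  thus ?thesis using a C real by (simp add: Lp_norm_def Lebesgue_exponent_def Let_def)
next
  case top
  thus ?thesis using a C by (simp add: Lp_norm_def Lebesgue_exponent_def Let_def top_unique)
qed

text \<open>For \<open>a > 0\<close> the function \<open>(\<bar>f\<bar>/n)\<^sup>1\<^sup>/\<^sup>a\<close> has mass at most \<open>1\<close>, and \<open>\<phi>\<close> is this function made positive. For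
  \<open>a = 0\<close> the bound of \<open>f\<close> is constant and every density serves.\<close>

lemma Lp_ball_dominated:
  fixes f :: "real \<Rightarrow> complex"
  assumes \<alpha>: "\<alpha> > -1" and a: "0 \<le> a" and n: "n > 0"
    and f: "f \<in> Lp_space (Lebesgue_exponent a) (dunkl_measure \<alpha>)"
    and N: "Lp_norm (Lebesgue_exponent a) (dunkl_measure \<alpha>) f \<le> ennreal n"
  obtains \<phi> where "positive_density \<alpha> \<phi>" "AE x in dunkl_measure \<alpha>. norm (f x) \<le> n * \<phi> x powr a"
proof (cases "a = 0")
  case True
  have "AE x in dunkl_measure \<alpha>. ennreal (norm (f x)) \<le> esssup (dunkl_measure \<alpha>) (\<lambda>x. ennreal (norm (f x)))" by (rule esssup_AE)
  moreover have "esssup (dunkl_measure \<alpha>) (\<lambda>x. ennreal (norm (f x))) \<le> ennreal n" using N True by (simp add: Lp_norm_0)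
  ultimately have "AE x in dunkl_measure \<alpha>. norm (f x) \<le> n * reference_density \<alpha> x powr a"
    using n reference_density_pos[OF \<alpha>] unfolding True 
    by (elim eventually_mono) (metis dual_order.trans ennreal_le_iff less_imp_le mult.right_neutral order_less_irrefl powr_zero_eq_one)
  thus ?thesis using that[OF positive_density_reference[OF \<alpha>]] by simp
next
  case False
  have [measurable]: "f \<in> borel_measurable borel" using f unfolding Lp_space_def measurable_cong_sets[OF sets_dunkl_measure refl] by simp
  define \<phi> where "\<phi> x = norm (f x) powr (1 / a) / n powr (1 / a) + reference_density \<alpha> x" for x
  have "positive_density \<alpha> \<phi>"
    unfolding \<phi>_def using N Lp_norm_le_iff[of a n "dunkl_measure \<alpha>" f] False a n
    by (intro positive_density_normalized[OF \<alpha>]) auto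
  moreover have "norm (f x) \<le> n * \<phi> x powr a" for x
  proof -
    have "norm (f x) / n = ((norm (f x) / n) powr (1 / a)) powr a" using False n by (simp add: powr_powr)
    also have "\<dots> \<le> \<phi> x powr a"
      using a n reference_density_pos[OF \<alpha>, of x] by (intro powr_mono2) (auto simp: \<phi>_def powr_divide)
    finally show ?thesis using n by (simp add: field_simps)
  qed
  ultimately show ?thesis using that[of \<phi>] by auto
qed

text \<open>The converse of Hoelder's inequality. For \<open>b < 1\<close> the extremal density is proportional to \<open>\<bar>g\<bar>\<^sup>q\<close>, whose mass is not
  known to be finite beforehand; \<open>g\<close> is first truncated to the functions \<open>min \<bar>g\<bar> (n exp (-x\<^sup>2))\<close>, which
  increase to \<open>\<bar>g\<bar>\<close>. For \<open>b = 1\<close> the density is concentrated on the set where \<open>\<bar>g\<bar>\<close> exceeds the bound.\<close>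

lemma Lp_norm_le_by_duality:
  fixes g :: "real \<Rightarrow> complex"
  assumes \<alpha>: "\<alpha> > -1" and b: "0 \<le> b" "b \<le> 1" and D: "D \<ge> 0"
    and [measurable]: "g \<in> borel_measurable borel"
    and dual: "\<And>\<psi>. positive_density \<alpha> \<psi> \<Longrightarrow> (\<integral>\<^sup>+x. ennreal (norm (g x) * \<psi> x powr b) \<partial>dunkl_measure \<alpha>) \<le> ennreal D"
  shows "Lp_norm (Lebesgue_exponent (1 - b)) (dunkl_measure \<alpha>) g \<le> ennreal D"
proof (cases "b = 1")
  case True
  define A where "A = {x. norm (g x) > D}"
  have [measurable]: "A \<in> sets borel" unfolding A_def by measurable
  have "AE x in dunkl_measure \<alpha>. x \<notin> A"
  proof (rule ccontr)
    assume nA: "\<not> (AE x in dunkl_measure \<alpha>. x \<notin> A)"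
    define w where "w x = exp (- x\<^sup>2) * indicator A x" for x :: real
    have [measurable]: "w \<in> borel_measurable borel" unfolding w_def by measurable
    have w0: "w x \<ge> 0" for x by (simp add: w_def)
    have "(\<integral>\<^sup>+x. ennreal (w x) \<partial>dunkl_measure \<alpha>) \<le> (\<integral>\<^sup>+x. ennreal (exp (- 1 * x\<^sup>2)) \<partial>dunkl_measure \<alpha>)"
      by (intro nn_integral_mono) (auto simp: w_def indicator_def)
    also have "\<dots> < \<infinity>" using nn_integral_exp_square[OF \<alpha>, of 1] by simp
    finally obtain m where m: "(\<integral>\<^sup>+x. ennreal (w x) \<partial>dunkl_measure \<alpha>) = ennreal m" "m \<ge> 0"
      by (cases "\<integral>\<^sup>+x. ennreal (w x) \<partial>dunkl_measure \<alpha>") auto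
    have m0: "m > 0"
    proof (rule ccontr)
      assume "\<not> m > 0"
      hence "(\<integral>\<^sup>+x. ennreal (w x) \<partial>dunkl_measure \<alpha>) = 0" using m by simp
      hence "AE x in dunkl_measure \<alpha>. ennreal (w x) = 0" by (subst (asm) nn_integral_0_iff_AE) auto
      hence "AE x in dunkl_measure \<alpha>. x \<notin> A"
        by (rule eventually_mono) (auto simp: w_def indicator_def split: if_splits)
      thus False using nA by simp
    qed
    define \<psi> where "\<psi> x = w x / m + reference_density \<alpha> x" for x
    have \<psi>: "positive_density \<alpha> \<psi>"
      unfolding \<psi>_def using w0 m0 m by (intro positive_density_normalized[OF \<alpha>]) auto
    from dual[OF this] have i1: "(\<integral>\<^sup>+x. ennreal (norm (g x) * \<psi> x) \<partial>dunkl_measure \<alpha>) \<le> ennreal D"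
      using \<psi> True by (simp add: positive_density_def less_imp_le)
    have "(\<integral>\<^sup>+x. ennreal ((norm (g x) - D) * w x) \<partial>dunkl_measure \<alpha>) + ennreal D * ennreal m
       = (\<integral>\<^sup>+x. ennreal ((norm (g x) - D) * w x) + ennreal D * ennreal (w x) \<partial>dunkl_measure \<alpha>)"
      by (simp add: nn_integral_add nn_integral_cmult m)
    also have "\<dots> \<le> (\<integral>\<^sup>+x. ennreal m * ennreal (norm (g x) * \<psi> x) \<partial>dunkl_measure \<alpha>)"
    proof (intro nn_integral_mono)
      fix x
      have pos: "(norm (g x) - D) * w x \<ge> 0" by (auto simp: w_def A_def indicator_def)
      have "ennreal ((norm (g x) - D) * w x) + ennreal D * ennreal (w x) = ennreal (norm (g x) * w x)"
        using pos D w0[of x] by (simp add: ennreal_mult'[symmetric] ennreal_plus[symmetric] algebra_simps del: ennreal_plus)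
      also have "norm (g x) * w x \<le> m * (norm (g x) * \<psi> x)"
      proof -
        have "w x \<le> m * \<psi> x" using m0 reference_density_pos[OF \<alpha>, of x] by (simp add: \<psi>_def distrib_left less_imp_le)
        hence "norm (g x) * w x \<le> norm (g x) * (m * \<psi> x)" by (rule mult_left_mono) simp
        thus ?thesis by (simp add: mult_ac)
      qed
      hence "ennreal (norm (g x) * w x) \<le> ennreal (m * (norm (g x) * \<psi> x))" by (rule ennreal_leI)
      finally show "ennreal ((norm (g x) - D) * w x) + ennreal D * ennreal (w x) \<le> ennreal m * ennreal (norm (g x) * \<psi> x)"
        using m by (simp add: ennreal_mult')
    qed
    also have "\<dots> = ennreal m * (\<integral>\<^sup>+x. ennreal (norm (g x) * \<psi> x) \<partial>dunkl_measure \<alpha>)"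
      unfolding \<psi>_def by (rule nn_integral_cmult) measurable
    also have "\<dots> \<le> 0 + ennreal D * ennreal m" using mult_left_mono[OF i1, of "ennreal m"] by (simp add: mult.commute)
    finally have "(\<integral>\<^sup>+x. ennreal ((norm (g x) - D) * w x) \<partial>dunkl_measure \<alpha>) \<le> 0"
      using D m by (simp add: ennreal_mult'[symmetric] ennreal_add_left_cancel_le add.commute[of _ "ennreal (D * m)"])
    hence "AE x in dunkl_measure \<alpha>. ennreal ((norm (g x) - D) * w x) = 0"
      by (subst (asm) le_zero_eq, subst (asm) nn_integral_0_iff_AE) auto
    hence "AE x in dunkl_measure \<alpha>. x \<notin> A"
      by (rule eventually_mono) (auto simp: w_def A_def indicator_def ennreal_eq_0_iff mult_le_0_iff split: if_splits)
    thus False using nA by simp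
  qed
  hence "AE x in dunkl_measure \<alpha>. ennreal (norm (g x)) \<le> ennreal D"
    by (rule eventually_mono) (auto simp: A_def intro!: ennreal_leI)
  hence "esssup (dunkl_measure \<alpha>) (\<lambda>x. ennreal (norm (g x))) \<le> ennreal D" by (intro esssup_I) auto
  thus ?thesis using True by (simp add: Lp_norm_0)
next
  case False
  define q where "q = 1 / (1 - b)"
  have q: "q \<ge> 1" "1 + q * b = q" "q * (1 - b) = 1" using b False by (auto simp: q_def field_simps)
  \<comment> \<open>The Gaussian cut-off makes the \<open>q\<close>-th power integrable.\<close>
  define h where "h n x = min (norm (g x)) (real n * exp (- x\<^sup>2))" for n x
  have h0: "h n x \<ge> 0" for n x by (simp add: h_def)
  have [measurable]: "h n \<in> borel_measurable borel" for n unfolding h_def by measurable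
  have hint: "(\<integral>\<^sup>+x. ennreal (h n x powr q) \<partial>dunkl_measure \<alpha>) \<le> ennreal (D powr q)" for n
  proof -
    have "(\<integral>\<^sup>+x. ennreal (h n x powr q) \<partial>dunkl_measure \<alpha>) \<le> (\<integral>\<^sup>+x. ennreal (real n powr q) * ennreal (exp (- q * x\<^sup>2)) \<partial>dunkl_measure \<alpha>)"
    proof (intro nn_integral_mono)
      fix x :: real
      have "h n x powr q \<le> (real n * exp (- x\<^sup>2)) powr q" using q h0 by (intro powr_mono2) (auto simp: h_def)
      also have "\<dots> = real n powr q * exp (- q * x\<^sup>2)" by (simp add: powr_mult exp_powr_real mult.commute)
      finally show "ennreal (h n x powr q) \<le> ennreal (real n powr q) * ennreal (exp (- q * x\<^sup>2))"
        by (simp add: ennreal_mult'[symmetric] ennreal_leI)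
    qed
    also have "\<dots> = ennreal (real n powr q) * ennreal (Gamma (\<alpha> + 1) / q powr (\<alpha> + 1))"
      using nn_integral_exp_square[OF \<alpha>, of q] q by (subst nn_integral_cmult) auto
    also have "\<dots> < \<infinity>" by (simp add: ennreal_mult_less_top)
    finally obtain N where N: "(\<integral>\<^sup>+x. ennreal (h n x powr q) \<partial>dunkl_measure \<alpha>) = ennreal N" "N \<ge> 0"
      by (cases "\<integral>\<^sup>+x. ennreal (h n x powr q) \<partial>dunkl_measure \<alpha>") auto
    have "N \<le> D powr q"
    proof (cases "N = 0")
      case True thus ?thesis by simp
    next
      case False
      hence N0: "N > 0" using N by simp
      define \<psi> where "\<psi> x = h n x powr q / N + reference_density \<alpha> x" for x
      have \<psi>: "positive_density \<alpha> \<psi>"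
        unfolding \<psi>_def using N0 N by (intro positive_density_normalized[OF \<alpha>]) auto
      \<comment> \<open>Testing with the normalized \<open>h\<^sup>q\<close> bounds \<open>N\<^sup>1\<^sup>-\<^sup>b\<close>, since \<open>1 + qb = q\<close>; finiteness of \<open>N\<close> permits the division.\<close>
      have "ennreal (N powr (1 - b)) = ennreal (N powr (- b)) * ennreal N"
        using N0 by (simp add: ennreal_mult'[symmetric] powr_diff powr_minus divide_inverse mult.commute)
      also have "\<dots> = (\<integral>\<^sup>+x. ennreal (N powr (- b)) * ennreal (h n x powr q) \<partial>dunkl_measure \<alpha>)"
        unfolding N(1)[symmetric] by (rule nn_integral_cmult[symmetric]) measurable
      also have "\<dots> \<le> (\<integral>\<^sup>+x. ennreal (norm (g x) * \<psi> x powr b) \<partial>dunkl_measure \<alpha>)"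
      proof (intro nn_integral_mono)
        fix x
        have "N powr (- b) * h n x powr q = h n x * (h n x powr q / N) powr b"
        proof (cases "h n x = 0")
          case False
          hence "h n x powr q = h n x powr (1 + q * b)" using q by simp
          also have "\<dots> = h n x * (h n x powr q) powr b" using False h0[of n x] by (simp add: powr_add powr_powr)
          finally have "N powr (- b) * h n x powr q = h n x * ((h n x powr q) powr b / N powr b)"
            by (simp add: powr_minus divide_inverse mult_ac)
          also have "(h n x powr q) powr b / N powr b = (h n x powr q / N) powr b" using N0 by (simp add: powr_divide)
          finally show ?thesis .
        qed simp
        also have "\<dots> \<le> norm (g x) * \<psi> x powr b"
          using b N0 h0[of n x] reference_density_pos[OF \<alpha>, of x] by (intro mult_mono powr_mono2) (auto simp: h_def \<psi>_def)
        finally show "ennreal (N powr (- b)) * ennreal (h n x powr q) \<le> ennreal (norm (g x) * \<psi> x powr b)"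
          by (simp add: ennreal_mult'[symmetric] ennreal_leI)
      qed
      also have "\<dots> \<le> ennreal D" by (rule dual[OF \<psi>])
      finally have "N powr (1 - b) \<le> D" using D by simp
      hence "(N powr (1 - b)) powr q \<le> D powr q" using q by (intro powr_mono2) auto
      thus ?thesis using N0 q(3) by (simp add: powr_powr mult.commute)
    qed
    thus ?thesis unfolding N(1) by (rule ennreal_leI)
  qed
  have "(\<integral>\<^sup>+x. ennreal (norm (g x) powr q) \<partial>dunkl_measure \<alpha>) = (\<integral>\<^sup>+x. (SUP n. ennreal (h n x powr q)) \<partial>dunkl_measure \<alpha>)"
  proof (intro nn_integral_cong antisym)
    fix x
    obtain n :: nat where "real n \<ge> norm (g x) / exp (- x\<^sup>2)" using real_arch_simple by blast
    hence "h n x = norm (g x)" by (simp add: h_def divide_le_eq min_def)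
    thus "ennreal (norm (g x) powr q) \<le> (SUP n. ennreal (h n x powr q))" by (metis SUP_upper UNIV_I)
    show "(SUP n. ennreal (h n x powr q)) \<le> ennreal (norm (g x) powr q)"
      using h0 q by (intro SUP_least ennreal_leI powr_mono2) (auto simp: h_def)
  qed
  also have "\<dots> = (SUP n. \<integral>\<^sup>+x. ennreal (h n x powr q) \<partial>dunkl_measure \<alpha>)"
  proof (rule nn_integral_monotone_convergence_SUP)
    show "incseq (\<lambda>n x. ennreal (h n x powr q))"
      unfolding incseq_def le_fun_def using h0 q
      by (intro allI impI ennreal_leI powr_mono2) (auto simp: h_def min_le_iff_disj intro: order.trans mult_right_mono)
  qed measurable
  also have "\<dots> \<le> ennreal (D powr q)" by (intro SUP_least hint)
  finally show ?thesis using Lp_norm_le_iff[of "1 - b" D "dunkl_measure \<alpha>" g] b False D by (simp add: q_def)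
qed

section \<open>Boundedness of the potential in terms of the form\<close>

definition laguerre_potential :: "real \<Rightarrow> real \<Rightarrow> real \<Rightarrow> real \<Rightarrow> ennreal" where
  "laguerre_potential \<alpha> \<sigma> x y = (\<integral>\<^sup>+t. potential_weight \<alpha> \<sigma> t x y \<partial>lborel)"

lemma borel_measurable_laguerre_potential [measurable (raw)]:
  assumes [measurable]: "g \<in> borel_measurable M" "h \<in> borel_measurable M"
  shows "(\<lambda>w. laguerre_potential \<alpha> \<sigma> (g w) (h w)) \<in> borel_measurable M"
  unfolding laguerre_potential_def by measurable

lemma laguerre_potential_even:
  "laguerre_potential \<alpha> \<sigma> (- x) y = laguerre_potential \<alpha> \<sigma> x y"
  "laguerre_potential \<alpha> \<sigma> x (- y) = laguerre_potential \<alpha> \<sigma> x y"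
  unfolding laguerre_potential_def potential_weight_def
  using laguerre_kernel_abs[of \<alpha> _ x y] laguerre_kernel_abs[of \<alpha> _ "-x" y] laguerre_kernel_abs[of \<alpha> _ x "-y"]
  by simp_all

lemma potential_form_eq:
  assumes [measurable]: "f \<in> borel_measurable borel" "g \<in> borel_measurable borel"
  shows "potential_form \<alpha> \<sigma> (\<lambda>t x y. f y * g x) = (\<integral>\<^sup>+x. (\<integral>\<^sup>+y. laguerre_potential \<alpha> \<sigma> x y * f y \<partial>dunkl_measure \<alpha>) * g x \<partial>dunkl_measure \<alpha>)"
proof -
  have "measurable3 (\<lambda>t x y. f y * g x)" unfolding measurable3_def by measurable
  from potential_form_swap_xy[OF this] show ?thesis
    by (simp add: laguerre_potential_def nn_integral_multc mult.assoc[symmetric])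
qed

lemma nn_integral_potential_weight:
  assumes [measurable]: "V \<in> borel_measurable borel" and t: "t > 0"
  shows "(\<integral>\<^sup>+x. potential_weight \<alpha> \<sigma> t x y * V x \<partial>dunkl_measure \<alpha>) 
     = ennreal (t powr (\<sigma> - 1)) * (\<integral>\<^sup>+x. ennreal (laguerre_kernel \<alpha> t x y) * V x \<partial>dunkl_measure \<alpha>)"
  using t by (subst nn_integral_cmult[symmetric]) (auto simp: potential_weight_def ennreal_mult' mult.assoc)

text \<open>The exponential decay reflects that the underlying operator has the lowest eigenvalue \<open>2(\<alpha>+1)\<close>.\<close>

lemma laguerre_marginal_le:
  assumes \<alpha>: "\<alpha> > -1" and t: "t > 0"
  shows "(\<integral>\<^sup>+x. ennreal (laguerre_kernel \<alpha> t x y) \<partial>dunkl_measure \<alpha>) \<le> ennreal (4 powr (\<alpha> + 1) * exp (- (2 * (\<alpha> + 1)) * t))"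
  unfolding nn_integral_laguerre_kernel[OF \<alpha> t]
proof (rule ennreal_leI)
  have "(cosh (2 * t) / 2) powr (- \<alpha> - 1) \<le> (exp (2 * t) / 4) powr (- \<alpha> - 1)"
    using \<alpha> by (intro powr_mono2') (auto simp: cosh_field_def)
  also have "\<dots> = exp (2 * t) powr (- \<alpha> - 1) * 4 powr (\<alpha> + 1)"
    using powr_minus_divide[of 4 "\<alpha> + 1"] by (simp add: powr_divide)
  also have "exp (2 * t) powr (- \<alpha> - 1) = exp (- (2 * (\<alpha> + 1)) * t)" by (simp add: powr_def algebra_simps)
  finally have 1: "(cosh (2 * t) / 2) powr (- \<alpha> - 1) \<le> 4 powr (\<alpha> + 1) * exp (- (2 * (\<alpha> + 1)) * t)" by (simp add: mult.commute)
  have "(cosh (2 * t) / 2) powr (- \<alpha> - 1) * exp (- (tanh (2 * t) / 2) * y\<^sup>2) \<le> (cosh (2 * t) / 2) powr (- \<alpha> - 1) * 1"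
    using t by (intro mult_left_mono) auto
  with 1 show "(cosh (2 * t) / 2) powr (- \<alpha> - 1) * exp (- (tanh (2 * t) / 2) * y\<^sup>2) \<le> 4 powr (\<alpha> + 1) * exp (- (2 * (\<alpha> + 1)) * t)"
    by linarith
qed

lemma potential_marginal_le:
  assumes \<alpha>: "\<alpha> > -1" and \<sigma>: "\<sigma> > 0"
  shows "(\<integral>\<^sup>+t. \<integral>\<^sup>+x. potential_weight \<alpha> \<sigma> t x y \<partial>dunkl_measure \<alpha> \<partial>lborel) \<le> ennreal (4 powr (\<alpha> + 1) * (Gamma \<sigma> / (2 * (\<alpha> + 1)) powr \<sigma>))"
proof -
  have "(\<integral>\<^sup>+t. \<integral>\<^sup>+x. potential_weight \<alpha> \<sigma> t x y \<partial>dunkl_measure \<alpha> \<partial>lborel)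
     \<le> (\<integral>\<^sup>+t. ennreal (4 powr (\<alpha> + 1)) * (ennreal (t powr (\<sigma> - 1) * exp (- (2 * (\<alpha> + 1)) * t)) * indicator {0<..} t) \<partial>lborel)"
  proof (rule nn_integral_mono)
    fix t :: real
    show "(\<integral>\<^sup>+x. potential_weight \<alpha> \<sigma> t x y \<partial>dunkl_measure \<alpha>) \<le> ennreal (4 powr (\<alpha> + 1)) * (ennreal (t powr (\<sigma> - 1) * exp (- (2 * (\<alpha> + 1)) * t)) * indicator {0<..} t)"
    proof (cases "t > 0")
      case True
      have "(\<integral>\<^sup>+x. potential_weight \<alpha> \<sigma> t x y \<partial>dunkl_measure \<alpha>) \<le> ennreal (t powr (\<sigma> - 1)) * ennreal (4 powr (\<alpha> + 1) * exp (- (2 * (\<alpha> + 1)) * t))"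
        using nn_integral_potential_weight[of "\<lambda>_. 1" t \<alpha> \<sigma> y] True laguerre_marginal_le[OF \<alpha> True, of y] by (simp add: mult_left_mono)
      thus ?thesis using True by (simp add: ennreal_mult'[symmetric] mult_ac)
    qed (simp add: potential_weight_def)
  qed
  also have "\<dots> = ennreal (4 powr (\<alpha> + 1)) * ennreal (Gamma \<sigma> / (2 * (\<alpha> + 1)) powr \<sigma>)"
    by (subst nn_integral_cmult) (use \<alpha> \<sigma> nn_integral_Gamma_scaled[of \<sigma> "2 * (\<alpha> + 1)"] in auto)
  also have "\<dots> = ennreal (4 powr (\<alpha> + 1) * (Gamma \<sigma> / (2 * (\<alpha> + 1)) powr \<sigma>))" by (rule ennreal_mult'[symmetric]) simp
  finally show ?thesis .
qed

text \<open>The marginals of the potential are bounded, so its integral over the plane against a density in one of the variables is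
  finite.\<close>

lemma laguerre_potential_finite:
  assumes \<alpha>: "\<alpha> > -1" and \<sigma>: "\<sigma> > 0"
  shows "AE x in dunkl_measure \<alpha>. AE y in dunkl_measure \<alpha>. laguerre_potential \<alpha> \<sigma> x y < \<infinity>"
proof -
  let ?r = "\<lambda>y. ennreal (reference_density \<alpha> y)"
  have "potential_form \<alpha> \<sigma> (\<lambda>t x y. 1 * ?r y) \<le> ennreal (4 powr (\<alpha> + 1) * (Gamma \<sigma> / (2 * (\<alpha> + 1)) powr \<sigma>)) * (\<integral>\<^sup>+y. ?r y \<partial>dunkl_measure \<alpha>)"
    using potential_marginal_le[OF \<alpha> \<sigma>] by (intro potential_form_le_y) (auto simp: measurable3_def)
  also have "\<dots> < \<infinity>" by (simp add: nn_integral_reference_density[OF \<alpha>])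
  finally have "(\<integral>\<^sup>+x. (\<integral>\<^sup>+y. laguerre_potential \<alpha> \<sigma> x y * ?r y \<partial>dunkl_measure \<alpha>) \<partial>dunkl_measure \<alpha>) < \<infinity>"
    using potential_form_eq[of ?r "\<lambda>_. 1" \<alpha> \<sigma>] by simp
  hence "AE x in dunkl_measure \<alpha>. (\<integral>\<^sup>+y. laguerre_potential \<alpha> \<sigma> x y * ?r y \<partial>dunkl_measure \<alpha>) \<noteq> \<infinity>"
    by (intro nn_integral_PInf_AE) auto
  thus ?thesis
  proof (rule eventually_mono)
    fix x assume "(\<integral>\<^sup>+y. laguerre_potential \<alpha> \<sigma> x y * ?r y \<partial>dunkl_measure \<alpha>) \<noteq> \<infinity>"
    hence "AE y in dunkl_measure \<alpha>. laguerre_potential \<alpha> \<sigma> x y * ?r y \<noteq> \<infinity>" by (intro nn_integral_PInf_AE) auto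
    thus "AE y in dunkl_measure \<alpha>. laguerre_potential \<alpha> \<sigma> x y < \<infinity>"
      by (rule eventually_mono)
         (use reference_density_pos[OF \<alpha>] in \<open>auto simp: ennreal_mult_eq_top_iff less_top ennreal_eq_0_iff not_le\<close>)
  qed
qed

lemma norm_integral_le_nn_integral:
  fixes f :: "'a \<Rightarrow> 'b::{banach, second_countable_topology}"
  shows "ennreal (norm (integral\<^sup>L M f)) \<le> (\<integral>\<^sup>+x. ennreal (norm (f x)) \<partial>M)"
  by (cases "integrable M f") (auto simp: integral_norm_bound_ennreal not_integrable_integral_eq)

lemma borel_measurable_dunkl_potential_kernel [measurable (raw)]:
  assumes [measurable]: "g \<in> borel_measurable M" "h \<in> borel_measurable M"
  shows "(\<lambda>w. dunkl_potential_kernel \<alpha> \<sigma> (g w) (h w)) \<in> borel_measurable M"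
  unfolding dunkl_potential_kernel_def set_lebesgue_integral_def by measurable

text \<open>The bound holds at every point: where the defining integral does not exist it has the value \<open>0\<close>.\<close>

lemma dunkl_potential_kernel_le:
  assumes \<alpha>: "\<alpha> > -1" and \<sigma>: "\<sigma> > 0"
  obtains C where "C > 0" "\<And>x y. ennreal (norm (dunkl_potential_kernel \<alpha> \<sigma> x y)) \<le> ennreal C * laguerre_potential \<alpha> \<sigma> x y"
proof -
  obtain C where C: "C > 0" "\<And>t x y. t > 0 \<Longrightarrow> \<bar>dunkl_heat_kernel \<alpha> t x y\<bar> \<le> C * laguerre_kernel \<alpha> t x y"
    using dunkl_heat_kernel_abs_le[OF \<alpha>] by blast
  have G: "Gamma \<sigma> > 0" using \<sigma> by simp
  have "ennreal (norm (dunkl_potential_kernel \<alpha> \<sigma> x y)) \<le> ennreal (C / Gamma \<sigma>) * laguerre_potential \<alpha> \<sigma> x y" for x y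
  proof -
    have "ennreal (norm (LBINT t:{0<..}. dunkl_heat_kernel \<alpha> t x y * t powr (\<sigma> - 1))) 
      \<le> (\<integral>\<^sup>+t. ennreal (norm (indicator {0<..} t *\<^sub>R (dunkl_heat_kernel \<alpha> t x y * t powr (\<sigma> - 1)))) \<partial>lborel)"
      unfolding set_lebesgue_integral_def by (rule norm_integral_le_nn_integral)
    also have "\<dots> \<le> (\<integral>\<^sup>+t. ennreal C * potential_weight \<alpha> \<sigma> t x y \<partial>lborel)"
    proof (rule nn_integral_mono)
      fix t :: real
      have "\<bar>dunkl_heat_kernel \<alpha> t x y\<bar> * t powr (\<sigma> - 1) \<le> C * (t powr (\<sigma> - 1) * laguerre_kernel \<alpha> t x y)" if "t > 0"
        using mult_right_mono[OF C(2)[OF that], of "t powr (\<sigma> - 1)" x y] by (simp add: mult_ac)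
      thus "ennreal (norm (indicator {0<..} t *\<^sub>R (dunkl_heat_kernel \<alpha> t x y * t powr (\<sigma> - 1)))) \<le> ennreal C * potential_weight \<alpha> \<sigma> t x y"
        using C(1) by (cases "t > 0") (auto simp: potential_weight_def abs_mult ennreal_mult'[symmetric] ennreal_leI)
    qed
    also have "\<dots> = ennreal C * laguerre_potential \<alpha> \<sigma> x y"
      unfolding laguerre_potential_def by (rule nn_integral_cmult) measurable
    finally have "ennreal (1 / Gamma \<sigma>) * ennreal (norm (LBINT t:{0<..}. dunkl_heat_kernel \<alpha> t x y * t powr (\<sigma> - 1))) \<le> ennreal (1 / Gamma \<sigma>) * (ennreal C * laguerre_potential \<alpha> \<sigma> x y)"
      by (rule mult_left_mono) simp
    thus ?thesis using G C(1) by (simp add: dunkl_potential_kernel_def abs_mult ennreal_mult'[symmetric] mult.assoc[symmetric])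
  qed
  thus ?thesis using that[of "C / Gamma \<sigma>"] C G by simp
qed

text \<open>Finiteness of the potential of the even part excludes the points where the defining integral does not exist and
  has the value \<open>0\<close>.\<close>

lemma dunkl_potential_kernel_ge:
  assumes \<alpha>: "\<alpha> > -1" and \<sigma>: "\<sigma> > 0" and xy: "x > 0" "y > 0" and fin: "laguerre_potential \<alpha> \<sigma> x y < \<infinity>"
  shows "dunkl_potential_kernel \<alpha> \<sigma> x y \<ge> 0"
    "ennreal (2 powr (- \<alpha> - 1) / Gamma \<sigma>) * laguerre_potential \<alpha> \<sigma> x y \<le> ennreal (dunkl_potential_kernel \<alpha> \<sigma> x y)"
proof -
  define k where "k t = indicator {0<..} t *\<^sub>R (dunkl_heat_kernel \<alpha> t x y * t powr (\<sigma> - 1))" for t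
  have [measurable]: "k \<in> borel_measurable borel" unfolding k_def by measurable
  have G: "Gamma \<sigma> > 0" using \<sigma> by simp
  have kl: "2 powr (- \<alpha> - 1) * (t powr (\<sigma> - 1) * laguerre_kernel \<alpha> t x y) \<le> k t" if "t > 0" for t
    using mult_right_mono[OF dunkl_heat_kernel_ge[OF \<alpha> that xy], of "t powr (\<sigma> - 1)"] that by (simp add: k_def mult_ac)
  have k0: "k t \<ge> 0" for t
  proof (cases "t > 0")
    case True
    have "0 \<le> 2 powr (- \<alpha> - 1) * (t powr (\<sigma> - 1) * laguerre_kernel \<alpha> t x y)" using laguerre_kernel_nonneg[OF \<alpha>] by simp
    thus ?thesis using kl[OF True] by linarith
  qed (simp add: k_def)
  obtain C where C: "C > 0" "\<And>t x y. t > 0 \<Longrightarrow> \<bar>dunkl_heat_kernel \<alpha> t x y\<bar> \<le> C * laguerre_kernel \<alpha> t x y"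
    using dunkl_heat_kernel_abs_le[OF \<alpha>] by blast
  have "(\<integral>\<^sup>+t. ennreal (norm (k t)) \<partial>lborel) \<le> (\<integral>\<^sup>+t. ennreal C * potential_weight \<alpha> \<sigma> t x y \<partial>lborel)"
  proof (rule nn_integral_mono)
    fix t :: real
    have "\<bar>dunkl_heat_kernel \<alpha> t x y\<bar> * t powr (\<sigma> - 1) \<le> C * (t powr (\<sigma> - 1) * laguerre_kernel \<alpha> t x y)" if "t > 0"
      using mult_right_mono[OF C(2)[OF that], of "t powr (\<sigma> - 1)" x y] by (simp add: mult_ac)
    thus "ennreal (norm (k t)) \<le> ennreal C * potential_weight \<alpha> \<sigma> t x y"
      using C(1) by (cases "t > 0") (auto simp: k_def potential_weight_def abs_mult ennreal_mult'[symmetric] ennreal_leI)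
  qed
  also have "\<dots> = ennreal C * laguerre_potential \<alpha> \<sigma> x y"
    unfolding laguerre_potential_def by (rule nn_integral_cmult) measurable
  also have "\<dots> < \<infinity>" using fin by (simp add: ennreal_mult_less_top)
  finally have ik: "integrable lborel k" by (intro integrableI_bounded) auto
  have K: "dunkl_potential_kernel \<alpha> \<sigma> x y = (1 / Gamma \<sigma>) * integral\<^sup>L lborel k"
    by (simp add: dunkl_potential_kernel_def set_lebesgue_integral_def k_def[abs_def])
  show "dunkl_potential_kernel \<alpha> \<sigma> x y \<ge> 0" unfolding K using G k0 by (intro mult_nonneg_nonneg integral_nonneg) auto
  have "ennreal (2 powr (- \<alpha> - 1)) * laguerre_potential \<alpha> \<sigma> x y = (\<integral>\<^sup>+t. ennreal (2 powr (- \<alpha> - 1)) * potential_weight \<alpha> \<sigma> t x y \<partial>lborel)"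
    unfolding laguerre_potential_def by (rule nn_integral_cmult[symmetric]) measurable
  also have "\<dots> \<le> (\<integral>\<^sup>+t. ennreal (k t) \<partial>lborel)"
  proof (rule nn_integral_mono)
    fix t :: real
    show "ennreal (2 powr (- \<alpha> - 1)) * potential_weight \<alpha> \<sigma> t x y \<le> ennreal (k t)"
      using kl[of t] by (cases "t > 0") (auto simp: potential_weight_def ennreal_mult'[symmetric] ennreal_leI)
  qed
  also have "\<dots> = ennreal (integral\<^sup>L lborel k)" using ik k0 by (intro nn_integral_eq_integral) auto
  finally have "ennreal (1 / Gamma \<sigma>) * (ennreal (2 powr (- \<alpha> - 1)) * laguerre_potential \<alpha> \<sigma> x y) \<le> ennreal (1 / Gamma \<sigma>) * ennreal (integral\<^sup>L lborel k)"
    by (rule mult_left_mono) simp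
  thus "ennreal (2 powr (- \<alpha> - 1) / Gamma \<sigma>) * laguerre_potential \<alpha> \<sigma> x y \<le> ennreal (dunkl_potential_kernel \<alpha> \<sigma> x y)"
    unfolding K using G by (simp add: ennreal_mult'[symmetric] mult.assoc[symmetric])
qed

abbreviation power_form :: "real \<Rightarrow> real \<Rightarrow> real \<Rightarrow> real \<Rightarrow> (real \<Rightarrow> real) \<Rightarrow> (real \<Rightarrow> real) \<Rightarrow> ennreal" where
  "power_form \<alpha> \<sigma> a b \<phi> \<psi> \<equiv> potential_form \<alpha> \<sigma> (\<lambda>t x y. ennreal (\<phi> y powr a) * ennreal (\<psi> x powr b))"

text \<open>Here \<open>a = 1/p\<close> belongs to the argument and \<open>b = 1 - 1/q\<close> to the dual variable.\<close>

definition form_bounded :: "real \<Rightarrow> real \<Rightarrow> real \<Rightarrow> real \<Rightarrow> bool" where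
  "form_bounded \<alpha> \<sigma> a b \<longleftrightarrow> (\<exists>C\<ge>0. \<forall>\<phi> \<psi>. positive_density \<alpha> \<phi> \<longrightarrow> positive_density \<alpha> \<psi> \<longrightarrow> power_form \<alpha> \<sigma> a b \<phi> \<psi> \<le> ennreal C)"

lemma form_boundedI:
  assumes "C \<ge> 0" "\<And>\<phi> \<psi>. \<phi> \<in> borel_measurable borel \<Longrightarrow> \<psi> \<in> borel_measurable borel \<Longrightarrow> (\<And>x. \<phi> x > 0) \<Longrightarrow> (\<And>x. \<psi> x > 0)
      \<Longrightarrow> (\<integral>\<^sup>+x. ennreal (\<phi> x) \<partial>dunkl_measure \<alpha>) \<le> 2 \<Longrightarrow> (\<integral>\<^sup>+x. ennreal (\<psi> x) \<partial>dunkl_measure \<alpha>) \<le> 2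
      \<Longrightarrow> power_form \<alpha> \<sigma> a b \<phi> \<psi> \<le> ennreal C"
  shows "form_bounded \<alpha> \<sigma> a b"
  unfolding form_bounded_def positive_density_def using assms by blast

text \<open>A function \<open>f\<close> of norm at most \<open>n\<close> is dominated by \<open>n \<phi>\<^sup>a\<close>. The form bound with the reference density in the
  dual variable shows that \<open>f\<close> lies in the domain, and with arbitrary densities it yields the norm bound by
  duality.\<close>

lemma dunkl_potential_bounded_if_form_bounded:
  assumes \<alpha>: "\<alpha> > -1" and \<sigma>: "\<sigma> > 0" and a: "0 \<le> a" and b: "0 \<le> b" "b \<le> 1" and fb: "form_bounded \<alpha> \<sigma> a b"
  shows "dunkl_potential_bounded \<alpha> \<sigma> (Lebesgue_exponent a) (Lebesgue_exponent (1 - b))"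
proof -
  let ?M = "dunkl_measure \<alpha>"
  obtain C where C: "C \<ge> 0" and form: "\<And>\<phi> \<psi>. positive_density \<alpha> \<phi> \<Longrightarrow> positive_density \<alpha> \<psi> \<Longrightarrow> power_form \<alpha> \<sigma> a b \<phi> \<psi> \<le> ennreal C"
    using fb unfolding form_bounded_def by blast
  obtain c where c: "c > 0" "\<And>x y. ennreal (norm (dunkl_potential_kernel \<alpha> \<sigma> x y)) \<le> ennreal c * laguerre_potential \<alpha> \<sigma> x y"
    using dunkl_potential_kernel_le[OF \<alpha> \<sigma>] by blast
  have key: "f \<in> dunkl_potential_domain \<alpha> \<sigma> \<and> Lp_norm (Lebesgue_exponent (1 - b)) ?M (dunkl_potential \<alpha> \<sigma> f) \<le> ennreal (c * (n * C))"
    if f: "f \<in> Lp_space (Lebesgue_exponent a) ?M" and n: "n > 0" and N: "Lp_norm (Lebesgue_exponent a) ?M f \<le> ennreal n" for f n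
  proof -
    have fm: "f \<in> borel_measurable ?M" using f by (simp add: Lp_space_def)
    hence [measurable]: "f \<in> borel_measurable borel" unfolding measurable_cong_sets[OF sets_dunkl_measure refl] .
    obtain \<phi> where \<phi>: "positive_density \<alpha> \<phi>" "AE x in ?M. norm (f x) \<le> n * \<phi> x powr a"
      using Lp_ball_dominated[OF \<alpha> a n f N] by blast
    have [measurable]: "\<phi> \<in> borel_measurable borel" using \<phi>(1) by (simp add: positive_density_def)
    define F where "F x = (\<integral>\<^sup>+y. laguerre_potential \<alpha> \<sigma> x y * ennreal (norm (f y)) \<partial>?M)" for x
    have [measurable]: "F \<in> borel_measurable borel" unfolding F_def by measurable
    have dualF: "(\<integral>\<^sup>+x. F x * ennreal (\<psi> x powr b) \<partial>?M) \<le> ennreal (n * C)"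
      if \<psi>: "positive_density \<alpha> \<psi>" for \<psi>
    proof -
      have [measurable]: "\<psi> \<in> borel_measurable borel" using \<psi> by (simp add: positive_density_def)
      have "F x \<le> ennreal n * (\<integral>\<^sup>+y. laguerre_potential \<alpha> \<sigma> x y * ennreal (\<phi> y powr a) \<partial>?M)" for x
      proof -
        have "F x \<le> (\<integral>\<^sup>+y. ennreal n * (laguerre_potential \<alpha> \<sigma> x y * ennreal (\<phi> y powr a)) \<partial>?M)"
          unfolding F_def
        proof (rule nn_integral_mono_AE, rule eventually_mono[OF \<phi>(2)])
          fix y assume "norm (f y) \<le> n * \<phi> y powr a"
          hence "ennreal (norm (f y)) \<le> ennreal n * ennreal (\<phi> y powr a)" using n by (simp add: ennreal_mult'[symmetric] ennreal_leI)
          hence "laguerre_potential \<alpha> \<sigma> x y * ennreal (norm (f y)) \<le> laguerre_potential \<alpha> \<sigma> x y * (ennreal n * ennreal (\<phi> y powr a))" by (rule mult_left_mono) simp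
          thus "laguerre_potential \<alpha> \<sigma> x y * ennreal (norm (f y)) \<le> ennreal n * (laguerre_potential \<alpha> \<sigma> x y * ennreal (\<phi> y powr a))"
            by (simp add: mult_ac)
        qed
        thus ?thesis by (simp add: nn_integral_cmult)
      qed
      hence "(\<integral>\<^sup>+x. F x * ennreal (\<psi> x powr b) \<partial>?M) \<le> (\<integral>\<^sup>+x. (ennreal n * (\<integral>\<^sup>+y. laguerre_potential \<alpha> \<sigma> x y * ennreal (\<phi> y powr a) \<partial>?M)) * ennreal (\<psi> x powr b) \<partial>?M)"
        by (intro nn_integral_mono mult_right_mono) auto
      also have "\<dots> = ennreal n * power_form \<alpha> \<sigma> a b \<phi> \<psi>"
        by (simp add: potential_form_eq nn_integral_cmult mult.assoc)
      also have "\<dots> \<le> ennreal n * ennreal C" by (intro mult_left_mono form \<phi> \<psi>) simp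
      also have "\<dots> = ennreal (n * C)" using n by (simp add: ennreal_mult')
      finally show ?thesis .
    qed
    have Kf: "(\<integral>\<^sup>+y. ennreal (norm (dunkl_potential_kernel \<alpha> \<sigma> x y *\<^sub>R f y)) \<partial>?M) \<le> ennreal c * F x" for x
    proof -
      have "(\<integral>\<^sup>+y. ennreal (norm (dunkl_potential_kernel \<alpha> \<sigma> x y *\<^sub>R f y)) \<partial>?M) \<le> (\<integral>\<^sup>+y. ennreal c * (laguerre_potential \<alpha> \<sigma> x y * ennreal (norm (f y))) \<partial>?M)"
      proof (rule nn_integral_mono)
        fix y
        have "ennreal (norm (dunkl_potential_kernel \<alpha> \<sigma> x y *\<^sub>R f y)) = ennreal (norm (dunkl_potential_kernel \<alpha> \<sigma> x y)) * ennreal (norm (f y))"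
          by (simp add: ennreal_mult')
        also have "\<dots> \<le> (ennreal c * laguerre_potential \<alpha> \<sigma> x y) * ennreal (norm (f y))" by (intro mult_right_mono c(2)) simp
        finally show "ennreal (norm (dunkl_potential_kernel \<alpha> \<sigma> x y *\<^sub>R f y)) \<le> ennreal c * (laguerre_potential \<alpha> \<sigma> x y * ennreal (norm (f y)))"
          by (simp add: mult.assoc)
      qed
      thus ?thesis by (simp add: F_def nn_integral_cmult)
    qed
    have "AE x in ?M. F x * ennreal (reference_density \<alpha> x powr b) \<noteq> \<infinity>"
    proof (rule nn_integral_PInf_AE)
      have "(\<integral>\<^sup>+x. F x * ennreal (reference_density \<alpha> x powr b) \<partial>?M) \<le> ennreal (n * C)"
        by (intro dualF positive_density_reference \<alpha>)
      thus "(\<integral>\<^sup>+x. F x * ennreal (reference_density \<alpha> x powr b) \<partial>?M) \<noteq> \<infinity>" by (auto simp: top_unique)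
    qed measurable
    hence "AE x in ?M. integrable ?M (\<lambda>y. dunkl_potential_kernel \<alpha> \<sigma> x y *\<^sub>R f y)"
    proof (rule eventually_mono)
      fix x assume "F x * ennreal (reference_density \<alpha> x powr b) \<noteq> \<infinity>"
      hence "F x < \<infinity>" using reference_density_pos[OF \<alpha>, of x] by (auto simp: ennreal_mult_eq_top_iff less_top ennreal_eq_0_iff not_le)
      hence "ennreal c * F x < \<infinity>" by (simp add: ennreal_mult_less_top)
      thus "integrable ?M (\<lambda>y. dunkl_potential_kernel \<alpha> \<sigma> x y *\<^sub>R f y)"
        using Kf[of x] by (intro integrableI_bounded) (auto intro: le_less_trans)
    qed
    hence dom: "f \<in> dunkl_potential_domain \<alpha> \<sigma>" using fm by (simp add: dunkl_potential_domain_def)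
    have "Lp_norm (Lebesgue_exponent (1 - b)) ?M (dunkl_potential \<alpha> \<sigma> f) \<le> ennreal (c * (n * C))"
    proof (rule Lp_norm_le_by_duality[OF \<alpha> b])
      show "c * (n * C) \<ge> 0" using c n C by simp
      show "dunkl_potential \<alpha> \<sigma> f \<in> borel_measurable borel"
        unfolding dunkl_potential_def[abs_def]
        by (intro sigma_finite_measure.borel_measurable_lebesgue_integral[OF sigma_finite_dunkl_measure]) measurable
      fix \<psi> :: "real \<Rightarrow> real" assume \<psi>: "positive_density \<alpha> \<psi>"
      have [measurable]: "\<psi> \<in> borel_measurable borel" using \<psi> by (simp add: positive_density_def)
      have "(\<integral>\<^sup>+x. ennreal (norm (dunkl_potential \<alpha> \<sigma> f x) * \<psi> x powr b) \<partial>?M) \<le> (\<integral>\<^sup>+x. ennreal c * (F x * ennreal (\<psi> x powr b)) \<partial>?M)"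
      proof (rule nn_integral_mono)
        fix x
        have "ennreal (norm (dunkl_potential \<alpha> \<sigma> f x)) \<le> ennreal c * F x"
          unfolding dunkl_potential_def using norm_integral_le_nn_integral Kf by (rule order.trans)
        hence "ennreal (norm (dunkl_potential \<alpha> \<sigma> f x)) * ennreal (\<psi> x powr b) \<le> ennreal c * F x * ennreal (\<psi> x powr b)" by (rule mult_right_mono) simp
        thus "ennreal (norm (dunkl_potential \<alpha> \<sigma> f x) * \<psi> x powr b) \<le> ennreal c * (F x * ennreal (\<psi> x powr b))"
          by (simp add: ennreal_mult' mult.assoc)
      qed
      also have "\<dots> = ennreal c * (\<integral>\<^sup>+x. F x * ennreal (\<psi> x powr b) \<partial>?M)" by (rule nn_integral_cmult) measurable
      also have "\<dots> \<le> ennreal c * ennreal (n * C)" by (intro mult_left_mono dualF \<psi>) simp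
      also have "\<dots> = ennreal (c * (n * C))" using c by (simp add: ennreal_mult')
      finally show "(\<integral>\<^sup>+x. ennreal (norm (dunkl_potential \<alpha> \<sigma> f x) * \<psi> x powr b) \<partial>?M) \<le> ennreal (c * (n * C))" .
    qed
    with dom show ?thesis by simp
  qed
  have bd: "Lp_norm (Lebesgue_exponent (1 - b)) ?M (dunkl_potential \<alpha> \<sigma> f) \<le> ennreal (c * C) * Lp_norm (Lebesgue_exponent a) ?M f"
    and dm: "f \<in> dunkl_potential_domain \<alpha> \<sigma>"
    if f: "f \<in> Lp_space (Lebesgue_exponent a) ?M" for f
  proof -
    have "Lp_norm (Lebesgue_exponent a) ?M f < \<infinity>" using f by (simp add: Lp_space_def)
    then obtain r where r: "Lp_norm (Lebesgue_exponent a) ?M f = ennreal r" "r \<ge> 0" by (cases "Lp_norm (Lebesgue_exponent a) ?M f") auto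
    show "f \<in> dunkl_potential_domain \<alpha> \<sigma>" using key[OF f, of "r + 1"] r by (simp add: ennreal_leI)
    show "Lp_norm (Lebesgue_exponent (1 - b)) ?M (dunkl_potential \<alpha> \<sigma> f) \<le> ennreal (c * C) * Lp_norm (Lebesgue_exponent a) ?M f"
    proof (cases "r = 0")
      case False
      thus ?thesis using key[OF f, of r] r c C by (simp add: ennreal_mult'[symmetric] mult_ac)
    next
      case True
      have "Lp_norm (Lebesgue_exponent (1 - b)) ?M (dunkl_potential \<alpha> \<sigma> f) \<le> 0"
      \<comment> \<open>A function of norm \<open>0\<close> satisfies the bound with every positive \<open>n\<close>.\<close>
      proof (rule ennreal_le_epsilon)
        fix e :: real assume e: "e > 0"
        define n where "n = e / (c * C + 1)"
        have cC: "c * C \<ge> 0" using c C by simp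
        hence n: "n > 0" using e by (simp add: n_def)
        have "c * (n * C) \<le> e"
        proof -
          have "c * (n * C) = e * ((c * C) / (c * C + 1))" by (simp add: n_def)
          also have "\<dots> \<le> e * 1" using cC e by (intro mult_left_mono) auto
          finally show ?thesis by simp
        qed
        thus "Lp_norm (Lebesgue_exponent (1 - b)) ?M (dunkl_potential \<alpha> \<sigma> f) \<le> 0 + ennreal e"
          using key[OF f n] r True by (auto intro: order.trans ennreal_leI)
      qed
      thus ?thesis by simp
    qed
  qed
  show ?thesis unfolding dunkl_potential_bounded_def using bd dm by blast
qed

text \<open>Young's inequality in the normalization in which the norm of \<open>g\<close> is at most \<open>D\<close> and the mass of \<open>\<psi>\<close> at most \<open>1\<close>.\<close>

lemma nn_integral_Holder_ball:
  fixes g :: "real \<Rightarrow> complex"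
  assumes b: "0 \<le> b" "b \<le> 1" and D: "D > 0"
    and [measurable]: "g \<in> borel_measurable M" "\<psi> \<in> borel_measurable M"
    and \<psi>: "\<And>x. \<psi> x \<ge> 0" "(\<integral>\<^sup>+x. ennreal (\<psi> x) \<partial>M) \<le> 1"
    and N: "Lp_norm (Lebesgue_exponent (1 - b)) M g \<le> ennreal D"
  shows "(\<integral>\<^sup>+x. ennreal (norm (g x) * \<psi> x powr b) \<partial>M) \<le> ennreal D"
proof (cases "b = 1")
  case True
  have "AE x in M. ennreal (norm (g x)) \<le> esssup M (\<lambda>x. ennreal (norm (g x)))" by (rule esssup_AE)
  moreover have "esssup M (\<lambda>x. ennreal (norm (g x))) \<le> ennreal D" using N True by (simp add: Lp_norm_0)
  ultimately have "AE x in M. ennreal (norm (g x)) \<le> ennreal D" by (auto elim: eventually_mono order.trans)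
  hence "AE x in M. ennreal (norm (g x) * \<psi> x powr b) \<le> ennreal D * ennreal (\<psi> x)"
    unfolding True
  proof (rule eventually_mono)
    fix x assume "ennreal (norm (g x)) \<le> ennreal D"
    thus "ennreal (norm (g x) * \<psi> x powr 1) \<le> ennreal D * ennreal (\<psi> x)"
      using \<psi>(1)[of x] by (simp add: ennreal_mult' mult_right_mono)
  qed
  hence "(\<integral>\<^sup>+x. ennreal (norm (g x) * \<psi> x powr b) \<partial>M) \<le> (\<integral>\<^sup>+x. ennreal D * ennreal (\<psi> x) \<partial>M)" by (rule nn_integral_mono_AE)
  also have "\<dots> = ennreal D * (\<integral>\<^sup>+x. ennreal (\<psi> x) \<partial>M)" by (rule nn_integral_cmult) measurable
  also have "\<dots> \<le> ennreal D * 1" by (intro mult_left_mono \<psi>) simp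
  finally show ?thesis by simp
next
  case False
  define q where "q = 1 / (1 - b)"
  have q: "q > 0" "q * (1 - b) = 1" using b False by (auto simp: q_def)
  have i: "(\<integral>\<^sup>+x. ennreal (norm (g x) powr q) \<partial>M) \<le> ennreal (D powr q)"
    using N Lp_norm_le_iff[of "1 - b" D M g] b False D by (simp add: q_def)
  have pt: "norm (g x) * \<psi> x powr b \<le> (D * (1 - b) / D powr q) * norm (g x) powr q + (D * b) * \<psi> x" for x
  proof (cases "norm (g x) = 0 \<or> \<psi> x = 0")
    case True
    thus ?thesis using b D \<psi>(1)[of x] by auto
  next
    case False
    hence pos: "norm (g x) > 0" "\<psi> x > 0" using \<psi>(1)[of x] by (auto simp: less_le)
    have "((norm (g x) / D) powr q) powr (1 - b) * \<psi> x powr b * 1 powr 0 \<le> (1 - b) * (norm (g x) / D) powr q + b * \<psi> x + 0 * 1"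
      using pos D b by (intro weighted_am_gm) auto
    moreover have "((norm (g x) / D) powr q) powr (1 - b) = norm (g x) / D" using q pos D by (simp add: powr_powr)
    ultimately have "norm (g x) / D * \<psi> x powr b \<le> (1 - b) * (norm (g x) / D) powr q + b * \<psi> x" by simp
    hence "D * (norm (g x) / D * \<psi> x powr b) \<le> D * ((1 - b) * (norm (g x) / D) powr q + b * \<psi> x)" using D by (intro mult_left_mono) auto
    thus ?thesis using D by (simp add: powr_divide algebra_simps)
  qed
  have "(\<integral>\<^sup>+x. ennreal (norm (g x) * \<psi> x powr b) \<partial>M) \<le> (\<integral>\<^sup>+x. ennreal (D * (1 - b) / D powr q) * ennreal (norm (g x) powr q) + ennreal (D * b) * ennreal (\<psi> x) \<partial>M)"
  proof (rule nn_integral_mono)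
    fix x
    have "ennreal (norm (g x) * \<psi> x powr b) \<le> ennreal ((D * (1 - b) / D powr q) * norm (g x) powr q + (D * b) * \<psi> x)" by (rule ennreal_leI[OF pt])
    thus "ennreal (norm (g x) * \<psi> x powr b) \<le> ennreal (D * (1 - b) / D powr q) * ennreal (norm (g x) powr q) + ennreal (D * b) * ennreal (\<psi> x)"
      using b D \<psi>(1)[of x] by (simp add: ennreal_mult'[symmetric])
  qed
  also have "\<dots> = ennreal (D * (1 - b) / D powr q) * (\<integral>\<^sup>+x. ennreal (norm (g x) powr q) \<partial>M) + ennreal (D * b) * (\<integral>\<^sup>+x. ennreal (\<psi> x) \<partial>M)"
    by (simp add: nn_integral_add nn_integral_cmult)
  also have "\<dots> \<le> ennreal (D * (1 - b) / D powr q) * ennreal (D powr q) + ennreal (D * b) * 1"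
    using i \<psi>(2) by (intro add_mono mult_left_mono) auto
  also have "\<dots> = ennreal (D * (1 - b) + D * b)" using b D by (subst ennreal_plus) (auto simp: ennreal_mult'[symmetric])
  finally show ?thesis by (simp add: algebra_simps)
qed

text \<open>Test densities for lower bounds may vanish. For the exponent \<open>0\<close> the convention \<open>0 powr 0 = 0\<close> turns such a
  density into the indicator of its support, which is still admissible in \<open>L\<^sup>\<infinity>\<close>.\<close>

definition even_density :: "real \<Rightarrow> (real \<Rightarrow> real) \<Rightarrow> bool" where
  "even_density \<alpha> \<phi> \<longleftrightarrow> \<phi> \<in> borel_measurable borel \<and> (\<forall>x. \<phi> x \<ge> 0) \<and> (\<forall>x. \<phi> (- x) = \<phi> x) \<and> (\<integral>\<^sup>+x. ennreal (\<phi> x) \<partial>dunkl_measure \<alpha>) \<le> 1"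

definition even_form_bounded :: "real \<Rightarrow> real \<Rightarrow> real \<Rightarrow> real \<Rightarrow> bool" where
  "even_form_bounded \<alpha> \<sigma> a b \<longleftrightarrow> (\<exists>C\<ge>0. \<forall>\<phi> \<psi>. even_density \<alpha> \<phi> \<longrightarrow> even_density \<alpha> \<psi> \<longrightarrow> power_form \<alpha> \<sigma> a b \<phi> \<psi> \<le> ennreal C)"

text \<open>The Dunkl kernel may be negative for arguments of opposite signs. The operator is therefore applied to the
  restriction of \<open>\<phi>\<^sup>a\<close> to the positive half-line and its image is tested there, where the kernel dominates a
  multiple of its even part. By symmetry the form of even densities is four times its part on the quadrant \<open>x, y > 0\<close>.\<close>

lemma even_form_bounded_if_dunkl_potential_bounded:
  assumes \<alpha>: "\<alpha> > -1" and \<sigma>: "\<sigma> > 0" and a: "0 \<le> a" and b: "0 \<le> b" "b \<le> 1"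
    and bd: "dunkl_potential_bounded \<alpha> \<sigma> (Lebesgue_exponent a) (Lebesgue_exponent (1 - b))"
  shows "even_form_bounded \<alpha> \<sigma> a b"
proof -
  let ?M = "dunkl_measure \<alpha>"
  obtain C0 where dom: "Lp_space (Lebesgue_exponent a) ?M \<subseteq> dunkl_potential_domain \<alpha> \<sigma>"
    and C0: "\<And>f. f \<in> Lp_space (Lebesgue_exponent a) ?M \<Longrightarrow> Lp_norm (Lebesgue_exponent (1 - b)) ?M (dunkl_potential \<alpha> \<sigma> f) \<le> ennreal C0 * Lp_norm (Lebesgue_exponent a) ?M f"
    using bd unfolding dunkl_potential_bounded_def by blast
  define D where "D = max C0 1"
  define c where "c = 2 powr (- \<alpha> - 1) / Gamma \<sigma>"
  have c: "c > 0" using \<sigma> by (simp add: c_def)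
  have "power_form \<alpha> \<sigma> a b \<phi> \<psi> \<le> ennreal (4 * (D / c))"
    if \<phi>m [measurable]: "\<phi> \<in> borel_measurable borel" and \<psi>m [measurable]: "\<psi> \<in> borel_measurable borel"
    and \<phi>: "\<And>x. \<phi> x \<ge> 0" "\<And>x. \<phi> (- x) = \<phi> x" "(\<integral>\<^sup>+x. ennreal (\<phi> x) \<partial>?M) \<le> 1" 
    and \<psi>: "\<And>x. \<psi> x \<ge> 0" "\<And>x. \<psi> (- x) = \<psi> x" "(\<integral>\<^sup>+x. ennreal (\<psi> x) \<partial>?M) \<le> 1" for \<phi> \<psi> :: "real \<Rightarrow> real"
  proof -
    define h where "h y = \<phi> y powr a * indicator {0<..} y" for y :: real
    have h0: "h y \<ge> 0" for y by (simp add: h_def)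
    have [measurable]: "h \<in> borel_measurable borel" unfolding h_def by measurable
    define f where "f y = complex_of_real (h y)" for y
    have [measurable]: "f \<in> borel_measurable borel" unfolding f_def by measurable
    have nf: "Lp_norm (Lebesgue_exponent a) ?M f \<le> ennreal 1"
    proof (cases "a = 0")
      case True
      have "esssup ?M (\<lambda>x. ennreal (norm (f x))) \<le> ennreal 1"
        by (intro esssup_I) (auto simp: f_def h_def True indicator_def)
      thus ?thesis using True by (simp add: Lp_norm_0)
    next
      case False
      have "(\<integral>\<^sup>+x. ennreal (norm (f x) powr (1 / a)) \<partial>?M) \<le> (\<integral>\<^sup>+x. ennreal (\<phi> x) \<partial>?M)"
      proof (intro nn_integral_mono ennreal_leI)
        fix x
        show "norm (f x) powr (1 / a) \<le> \<phi> x"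
          using \<phi>(1)[of x] False a by (simp add: f_def h_def indicator_def powr_powr)
      qed
      also have "\<dots> \<le> 1" by (rule \<phi>)
      finally show ?thesis using Lp_norm_le_iff[of a 1 ?M f] a False by simp
    qed
    have f: "f \<in> Lp_space (Lebesgue_exponent a) ?M"
      using nf by (auto simp: Lp_space_def intro: le_less_trans)
    have "Lp_norm (Lebesgue_exponent (1 - b)) ?M (dunkl_potential \<alpha> \<sigma> f) \<le> ennreal C0 * Lp_norm (Lebesgue_exponent a) ?M f" by (rule C0[OF f])
    also have "\<dots> \<le> ennreal D * ennreal 1" by (intro mult_mono nf ennreal_leI) (auto simp: D_def)
    finally have nI: "Lp_norm (Lebesgue_exponent (1 - b)) ?M (dunkl_potential \<alpha> \<sigma> f) \<le> ennreal D" by simp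
    have Im [measurable]: "dunkl_potential \<alpha> \<sigma> f \<in> borel_measurable borel"
      unfolding dunkl_potential_def[abs_def]
      by (intro sigma_finite_measure.borel_measurable_lebesgue_integral[OF sigma_finite_dunkl_measure]) measurable
    have I: "(\<integral>\<^sup>+x. ennreal (norm (dunkl_potential \<alpha> \<sigma> f x) * \<psi> x powr b) \<partial>?M) \<le> ennreal D"
      by (rule nn_integral_Holder_ball[OF b _ _ _ \<psi>(1,3) nI]) (auto simp: D_def)
    define Q where "Q x = (\<integral>\<^sup>+y. laguerre_potential \<alpha> \<sigma> x y * ennreal (\<phi> y powr a) \<partial>?M)" for x
    have [measurable]: "Q \<in> borel_measurable borel" unfolding Q_def by measurable
    have Q: "Q x = 2 * (\<integral>\<^sup>+y. laguerre_potential \<alpha> \<sigma> x y * ennreal (h y) \<partial>?M)" for x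
      unfolding Q_def by (subst nn_integral_dunkl_even)
        (auto simp: \<phi>(2) laguerre_potential_even h_def indicator_def intro!: arg_cong[where f = "\<lambda>z. 2 * z"] nn_integral_cong)
    have "AE x in ?M. integrable ?M (\<lambda>y. dunkl_potential_kernel \<alpha> \<sigma> x y *\<^sub>R f y)"
      using dom f by (auto simp: dunkl_potential_domain_def)
    with laguerre_potential_finite[OF \<alpha> \<sigma>]
    have low: "AE x in ?M. x > 0 \<longrightarrow> ennreal c * Q x \<le> 2 * ennreal (norm (dunkl_potential \<alpha> \<sigma> f x))"
    proof eventually_elim
      case (elim x)
      show ?case
      proof
        assume x: "x > 0"
        have nn: "AE y in ?M. 0 \<le> dunkl_potential_kernel \<alpha> \<sigma> x y * h y" and lb: "AE y in ?M. ennreal c * (laguerre_potential \<alpha> \<sigma> x y * ennreal (h y)) \<le> ennreal (dunkl_potential_kernel \<alpha> \<sigma> x y * h y)"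
        proof -
          show "AE y in ?M. 0 \<le> dunkl_potential_kernel \<alpha> \<sigma> x y * h y"
            using elim(1) by eventually_elim (auto simp: h_def indicator_def intro!: mult_nonneg_nonneg dunkl_potential_kernel_ge[OF \<alpha> \<sigma> x])
          show "AE y in ?M. ennreal c * (laguerre_potential \<alpha> \<sigma> x y * ennreal (h y)) \<le> ennreal (dunkl_potential_kernel \<alpha> \<sigma> x y * h y)"
            using elim(1)
          proof eventually_elim
            case (elim y)
            show ?case
            proof (cases "y > 0")
              case True
              from dunkl_potential_kernel_ge[OF \<alpha> \<sigma> x True elim]
              have "ennreal c * laguerre_potential \<alpha> \<sigma> x y * ennreal (h y) \<le> ennreal (dunkl_potential_kernel \<alpha> \<sigma> x y) * ennreal (h y)"
                by (intro mult_right_mono) (auto simp: c_def)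
              thus ?thesis using dunkl_potential_kernel_ge(1)[OF \<alpha> \<sigma> x True elim] by (simp add: ennreal_mult' mult.assoc)
            qed (simp add: h_def)
          qed
        qed
        have Kh: "(\<lambda>y. dunkl_potential_kernel \<alpha> \<sigma> x y *\<^sub>R f y) = (\<lambda>y. complex_of_real (dunkl_potential_kernel \<alpha> \<sigma> x y * h y))"
          by (simp add: f_def scaleR_conv_of_real)
        have int: "integrable ?M (\<lambda>y. dunkl_potential_kernel \<alpha> \<sigma> x y * h y)"
          using integrable_Re[OF elim(2)[unfolded Kh]] by simp
        have "dunkl_potential \<alpha> \<sigma> f x = complex_of_real (integral\<^sup>L ?M (\<lambda>y. dunkl_potential_kernel \<alpha> \<sigma> x y * h y))"
          unfolding dunkl_potential_def Kh by (rule integral_complex_of_real)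
        hence "norm (dunkl_potential \<alpha> \<sigma> f x) = integral\<^sup>L ?M (\<lambda>y. dunkl_potential_kernel \<alpha> \<sigma> x y * h y)"
          using integral_nonneg_AE[OF nn] by simp
        hence "ennreal (norm (dunkl_potential \<alpha> \<sigma> f x)) = (\<integral>\<^sup>+y. ennreal (dunkl_potential_kernel \<alpha> \<sigma> x y * h y) \<partial>?M)"
          using nn_integral_eq_integral[OF int nn] by simp
        also have "\<dots> \<ge> (\<integral>\<^sup>+y. ennreal c * (laguerre_potential \<alpha> \<sigma> x y * ennreal (h y)) \<partial>?M)" by (rule nn_integral_mono_AE[OF lb])
        also have "(\<integral>\<^sup>+y. ennreal c * (laguerre_potential \<alpha> \<sigma> x y * ennreal (h y)) \<partial>?M) = ennreal c * (\<integral>\<^sup>+y. laguerre_potential \<alpha> \<sigma> x y * ennreal (h y) \<partial>?M)"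
          by (rule nn_integral_cmult) measurable
        finally have "2 * (ennreal c * (\<integral>\<^sup>+y. laguerre_potential \<alpha> \<sigma> x y * ennreal (h y) \<partial>?M)) \<le> 2 * ennreal (norm (dunkl_potential \<alpha> \<sigma> f x))"
          by (rule mult_left_mono) simp
        thus "ennreal c * Q x \<le> 2 * ennreal (norm (dunkl_potential \<alpha> \<sigma> f x))" unfolding Q by (simp add: mult.left_commute)
      qed
    qed
    have Qe: "Q (- x) = Q x" for x unfolding Q_def laguerre_potential_even ..
    have "power_form \<alpha> \<sigma> a b \<phi> \<psi> = (\<integral>\<^sup>+x. Q x * ennreal (\<psi> x powr b) \<partial>?M)"
      by (simp add: potential_form_eq Q_def)
    also have "\<dots> = 2 * (\<integral>\<^sup>+x. Q x * ennreal (\<psi> x powr b) * indicator {0<..} x \<partial>?M)"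
      by (rule nn_integral_dunkl_even) (auto simp: Qe \<psi>(2))
    finally have form: "power_form \<alpha> \<sigma> a b \<phi> \<psi> = 2 * (\<integral>\<^sup>+x. Q x * ennreal (\<psi> x powr b) * indicator {0<..} x \<partial>?M)" .
    have "ennreal c * (\<integral>\<^sup>+x. Q x * ennreal (\<psi> x powr b) * indicator {0<..} x \<partial>?M) = (\<integral>\<^sup>+x. ennreal c * (Q x * ennreal (\<psi> x powr b) * indicator {0<..} x) \<partial>?M)"
      by (rule nn_integral_cmult[symmetric]) measurable
    also have "\<dots> \<le> (\<integral>\<^sup>+x. 2 * ennreal (norm (dunkl_potential \<alpha> \<sigma> f x) * \<psi> x powr b) \<partial>?M)"
    proof (rule nn_integral_mono_AE, use low in eventually_elim)
      case (elim x)
      show ?case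
      proof (cases "x > 0")
        case True
        hence "ennreal c * Q x * ennreal (\<psi> x powr b) \<le> 2 * ennreal (norm (dunkl_potential \<alpha> \<sigma> f x)) * ennreal (\<psi> x powr b)"
          using elim by (intro mult_right_mono) auto
        thus ?thesis using True by (simp add: ennreal_mult' mult.assoc)
      qed simp
    qed
    also have "\<dots> = 2 * (\<integral>\<^sup>+x. ennreal (norm (dunkl_potential \<alpha> \<sigma> f x) * \<psi> x powr b) \<partial>?M)"
      by (rule nn_integral_cmult) measurable
    also have "\<dots> \<le> 2 * ennreal D" by (intro mult_left_mono I) simp
    finally have "ennreal (1 / c) * (ennreal c * (\<integral>\<^sup>+x. Q x * ennreal (\<psi> x powr b) * indicator {0<..} x \<partial>?M)) \<le> ennreal (1 / c) * (2 * ennreal D)"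
      by (rule mult_left_mono) simp
    moreover have "ennreal (1 / c) * ennreal c = 1" using c by (simp add: ennreal_mult'[symmetric])
    moreover have "ennreal (1 / c) * (2 * ennreal D) = ennreal (2 * (D / c))"
      using c by (simp add: ennreal_mult'[symmetric] flip: ennreal_numeral)
    ultimately have "(\<integral>\<^sup>+x. Q x * ennreal (\<psi> x powr b) * indicator {0<..} x \<partial>?M) \<le> ennreal (2 * (D / c))"
      by (simp add: mult.assoc[symmetric])
    hence "2 * (\<integral>\<^sup>+x. Q x * ennreal (\<psi> x powr b) * indicator {0<..} x \<partial>?M) \<le> 2 * ennreal (2 * (D / c))" by (rule mult_left_mono) simp
    also have "2 * ennreal (2 * (D / c)) = ennreal (4 * (D / c))" using ennreal_mult'[of 2 "2 * (D / c)"] by simp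
    finally show ?thesis unfolding form .
  qed
  moreover have "4 * (D / c) \<ge> 0" using c by (simp add: D_def)
  ultimately show ?thesis unfolding even_form_bounded_def even_density_def by (intro exI[of _ "4 * (D / c)"]) auto
qed

section \<open>Sufficient conditions\<close>

lemma sinh_double_ge:
  assumes "(t::real) > 0"
  shows "sinh (2 * t) \<ge> t * exp t" "sinh (2 * t) \<ge> t"
proof -
  have "sinh t \<ge> t" using assms
  proof -
    have "exp t - exp (- t) \<ge> 2 * t"
    proof -
      define f where "f u = exp u - exp (- u) - 2 * u" for u :: real
      have "f 0 \<le> f t"
      proof (rule DERIV_nonneg_imp_nondecreasing[of 0 t f])
        fix u :: real
        have "(f has_real_derivative (exp u + exp (- u) - 2)) (at u)"
          unfolding f_def by (auto intro!: derivative_eq_intros)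
        moreover have "exp u + exp (- u) - 2 \<ge> 0"
          using arith_geo_mean_sqrt[of "exp u" "exp (-u)"] by (simp add: exp_minus)
        ultimately show "\<exists>y. (f has_real_derivative y) (at u) \<and> 0 \<le> y" by blast
      qed (use assms in simp)
      thus ?thesis by (simp add: f_def)
    qed
    thus ?thesis by (simp add: sinh_field_def)
  qed
  moreover have "cosh t \<ge> exp t / 2" by (simp add: cosh_field_def)
  ultimately have "t * (exp t / 2) \<le> sinh t * cosh t" using assms by (intro mult_mono) auto
  thus 1: "sinh (2 * t) \<ge> t * exp t" by (simp add: sinh_double)
  have "t * 1 \<le> t * exp t" using assms by (intro mult_left_mono) auto
  with 1 show "sinh (2 * t) \<ge> t" by simp
qed

text \<open>Convergence at \<open>0\<close> comes from \<open>k < \<sigma>\<close>, and at infinity from \<open>k > 0\<close> and the exponential growth of the hyperbolic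
  sine.\<close>

lemma nn_integral_sinh_powr_le:
  assumes k: "0 < k" "k < \<sigma>"
  shows "(\<integral>\<^sup>+t. ennreal (t powr (\<sigma> - 1) * sinh (2 * t) powr (- k)) * indicator {0<..} t \<partial>lborel) \<le> ennreal (Gamma (\<sigma> - k) / k powr (\<sigma> - k))"
proof -
  have "(\<integral>\<^sup>+t. ennreal (t powr (\<sigma> - 1) * sinh (2 * t) powr (- k)) * indicator {0<..} t \<partial>lborel)
    \<le> (\<integral>\<^sup>+t. ennreal (t powr (\<sigma> - k - 1) * exp (- k * t)) * indicator {0<..} t \<partial>lborel)"
  proof (intro nn_integral_mono)
    fix t :: real
    have "t powr (\<sigma> - 1) * sinh (2 * t) powr (- k) \<le> t powr (\<sigma> - k - 1) * exp (- k * t)" if t: "t > 0"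
    proof -
      have "sinh (2 * t) powr (- k) \<le> (t * exp t) powr (- k)"
        using t k sinh_double_ge[OF t] by (intro powr_mono2') auto
      also have "\<dots> = t powr (- k) * exp (- k * t)" using t by (simp add: powr_mult exp_powr_real mult.commute)
      finally have "t powr (\<sigma> - 1) * sinh (2 * t) powr (- k) \<le> t powr (\<sigma> - 1) * (t powr (- k) * exp (- k * t))" by (intro mult_left_mono) auto
      also have "\<dots> = t powr (\<sigma> - k - 1) * exp (- k * t)"
        using powr_add[of t "\<sigma> - 1" "- k"] by (simp add: algebra_simps)
      finally show ?thesis .
    qed
    thus "ennreal (t powr (\<sigma> - 1) * sinh (2 * t) powr (- k)) * indicator {0<..} t \<le> ennreal (t powr (\<sigma> - k - 1) * exp (- k * t)) * indicator {0<..} t"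
      by (cases "t > 0") (auto intro: ennreal_leI)
  qed
  also have "\<dots> = ennreal (Gamma (\<sigma> - k) / k powr (\<sigma> - k))"
    using nn_integral_Gamma_scaled[of "\<sigma> - k" k] k by simp
  finally show ?thesis .
qed

lemma weighted_marginal_le:
  assumes \<alpha>: "\<alpha> > -1" and [measurable]: "w \<in> borel_measurable borel" and w: "\<And>t. w t \<ge> 0"
  shows "(\<integral>\<^sup>+t. \<integral>\<^sup>+x. potential_weight \<alpha> \<sigma> t x y * ennreal (w t) \<partial>dunkl_measure \<alpha> \<partial>lborel) 
     \<le> ennreal (4 powr (\<alpha> + 1)) * (\<integral>\<^sup>+t. ennreal (t powr (\<sigma> - 1) * w t) * indicator {0<..} t \<partial>lborel)"
proof -
  have "(\<integral>\<^sup>+t. \<integral>\<^sup>+x. potential_weight \<alpha> \<sigma> t x y * ennreal (w t) \<partial>dunkl_measure \<alpha> \<partial>lborel)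
     \<le> (\<integral>\<^sup>+t. ennreal (4 powr (\<alpha> + 1)) * (ennreal (t powr (\<sigma> - 1) * w t) * indicator {0<..} t) \<partial>lborel)"
  proof (rule nn_integral_mono)
    fix t :: real
    show "(\<integral>\<^sup>+x. potential_weight \<alpha> \<sigma> t x y * ennreal (w t) \<partial>dunkl_measure \<alpha>) \<le> ennreal (4 powr (\<alpha> + 1)) * (ennreal (t powr (\<sigma> - 1) * w t) * indicator {0<..} t)"
    proof (cases "t > 0")
      case True
      have "4 powr (\<alpha> + 1) * exp (- (2 * (\<alpha> + 1)) * t) \<le> 4 powr (\<alpha> + 1) * 1"
      proof (rule mult_left_mono)
        have "2 * (\<alpha> + 1) * t \<ge> 0" using \<alpha> True by (intro mult_nonneg_nonneg) auto
        hence "- (2 * (\<alpha> + 1)) * t \<le> 0" by linarith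
        thus "exp (- (2 * (\<alpha> + 1)) * t) \<le> 1" by (simp only: exp_le_one_iff)
      qed simp
      hence "(\<integral>\<^sup>+x. ennreal (laguerre_kernel \<alpha> t x y) \<partial>dunkl_measure \<alpha>) \<le> ennreal (4 powr (\<alpha> + 1))"
        using laguerre_marginal_le[OF \<alpha> True, of y] by (auto elim: order.trans intro: ennreal_leI)
      hence "ennreal (t powr (\<sigma> - 1)) * ((\<integral>\<^sup>+x. ennreal (laguerre_kernel \<alpha> t x y) \<partial>dunkl_measure \<alpha>) * ennreal (w t)) \<le> ennreal (t powr (\<sigma> - 1)) * (ennreal (4 powr (\<alpha> + 1)) * ennreal (w t))"
        by (intro mult_left_mono mult_right_mono) auto
      moreover have "(\<integral>\<^sup>+x. potential_weight \<alpha> \<sigma> t x y * ennreal (w t) \<partial>dunkl_measure \<alpha>) 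
         = ennreal (t powr (\<sigma> - 1)) * ((\<integral>\<^sup>+x. ennreal (laguerre_kernel \<alpha> t x y) \<partial>dunkl_measure \<alpha>) * ennreal (w t))"
        using True by (subst nn_integral_potential_weight) (auto simp: nn_integral_multc)
      moreover have "ennreal (t powr (\<sigma> - 1)) * (ennreal (4 powr (\<alpha> + 1)) * ennreal (w t)) = ennreal (4 powr (\<alpha> + 1)) * (ennreal (t powr (\<sigma> - 1) * w t) * indicator {0<..} t)"
        using True ennreal_mult'[of "t powr (\<sigma> - 1)" "w t"] by (simp add: mult_ac)
      ultimately show ?thesis by simp
    qed (simp add: potential_weight_def)
  qed
  also have "\<dots> = ennreal (4 powr (\<alpha> + 1)) * (\<integral>\<^sup>+t. ennreal (t powr (\<sigma> - 1) * w t) * indicator {0<..} t \<partial>lborel)"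
    by (rule nn_integral_cmult) measurable
  finally show ?thesis .
qed

lemma weighted_marginal_le':
  assumes \<alpha>: "\<alpha> > -1" and [measurable]: "w \<in> borel_measurable borel" and w: "\<And>t. w t \<ge> 0"
  shows "(\<integral>\<^sup>+t. \<integral>\<^sup>+y. potential_weight \<alpha> \<sigma> t x y * ennreal (w t) \<partial>dunkl_measure \<alpha> \<partial>lborel) 
     \<le> ennreal (4 powr (\<alpha> + 1)) * (\<integral>\<^sup>+t. ennreal (t powr (\<sigma> - 1) * w t) * indicator {0<..} t \<partial>lborel)"
  using weighted_marginal_le[OF assms, of \<sigma> x] by (simp add: potential_weight_commute[of \<alpha> \<sigma> _ x])

text \<open>Here the three weights \<open>a\<close>, \<open>b\<close>, \<open>\<kappa> = 1-a-b\<close> belong to \<open>\<phi>\<close>, \<open>\<psi>\<close> and \<open>v(t) = sinh(2t)\<^sup>\<alpha>\<^sup>+\<^sup>1\<close>. The integral of the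
  kernel over both space variables is a constant multiple of \<open>1/v(t)\<close>, so with \<open>w = v\<^sup>-\<^sup>\<kappa>\<close> all three terms are
  bounded by the same time integral of \<open>w\<close>. In the diagonal case \<open>\<kappa> = 0\<close> there is no \<open>w\<close>, and convergence at
  large times comes from the exponential decay of the marginal.\<close>

lemma form_bounded_if_q_le_p:
  assumes \<alpha>: "\<alpha> > -1" and \<sigma>: "\<sigma> > 0" and ab: "a \<ge> 0" "b \<ge> 0" "a + b \<le> 1" and k: "(\<alpha> + 1) * (1 - a - b) < \<sigma>"
  shows "form_bounded \<alpha> \<sigma> a b"
proof (cases "a + b = 1")
  case True
  define C0 where "C0 = 4 powr (\<alpha> + 1) * (Gamma \<sigma> / (2 * (\<alpha> + 1)) powr \<sigma>)"
  have C0: "C0 \<ge> 0" using \<sigma> Gamma_real_pos[OF \<sigma>] by (simp add: C0_def)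
  have m: "(\<integral>\<^sup>+t. \<integral>\<^sup>+x. potential_weight \<alpha> \<sigma> t x y * 1 \<partial>dunkl_measure \<alpha> \<partial>lborel) \<le> ennreal C0" for y
    using potential_marginal_le[OF \<alpha> \<sigma>, of y] unfolding C0_def by simp
  have m': "(\<integral>\<^sup>+t. \<integral>\<^sup>+y. potential_weight \<alpha> \<sigma> t x y * 1 \<partial>dunkl_measure \<alpha> \<partial>lborel) \<le> ennreal C0" for x
    using m[of x] by (simp add: potential_weight_commute[of \<alpha> \<sigma> _ x])
  have M1: "measurable3 (\<lambda>t x y. 1)" by (simp add: measurable3_def)
  show ?thesis
  proof (rule form_boundedI[of "4 * C0"])
    fix \<phi> \<psi> :: "real \<Rightarrow> real"
    assume [measurable]: "\<phi> \<in> borel_measurable borel" "\<psi> \<in> borel_measurable borel"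
      and pos: "\<And>x. \<phi> x > 0" "\<And>x. \<psi> x > 0" 
      and i: "(\<integral>\<^sup>+x. ennreal (\<phi> x) \<partial>dunkl_measure \<alpha>) \<le> 2" "(\<integral>\<^sup>+x. ennreal (\<psi> x) \<partial>dunkl_measure \<alpha>) \<le> 2"
    have "power_form \<alpha> \<sigma> a b \<phi> \<psi> \<le> potential_form \<alpha> \<sigma> (\<lambda>t x y. 1 * ennreal (\<phi> y) + 1 * ennreal (\<psi> x))"
    proof (rule potential_form_mono)
      fix t x y :: real
      have "\<phi> y powr a * \<psi> x powr b * 1 powr 0 \<le> a * \<phi> y + b * \<psi> x + 0 * 1"
        using pos ab True by (intro weighted_am_gm) auto
      also have "\<dots> \<le> \<phi> y + \<psi> x" using pos ab mult_left_le_one_le[of "\<phi> y" a] mult_left_le_one_le[of "\<psi> x" b]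
        by (simp add: less_imp_le add_mono)
      finally show "ennreal (\<phi> y powr a) * ennreal (\<psi> x powr b) \<le> 1 * ennreal (\<phi> y) + 1 * ennreal (\<psi> x)"
        using pos by (simp add: ennreal_mult'[symmetric] ennreal_plus[symmetric] ennreal_leI less_imp_le del: ennreal_plus)
    qed
    also have "\<dots> = potential_form \<alpha> \<sigma> (\<lambda>t x y. 1 * ennreal (\<phi> y)) + potential_form \<alpha> \<sigma> (\<lambda>t x y. 1 * ennreal (\<psi> x))"
      by (rule potential_form_add) (auto simp: measurable3_def)
    also have "\<dots> \<le> ennreal C0 * (\<integral>\<^sup>+y. ennreal (\<phi> y) \<partial>dunkl_measure \<alpha>) + ennreal C0 * (\<integral>\<^sup>+x. ennreal (\<psi> x) \<partial>dunkl_measure \<alpha>)"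
      by (intro add_mono potential_form_le_y[OF M1 _ m] potential_form_le_x[OF M1 _ m']) measurable
    also have "\<dots> \<le> ennreal C0 * 2 + ennreal C0 * 2" by (intro add_mono mult_left_mono i) auto
    also have "\<dots> = ennreal (4 * C0)" using C0 by (simp add: ennreal_mult' mult.commute distrib_left[symmetric])
    finally show "power_form \<alpha> \<sigma> a b \<phi> \<psi> \<le> ennreal (4 * C0)" .
  qed (use C0 in simp)
next
  case False
  define \<kappa> where "\<kappa> = 1 - a - b"
  have \<kappa>: "\<kappa> > 0" "a + b + \<kappa> = 1" "(\<alpha> + 1) * \<kappa> < \<sigma>" "(\<alpha> + 1) * \<kappa> > 0" using ab k False \<alpha> by (auto simp: \<kappa>_def)
  define w where "w t = sinh (2 * t) powr (- ((\<alpha> + 1) * \<kappa>))" for t :: real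
  define v where "v t = sinh (2 * t) powr (\<alpha> + 1)" for t :: real
  have [measurable]: "w \<in> borel_measurable borel" "v \<in> borel_measurable borel" unfolding w_def v_def by measurable
  define J where "J = Gamma (\<sigma> - (\<alpha> + 1) * \<kappa>) / ((\<alpha> + 1) * \<kappa>) powr (\<sigma> - (\<alpha> + 1) * \<kappa>)"
  have J: "J \<ge> 0" using \<kappa> by (simp add: J_def Gamma_real_pos less_imp_le)
  have iw: "(\<integral>\<^sup>+t. ennreal (t powr (\<sigma> - 1) * w t) * indicator {0<..} t \<partial>lborel) \<le> ennreal J"
    unfolding w_def J_def using \<kappa> by (intro nn_integral_sinh_powr_le) auto
  define C0 where "C0 = 4 powr (\<alpha> + 1) * J"
  have C0: "C0 \<ge> 0" using J by (simp add: C0_def)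
  have "ennreal (4 powr (\<alpha> + 1)) * (\<integral>\<^sup>+t. ennreal (t powr (\<sigma> - 1) * w t) * indicator {0<..} t \<partial>lborel) \<le> ennreal (4 powr (\<alpha> + 1)) * ennreal J"
    by (intro mult_left_mono iw) simp
  hence le: "ennreal (4 powr (\<alpha> + 1)) * (\<integral>\<^sup>+t. ennreal (t powr (\<sigma> - 1) * w t) * indicator {0<..} t \<partial>lborel) \<le> ennreal C0"
    by (simp add: C0_def ennreal_mult')
  have m: "(\<integral>\<^sup>+t. \<integral>\<^sup>+x. potential_weight \<alpha> \<sigma> t x y * ennreal (w t) \<partial>dunkl_measure \<alpha> \<partial>lborel) \<le> ennreal C0" for y
    by (rule order.trans[OF weighted_marginal_le[OF \<alpha>] le]) (auto simp: w_def)
  have m': "(\<integral>\<^sup>+t. \<integral>\<^sup>+y. potential_weight \<alpha> \<sigma> t x y * ennreal (w t) \<partial>dunkl_measure \<alpha> \<partial>lborel) \<le> ennreal C0" for x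
    by (rule order.trans[OF weighted_marginal_le'[OF \<alpha>] le]) (auto simp: w_def)
  have Mw: "measurable3 (\<lambda>t x y. ennreal (w t))" unfolding measurable3_def by measurable
  define G where "G = 4 powr (\<alpha> + 1) * Gamma (\<alpha> + 1)"
  have G: "G \<ge> 0" using \<alpha> by (simp add: G_def less_imp_le)
  \<comment> \<open>In the product of the marginal with the Gaussian integral in the other variable, \<open>cosh\<close> and \<open>tanh\<close> combine to
    \<open>sinh\<close>, and the factor \<open>v\<close> cancels.\<close>
  have third: "potential_form \<alpha> \<sigma> (\<lambda>t x y. ennreal (w t) * ennreal (v t)) \<le> ennreal (G * J)"
  proof -
    have "potential_form \<alpha> \<sigma> (\<lambda>t x y. ennreal (w t) * ennreal (v t)) \<le> (\<integral>\<^sup>+t. ennreal G * (ennreal (t powr (\<sigma> - 1) * w t) * indicator {0<..} t) \<partial>lborel)"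
      unfolding potential_form_def
    proof (rule nn_integral_mono)
      fix t :: real
      show "(\<integral>\<^sup>+x. \<integral>\<^sup>+y. potential_weight \<alpha> \<sigma> t x y * (ennreal (w t) * ennreal (v t)) \<partial>dunkl_measure \<alpha> \<partial>dunkl_measure \<alpha>) \<le> ennreal G * (ennreal (t powr (\<sigma> - 1) * w t) * indicator {0<..} t)"
      proof (cases "t > 0")
        case True
        have s: "sinh (2 * t) > 0" "cosh (2 * t) > 0" using True by (auto simp: cosh_real_pos)
        have th: "tanh (2 * t) / 2 > 0" using True by simp
        have "(\<integral>\<^sup>+y. potential_weight \<alpha> \<sigma> t x y * (ennreal (w t) * ennreal (v t)) \<partial>dunkl_measure \<alpha>) 
            = ennreal (t powr (\<sigma> - 1) * w t * v t * (cosh (2 * t) / 2) powr (- \<alpha> - 1)) * ennreal (exp (- (tanh (2 * t) / 2) * x\<^sup>2))" for x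
        proof -
          have "(\<integral>\<^sup>+y. potential_weight \<alpha> \<sigma> t x y * (ennreal (w t) * ennreal (v t)) \<partial>dunkl_measure \<alpha>)
            = ennreal (t powr (\<sigma> - 1)) * ((\<integral>\<^sup>+y. ennreal (laguerre_kernel \<alpha> t y x) \<partial>dunkl_measure \<alpha>) * (ennreal (w t) * ennreal (v t)))"
            unfolding potential_weight_commute[of \<alpha> \<sigma> t x]
            using True by (subst nn_integral_potential_weight) (auto simp: nn_integral_multc)
          thus ?thesis unfolding nn_integral_laguerre_kernel[OF \<alpha> True]
            by (simp add: ennreal_mult'[symmetric] w_def v_def mult_ac)
        qed
        hence "(\<integral>\<^sup>+x. \<integral>\<^sup>+y. potential_weight \<alpha> \<sigma> t x y * (ennreal (w t) * ennreal (v t)) \<partial>dunkl_measure \<alpha> \<partial>dunkl_measure \<alpha>)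
          = ennreal (t powr (\<sigma> - 1) * w t * v t * (cosh (2 * t) / 2) powr (- \<alpha> - 1)) * ennreal (Gamma (\<alpha> + 1) / (tanh (2 * t) / 2) powr (\<alpha> + 1))"
          using nn_integral_exp_square[OF \<alpha> th] by (simp add: nn_integral_cmult)
        also have "\<dots> = ennreal (t powr (\<sigma> - 1) * w t * v t * (cosh (2 * t) / 2) powr (- \<alpha> - 1) * (Gamma (\<alpha> + 1) / (tanh (2 * t) / 2) powr (\<alpha> + 1)))"
          by (rule ennreal_mult'[symmetric]) (simp add: w_def v_def)
        also have "t powr (\<sigma> - 1) * w t * v t * (cosh (2 * t) / 2) powr (- \<alpha> - 1) * (Gamma (\<alpha> + 1) / (tanh (2 * t) / 2) powr (\<alpha> + 1)) = G * (t powr (\<sigma> - 1) * w t)"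
        proof -
          have "(cosh (2 * t) / 2) powr (- \<alpha> - 1) = 1 / (cosh (2 * t) / 2) powr (\<alpha> + 1)"
            using powr_minus_divide[of "cosh (2 * t) / 2" "\<alpha> + 1"] by simp
          hence "(cosh (2 * t) / 2) powr (- \<alpha> - 1) * (1 / (tanh (2 * t) / 2) powr (\<alpha> + 1)) = 1 / ((cosh (2 * t) / 2) powr (\<alpha> + 1) * (tanh (2 * t) / 2) powr (\<alpha> + 1))" by simp
          also have "(cosh (2 * t) / 2) powr (\<alpha> + 1) * (tanh (2 * t) / 2) powr (\<alpha> + 1) = (sinh (2 * t) / 4) powr (\<alpha> + 1)"
            using s th by (subst powr_mult[symmetric]) (auto simp: tanh_def)
          also have "\<dots> = v t / 4 powr (\<alpha> + 1)" using s by (simp add: v_def powr_divide)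
          finally have "v t * ((cosh (2 * t) / 2) powr (- \<alpha> - 1) * (1 / (tanh (2 * t) / 2) powr (\<alpha> + 1))) = 4 powr (\<alpha> + 1)"
            using s by (simp add: v_def)
          hence "(t powr (\<sigma> - 1) * w t * Gamma (\<alpha> + 1)) * (v t * ((cosh (2 * t) / 2) powr (- \<alpha> - 1) * (1 / (tanh (2 * t) / 2) powr (\<alpha> + 1)))) = (t powr (\<sigma> - 1) * w t * Gamma (\<alpha> + 1)) * 4 powr (\<alpha> + 1)" by (rule arg_cong)
          thus ?thesis by (simp add: G_def mult_ac)
        qed
        finally show ?thesis using True G by (simp add: ennreal_mult')
      qed (simp add: potential_weight_def)
    qed
    also have "\<dots> = ennreal G * (\<integral>\<^sup>+t. ennreal (t powr (\<sigma> - 1) * w t) * indicator {0<..} t \<partial>lborel)" by (rule nn_integral_cmult) measurable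
    also have "\<dots> \<le> ennreal G * ennreal J" by (intro mult_left_mono iw) simp
    finally show ?thesis using G by (simp add: ennreal_mult')
  qed
  show ?thesis
  proof (rule form_boundedI[of "4 * C0 + G * J"])
    fix \<phi> \<psi> :: "real \<Rightarrow> real"
    assume [measurable]: "\<phi> \<in> borel_measurable borel" "\<psi> \<in> borel_measurable borel"
      and pos: "\<And>x. \<phi> x > 0" "\<And>x. \<psi> x > 0" 
      and i: "(\<integral>\<^sup>+x. ennreal (\<phi> x) \<partial>dunkl_measure \<alpha>) \<le> 2" "(\<integral>\<^sup>+x. ennreal (\<psi> x) \<partial>dunkl_measure \<alpha>) \<le> 2"
    have "power_form \<alpha> \<sigma> a b \<phi> \<psi> 
       \<le> potential_form \<alpha> \<sigma> (\<lambda>t x y. ennreal (w t) * ennreal (\<phi> y) + (ennreal (w t) * ennreal (\<psi> x) + ennreal (w t) * ennreal (v t)))"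
    proof (rule potential_form_mono)
      fix t x y :: real assume t: "t > 0"
      have s: "sinh (2 * t) > 0" using t by simp
      have v: "v t > 0" using s by (simp add: v_def)
      have "\<phi> y powr a * \<psi> x powr b * v t powr \<kappa> \<le> a * \<phi> y + b * \<psi> x + \<kappa> * v t"
        using pos ab \<kappa> v by (intro weighted_am_gm) auto
      also have "\<dots> \<le> \<phi> y + (\<psi> x + v t)"
      proof -
        have "a \<le> 1" "b \<le> 1" "\<kappa> \<le> 1" using ab \<kappa> by linarith+
        hence "a * \<phi> y \<le> \<phi> y" "b * \<psi> x \<le> \<psi> x" "\<kappa> * v t \<le> v t"
          using pos(1)[of y] pos(2)[of x] v ab \<kappa> by (auto intro!: mult_left_le_one_le)
        thus ?thesis by linarith
      qed
      finally have "w t * (\<phi> y powr a * \<psi> x powr b * v t powr \<kappa>) \<le> w t * (\<phi> y + (\<psi> x + v t))" by (intro mult_left_mono) (auto simp: w_def)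
      moreover have "w t * v t powr \<kappa> = 1" using s by (simp add: w_def v_def powr_powr powr_minus)
      moreover have "w t * (\<phi> y powr a * \<psi> x powr b * v t powr \<kappa>) = \<phi> y powr a * \<psi> x powr b * (w t * v t powr \<kappa>)" by simp
      ultimately have "\<phi> y powr a * \<psi> x powr b \<le> w t * \<phi> y + (w t * \<psi> x + w t * v t)" by (simp add: distrib_left)
      hence "ennreal (\<phi> y powr a * \<psi> x powr b) \<le> ennreal (w t * \<phi> y + (w t * \<psi> x + w t * v t))" by (rule ennreal_leI)
      thus "ennreal (\<phi> y powr a) * ennreal (\<psi> x powr b) \<le> ennreal (w t) * ennreal (\<phi> y) + (ennreal (w t) * ennreal (\<psi> x) + ennreal (w t) * ennreal (v t))"
        using pos v by (simp add: ennreal_mult' less_imp_le w_def)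
    qed
    also have "\<dots> = potential_form \<alpha> \<sigma> (\<lambda>t x y. ennreal (w t) * ennreal (\<phi> y)) + (potential_form \<alpha> \<sigma> (\<lambda>t x y. ennreal (w t) * ennreal (\<psi> x)) + potential_form \<alpha> \<sigma> (\<lambda>t x y. ennreal (w t) * ennreal (v t)))"
      by (subst potential_form_add, measurable, unfold measurable3_def, measurable, subst potential_form_add) (unfold measurable3_def, measurable)
    also have "\<dots> \<le> ennreal C0 * (\<integral>\<^sup>+y. ennreal (\<phi> y) \<partial>dunkl_measure \<alpha>) + (ennreal C0 * (\<integral>\<^sup>+x. ennreal (\<psi> x) \<partial>dunkl_measure \<alpha>) + ennreal (G * J))"
      by (intro add_mono potential_form_le_y[OF Mw _ m] potential_form_le_x[OF Mw _ m'] third) measurable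
    also have "\<dots> \<le> ennreal C0 * 2 + (ennreal C0 * 2 + ennreal (G * J))" by (intro add_mono mult_left_mono i) auto
    also have "\<dots> = ennreal (2 * C0) + (ennreal (2 * C0) + ennreal (G * J))" using ennreal_mult'[of 2 C0] by (simp add: mult.commute)
    also have "\<dots> = ennreal (2 * C0 + (2 * C0 + G * J))" using C0 G J by (simp add: ennreal_plus[symmetric] del: ennreal_plus)
    also have "2 * C0 + (2 * C0 + G * J) = 4 * C0 + G * J" by simp
    finally show "power_form \<alpha> \<sigma> a b \<phi> \<psi> \<le> ennreal (4 * C0 + G * J)" .
  qed (use C0 G J in simp)
qed

text \<open>The means of \<open>X = \<phi>\<psi>L\<^sup>1\<^sup>-\<^sup>\<theta>\<close>, \<open>Y = \<phi>L\<^sup>-\<^sup>\<theta>\<close>, \<open>Z = \<psi>L\<^sup>-\<^sup>\<theta>\<close> with weights \<open>\<theta> = a+b-1\<close>, \<open>1-b\<close>, \<open>1-a\<close> give back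
  \<open>\<phi>\<^sup>a \<psi>\<^sup>b\<close>, as the powers of \<open>L\<close> cancel. The weight \<open>L\<close> should be the reciprocal of a good upper bound of
  the kernel: then the kernel times \<open>L\<^sup>1\<^sup>-\<^sup>\<theta>\<close> is about \<open>L\<^sup>-\<^sup>\<theta>\<close>, and both hypotheses amount to the convergence of
  \<open>\<integral> t\<^sup>\<sigma>\<^sup>-\<^sup>1 L\<^sup>-\<^sup>\<theta> dt\<close>.\<close>

lemma form_bounded_if_p_less_q:
  assumes ab: "a \<le> 1" "b \<le> 1" "a + b > 1" and C: "C1 \<ge> 0" "C2 \<ge> 0"
    and Lpos: "\<And>t x y. t > 0 \<Longrightarrow> L t x y > 0" and sym: "\<And>t x y. L t x y = L t y x"
    and Lm: "measurable3 (\<lambda>t x y. ennreal (L t x y powr (2 - a - b)))" "measurable3 (\<lambda>t x y. ennreal (L t x y powr (1 - a - b)))"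
    and b1: "\<And>x y. (\<integral>\<^sup>+t. potential_weight \<alpha> \<sigma> t x y * ennreal (L t x y powr (2 - a - b)) \<partial>lborel) \<le> ennreal C1"
    and b2: "\<And>y. (\<integral>\<^sup>+t. \<integral>\<^sup>+x. potential_weight \<alpha> \<sigma> t x y * ennreal (L t x y powr (1 - a - b)) \<partial>dunkl_measure \<alpha> \<partial>lborel) \<le> ennreal C2"
  shows "form_bounded \<alpha> \<sigma> a b"
proof (rule form_boundedI[of "4 * C1 + 4 * C2"])
  fix \<phi> \<psi> :: "real \<Rightarrow> real"
  assume [measurable]: "\<phi> \<in> borel_measurable borel" "\<psi> \<in> borel_measurable borel"
    and pos: "\<And>x. \<phi> x > 0" "\<And>x. \<psi> x > 0"
    and i: "(\<integral>\<^sup>+x. ennreal (\<phi> x) \<partial>dunkl_measure \<alpha>) \<le> 2" "(\<integral>\<^sup>+x. ennreal (\<psi> x) \<partial>dunkl_measure \<alpha>) \<le> 2"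
  define \<theta> where "\<theta> = a + b - 1"
  have \<theta>: "\<theta> > 0" "\<theta> \<le> 1" "2 - a - b = 1 - \<theta>" "1 - a - b = - \<theta>" "\<theta> + (1 - b) + (1 - a) = 1" using ab by (auto simp: \<theta>_def)
  let ?U = "\<lambda>t x y. ennreal (L t x y powr (2 - a - b))"
  let ?V = "\<lambda>t x y. ennreal (L t x y powr (1 - a - b))"
  note [measurable (raw)] = measurable3_compose[OF Lm(1)] measurable3_compose[OF Lm(2)]
  have "power_form \<alpha> \<sigma> a b \<phi> \<psi> 
     \<le> potential_form \<alpha> \<sigma> (\<lambda>t x y. ?U t x y * (ennreal (\<phi> y) * ennreal (\<psi> x)) + (?V t x y * ennreal (\<phi> y) + ?V t x y * ennreal (\<psi> x)))"
  proof (rule potential_form_mono)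
    fix t x y :: real assume t: "t > 0"
    define l where "l = L t x y"
    have l: "l > 0" using Lpos[OF t] by (simp add: l_def)
    define X Y Z where "X = \<phi> y * \<psi> x * l powr (1 - \<theta>)" and "Y = \<phi> y * l powr (- \<theta>)" and "Z = \<psi> x * l powr (- \<theta>)"
    have p: "X > 0" "Y > 0" "Z > 0" using pos l by (auto simp: X_def Y_def Z_def)
    have "X powr \<theta> * Y powr (1 - b) * Z powr (1 - a) = \<phi> y powr a * \<psi> x powr b"
    proof -
      have "X powr \<theta> * Y powr (1 - b) * Z powr (1 - a) 
        = (\<phi> y powr \<theta> * \<phi> y powr (1 - b)) * (\<psi> x powr \<theta> * \<psi> x powr (1 - a)) * (l powr ((1 - \<theta>) * \<theta>) * (l powr (- \<theta> * (1 - b)) * l powr (- \<theta> * (1 - a))))"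
        using pos l by (simp add: X_def Y_def Z_def powr_mult powr_powr less_imp_le mult_ac)
      also have "\<dots> = \<phi> y powr (\<theta> + (1 - b)) * \<psi> x powr (\<theta> + (1 - a)) * l powr ((1 - \<theta>) * \<theta> + (- \<theta> * (1 - b) + - \<theta> * (1 - a)))"
        by (simp only: powr_add)
      also have "(1 - \<theta>) * \<theta> + (- \<theta> * (1 - b) + - \<theta> * (1 - a)) = 0" by (simp add: \<theta>_def algebra_simps)
      also have "\<theta> + (1 - b) = a" by (simp add: \<theta>_def)
      also have "\<theta> + (1 - a) = b" by (simp add: \<theta>_def)
      finally show ?thesis using l by simp
    qed
    moreover have "X powr \<theta> * Y powr (1 - b) * Z powr (1 - a) \<le> \<theta> * X + (1 - b) * Y + (1 - a) * Z"
      using p ab \<theta> by (intro weighted_am_gm) auto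
    moreover have "\<theta> * X \<le> X" "(1 - b) * Y \<le> Y" "(1 - a) * Z \<le> Z"
      using p ab \<theta> mult_left_le_one_le[of X \<theta>] mult_left_le_one_le[of Y "1 - b"] mult_left_le_one_le[of Z "1 - a"] by auto
    ultimately have "\<phi> y powr a * \<psi> x powr b \<le> X + (Y + Z)" by linarith
    hence "ennreal (\<phi> y powr a * \<psi> x powr b) \<le> ennreal (X + (Y + Z))" by (rule ennreal_leI)
    also have "\<dots> = ennreal X + (ennreal Y + ennreal Z)" using p by simp
    finally show "ennreal (\<phi> y powr a) * ennreal (\<psi> x powr b) \<le> ?U t x y * (ennreal (\<phi> y) * ennreal (\<psi> x)) + (?V t x y * ennreal (\<phi> y) + ?V t x y * ennreal (\<psi> x))"
      using pos unfolding \<theta> l_def[symmetric] X_def Y_def Z_def by (simp add: ennreal_mult' less_imp_le mult_ac)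
  qed
  also have "\<dots> = potential_form \<alpha> \<sigma> (\<lambda>t x y. ?U t x y * (ennreal (\<phi> y) * ennreal (\<psi> x))) + (potential_form \<alpha> \<sigma> (\<lambda>t x y. ?V t x y * ennreal (\<phi> y)) + potential_form \<alpha> \<sigma> (\<lambda>t x y. ?V t x y * ennreal (\<psi> x)))"
    by (subst potential_form_add, unfold measurable3_def, measurable, subst potential_form_add) (unfold measurable3_def, measurable)
  also have "\<dots> \<le> ennreal C1 * ((\<integral>\<^sup>+x. ennreal (\<phi> x) \<partial>dunkl_measure \<alpha>) * (\<integral>\<^sup>+x. ennreal (\<psi> x) \<partial>dunkl_measure \<alpha>)) + (ennreal C2 * (\<integral>\<^sup>+x. ennreal (\<phi> x) \<partial>dunkl_measure \<alpha>) + ennreal C2 * (\<integral>\<^sup>+x. ennreal (\<psi> x) \<partial>dunkl_measure \<alpha>))"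
  proof (intro add_mono)
    show "potential_form \<alpha> \<sigma> (\<lambda>t x y. ?U t x y * (ennreal (\<phi> y) * ennreal (\<psi> x))) \<le> ennreal C1 * ((\<integral>\<^sup>+x. ennreal (\<phi> x) \<partial>dunkl_measure \<alpha>) * (\<integral>\<^sup>+x. ennreal (\<psi> x) \<partial>dunkl_measure \<alpha>))"
    proof (rule potential_form_le_xy[OF Lm(1)])
      fix x y
      show "ennreal (\<phi> y) * ennreal (\<psi> x) * (\<integral>\<^sup>+t. potential_weight \<alpha> \<sigma> t x y * ?U t x y \<partial>lborel) \<le> ennreal C1 * (ennreal (\<phi> y) * ennreal (\<psi> x))"
        using mult_left_mono[OF b1[of x y], of "ennreal (\<phi> y) * ennreal (\<psi> x)"] by (simp add: mult_ac)
    qed measurable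
    show "potential_form \<alpha> \<sigma> (\<lambda>t x y. ?V t x y * ennreal (\<phi> y)) \<le> ennreal C2 * (\<integral>\<^sup>+x. ennreal (\<phi> x) \<partial>dunkl_measure \<alpha>)"
      by (rule potential_form_le_y[OF Lm(2) _ b2]) measurable
    show "potential_form \<alpha> \<sigma> (\<lambda>t x y. ?V t x y * ennreal (\<psi> x)) \<le> ennreal C2 * (\<integral>\<^sup>+x. ennreal (\<psi> x) \<partial>dunkl_measure \<alpha>)"
    proof (rule potential_form_le_x[OF Lm(2)])
      fix x
      show "(\<integral>\<^sup>+t. \<integral>\<^sup>+y. potential_weight \<alpha> \<sigma> t x y * ?V t x y \<partial>dunkl_measure \<alpha> \<partial>lborel) \<le> ennreal C2"
        using b2[of x] by (simp add: potential_weight_commute[of \<alpha> \<sigma> _ x] sym[of _ x])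
    qed measurable
  qed
  also have "\<dots> \<le> ennreal C1 * (2 * 2) + (ennreal C2 * 2 + ennreal C2 * 2)"
    by (intro add_mono mult_mono i) auto
  also have "ennreal C1 * (2 * 2) + (ennreal C2 * 2 + ennreal C2 * 2) = ennreal (4 * C1 + 4 * C2)"
  proof -
    have "ennreal (4 * C1 + 4 * C2) = ennreal (4 * C1) + ennreal (4 * C2)" using C by simp
    also have "\<dots> = 4 * ennreal C1 + 4 * ennreal C2" using ennreal_mult'[of 4 C1] ennreal_mult'[of 4 C2] by simp
    finally show ?thesis by (simp add: mult.commute distrib_left[symmetric])
  qed
  finally show "power_form \<alpha> \<sigma> a b \<phi> \<psi> \<le> ennreal (4 * C1 + 4 * C2)" .
qed (use C in simp)

text \<open>The uniform bound of the kernel for these orders suggests \<open>L = sinh(2t)\<^sup>\<alpha>\<^sup>+\<^sup>1\<close>. The time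
  integral then converges at \<open>0\<close> because \<open>(\<alpha>+1)(a+b-1)\<close> is strictly below \<open>\<sigma>\<close>.\<close>

lemma form_bounded_subcritical:
  assumes \<alpha>: "\<alpha> \<ge> -1/2" and ab: "a \<le> 1" "b \<le> 1" "a + b > 1" and k: "(\<alpha> + 1) * (a + b - 1) < \<sigma>"
  shows "form_bounded \<alpha> \<sigma> a b"
proof -
  define \<theta> where "\<theta> = a + b - 1"
  have \<alpha>1: "\<alpha> > -1" using \<alpha> by linarith
  have \<theta>: "\<theta> > 0" "(\<alpha> + 1) * \<theta> < \<sigma>" "(\<alpha> + 1) * \<theta> > 0" using ab k \<alpha>1 by (auto simp: \<theta>_def)
  define w where "w t = sinh (2 * t) powr (- ((\<alpha> + 1) * \<theta>))" for t :: real
  have [measurable]: "w \<in> borel_measurable borel" unfolding w_def by measurable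
  define J where "J = Gamma (\<sigma> - (\<alpha> + 1) * \<theta>) / ((\<alpha> + 1) * \<theta>) powr (\<sigma> - (\<alpha> + 1) * \<theta>)"
  have J: "J \<ge> 0" using \<theta> by (simp add: J_def Gamma_real_pos less_imp_le)
  have iw: "(\<integral>\<^sup>+t. ennreal (t powr (\<sigma> - 1) * w t) * indicator {0<..} t \<partial>lborel) \<le> ennreal J"
    unfolding w_def J_def using \<theta> by (intro nn_integral_sinh_powr_le) auto
  have G: "Gamma (\<alpha> + 1) > 0" using \<alpha>1 by simp
  let ?L = "\<lambda>t x y :: real. if t > 0 then sinh (2 * t) powr (\<alpha> + 1) else 1"
  show ?thesis
  proof (rule form_bounded_if_p_less_q[OF ab, of "J / Gamma (\<alpha> + 1)" "4 powr (\<alpha> + 1) * J" ?L])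
    show "0 \<le> J / Gamma (\<alpha> + 1)" "0 \<le> 4 powr (\<alpha> + 1) * J" using J G by auto
    show "measurable3 (\<lambda>t x y. ennreal (?L t x y powr (2 - a - b)))" "measurable3 (\<lambda>t x y. ennreal (?L t x y powr (1 - a - b)))"
      unfolding measurable3_def by measurable
    fix x y :: real
    have "(\<integral>\<^sup>+t. potential_weight \<alpha> \<sigma> t x y * ennreal (?L t x y powr (2 - a - b)) \<partial>lborel) 
       \<le> (\<integral>\<^sup>+t. ennreal (1 / Gamma (\<alpha> + 1)) * (ennreal (t powr (\<sigma> - 1) * w t) * indicator {0<..} t) \<partial>lborel)"
    proof (rule nn_integral_mono)
      fix t :: real
      show "potential_weight \<alpha> \<sigma> t x y * ennreal (?L t x y powr (2 - a - b)) \<le> ennreal (1 / Gamma (\<alpha> + 1)) * (ennreal (t powr (\<sigma> - 1) * w t) * indicator {0<..} t)"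
      proof (cases "t > 0")
        case True
        have "laguerre_kernel \<alpha> t x y * (sinh (2 * t) powr (\<alpha> + 1)) powr (2 - a - b) 
          \<le> sinh (2 * t) powr (- \<alpha> - 1) / Gamma (\<alpha> + 1) * (sinh (2 * t) powr (\<alpha> + 1)) powr (2 - a - b)"
          by (intro mult_right_mono laguerre_kernel_le[OF \<alpha> True]) auto
        also have "\<dots> = 1 / Gamma (\<alpha> + 1) * w t"
          by (simp add: w_def powr_powr powr_add[symmetric] \<theta>_def algebra_simps)
        finally have "t powr (\<sigma> - 1) * (laguerre_kernel \<alpha> t x y * (sinh (2 * t) powr (\<alpha> + 1)) powr (2 - a - b)) \<le> t powr (\<sigma> - 1) * (1 / Gamma (\<alpha> + 1) * w t)"
          by (rule mult_left_mono) simp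
        hence "ennreal (t powr (\<sigma> - 1) * (laguerre_kernel \<alpha> t x y * (sinh (2 * t) powr (\<alpha> + 1)) powr (2 - a - b))) \<le> ennreal (1 / Gamma (\<alpha> + 1) * (t powr (\<sigma> - 1) * w t))"
          by (intro ennreal_leI) (simp add: mult_ac)
        also have "\<dots> = ennreal (1 / Gamma (\<alpha> + 1)) * ennreal (t powr (\<sigma> - 1) * w t)"
          by (rule ennreal_mult') (use G in simp)
        finally show ?thesis using True laguerre_kernel_nonneg[OF \<alpha>1]
          by (simp add: potential_weight_def ennreal_mult''[symmetric] mult.assoc)
      qed (simp add: potential_weight_def)
    qed
    also have "\<dots> = ennreal (1 / Gamma (\<alpha> + 1)) * (\<integral>\<^sup>+t. ennreal (t powr (\<sigma> - 1) * w t) * indicator {0<..} t \<partial>lborel)"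
      by (rule nn_integral_cmult) measurable
    also have "\<dots> \<le> ennreal (1 / Gamma (\<alpha> + 1)) * ennreal J" by (intro mult_left_mono iw) simp
    also have "\<dots> = ennreal (J / Gamma (\<alpha> + 1))" using ennreal_mult'[of "1 / Gamma (\<alpha> + 1)" J] G by simp
    finally show "(\<integral>\<^sup>+t. potential_weight \<alpha> \<sigma> t x y * ennreal (?L t x y powr (2 - a - b)) \<partial>lborel) \<le> ennreal (J / Gamma (\<alpha> + 1))" .
  next
    fix y :: real
    have "(\<integral>\<^sup>+t. \<integral>\<^sup>+x. potential_weight \<alpha> \<sigma> t x y * ennreal (?L t x y powr (1 - a - b)) \<partial>dunkl_measure \<alpha> \<partial>lborel)
       = (\<integral>\<^sup>+t. \<integral>\<^sup>+x. potential_weight \<alpha> \<sigma> t x y * ennreal (w t) \<partial>dunkl_measure \<alpha> \<partial>lborel)"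
    proof (intro nn_integral_cong)
      fix t x :: real
      have "?L t x y powr (1 - a - b) = w t" if "t > 0" using that by (simp add: w_def powr_powr \<theta>_def algebra_simps)
      thus "potential_weight \<alpha> \<sigma> t x y * ennreal (?L t x y powr (1 - a - b)) = potential_weight \<alpha> \<sigma> t x y * ennreal (w t)"
        by (cases "t > 0") (simp_all add: potential_weight_def)
    qed
    also have "\<dots> \<le> ennreal (4 powr (\<alpha> + 1)) * (\<integral>\<^sup>+t. ennreal (t powr (\<sigma> - 1) * w t) * indicator {0<..} t \<partial>lborel)"
      by (rule weighted_marginal_le[OF \<alpha>1]) (auto simp: w_def)
    also have "\<dots> \<le> ennreal (4 powr (\<alpha> + 1)) * ennreal J" by (intro mult_left_mono iw) simp
    also have "\<dots> = ennreal (4 powr (\<alpha> + 1) * J)" by (rule ennreal_mult'[symmetric]) simp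
    finally show "(\<integral>\<^sup>+t. \<integral>\<^sup>+x. potential_weight \<alpha> \<sigma> t x y * ennreal (?L t x y powr (1 - a - b)) \<partial>dunkl_measure \<alpha> \<partial>lborel) \<le> ennreal (4 powr (\<alpha> + 1) * J)" .
  qed auto
qed

text \<open>The measure \<open>dt/t\<close> is invariant under scaling, so the bound does not depend on \<open>A\<close>. The integral is split at
  the peak \<open>T\<close>, where \<open>A T\<^sup>\<gamma> = 1\<close>.\<close>

lemma nn_integral_tent_le:
  assumes A: "A > 0" and \<gamma>: "\<gamma> > 0" and d: "d > 0"
  shows "(\<integral>\<^sup>+t. ennreal (t powr (- 1) * tent (A * t powr \<gamma>) powr d) * indicator {0<..} t \<partial>lborel) \<le> ennreal (2 / (\<gamma> * d))"
proof -
  define T where "T = A powr (- 1 / \<gamma>)"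
  define p where "p = \<gamma> * d"
  have T: "T > 0" and p: "p > 0" using A \<gamma> d by (auto simp: T_def p_def)
  have AT: "A = T powr (- \<gamma>)" using A \<gamma> by (simp add: T_def powr_powr)
  have i1: "((\<lambda>t. t powr (p - 1)) has_integral (T powr p / p)) {0..T}"
    using has_integral_powr_from_0[of "p - 1" T] p T by simp
  have i2: "((\<lambda>t. t powr (- p - 1)) has_integral (T powr (- p) / p)) {T..}"
    using has_integral_powr_to_inf[of "- p - 1" T] p T by simp
  have n1: "(\<integral>\<^sup>+t. ennreal (t powr (p - 1)) * indicator {0..T} t \<partial>lborel) = ennreal (T powr p / p)"
    by (rule nn_integral_has_integral_lebesgue'[OF _ i1]) simp
  have n2: "(\<integral>\<^sup>+t. ennreal (t powr (- p - 1)) * indicator {T..} t \<partial>lborel) = ennreal (T powr (- p) / p)"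
    by (rule nn_integral_has_integral_lebesgue'[OF _ i2]) simp
  have "(\<integral>\<^sup>+t. ennreal (t powr (- 1) * tent (A * t powr \<gamma>) powr d) * indicator {0<..} t \<partial>lborel)
     \<le> (\<integral>\<^sup>+t. ennreal (T powr (- p)) * (ennreal (t powr (p - 1)) * indicator {0..T} t) + ennreal (T powr p) * (ennreal (t powr (- p - 1)) * indicator {T..} t) \<partial>lborel)"
  proof (rule nn_integral_mono)
    fix t :: real
    show "ennreal (t powr (- 1) * tent (A * t powr \<gamma>) powr d) * indicator {0<..} t \<le> ennreal (T powr (- p)) * (ennreal (t powr (p - 1)) * indicator {0..T} t) + ennreal (T powr p) * (ennreal (t powr (- p - 1)) * indicator {T..} t)"
    proof (cases "t > 0")
      case t: True
      define z where "z = A * t powr \<gamma>"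
      have z: "z > 0" using A t by (simp add: z_def)
      have zd: "z powr d = T powr (- p) * t powr p" using t T by (simp add: z_def AT powr_mult powr_powr p_def)
      have zd': "(1 / z) powr d = T powr p * t powr (- p)"
        using z T t by (simp add: powr_divide zd powr_minus field_simps)
      have te: "tent z \<le> z" "tent z \<le> 1 / z" "tent z \<ge> 0" using z by (auto simp: tent_def)
      have l1: "tent z powr d \<le> T powr (- p) * t powr p" using te d unfolding zd[symmetric] by (intro powr_mono2) auto
      have l2: "tent z powr d \<le> T powr p * t powr (- p)" using te d unfolding zd'[symmetric] by (intro powr_mono2) auto
      have e1: "t powr (p - 1) = t powr (- 1) * t powr p" "t powr (- p - 1) = t powr (- 1) * t powr (- p)"
      proof -
        have "p - 1 = - 1 + p" "- p - 1 = - 1 + - p" by simp_all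
        thus "t powr (p - 1) = t powr (- 1) * t powr p" "t powr (- p - 1) = t powr (- 1) * t powr (- p)" by (simp_all only: powr_add)
      qed
      show ?thesis
      proof (cases "t \<le> T")
        case True
        have "t powr (- 1) * tent z powr d \<le> t powr (- 1) * (T powr (- p) * t powr p)" by (intro mult_left_mono l1) simp
        hence "ennreal (t powr (- 1) * tent z powr d) \<le> ennreal (T powr (- p) * t powr (p - 1))" unfolding e1 by (intro ennreal_leI) (simp add: mult_ac)
        also have "\<dots> \<le> ennreal (T powr (- p)) * (ennreal (t powr (p - 1)) * indicator {0..T} t) + ennreal (T powr p) * (ennreal (t powr (- p - 1)) * indicator {T..} t)"
          using True t by (simp add: ennreal_mult')
        finally show ?thesis using t by (simp add: z_def)
      next
        case False
        have "t powr (- 1) * tent z powr d \<le> t powr (- 1) * (T powr p * t powr (- p))" by (intro mult_left_mono l2) simp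
        hence "ennreal (t powr (- 1) * tent z powr d) \<le> ennreal (T powr p * t powr (- p - 1))" unfolding e1 by (intro ennreal_leI) (simp add: mult_ac)
        also have "\<dots> \<le> ennreal (T powr (- p)) * (ennreal (t powr (p - 1)) * indicator {0..T} t) + ennreal (T powr p) * (ennreal (t powr (- p - 1)) * indicator {T..} t)"
          using False t by (simp add: ennreal_mult')
        finally show ?thesis using t by (simp add: z_def)
      qed
    qed simp
  qed
  also have "\<dots> = ennreal (T powr (- p)) * ennreal (T powr p / p) + ennreal (T powr p) * ennreal (T powr (- p) / p)"
    by (simp add: nn_integral_add nn_integral_cmult n1 n2)
  also have "\<dots> = ennreal (1 / p) + ennreal (1 / p)"
    using T by (simp add: ennreal_mult'[symmetric] powr_minus field_simps)
  also have "\<dots> = ennreal (2 / p)" using p by (simp add: ennreal_plus[symmetric] del: ennreal_plus)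
  finally show ?thesis by (simp add: p_def)
qed

lemma borel_measurable_tent [measurable]: "tent \<in> borel_measurable borel"
  unfolding tent_def by measurable

text \<open>On the boundary line the integrals of the subcritical case diverge logarithmically. With the scale
  \<open>\<tau> = t\<^sup>\<alpha>\<^sup>+\<^sup>1\<close> the kernel is at most a multiple of \<open>1/\<tau>\<close>, and \<open>\<tau>\<^sup>a\<^sup>+\<^sup>b\<^sup>-\<^sup>1 = t\<^sup>\<sigma>\<close> turns \<open>t\<^sup>\<sigma>\<^sup>-\<^sup>1 dt\<close> into \<open>dt/t\<close>. The inequality
  \<open>powr_product_le_tents\<close> supplies factors that make this measure integrable; they are evaluated at \<open>\<phi>(y)\<tau>\<close> or
  \<open>\<psi>(x)\<tau>\<close>, and the resulting integrals do not depend on \<open>\<phi>(y)\<close> and \<open>\<psi>(x)\<close>.\<close>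

lemma form_bounded_critical:
  assumes \<alpha>: "\<alpha> \<ge> -1/2" and ab: "a < 1" "b < 1" "a + b > 1" and k: "\<sigma> = (\<alpha> + 1) * (a + b - 1)"
  shows "form_bounded \<alpha> \<sigma> a b"
proof -
  define \<gamma> where "\<gamma> = \<alpha> + 1"
  have \<alpha>1: "\<alpha> > -1" and \<gamma>: "\<gamma> > 0" using \<alpha> by (auto simp: \<gamma>_def)
  define d where "d = min (1 - a) (min (1 - b) (a + b - 1))"
  have d: "0 < d" "d \<le> 1 - a" "d \<le> 1 - b" "d \<le> a + b - 1" using ab by (auto simp: d_def)
  have G: "Gamma (\<alpha> + 1) > 0" using \<alpha>1 by simp
  define J where "J = 2 / (\<gamma> * d)"
  have J: "J \<ge> 0" using \<gamma> d by (simp add: J_def)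
  define C0 where "C0 = 4 powr (\<alpha> + 1) * J"
  have C0: "C0 \<ge> 0" using J by (simp add: C0_def)
  define C1 where "C1 = J / Gamma (\<alpha> + 1)"
  have C1: "C1 \<ge> 0" using J G by (simp add: C1_def)
  \<comment> \<open>The factor \<open>t powr (- \<sigma>)\<close> cancels the weight of the form up to \<open>1/t\<close>.\<close>
  define m where "m A t = t powr (- \<sigma>) * tent (A * t powr \<gamma>) powr d" for A t :: real
  have m0: "m A t \<ge> 0" for A t by (simp add: m_def)
  have [measurable (raw)]: "(\<lambda>w. m (f w) (g w)) \<in> borel_measurable N" if "f \<in> borel_measurable N" "g \<in> borel_measurable N" for f g and N :: "'z measure"
    unfolding m_def using that by measurable
  have im: "(\<integral>\<^sup>+t. ennreal (t powr (\<sigma> - 1) * m A t) * indicator {0<..} t \<partial>lborel) \<le> ennreal J" if "A > 0" for A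
  proof -
    have "ennreal (t powr (\<sigma> - 1) * m A t) * indicator {0<..} t = ennreal (t powr (- 1) * tent (A * t powr \<gamma>) powr d) * indicator {0<..} t" for t
    proof (cases "t > 0")
      case True
      have "t powr (\<sigma> - 1) * t powr (- \<sigma>) = t powr (- 1)" by (simp add: powr_add[symmetric])
      thus ?thesis by (simp add: m_def mult.assoc[symmetric])
    qed simp
    thus ?thesis using nn_integral_tent_le[OF that \<gamma> d(1)] by (simp add: J_def)
  qed
  have marg: "(\<integral>\<^sup>+t. \<integral>\<^sup>+x. potential_weight \<alpha> \<sigma> t x y * ennreal (m A t) \<partial>dunkl_measure \<alpha> \<partial>lborel) \<le> ennreal C0" if "A > 0" for A y
  proof -
    have "(\<integral>\<^sup>+t. \<integral>\<^sup>+x. potential_weight \<alpha> \<sigma> t x y * ennreal (m A t) \<partial>dunkl_measure \<alpha> \<partial>lborel) 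
       \<le> ennreal (4 powr (\<alpha> + 1)) * (\<integral>\<^sup>+t. ennreal (t powr (\<sigma> - 1) * m A t) * indicator {0<..} t \<partial>lborel)"
      by (rule weighted_marginal_le[OF \<alpha>1]) (auto simp: m0)
    also have "\<dots> \<le> ennreal (4 powr (\<alpha> + 1)) * ennreal J" by (intro mult_left_mono im that) simp
    finally show ?thesis by (simp add: C0_def ennreal_mult')
  qed
  have marg': "(\<integral>\<^sup>+t. \<integral>\<^sup>+y. potential_weight \<alpha> \<sigma> t x y * ennreal (m A t) \<partial>dunkl_measure \<alpha> \<partial>lborel) \<le> ennreal C0" if "A > 0" for A x
    using marg[OF that, of x] by (simp add: potential_weight_commute[of \<alpha> \<sigma> _ x])
  show ?thesis
  proof (rule form_boundedI[of "4 * C0 + 4 * C1"])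
    fix \<phi> \<psi> :: "real \<Rightarrow> real"
    assume [measurable]: "\<phi> \<in> borel_measurable borel" "\<psi> \<in> borel_measurable borel"
      and pos: "\<And>x. \<phi> x > 0" "\<And>x. \<psi> x > 0" 
      and i: "(\<integral>\<^sup>+x. ennreal (\<phi> x) \<partial>dunkl_measure \<alpha>) \<le> 2" "(\<integral>\<^sup>+x. ennreal (\<psi> x) \<partial>dunkl_measure \<alpha>) \<le> 2"
    let ?U = "\<lambda>t x y. ennreal (m (\<phi> y) t)"
    let ?V = "\<lambda>t x y. ennreal (m (\<psi> x) t)"
    let ?W = "\<lambda>t x y. ennreal (t powr \<gamma> * m (\<phi> y) t)"
    have M: "measurable3 ?U" "measurable3 ?V" "measurable3 ?W"
      "measurable3 (\<lambda>t x y. ?U t x y * ennreal (\<phi> y))" "measurable3 (\<lambda>t x y. ?V t x y * ennreal (\<psi> x))" "measurable3 (\<lambda>t x y. ?W t x y * (ennreal (\<phi> y) * ennreal (\<psi> x)))"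
      "measurable3 (\<lambda>t x y. ?V t x y * ennreal (\<psi> x) + ?W t x y * (ennreal (\<phi> y) * ennreal (\<psi> x)))"
      unfolding measurable3_def by measurable
    have "power_form \<alpha> \<sigma> a b \<phi> \<psi> 
      \<le> potential_form \<alpha> \<sigma> (\<lambda>t x y. ?U t x y * ennreal (\<phi> y) + (?V t x y * ennreal (\<psi> x) + ?W t x y * (ennreal (\<phi> y) * ennreal (\<psi> x))))"
    proof (rule potential_form_mono)
      fix t x y :: real assume t: "t > 0"
      define \<tau> where "\<tau> = t powr \<gamma>"
      have \<tau>: "\<tau> > 0" using t by (simp add: \<tau>_def)
      have \<tau>\<sigma>: "\<tau> powr (a + b - 1) = t powr \<sigma>" using k by (simp add: \<tau>_def powr_powr \<gamma>_def)
      have "(\<phi> y * \<tau>) powr a * (\<psi> x * \<tau>) powr b \<le> (\<phi> y * \<tau>) * tent (\<phi> y * \<tau>) powr d + (\<psi> x * \<tau>) * tent (\<psi> x * \<tau>) powr d + (\<phi> y * \<tau>) * (\<psi> x * \<tau>) * tent (\<phi> y * \<tau>) powr d"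
        using pos \<tau> d by (intro powr_product_le_tents) auto
      also have "(\<phi> y * \<tau>) powr a * (\<psi> x * \<tau>) powr b = \<tau> * t powr \<sigma> * (\<phi> y powr a * \<psi> x powr b)"
      proof -
        have "\<tau> powr a * \<tau> powr b = \<tau> powr (1 + (a + b - 1))" by (simp add: powr_add[symmetric])
        also have "\<dots> = \<tau> powr 1 * \<tau> powr (a + b - 1)" by (rule powr_add)
        also have "\<dots> = \<tau> * t powr \<sigma>" using \<tau> by (simp add: \<tau>\<sigma>)
        finally show ?thesis using pos \<tau> by (simp add: powr_mult less_imp_le mult_ac)
      qed
      also have "(\<phi> y * \<tau>) * tent (\<phi> y * \<tau>) powr d + (\<psi> x * \<tau>) * tent (\<psi> x * \<tau>) powr d + (\<phi> y * \<tau>) * (\<psi> x * \<tau>) * tent (\<phi> y * \<tau>) powr d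
        = \<tau> * (tent (\<phi> y * \<tau>) powr d * \<phi> y + (tent (\<psi> x * \<tau>) powr d * \<psi> x + (\<tau> * tent (\<phi> y * \<tau>) powr d) * (\<phi> y * \<psi> x)))"
        by (simp add: algebra_simps)
      finally have "t powr \<sigma> * (\<phi> y powr a * \<psi> x powr b) \<le> tent (\<phi> y * \<tau>) powr d * \<phi> y + (tent (\<psi> x * \<tau>) powr d * \<psi> x + (\<tau> * tent (\<phi> y * \<tau>) powr d) * (\<phi> y * \<psi> x))"
        using \<tau> by (simp add: mult.assoc)
      hence "t powr (- \<sigma>) * (t powr \<sigma> * (\<phi> y powr a * \<psi> x powr b)) \<le> t powr (- \<sigma>) * (tent (\<phi> y * \<tau>) powr d * \<phi> y + (tent (\<psi> x * \<tau>) powr d * \<psi> x + (\<tau> * tent (\<phi> y * \<tau>) powr d) * (\<phi> y * \<psi> x)))"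
        by (rule mult_left_mono) simp
      also have "t powr (- \<sigma>) * (t powr \<sigma> * (\<phi> y powr a * \<psi> x powr b)) = \<phi> y powr a * \<psi> x powr b"
        using t by (simp add: mult.assoc[symmetric] powr_add[symmetric])
      also have "t powr (- \<sigma>) * (tent (\<phi> y * \<tau>) powr d * \<phi> y + (tent (\<psi> x * \<tau>) powr d * \<psi> x + (\<tau> * tent (\<phi> y * \<tau>) powr d) * (\<phi> y * \<psi> x)))
         = m (\<phi> y) t * \<phi> y + (m (\<psi> x) t * \<psi> x + t powr \<gamma> * m (\<phi> y) t * (\<phi> y * \<psi> x))"
        by (simp add: m_def \<tau>_def algebra_simps)
      finally have "ennreal (\<phi> y powr a * \<psi> x powr b) \<le> ennreal (m (\<phi> y) t * \<phi> y + (m (\<psi> x) t * \<psi> x + t powr \<gamma> * m (\<phi> y) t * (\<phi> y * \<psi> x)))"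
        by (rule ennreal_leI)
      also have "\<dots> = ?U t x y * ennreal (\<phi> y) + (?V t x y * ennreal (\<psi> x) + ?W t x y * (ennreal (\<phi> y) * ennreal (\<psi> x)))"
        using pos m0 by (simp add: ennreal_mult less_imp_le)
      finally show "ennreal (\<phi> y powr a) * ennreal (\<psi> x powr b) \<le> ?U t x y * ennreal (\<phi> y) + (?V t x y * ennreal (\<psi> x) + ?W t x y * (ennreal (\<phi> y) * ennreal (\<psi> x)))"
        by (simp add: ennreal_mult')
    qed
    also have "\<dots> = potential_form \<alpha> \<sigma> (\<lambda>t x y. ?U t x y * ennreal (\<phi> y)) + (potential_form \<alpha> \<sigma> (\<lambda>t x y. ?V t x y * ennreal (\<psi> x)) + potential_form \<alpha> \<sigma> (\<lambda>t x y. ?W t x y * (ennreal (\<phi> y) * ennreal (\<psi> x))))"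
      by (simp only: potential_form_add[OF M(4,7)] potential_form_add[OF M(5,6)])
    also have "\<dots> \<le> ennreal C0 * (\<integral>\<^sup>+x. ennreal (\<phi> x) \<partial>dunkl_measure \<alpha>) + (ennreal C0 * (\<integral>\<^sup>+x. ennreal (\<psi> x) \<partial>dunkl_measure \<alpha>) + ennreal C1 * ((\<integral>\<^sup>+x. ennreal (\<phi> x) \<partial>dunkl_measure \<alpha>) * (\<integral>\<^sup>+x. ennreal (\<psi> x) \<partial>dunkl_measure \<alpha>)))"
    proof (intro add_mono)
      show "potential_form \<alpha> \<sigma> (\<lambda>t x y. ?U t x y * ennreal (\<phi> y)) \<le> ennreal C0 * (\<integral>\<^sup>+x. ennreal (\<phi> x) \<partial>dunkl_measure \<alpha>)"
        by (rule potential_form_le_y[OF M(1) _ marg[OF pos(1)]]) measurable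
      show "potential_form \<alpha> \<sigma> (\<lambda>t x y. ?V t x y * ennreal (\<psi> x)) \<le> ennreal C0 * (\<integral>\<^sup>+x. ennreal (\<psi> x) \<partial>dunkl_measure \<alpha>)"
        by (rule potential_form_le_x[OF M(2) _ marg'[OF pos(2)]]) measurable
      show "potential_form \<alpha> \<sigma> (\<lambda>t x y. ?W t x y * (ennreal (\<phi> y) * ennreal (\<psi> x))) \<le> ennreal C1 * ((\<integral>\<^sup>+x. ennreal (\<phi> x) \<partial>dunkl_measure \<alpha>) * (\<integral>\<^sup>+x. ennreal (\<psi> x) \<partial>dunkl_measure \<alpha>))"
      proof (rule potential_form_le_xy[OF M(3)])
        fix x y
        have "(\<integral>\<^sup>+t. potential_weight \<alpha> \<sigma> t x y * ?W t x y \<partial>lborel) \<le> (\<integral>\<^sup>+t. ennreal (1 / Gamma (\<alpha> + 1)) * (ennreal (t powr (\<sigma> - 1) * m (\<phi> y) t) * indicator {0<..} t) \<partial>lborel)"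
        proof (rule nn_integral_mono)
          fix t :: real
          show "potential_weight \<alpha> \<sigma> t x y * ?W t x y \<le> ennreal (1 / Gamma (\<alpha> + 1)) * (ennreal (t powr (\<sigma> - 1) * m (\<phi> y) t) * indicator {0<..} t)"
          proof (cases "t > 0")
            case True
            have "sinh (2 * t) powr (- \<alpha> - 1) \<le> t powr (- \<alpha> - 1)"
              using True sinh_double_ge(2)[OF True] \<alpha>1 by (intro powr_mono2') auto
            hence "sinh (2 * t) powr (- \<alpha> - 1) / Gamma (\<alpha> + 1) \<le> t powr (- \<alpha> - 1) / Gamma (\<alpha> + 1)" using G by (intro divide_right_mono) auto
            with laguerre_kernel_le[OF \<alpha> True, of x y] have "laguerre_kernel \<alpha> t x y \<le> t powr (- \<alpha> - 1) / Gamma (\<alpha> + 1)" by (rule order.trans)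
            hence "laguerre_kernel \<alpha> t x y * t powr \<gamma> \<le> t powr (- \<alpha> - 1) / Gamma (\<alpha> + 1) * t powr \<gamma>" by (rule mult_right_mono) simp
            also have "\<dots> = 1 / Gamma (\<alpha> + 1)" using True by (simp add: \<gamma>_def powr_add[symmetric])
            finally have "(laguerre_kernel \<alpha> t x y * t powr \<gamma>) * (t powr (\<sigma> - 1) * m (\<phi> y) t) \<le> 1 / Gamma (\<alpha> + 1) * (t powr (\<sigma> - 1) * m (\<phi> y) t)"
              by (rule mult_right_mono) (simp add: m0)
            hence "ennreal (t powr (\<sigma> - 1) * laguerre_kernel \<alpha> t x y * (t powr \<gamma> * m (\<phi> y) t)) \<le> ennreal (1 / Gamma (\<alpha> + 1) * (t powr (\<sigma> - 1) * m (\<phi> y) t))"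
              by (intro ennreal_leI) (simp add: mult_ac)
            thus ?thesis using True G laguerre_kernel_nonneg[OF \<alpha>1, of t x y] m0[of "\<phi> y" t]
              ennreal_mult'[of "1 / Gamma (\<alpha> + 1)" "t powr (\<sigma> - 1) * m (\<phi> y) t"] ennreal_mult''[of "t powr \<gamma> * m (\<phi> y) t" "t powr (\<sigma> - 1) * laguerre_kernel \<alpha> t x y"]
              by (simp add: potential_weight_def)
          qed (simp add: potential_weight_def)
        qed
        also have "\<dots> = ennreal (1 / Gamma (\<alpha> + 1)) * (\<integral>\<^sup>+t. ennreal (t powr (\<sigma> - 1) * m (\<phi> y) t) * indicator {0<..} t \<partial>lborel)"
          by (rule nn_integral_cmult) measurable
        also have "\<dots> \<le> ennreal (1 / Gamma (\<alpha> + 1)) * ennreal J" by (intro mult_left_mono im pos) simp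
        also have "\<dots> = ennreal C1" using G by (simp add: C1_def ennreal_mult'[symmetric])
        finally have "(\<integral>\<^sup>+t. potential_weight \<alpha> \<sigma> t x y * ?W t x y \<partial>lborel) \<le> ennreal C1" .
        from mult_left_mono[OF this, of "ennreal (\<phi> y) * ennreal (\<psi> x)"]
        show "ennreal (\<phi> y) * ennreal (\<psi> x) * (\<integral>\<^sup>+t. potential_weight \<alpha> \<sigma> t x y * ?W t x y \<partial>lborel) \<le> ennreal C1 * (ennreal (\<phi> y) * ennreal (\<psi> x))"
          by (simp add: mult_ac)
      qed measurable
    qed
    also have "\<dots> \<le> ennreal C0 * 2 + (ennreal C0 * 2 + ennreal C1 * (2 * 2))"
      by (intro add_mono mult_mono i) auto
    also have "\<dots> = 4 * ennreal C0 + 4 * ennreal C1" by (simp add: mult.commute distrib_left[symmetric] add.assoc[symmetric])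
    also have "\<dots> = ennreal (4 * C0 + 4 * C1)" using C0 C1 ennreal_mult'[of 4 C0] ennreal_mult'[of 4 C1] by simp
    finally show "power_form \<alpha> \<sigma> a b \<phi> \<psi> \<le> ennreal (4 * C0 + 4 * C1)" .
  qed (use C0 C1 in simp)
qed

lemma tanh_ge:
  assumes "(t::real) > 0" shows "tanh t \<ge> t / (1 + t)"
proof -
  have "exp (2 * t) \<ge> 1 + 2 * t" by (rule exp_ge_add_one_self)
  moreover have "exp (2 * t) = exp t * exp t" by (simp add: exp_add[symmetric])
  ultimately have "exp t * exp t * exp (- t) \<ge> (1 + 2 * t) * exp (- t)" by (intro mult_right_mono) auto
  hence "exp t \<ge> (1 + 2 * t) * exp (- t)" by (simp add: mult.assoc exp_add[symmetric])
  hence "t * cosh t \<le> (1 + t) * sinh t" by (simp add: cosh_field_def sinh_field_def field_simps)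
  thus ?thesis using assms cosh_real_pos[of t] by (simp add: tanh_def field_simps)
qed

lemma powr_add_le:
  assumes "(u::real) \<ge> 0" "v \<ge> 0" "0 \<le> p" "p \<le> 1"
  shows "(u + v) powr p \<le> 2 * (u powr p + v powr p)"
proof -
  have "(u + v) powr p \<le> (2 * max u v) powr p" using assms by (intro powr_mono2) auto
  also have "\<dots> = 2 powr p * max u v powr p" using assms by (simp add: powr_mult)
  also have "\<dots> \<le> 2 powr 1 * (u powr p + v powr p)"
    using assms by (intro mult_mono powr_mono) (auto simp: max_def)
  finally show ?thesis by simp
qed

text \<open>The linear bound of the exponential, raised to the power \<open>\<kappa>\<close>. The rate \<open>1/4\<close> is the one that the kernel bound provides at times \<open>t \<ge> 1\<close>, where \<open>tanh t / 2 \<ge> 1/4\<close>.\<close>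

lemma powr_le_exp:
  assumes "(\<kappa>::real) > 0" "R \<ge> 0"
  shows "R powr \<kappa> \<le> (4 * \<kappa>) powr \<kappa> * exp (R / 4)"
proof -
  have "R / (4 * \<kappa>) \<le> exp (R / (4 * \<kappa>))" using exp_ge_add_one_self[of "R / (4 * \<kappa>)"] by linarith
  hence "(R / (4 * \<kappa>)) powr \<kappa> \<le> exp (R / (4 * \<kappa>)) powr \<kappa>" using assms by (intro powr_mono2) auto
  also have "\<dots> = exp (R / 4)" using assms by (simp add: exp_powr_real)
  finally show ?thesis using assms by (simp add: powr_divide field_simps)
qed

text \<open>Here \<open>R\<close> stands for \<open>x\<^sup>2+y\<^sup>2\<close> and \<open>w\<close> for the kernel bound times the power of \<open>L\<close>. Expanding the power of
  \<open>sinh(2t) + R\<close> leaves integrals with \<open>R\<close> absent, which converge, and one with \<open>R\<^sup>\<kappa> t\<^sup>\<kappa>\<^sup>-\<^sup>1 exp(-Rt/4)\<close>, which is invariant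
  under scaling and therefore bounded in \<open>R\<close>. This is what admits the boundary case \<open>\<theta>(-\<alpha>) = \<sigma>\<close>, where the
  power of \<open>R\<close> that occurs is \<open>\<kappa>\<close> itself.\<close>

lemma nn_integral_small_order_weight:
  assumes \<alpha>: "\<alpha> > -1" "\<alpha> < -1/2" and \<theta>: "0 < \<theta>" "\<theta> \<le> 1" "\<theta> * (- \<alpha>) \<le> \<sigma>"
  defines "w \<equiv> \<lambda>t R. sinh (2 * t) powr (- \<theta> / 2) * (sinh (2 * t) + R) powr ((- \<alpha> - 1/2) * \<theta>) * exp (- tanh t / 2 * R)"
  obtains J where "J \<ge> 0" "\<And>R. R \<ge> 0 \<Longrightarrow> (\<integral>\<^sup>+t. ennreal (t powr (\<sigma> - 1) * w t R) * indicator {0<..} t \<partial>lborel) \<le> ennreal J"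
proof -
  define p where "p = (- \<alpha> - 1/2) * \<theta>"
  define \<kappa> where "\<kappa> = \<sigma> - \<theta> / 2"
  have p: "0 \<le> p" "p \<le> 1"
    using \<alpha> \<theta> mult_mono[of "- \<alpha> - 1/2" 1 \<theta> 1] by (auto simp: p_def)
  \<comment> \<open>This is the hypothesis \<open>\<theta>(-\<alpha>) \<le> \<sigma>\<close>, and equality corresponds to equality.\<close>
  have p\<kappa>: "p \<le> \<kappa>" using \<theta> by (simp add: p_def \<kappa>_def algebra_simps)
  have "\<theta> * (1/2) < \<theta> * (- \<alpha>)" "\<theta> * (\<alpha> + 1) < \<theta> * (- \<alpha>)" using \<theta> \<alpha> by (intro mult_strict_left_mono; simp)+
  hence \<kappa>: "\<kappa> > 0" and k1: "\<theta> / 2 < \<sigma>" and k2: "\<theta> * (\<alpha> + 1) < \<sigma>" "\<theta> * (\<alpha> + 1) > 0" using \<theta> \<alpha> by (auto simp: \<kappa>_def)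
  define u1 where "u1 t = t powr (\<sigma> - 1) * sinh (2 * t) powr (- (\<theta> * (\<alpha> + 1)))" for t :: real
  define u2 where "u2 t = t powr (\<sigma> - 1) * sinh (2 * t) powr (- (\<theta> / 2))" for t :: real
  define u3 where "u3 R t = t powr (\<kappa> - 1) * exp (- (R / 4) * t)" for R t :: real
  have [measurable]: "u1 \<in> borel_measurable borel" "u2 \<in> borel_measurable borel" "u3 R \<in> borel_measurable borel" for R
    unfolding u1_def u2_def u3_def by measurable
  define J1 where "J1 = Gamma (\<sigma> - \<theta> * (\<alpha> + 1)) / (\<theta> * (\<alpha> + 1)) powr (\<sigma> - \<theta> * (\<alpha> + 1))"
  define J2 where "J2 = Gamma (\<sigma> - \<theta> / 2) / (\<theta> / 2) powr (\<sigma> - \<theta> / 2)"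
  have J: "J1 \<ge> 0" "J2 \<ge> 0" using k1 k2 \<theta> by (auto simp: J1_def J2_def Gamma_real_pos less_imp_le)
  have i1: "(\<integral>\<^sup>+t. ennreal (u1 t) * indicator {0<..} t \<partial>lborel) \<le> ennreal J1"
    unfolding u1_def J1_def using k2 by (intro nn_integral_sinh_powr_le)
  have i2: "(\<integral>\<^sup>+t. ennreal (u2 t) * indicator {0<..} t \<partial>lborel) \<le> ennreal J2"
    unfolding u2_def J2_def using k1 \<theta> by (intro nn_integral_sinh_powr_le) auto
  have i3: "(\<integral>\<^sup>+t. ennreal (R powr \<kappa>) * (ennreal (u3 R t) * indicator {0<..} t) \<partial>lborel) \<le> ennreal (4 powr \<kappa> * Gamma \<kappa>)" if R: "R \<ge> 0" for R
  proof (cases "R = 0")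
    case False
    hence R0: "R > 0" using R by simp
    have "(\<integral>\<^sup>+t. ennreal (R powr \<kappa>) * (ennreal (u3 R t) * indicator {0<..} t) \<partial>lborel) = ennreal (R powr \<kappa>) * ennreal (Gamma \<kappa> / (R / 4) powr \<kappa>)"
      unfolding u3_def using nn_integral_Gamma_scaled[of \<kappa> "R / 4"] R0 \<kappa> by (subst nn_integral_cmult) auto
    also have "\<dots> = ennreal (R powr \<kappa> * (Gamma \<kappa> / (R / 4) powr \<kappa>))" by (rule ennreal_mult'[symmetric]) simp
    also have "R powr \<kappa> * (Gamma \<kappa> / (R / 4) powr \<kappa>) = 4 powr \<kappa> * Gamma \<kappa>" using R0 by (simp add: powr_divide)
    finally show ?thesis by simp
  qed simp
  define D where "D = 2 * (4 * \<kappa>) powr \<kappa> + 2"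
  have D: "D \<ge> 0" by (simp add: D_def)
  have pt: "t powr (\<sigma> - 1) * w t R \<le> 2 * u1 t + (D * u2 t + 2 * (R powr \<kappa> * u3 R t))" if t: "t > 0" and R: "R \<ge> 0" for t R
  proof -
    have s: "sinh (2 * t) > 0" using t by simp
    have e1: "exp (- tanh t / 2 * R) \<le> 1" using t R by simp
    have pa: "(sinh (2 * t) + R) powr p \<le> 2 * (sinh (2 * t) powr p + R powr p)" using s R p by (intro powr_add_le) auto
    have pb: "R powr p \<le> 1 + R powr \<kappa>"
    proof (cases "R \<le> 1")
      case True
      hence "R powr p \<le> 1" using R p by (intro powr_le1) auto
      thus ?thesis using powr_ge_zero[of R \<kappa>] by linarith
    next
      case False
      hence "R powr p \<le> R powr \<kappa>" using p\<kappa> by (intro powr_mono) auto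
      thus ?thesis by simp
    qed
    have "2 * (sinh (2 * t) powr p + R powr p) \<le> 2 * (sinh (2 * t) powr p + (1 + R powr \<kappa>))"
      using pb by (intro mult_left_mono add_left_mono) auto
    also have "\<dots> = 2 * sinh (2 * t) powr p + 2 + 2 * R powr \<kappa>" by (simp add: algebra_simps)
    finally have 1: "(sinh (2 * t) + R) powr p \<le> 2 * sinh (2 * t) powr p + 2 + 2 * R powr \<kappa>" using pa by (rule order.trans[rotated])
    define E where "E = exp (- tanh t / 2 * R)"
    have E: "0 \<le> E" "E \<le> 1" using e1 by (auto simp: E_def)
    have "(sinh (2 * t) + R) powr p * E \<le> (2 * sinh (2 * t) powr p + 2 + 2 * R powr \<kappa>) * E" using 1 E by (intro mult_right_mono) auto
    also have "\<dots> = 2 * sinh (2 * t) powr p * E + 2 * E + 2 * R powr \<kappa> * E" by (simp add: algebra_simps)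
    also have "\<dots> \<le> 2 * sinh (2 * t) powr p + 2 + 2 * R powr \<kappa> * E"
      using E mult_left_le[of E "2 * sinh (2 * t) powr p"] by (intro add_mono) auto
    finally have 2: "(sinh (2 * t) + R) powr p * E \<le> 2 * sinh (2 * t) powr p + 2 + 2 * R powr \<kappa> * E" .
    define S where "S = t powr (\<sigma> - 1) * sinh (2 * t) powr (- \<theta> / 2)"
    have S0: "S \<ge> 0" by (simp add: S_def)
    have Su2: "S = u2 t" by (simp add: S_def u2_def)
    have Su1: "S * sinh (2 * t) powr p = u1 t"
    proof -
      have "sinh (2 * t) powr (- \<theta> / 2) * sinh (2 * t) powr p = sinh (2 * t) powr (- (\<theta> * (\<alpha> + 1)))"
      proof -
        have "- \<theta> / 2 + p = - (\<theta> * (\<alpha> + 1))" by (simp add: p_def field_simps)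
        thus ?thesis by (simp only: powr_add[symmetric])
      qed
      thus ?thesis by (simp add: S_def u1_def mult.assoc)
    qed
    \<comment> \<open>For \<open>t \<le> 1\<close> the decay \<open>tanh t \<ge> t/2\<close> gives the scale-invariant term; for \<open>t > 1\<close> the power of \<open>R\<close> is absorbed
      by the exponential altogether.\<close>
    have "S * (R powr \<kappa> * E) \<le> R powr \<kappa> * u3 R t + (4 * \<kappa>) powr \<kappa> * S"
    proof (cases "t \<le> 1")
      case True
      have "t / 2 \<le> t / (1 + t)" using t True by (intro divide_left_mono) auto
      hence "t / 2 \<le> tanh t" using tanh_ge[OF t] by linarith
      hence "t / 2 / 2 * R \<le> tanh t / 2 * R" using R by (intro mult_right_mono divide_right_mono) auto
      hence "E \<le> exp (- (R / 4) * t)" by (simp add: E_def mult.commute)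
      moreover have "S \<le> t powr (\<kappa> - 1)"
      proof -
        have "sinh (2 * t) powr (- \<theta> / 2) \<le> t powr (- \<theta> / 2)" using t sinh_double_ge(2)[OF t] \<theta> by (intro powr_mono2') auto
        hence "S \<le> t powr (\<sigma> - 1) * t powr (- \<theta> / 2)" unfolding S_def by (intro mult_left_mono) auto
        also have "\<dots> = t powr (\<kappa> - 1)" by (simp add: powr_add[symmetric] \<kappa>_def algebra_simps)
        finally show ?thesis .
      qed
      ultimately have "S * E \<le> u3 R t" unfolding u3_def using S0 E by (intro mult_mono) auto
      hence "R powr \<kappa> * (S * E) \<le> R powr \<kappa> * u3 R t" by (intro mult_left_mono) auto
      moreover have "0 \<le> (4 * \<kappa>) powr \<kappa> * S" using S0 by simp
      ultimately show ?thesis by (simp add: mult_ac)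
    next
      case False
      have "1 / 2 \<le> t / (1 + t)" using False by (simp add: field_simps)
      hence "1 / 2 \<le> tanh t" using tanh_ge[OF t] by linarith
      hence "1 / 2 / 2 * R \<le> tanh t / 2 * R" using R by (intro mult_right_mono divide_right_mono) auto
      hence "E \<le> exp (- (R / 4))" by (simp add: E_def)
      hence "R powr \<kappa> * E \<le> ((4 * \<kappa>) powr \<kappa> * exp (R / 4)) * exp (- (R / 4))"
        using powr_le_exp[OF \<kappa> R] E by (intro mult_mono) auto
      also have "\<dots> = (4 * \<kappa>) powr \<kappa>" by (simp add: mult.assoc exp_add[symmetric])
      finally have "S * (R powr \<kappa> * E) \<le> S * (4 * \<kappa>) powr \<kappa>" using S0 by (intro mult_left_mono) auto
      moreover have "0 \<le> R powr \<kappa> * u3 R t" by (simp add: u3_def)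
      ultimately show ?thesis by (simp add: mult_ac)
    qed
    moreover have "S * ((sinh (2 * t) + R) powr p * E) \<le> S * (2 * sinh (2 * t) powr p + 2 + 2 * R powr \<kappa> * E)" using 2 S0 by (intro mult_left_mono) auto
    moreover have "S * (2 * sinh (2 * t) powr p + 2 + 2 * R powr \<kappa> * E) = 2 * (S * sinh (2 * t) powr p) + 2 * S + 2 * (S * (R powr \<kappa> * E))" by (simp add: algebra_simps)
    moreover have "t powr (\<sigma> - 1) * w t R = S * ((sinh (2 * t) + R) powr p * E)" by (simp add: w_def S_def E_def p_def mult.assoc)
    moreover have "D * S = 2 * S + 2 * ((4 * \<kappa>) powr \<kappa> * S)" by (simp add: D_def algebra_simps)
    ultimately show ?thesis unfolding Su1[symmetric] Su2[symmetric] by linarith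
  qed
  show ?thesis
  proof (rule that[of "2 * J1 + (D * J2 + 2 * (4 powr \<kappa> * Gamma \<kappa>))"])
    have GK: "Gamma \<kappa> \<ge> 0" using \<kappa> by (simp add: Gamma_real_pos less_imp_le)
    show "0 \<le> 2 * J1 + (D * J2 + 2 * (4 powr \<kappa> * Gamma \<kappa>))" using J D GK by simp
    fix R :: real assume R: "R \<ge> 0"
    have "(\<integral>\<^sup>+t. ennreal (t powr (\<sigma> - 1) * w t R) * indicator {0<..} t \<partial>lborel)
      \<le> (\<integral>\<^sup>+t. 2 * (ennreal (u1 t) * indicator {0<..} t) + (ennreal D * (ennreal (u2 t) * indicator {0<..} t) + 2 * (ennreal (R powr \<kappa>) * (ennreal (u3 R t) * indicator {0<..} t))) \<partial>lborel)"
    proof (rule nn_integral_mono)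
      fix t :: real
      show "ennreal (t powr (\<sigma> - 1) * w t R) * indicator {0<..} t \<le> 2 * (ennreal (u1 t) * indicator {0<..} t) + (ennreal D * (ennreal (u2 t) * indicator {0<..} t) + 2 * (ennreal (R powr \<kappa>) * (ennreal (u3 R t) * indicator {0<..} t)))"
      proof (cases "t > 0")
        case True
        have nn: "u1 t \<ge> 0" "u2 t \<ge> 0" "u3 R t \<ge> 0" by (auto simp: u1_def u2_def u3_def)
        have "ennreal (t powr (\<sigma> - 1) * w t R) \<le> ennreal (2 * u1 t + (D * u2 t + 2 * (R powr \<kappa> * u3 R t)))" by (rule ennreal_leI[OF pt[OF True R]])
        also have "\<dots> = ennreal (2 * u1 t) + (ennreal (D * u2 t) + ennreal (2 * (R powr \<kappa> * u3 R t)))" using nn D by simp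
        also have "\<dots> = 2 * ennreal (u1 t) + (ennreal D * ennreal (u2 t) + 2 * (ennreal (R powr \<kappa>) * ennreal (u3 R t)))"
          using ennreal_mult'[of 2 "u1 t"] ennreal_mult'[OF D, of "u2 t"] ennreal_mult'[of 2 "R powr \<kappa> * u3 R t"] ennreal_mult'[of "R powr \<kappa>" "u3 R t"] by simp
        finally show ?thesis using True by simp
      qed simp
    qed
    also have "\<dots> = 2 * (\<integral>\<^sup>+t. ennreal (u1 t) * indicator {0<..} t \<partial>lborel) + (ennreal D * (\<integral>\<^sup>+t. ennreal (u2 t) * indicator {0<..} t \<partial>lborel) + 2 * (\<integral>\<^sup>+t. ennreal (R powr \<kappa>) * (ennreal (u3 R t) * indicator {0<..} t) \<partial>lborel))"
      by (simp add: nn_integral_add nn_integral_cmult)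
    also have "\<dots> \<le> 2 * ennreal J1 + (ennreal D * ennreal J2 + 2 * ennreal (4 powr \<kappa> * Gamma \<kappa>))"
      by (intro add_mono mult_left_mono i1 i2 i3 R) auto
    also have "\<dots> = ennreal (2 * J1) + (ennreal (D * J2) + ennreal (2 * (4 powr \<kappa> * Gamma \<kappa>)))"
      using ennreal_mult'[of 2 J1] ennreal_mult'[OF D, of J2] ennreal_mult'[of 2 "4 powr \<kappa> * Gamma \<kappa>"] by simp
    also have "\<dots> = ennreal (2 * J1 + (D * J2 + 2 * (4 powr \<kappa> * Gamma \<kappa>)))" using J D GK by simp
    finally show "(\<integral>\<^sup>+t. ennreal (t powr (\<sigma> - 1) * w t R) * indicator {0<..} t \<partial>lborel) \<le> ennreal (2 * J1 + (D * J2 + 2 * (4 powr \<kappa> * Gamma \<kappa>)))" .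
  qed
qed

text \<open>The weight is \<open>L = s\<^sup>1\<^sup>/\<^sup>2 (s+x\<^sup>2+y\<^sup>2)\<^sup>\<alpha>\<^sup>+\<^sup>1\<^sup>/\<^sup>2\<close> with \<open>s = sinh(2t)\<close>, the reciprocal of the kernel bound without its
  exponential. For the marginal with \<open>y\<close> fixed, replacing \<open>s+x\<^sup>2+y\<^sup>2\<close> by \<open>s+y\<^sup>2\<close> costs a factor
  \<open>1 + x\<^sup>2/(s+y\<^sup>2)\<close>, whose mean under the kernel is bounded by the second moment.\<close>

lemma form_bounded_small_order:
  assumes \<alpha>: "\<alpha> > -1" "\<alpha> < -1/2" and ab: "a \<le> 1" "b \<le> 1" "a + b > 1" and k: "(a + b - 1) * (- \<alpha>) \<le> \<sigma>"
  shows "form_bounded \<alpha> \<sigma> a b"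
proof -
  define \<theta> where "\<theta> = a + b - 1"
  define e where "e = - \<alpha> - 1/2"
  have \<theta>: "0 < \<theta>" "\<theta> \<le> 1" "\<theta> * (- \<alpha>) \<le> \<sigma>" using ab k by (auto simp: \<theta>_def)
  have e: "0 < e" "e < 1/2" using \<alpha> by (auto simp: e_def)
  define w where "w t R = sinh (2 * t) powr (- \<theta> / 2) * (sinh (2 * t) + R) powr (e * \<theta>) * exp (- tanh t / 2 * R)" for t R
  have [measurable (raw)]: "(\<lambda>z. w (f z) (g z)) \<in> borel_measurable N" if "f \<in> borel_measurable N" "g \<in> borel_measurable N" for f g and N :: "'z measure"
  proof -
    note [measurable] = that
    have [measurable]: "(\<lambda>z. tanh (f z)) \<in> borel_measurable N" unfolding tanh_def by measurable
    show ?thesis unfolding w_def by measurable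
  qed
  obtain J where J: "J \<ge> 0" "\<And>R. R \<ge> 0 \<Longrightarrow> (\<integral>\<^sup>+t. ennreal (t powr (\<sigma> - 1) * w t R) * indicator {0<..} t \<partial>lborel) \<le> ennreal J"
    unfolding w_def e_def using nn_integral_small_order_weight[OF \<alpha> \<theta>] by blast
  obtain C where C: "C > 0" "\<And>t x y. t > 0 \<Longrightarrow> laguerre_kernel \<alpha> t x y \<le> 
     C * (sinh (2 * t) powr (-1/2) * (sinh (2 * t) + (x\<^sup>2 + y\<^sup>2)) powr (- \<alpha> - 1/2)) * exp (- tanh t / 2 * (x\<^sup>2 + y\<^sup>2))"
    using laguerre_kernel_le_small_order[OF \<alpha>] by blast
  let ?L = "\<lambda>t x y :: real. if t > 0 then sinh (2 * t) powr (1/2) * (sinh (2 * t) + (x\<^sup>2 + y\<^sup>2)) powr (- e) else 1"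
  have spos: "sinh (2 * t) + (x\<^sup>2 + y\<^sup>2) > 0" if "t > 0" for t x y :: real using that by (simp add: add_pos_nonneg)
  have Lneg: "?L t x y powr (- \<theta>) = sinh (2 * t) powr (- \<theta> / 2) * (sinh (2 * t) + (x\<^sup>2 + y\<^sup>2)) powr (e * \<theta>)" if t: "t > 0" for t x y
    using t spos[OF t, of x y] by (simp add: powr_mult powr_powr mult.commute)
  show ?thesis
  proof (rule form_bounded_if_p_less_q[OF ab, of "C * J" "2 * 2 powr (\<alpha> + 1) * J" ?L])
    show "0 \<le> C * J" "0 \<le> 2 * 2 powr (\<alpha> + 1) * J" using J C by auto
    show "measurable3 (\<lambda>t x y. ennreal (?L t x y powr (2 - a - b)))" "measurable3 (\<lambda>t x y. ennreal (?L t x y powr (1 - a - b)))"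
      unfolding measurable3_def by measurable
    show "?L t x y > 0" if "t > 0" for t x y using that spos[OF that, of x y] by simp
    show "?L t x y = ?L t y x" for t x y by (simp add: add.commute)
    fix x y :: real
    have "(\<integral>\<^sup>+t. potential_weight \<alpha> \<sigma> t x y * ennreal (?L t x y powr (2 - a - b)) \<partial>lborel) 
       \<le> (\<integral>\<^sup>+t. ennreal C * (ennreal (t powr (\<sigma> - 1) * w t (x\<^sup>2 + y\<^sup>2)) * indicator {0<..} t) \<partial>lborel)"
    proof (rule nn_integral_mono)
      fix t :: real
      show "potential_weight \<alpha> \<sigma> t x y * ennreal (?L t x y powr (2 - a - b)) \<le> ennreal C * (ennreal (t powr (\<sigma> - 1) * w t (x\<^sup>2 + y\<^sup>2)) * indicator {0<..} t)"
      proof (cases "t > 0")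
        case True
        define l where "l = ?L t x y"
        have l: "l > 0" using True spos[OF True, of x y] by (simp add: l_def)
        have li: "sinh (2 * t) powr (-1/2) * (sinh (2 * t) + (x\<^sup>2 + y\<^sup>2)) powr e = 1 / l"
          using True spos[OF True, of x y] powr_minus[of "sinh (2 * t)" "1/2"] by (simp add: l_def powr_minus field_simps)
        have "laguerre_kernel \<alpha> t x y \<le> C * (1 / l) * exp (- tanh t / 2 * (x\<^sup>2 + y\<^sup>2))"
          using C(2)[OF True, of x y] unfolding e_def[symmetric] li .
        hence "laguerre_kernel \<alpha> t x y * l powr (2 - a - b) \<le> C * (1 / l) * exp (- tanh t / 2 * (x\<^sup>2 + y\<^sup>2)) * l powr (2 - a - b)"
          by (rule mult_right_mono) simp
        also have "\<dots> = C * (l powr (- \<theta>) * exp (- tanh t / 2 * (x\<^sup>2 + y\<^sup>2)))"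
        proof -
          have "2 - a - b = 1 + - \<theta>" by (simp add: \<theta>_def)
          hence "l powr (2 - a - b) = l * l powr (- \<theta>)" using l by (simp only: powr_add) simp
          thus ?thesis using l by simp
        qed
        also have "\<dots> = C * w t (x\<^sup>2 + y\<^sup>2)" unfolding l_def Lneg[OF True] by (simp add: w_def mult.assoc)
        finally have "t powr (\<sigma> - 1) * (laguerre_kernel \<alpha> t x y * l powr (2 - a - b)) \<le> t powr (\<sigma> - 1) * (C * w t (x\<^sup>2 + y\<^sup>2))"
          by (rule mult_left_mono) simp
        hence "ennreal (t powr (\<sigma> - 1) * laguerre_kernel \<alpha> t x y * l powr (2 - a - b)) \<le> ennreal (C * (t powr (\<sigma> - 1) * w t (x\<^sup>2 + y\<^sup>2)))"
          by (intro ennreal_leI) (simp add: mult_ac)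
        thus ?thesis using True C(1) unfolding l_def[symmetric]
          by (simp add: potential_weight_def ennreal_mult''[symmetric] ennreal_mult'[symmetric])
      qed (simp add: potential_weight_def)
    qed
    also have "\<dots> = ennreal C * (\<integral>\<^sup>+t. ennreal (t powr (\<sigma> - 1) * w t (x\<^sup>2 + y\<^sup>2)) * indicator {0<..} t \<partial>lborel)"
      by (rule nn_integral_cmult) measurable
    also have "\<dots> \<le> ennreal C * ennreal J" by (intro mult_left_mono J) auto
    also have "\<dots> = ennreal (C * J)" using C(1) by (simp add: ennreal_mult')
    finally show "(\<integral>\<^sup>+t. potential_weight \<alpha> \<sigma> t x y * ennreal (?L t x y powr (2 - a - b)) \<partial>lborel) \<le> ennreal (C * J)" .
  next
    fix y :: real
    have "(\<integral>\<^sup>+t. \<integral>\<^sup>+x. potential_weight \<alpha> \<sigma> t x y * ennreal (?L t x y powr (1 - a - b)) \<partial>dunkl_measure \<alpha> \<partial>lborel)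
       \<le> (\<integral>\<^sup>+t. ennreal (2 * 2 powr (\<alpha> + 1)) * (ennreal (t powr (\<sigma> - 1) * w t (y\<^sup>2)) * indicator {0<..} t) \<partial>lborel)"
    proof (rule nn_integral_mono)
      fix t :: real
      show "(\<integral>\<^sup>+x. potential_weight \<alpha> \<sigma> t x y * ennreal (?L t x y powr (1 - a - b)) \<partial>dunkl_measure \<alpha>) \<le> ennreal (2 * 2 powr (\<alpha> + 1)) * (ennreal (t powr (\<sigma> - 1) * w t (y\<^sup>2)) * indicator {0<..} t)"
      proof (cases "t > 0")
        case True
        define s where "s = sinh (2 * t)"
        define c where "c = cosh (2 * t)"
        have s: "s > 0" "c \<ge> 1" using True by (auto simp: s_def c_def cosh_real_ge_1)
        define B where "B = s powr (- \<theta> / 2) * (s + y\<^sup>2) powr (e * \<theta>)"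
        have B: "B \<ge> 0" by (simp add: B_def)
        have sy: "s + y\<^sup>2 > 0" using s by (simp add: add_pos_nonneg)
        have p1: "e * \<theta> \<le> 1" "e * \<theta> \<ge> 0" using e \<theta> mult_mono[of e 1 \<theta> 1] by auto
        have pt: "?L t x y powr (1 - a - b) \<le> B * (1 + x\<^sup>2 / (s + y\<^sup>2))" for x
        proof -
          have "1 - a - b = - \<theta>" by (simp add: \<theta>_def)
          hence "?L t x y powr (1 - a - b) = s powr (- \<theta> / 2) * (s + (x\<^sup>2 + y\<^sup>2)) powr (e * \<theta>)"
            using Lneg[OF True, of x y] unfolding s_def by (simp only:)
          also have "s + (x\<^sup>2 + y\<^sup>2) = (s + y\<^sup>2) * (1 + x\<^sup>2 / (s + y\<^sup>2))" using sy by (simp add: field_simps)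
          also have "\<dots> powr (e * \<theta>) = (s + y\<^sup>2) powr (e * \<theta>) * (1 + x\<^sup>2 / (s + y\<^sup>2)) powr (e * \<theta>)" using sy by (intro powr_mult)
          also have "s powr (- \<theta> / 2) * \<dots> \<le> B * (1 + x\<^sup>2 / (s + y\<^sup>2)) powr 1"
            unfolding B_def mult.assoc using sy p1 by (intro mult_left_mono powr_mono) auto
          also have "(1 + x\<^sup>2 / (s + y\<^sup>2)) powr 1 = 1 + x\<^sup>2 / (s + y\<^sup>2)" using sy by (simp add: add_nonneg_nonneg)
          finally show ?thesis .
        qed
        define m where "m = (c / 2) powr (- \<alpha> - 1) * exp (- (tanh (2 * t) / 2) * y\<^sup>2)"
        have m0: "m \<ge> 0" by (simp add: m_def)
        have "(\<integral>\<^sup>+x. potential_weight \<alpha> \<sigma> t x y * ennreal (?L t x y powr (1 - a - b)) \<partial>dunkl_measure \<alpha>)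
          \<le> (\<integral>\<^sup>+x. ennreal (t powr (\<sigma> - 1) * B) * (ennreal (laguerre_kernel \<alpha> t x y) + ennreal (1 / (s + y\<^sup>2)) * ennreal (x\<^sup>2 * laguerre_kernel \<alpha> t x y)) \<partial>dunkl_measure \<alpha>)"
        proof (rule nn_integral_mono)
          fix x
          have H: "laguerre_kernel \<alpha> t x y \<ge> 0" by (rule laguerre_kernel_nonneg[OF \<alpha>(1)])
          have "t powr (\<sigma> - 1) * laguerre_kernel \<alpha> t x y * ?L t x y powr (1 - a - b) \<le> t powr (\<sigma> - 1) * laguerre_kernel \<alpha> t x y * (B * (1 + x\<^sup>2 / (s + y\<^sup>2)))"
            using H by (intro mult_left_mono pt) auto
          also have "\<dots> = (t powr (\<sigma> - 1) * B) * (laguerre_kernel \<alpha> t x y + 1 / (s + y\<^sup>2) * (x\<^sup>2 * laguerre_kernel \<alpha> t x y))"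
            by (simp add: algebra_simps)
          finally have "ennreal (t powr (\<sigma> - 1) * laguerre_kernel \<alpha> t x y * ?L t x y powr (1 - a - b)) \<le> ennreal ((t powr (\<sigma> - 1) * B) * (laguerre_kernel \<alpha> t x y + 1 / (s + y\<^sup>2) * (x\<^sup>2 * laguerre_kernel \<alpha> t x y)))"
            by (rule ennreal_leI)
          also have "\<dots> = ennreal (t powr (\<sigma> - 1) * B) * ennreal (laguerre_kernel \<alpha> t x y + 1 / (s + y\<^sup>2) * (x\<^sup>2 * laguerre_kernel \<alpha> t x y))"
            using B by (intro ennreal_mult') auto
          also have "ennreal (laguerre_kernel \<alpha> t x y + 1 / (s + y\<^sup>2) * (x\<^sup>2 * laguerre_kernel \<alpha> t x y)) = ennreal (laguerre_kernel \<alpha> t x y) + ennreal (1 / (s + y\<^sup>2) * (x\<^sup>2 * laguerre_kernel \<alpha> t x y))"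
            using H sy by (intro ennreal_plus) auto
          also have "ennreal (1 / (s + y\<^sup>2) * (x\<^sup>2 * laguerre_kernel \<alpha> t x y)) = ennreal (1 / (s + y\<^sup>2)) * ennreal (x\<^sup>2 * laguerre_kernel \<alpha> t x y)"
            using sy by (intro ennreal_mult') auto
          finally show "potential_weight \<alpha> \<sigma> t x y * ennreal (?L t x y powr (1 - a - b)) \<le> ennreal (t powr (\<sigma> - 1) * B) * (ennreal (laguerre_kernel \<alpha> t x y) + ennreal (1 / (s + y\<^sup>2)) * ennreal (x\<^sup>2 * laguerre_kernel \<alpha> t x y))"
            using True by (simp add: potential_weight_def ennreal_mult''[symmetric])
        qed
        also have "\<dots> = ennreal (t powr (\<sigma> - 1) * B) * (ennreal m + ennreal (1 / (s + y\<^sup>2)) * ennreal (m * (y\<^sup>2 / c\<^sup>2 + 2 * (\<alpha> + 1) * tanh (2 * t))))"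
          using nn_integral_laguerre_kernel[OF \<alpha>(1) True, of y] nn_integral_laguerre_kernel_second_moment[OF \<alpha>(1) True, of y]
          by (simp add: nn_integral_cmult nn_integral_add m_def c_def)
        also have "\<dots> \<le> ennreal (t powr (\<sigma> - 1) * B) * (ennreal m + ennreal (1 / (s + y\<^sup>2)) * ennreal (m * (s + y\<^sup>2)))"
        proof (intro mult_left_mono add_left_mono ennreal_leI m0)
          have "y\<^sup>2 / c\<^sup>2 \<le> y\<^sup>2 / 1" using s by (intro divide_left_mono) auto
          moreover have "tanh (2 * t) \<le> s"
          proof -
            have "s / c \<le> s / 1" using s by (intro divide_left_mono) auto
            thus ?thesis by (simp add: tanh_def s_def c_def)
          qed
          moreover have "2 * (\<alpha> + 1) * tanh (2 * t) \<le> 1 * tanh (2 * t)" using \<alpha> True by (intro mult_right_mono) auto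
          ultimately show "y\<^sup>2 / c\<^sup>2 + 2 * (\<alpha> + 1) * tanh (2 * t) \<le> s + y\<^sup>2" by simp
        qed auto
        also have "ennreal (1 / (s + y\<^sup>2)) * ennreal (m * (s + y\<^sup>2)) = ennreal m" using sy by (simp add: ennreal_mult'[symmetric])
        also have "ennreal m + ennreal m = ennreal (2 * m)" using m0 by (simp add: ennreal_plus[symmetric] del: ennreal_plus)
        also have "ennreal (t powr (\<sigma> - 1) * B) * ennreal (2 * m) = ennreal (t powr (\<sigma> - 1) * B * (2 * m))" using B by (simp add: ennreal_mult')
        also have "\<dots> \<le> ennreal (2 * 2 powr (\<alpha> + 1) * (t powr (\<sigma> - 1) * w t (y\<^sup>2)))"
        proof (rule ennreal_leI)
          have "(c / 2) powr (- \<alpha> - 1) \<le> (1 / 2) powr (- \<alpha> - 1)" using s \<alpha> by (intro powr_mono2') auto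
          also have "\<dots> = 2 powr (\<alpha> + 1)" using powr_minus_divide[of 2 "\<alpha> + 1"] by (simp add: powr_divide)
          finally have 1: "(c / 2) powr (- \<alpha> - 1) \<le> 2 powr (\<alpha> + 1)" .
          have "tanh t \<le> tanh (2 * t)" using True by simp
          hence "tanh t / 2 * y\<^sup>2 \<le> tanh (2 * t) / 2 * y\<^sup>2" by (intro mult_right_mono divide_right_mono) auto
          hence "exp (- (tanh (2 * t) / 2) * y\<^sup>2) \<le> exp (- tanh t / 2 * y\<^sup>2)" by simp
          hence "m \<le> 2 powr (\<alpha> + 1) * exp (- tanh t / 2 * y\<^sup>2)" unfolding m_def using 1 by (intro mult_mono) auto
          hence "(t powr (\<sigma> - 1) * B * 2) * m \<le> (t powr (\<sigma> - 1) * B * 2) * (2 powr (\<alpha> + 1) * exp (- tanh t / 2 * y\<^sup>2))"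
            using B by (intro mult_left_mono) auto
          thus "t powr (\<sigma> - 1) * B * (2 * m) \<le> 2 * 2 powr (\<alpha> + 1) * (t powr (\<sigma> - 1) * w t (y\<^sup>2))"
            by (simp add: w_def B_def s_def mult_ac)
        qed
        also have "\<dots> = ennreal (2 * 2 powr (\<alpha> + 1)) * ennreal (t powr (\<sigma> - 1) * w t (y\<^sup>2))" by (rule ennreal_mult') simp
        finally show ?thesis using True by simp
      qed (simp add: potential_weight_def)
    qed
    also have "\<dots> = ennreal (2 * 2 powr (\<alpha> + 1)) * (\<integral>\<^sup>+t. ennreal (t powr (\<sigma> - 1) * w t (y\<^sup>2)) * indicator {0<..} t \<partial>lborel)"
      by (rule nn_integral_cmult) measurable
    also have "\<dots> \<le> ennreal (2 * 2 powr (\<alpha> + 1)) * ennreal J" by (intro mult_left_mono J) auto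
    also have "\<dots> = ennreal (2 * 2 powr (\<alpha> + 1) * J)" by (rule ennreal_mult'[symmetric]) simp
    finally show "(\<integral>\<^sup>+t. \<integral>\<^sup>+x. potential_weight \<alpha> \<sigma> t x y * ennreal (?L t x y powr (1 - a - b)) \<partial>dunkl_measure \<alpha> \<partial>lborel) \<le> ennreal (2 * 2 powr (\<alpha> + 1) * J)" .
  qed
qed

section \<open>Necessary conditions\<close>

lemma potential_form_flip:
  assumes [measurable]: "f \<in> borel_measurable borel" "g \<in> borel_measurable borel"
  shows "potential_form \<alpha> \<sigma> (\<lambda>t x y. f y * g x) = potential_form \<alpha> \<sigma> (\<lambda>t x y. g y * f x)"
proof -
  have "measurable3 (\<lambda>t x y. g y * f x)" unfolding measurable3_def by measurable
  hence "potential_form \<alpha> \<sigma> (\<lambda>t x y. g y * f x) = (\<integral>\<^sup>+t. \<integral>\<^sup>+y. \<integral>\<^sup>+x. potential_weight \<alpha> \<sigma> t x y * (g y * f x) \<partial>dunkl_measure \<alpha> \<partial>dunkl_measure \<alpha> \<partial>lborel)"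
    unfolding potential_form_def by (intro nn_integral_cong dunkl_pair.Fubini') measurable
  thus ?thesis unfolding potential_form_def by (simp add: mult.commute[of "g _"] potential_weight_commute[of \<alpha> \<sigma>])
qed

text \<open>Self-adjointness of the potential: the conditions are symmetric under \<open>(p, q) \<mapsto> (q', p')\<close>, so the two excluded
  endpoints need only one test.\<close>

lemma even_form_bounded_commute:
  assumes "even_form_bounded \<alpha> \<sigma> a b" shows "even_form_bounded \<alpha> \<sigma> b a"
proof -
  have "power_form \<alpha> \<sigma> b a \<phi> \<psi> = power_form \<alpha> \<sigma> a b \<psi> \<phi>" if "even_density \<alpha> \<phi>" "even_density \<alpha> \<psi>" for \<phi> \<psi>
    using that by (subst potential_form_flip) (auto simp: even_density_def)
  thus ?thesis using assms unfolding even_form_bounded_def by metis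
qed

text \<open>The factor \<open>exp 2\<close> bounds \<open>cosh(2t)\<close> and \<open>sinh(2t)/(2t)\<close> for \<open>0 < t \<le> 1\<close>.\<close>

definition Gaussian_constant :: "real \<Rightarrow> real" where
  "Gaussian_constant \<alpha> = Gamma (\<alpha> + 1) * (2 * exp 2) powr (- \<alpha> - 1)"

lemma Gaussian_constant_pos: "\<alpha> > -1 \<Longrightarrow> Gaussian_constant \<alpha> > 0"
  by (simp add: Gaussian_constant_def)

lemma sinh_le_exp:
  assumes "(u::real) \<ge> 0" shows "sinh u \<le> u * exp u"
proof -
  have "1 - 2 * u \<le> exp (- (2 * u))" using exp_ge_add_one_self[of "- (2 * u)"] by simp
  hence "(1 - 2 * u) * exp u \<le> exp (- (2 * u)) * exp u" by (intro mult_right_mono) auto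
  also have "\<dots> = exp (- u)" by (simp add: exp_add[symmetric])
  finally show ?thesis by (simp add: sinh_field_def algebra_simps)
qed

lemma Gaussian_pair_ge:
  assumes \<alpha>: "\<alpha> > -1" and t: "0 < t" "t \<le> 1" and AB: "A > 0" "B > 0"
  shows "ennreal (Gaussian_constant \<alpha> * t powr (\<sigma> - 1) * (t * (1 + A * B) + A + B) powr (- \<alpha> - 1))
     \<le> (\<integral>\<^sup>+x. \<integral>\<^sup>+y. potential_weight \<alpha> \<sigma> t x y * (ennreal (exp (- A * y\<^sup>2)) * ennreal (exp (- B * x\<^sup>2))) \<partial>dunkl_measure \<alpha> \<partial>dunkl_measure \<alpha>)"
proof -
  have s: "sinh (2 * t) \<le> 2 * t * exp 2"
  proof -
    have "sinh (2 * t) \<le> 2 * t * exp (2 * t)" using sinh_le_exp[of "2 * t"] t by simp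
    also have "\<dots> \<le> 2 * t * exp 2" using t by (intro mult_left_mono) auto
    finally show ?thesis .
  qed
  have s0: "sinh (2 * t) > 0" using t by simp
  have c: "cosh (2 * t) \<le> exp 2" 
  proof -
    have "exp (2 * t) \<le> exp 2" "exp (- (2 * t)) \<le> exp 2" using t by auto
    hence "exp (2 * t) + exp (- (2 * t)) \<le> exp 2 * 2" by linarith
    thus ?thesis by (simp add: cosh_field_def)
  qed
  have e2: "exp (2::real) > 0" by simp
  have "sinh (2 * t) * (1 / 4 + A * B) + (A + B) * cosh (2 * t) / 2 \<le> (2 * t * exp 2) * (1 + A * B) + (A + B) * (2 * exp 2)"
  proof (intro add_mono mult_mono)
    have "(A + B) * cosh (2 * t) / 2 = (A + B) * (cosh (2 * t) / 2)" by simp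
    also have "\<dots> \<le> (A + B) * (2 * exp 2)"
    proof (rule mult_left_mono)
      show "cosh (2 * t) / 2 \<le> 2 * exp 2" using c e2 by linarith
    qed (use AB in simp)
    finally show "(A + B) * cosh (2 * t) / 2 \<le> (A + B) * (2 * exp 2)" .
  qed (use s AB t in auto)
  also have "\<dots> = (2 * exp 2) * (t * (1 + A * B) + A + B)" by (simp add: algebra_simps)
  finally have le: "sinh (2 * t) * (1 / 4 + A * B) + (A + B) * cosh (2 * t) / 2 \<le> (2 * exp 2) * (t * (1 + A * B) + A + B)" .
  have pos: "sinh (2 * t) * (1 / 4 + A * B) + (A + B) * cosh (2 * t) / 2 > 0"
    using s0 AB by (intro add_pos_pos mult_pos_pos divide_pos_pos) (auto intro: add_pos_pos simp: cosh_real_pos)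
  have pos2: "t * (1 + A * B) + A + B > 0" using t AB by (intro add_pos_pos mult_pos_pos) auto
  have "((2 * exp 2) * (t * (1 + A * B) + A + B)) powr (- \<alpha> - 1) \<le> (sinh (2 * t) * (1 / 4 + A * B) + (A + B) * cosh (2 * t) / 2) powr (- \<alpha> - 1)"
    using le pos \<alpha> by (intro powr_mono2') auto
  hence "(2 * exp 2) powr (- \<alpha> - 1) * (t * (1 + A * B) + A + B) powr (- \<alpha> - 1) \<le> (sinh (2 * t) * (1 / 4 + A * B) + (A + B) * cosh (2 * t) / 2) powr (- \<alpha> - 1)"
    using pos2 by (subst (asm) powr_mult) auto
  hence "(t powr (\<sigma> - 1) * Gamma (\<alpha> + 1)) * ((2 * exp 2) powr (- \<alpha> - 1) * (t * (1 + A * B) + A + B) powr (- \<alpha> - 1)) \<le> (t powr (\<sigma> - 1) * Gamma (\<alpha> + 1)) * (sinh (2 * t) * (1 / 4 + A * B) + (A + B) * cosh (2 * t) / 2) powr (- \<alpha> - 1)"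
    using \<alpha> by (intro mult_left_mono) (auto simp: less_imp_le)
  hence "ennreal (Gaussian_constant \<alpha> * t powr (\<sigma> - 1) * (t * (1 + A * B) + A + B) powr (- \<alpha> - 1))
     \<le> ennreal (t powr (\<sigma> - 1) * (Gamma (\<alpha> + 1) * (sinh (2 * t) * (1 / 4 + A * B) + (A + B) * cosh (2 * t) / 2) powr (- \<alpha> - 1)))"
    by (intro ennreal_leI) (simp add: Gaussian_constant_def mult_ac)
  also have "\<dots> = ennreal (t powr (\<sigma> - 1)) * (\<integral>\<^sup>+x. (\<integral>\<^sup>+y. ennreal (laguerre_kernel \<alpha> t y x * exp (- A * y\<^sup>2) * exp (- B * x\<^sup>2)) \<partial>dunkl_measure \<alpha>) \<partial>dunkl_measure \<alpha>)"
    unfolding nn_integral_laguerre_kernel_two_Gaussians[OF \<alpha> t(1) AB(2,1)] by (simp add: ennreal_mult' add.commute mult.commute)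
  also have "\<dots> = (\<integral>\<^sup>+x. \<integral>\<^sup>+y. ennreal (t powr (\<sigma> - 1)) * ennreal (laguerre_kernel \<alpha> t y x * exp (- A * y\<^sup>2) * exp (- B * x\<^sup>2)) \<partial>dunkl_measure \<alpha> \<partial>dunkl_measure \<alpha>)"
    by (simp add: nn_integral_cmult)
  also have "\<dots> = (\<integral>\<^sup>+x. \<integral>\<^sup>+y. potential_weight \<alpha> \<sigma> t x y * (ennreal (exp (- A * y\<^sup>2)) * ennreal (exp (- B * x\<^sup>2))) \<partial>dunkl_measure \<alpha> \<partial>dunkl_measure \<alpha>)"
    using t laguerre_kernel_nonneg[OF \<alpha>]
    by (intro nn_integral_cong) (simp add: potential_weight_def laguerre_kernel_commute[of \<alpha> t] ennreal_mult'' ennreal_mult mult.assoc)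
  finally show ?thesis .
qed

lemma AE_dunkl_nonzero: "AE x in dunkl_measure \<alpha>. x \<noteq> 0"
  unfolding dunkl_measure_def using AE_lborel_singleton[of "0::real"] by (subst AE_density) auto

text \<open>The common device of the lower bounds: at each time the test functions are minorized by Gaussians whose widths and
  heights may depend on the time, and the pairing of two Gaussians is known. The origin is excluded for \<open>f\<close>, since a
  negative power of \<open>0\<close> has the value \<open>0\<close>.\<close>

lemma potential_form_ge_Gaussians:
  assumes \<alpha>: "\<alpha> > -1" and [measurable]: "f \<in> borel_measurable borel" "g \<in> borel_measurable borel" "h \<in> borel_measurable borel"
    and T: "0 \<le> T0" "T1 \<le> 1"
    and h0: "\<And>t. h t \<ge> 0"
    and pos: "\<And>t. T0 < t \<Longrightarrow> t < T1 \<Longrightarrow> A t > 0 \<and> B t > 0 \<and> u t \<ge> 0 \<and> v t \<ge> 0"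
    and f: "\<And>t y. T0 < t \<Longrightarrow> t < T1 \<Longrightarrow> y \<noteq> 0 \<Longrightarrow> u t * exp (- A t * y\<^sup>2) \<le> f y"
    and g: "\<And>t x. T0 < t \<Longrightarrow> t < T1 \<Longrightarrow> v t * exp (- B t * x\<^sup>2) \<le> g x"
    and h: "\<And>t. T0 < t \<Longrightarrow> t < T1 \<Longrightarrow> h t \<le> u t * v t * t powr (\<sigma> - 1) * (t * (1 + A t * B t) + A t + B t) powr (- \<alpha> - 1)"
  shows "ennreal (Gaussian_constant \<alpha>) * (\<integral>\<^sup>+t. ennreal (h t) * indicator {T0<..<T1} t \<partial>lborel) \<le> potential_form \<alpha> \<sigma> (\<lambda>t x y. ennreal (f y) * ennreal (g x))"
proof -
  have "ennreal (Gaussian_constant \<alpha>) * (\<integral>\<^sup>+t. ennreal (h t) * indicator {T0<..<T1} t \<partial>lborel) = (\<integral>\<^sup>+t. ennreal (Gaussian_constant \<alpha>) * (ennreal (h t) * indicator {T0<..<T1} t) \<partial>lborel)"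
    by (rule nn_integral_cmult[symmetric]) measurable
  also have "\<dots> \<le> potential_form \<alpha> \<sigma> (\<lambda>t x y. ennreal (f y) * ennreal (g x))"
    unfolding potential_form_def
  proof (rule nn_integral_mono)
    fix t :: real
    show "ennreal (Gaussian_constant \<alpha>) * (ennreal (h t) * indicator {T0<..<T1} t) \<le> (\<integral>\<^sup>+x. \<integral>\<^sup>+y. potential_weight \<alpha> \<sigma> t x y * (ennreal (f y) * ennreal (g x)) \<partial>dunkl_measure \<alpha> \<partial>dunkl_measure \<alpha>)"
    proof (cases "T0 < t \<and> t < T1")
      case True
      hence t: "T0 < t" "t < T1" "0 < t" "t \<le> 1" using T by auto
      note p = pos[OF t(1,2)]
      have "Gaussian_constant \<alpha> * h t \<le> Gaussian_constant \<alpha> * (u t * v t * t powr (\<sigma> - 1) * (t * (1 + A t * B t) + A t + B t) powr (- \<alpha> - 1))"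
        using Gaussian_constant_pos[OF \<alpha>] by (intro mult_left_mono h t) auto
      hence "ennreal (Gaussian_constant \<alpha> * h t) \<le> ennreal ((u t * v t) * (Gaussian_constant \<alpha> * t powr (\<sigma> - 1) * (t * (1 + A t * B t) + A t + B t) powr (- \<alpha> - 1)))"
        by (intro ennreal_leI) (simp add: mult_ac)
      also have "\<dots> = ennreal (u t * v t) * ennreal (Gaussian_constant \<alpha> * t powr (\<sigma> - 1) * (t * (1 + A t * B t) + A t + B t) powr (- \<alpha> - 1))"
        using p by (intro ennreal_mult') auto
      also have "\<dots> \<le> ennreal (u t * v t) * (\<integral>\<^sup>+x. \<integral>\<^sup>+y. potential_weight \<alpha> \<sigma> t x y * (ennreal (exp (- A t * y\<^sup>2)) * ennreal (exp (- B t * x\<^sup>2))) \<partial>dunkl_measure \<alpha> \<partial>dunkl_measure \<alpha>)"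
        using p t by (intro mult_left_mono Gaussian_pair_ge[OF \<alpha>]) auto
      also have "\<dots> = (\<integral>\<^sup>+x. \<integral>\<^sup>+y. ennreal (u t * v t) * (potential_weight \<alpha> \<sigma> t x y * (ennreal (exp (- A t * y\<^sup>2)) * ennreal (exp (- B t * x\<^sup>2)))) \<partial>dunkl_measure \<alpha> \<partial>dunkl_measure \<alpha>)"
        by (simp add: nn_integral_cmult)
      also have "\<dots> \<le> (\<integral>\<^sup>+x. \<integral>\<^sup>+y. potential_weight \<alpha> \<sigma> t x y * (ennreal (f y) * ennreal (g x)) \<partial>dunkl_measure \<alpha> \<partial>dunkl_measure \<alpha>)"
      proof (intro nn_integral_mono nn_integral_mono_AE, rule eventually_mono[OF AE_dunkl_nonzero])
        fix x y :: real assume y: "y \<noteq> 0"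
        have "ennreal (u t * exp (- A t * y\<^sup>2)) * ennreal (v t * exp (- B t * x\<^sup>2)) \<le> ennreal (f y) * ennreal (g x)"
          by (intro mult_mono ennreal_leI f g t y) auto
        hence "potential_weight \<alpha> \<sigma> t x y * (ennreal (u t * exp (- A t * y\<^sup>2)) * ennreal (v t * exp (- B t * x\<^sup>2))) \<le> potential_weight \<alpha> \<sigma> t x y * (ennreal (f y) * ennreal (g x))"
          by (rule mult_left_mono) simp
        thus "ennreal (u t * v t) * (potential_weight \<alpha> \<sigma> t x y * (ennreal (exp (- A t * y\<^sup>2)) * ennreal (exp (- B t * x\<^sup>2)))) \<le> potential_weight \<alpha> \<sigma> t x y * (ennreal (f y) * ennreal (g x))"
          using p by (simp add: ennreal_mult' mult_ac)
      qed
      finally show ?thesis using True Gaussian_constant_pos[OF \<alpha>] by (simp add: ennreal_mult')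
    next
      case False
      thus ?thesis by (auto simp: indicator_def)
    qed
  qed
  finally show ?thesis .
qed

lemma nn_integral_powr_interval:
  assumes "0 \<le> T" "\<sigma> > 0"
  shows "(\<integral>\<^sup>+t. ennreal (t powr (\<sigma> - 1)) * indicator {0<..<T} t \<partial>lborel) = ennreal (T powr \<sigma> / \<sigma>)"
proof -
  have "(\<integral>\<^sup>+t. ennreal (t powr (\<sigma> - 1)) * indicator {0<..<T} t \<partial>lborel) = (\<integral>\<^sup>+t. ennreal (t powr (\<sigma> - 1)) * indicator {0..T} t \<partial>lborel)"
    using AE_lborel_singleton[of "0::real"] AE_lborel_singleton[of T]
    by (intro nn_integral_cong_AE, eventually_elim) (auto simp: indicator_def)
  also have "\<dots> = ennreal (T powr \<sigma> / \<sigma>)"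
    using has_integral_powr_from_0[of "\<sigma> - 1" T] assms by (intro nn_integral_has_integral_lebesgue') auto
  finally show ?thesis .
qed

lemma nn_integral_powr_interval_ge:
  assumes "0 < T" "T \<le> 1" "\<epsilon> > 0"
  shows "ennreal ((1 - T powr \<epsilon>) / \<epsilon>) \<le> (\<integral>\<^sup>+t. ennreal (t powr (\<epsilon> - 1)) * indicator {T<..<1} t \<partial>lborel)"
proof -
  have "((\<lambda>t. t powr (\<epsilon> - 1)) has_integral (1 powr \<epsilon> / \<epsilon> - T powr \<epsilon> / \<epsilon>)) {T..1}"
    using assms by (intro fundamental_theorem_of_calculus)
      (auto intro!: derivative_eq_intros simp: has_real_derivative_iff_has_vector_derivative[symmetric])
  hence "(\<integral>\<^sup>+t. ennreal (t powr (\<epsilon> - 1)) * indicator {T..1} t \<partial>lborel) = ennreal (1 powr \<epsilon> / \<epsilon> - T powr \<epsilon> / \<epsilon>)"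
    by (intro nn_integral_has_integral_lebesgue') auto
  moreover have "(\<integral>\<^sup>+t. ennreal (t powr (\<epsilon> - 1)) * indicator {T<..<1} t \<partial>lborel) = (\<integral>\<^sup>+t. ennreal (t powr (\<epsilon> - 1)) * indicator {T..1} t \<partial>lborel)"
    using AE_lborel_singleton[of "1::real"] AE_lborel_singleton[of T]
    by (intro nn_integral_cong_AE, eventually_elim) (auto simp: indicator_def)
  ultimately show ?thesis by (simp add: diff_divide_distrib)
qed

lemma nn_integral_inverse_interval:
  assumes "0 < T" "T \<le> 1"
  shows "(\<integral>\<^sup>+t. ennreal (t powr (- 1)) * indicator {T<..<1} t \<partial>lborel) = ennreal (- ln T)"
proof -
  have "((\<lambda>t. t powr (- 1)) has_integral (ln 1 - ln T)) {T..1}"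
    using assms by (intro fundamental_theorem_of_calculus)
      (auto intro!: derivative_eq_intros simp: has_real_derivative_iff_has_vector_derivative[symmetric] powr_minus_divide)
  hence "(\<integral>\<^sup>+t. ennreal (t powr (- 1)) * indicator {T..1} t \<partial>lborel) = ennreal (ln 1 - ln T)"
    by (intro nn_integral_has_integral_lebesgue') auto
  moreover have "(\<integral>\<^sup>+t. ennreal (t powr (- 1)) * indicator {T<..<1} t \<partial>lborel) = (\<integral>\<^sup>+t. ennreal (t powr (- 1)) * indicator {T..1} t \<partial>lborel)"
    using AE_lborel_singleton[of "1::real"] AE_lborel_singleton[of T]
    by (intro nn_integral_cong_AE, eventually_elim) (auto simp: indicator_def)
  ultimately show ?thesis by simp
qed

lemma powr_unbounded:
  assumes "(\<epsilon>::real) > 0" "c > 0"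
  obtains R where "R \<ge> R0" "R \<ge> 1" "c * R powr \<epsilon> > C"
proof -
  define R where "R = max (max R0 1) ((\<bar>C\<bar> / c + 1) powr (1 / \<epsilon>))"
  have "(\<bar>C\<bar> / c + 1) = ((\<bar>C\<bar> / c + 1) powr (1 / \<epsilon>)) powr \<epsilon>" using assms by (simp add: powr_powr)
  also have "\<dots> \<le> R powr \<epsilon>" using assms by (intro powr_mono2) (auto simp: R_def)
  finally have "c * (\<bar>C\<bar> / c + 1) \<le> c * R powr \<epsilon>" using assms by (intro mult_left_mono) auto
  hence "\<bar>C\<bar> + c \<le> c * R powr \<epsilon>" using assms by (simp add: distrib_left)
  hence "c * R powr \<epsilon> > C" using assms by linarith
  thus ?thesis using that[of R] by (simp add: R_def)
qed

definition Gaussian_density :: "real \<Rightarrow> real \<Rightarrow> real \<Rightarrow> real" where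
  "Gaussian_density \<alpha> A x = A powr (\<alpha> + 1) / Gamma (\<alpha> + 1) * exp (- A * x\<^sup>2)"

lemma Gaussian_density:
  assumes \<alpha>: "\<alpha> > -1" and A: "A > 0"
  shows "Gaussian_density \<alpha> A \<in> borel_measurable borel" "Gaussian_density \<alpha> A x > 0"
    "even_density \<alpha> (Gaussian_density \<alpha> A)"
proof -
  have G: "Gamma (\<alpha> + 1) > 0" using \<alpha> by simp
  have m: "Gaussian_density \<alpha> A \<in> borel_measurable borel" unfolding Gaussian_density_def by measurable
  have p: "Gaussian_density \<alpha> A x > 0" "Gaussian_density \<alpha> A (- x) = Gaussian_density \<alpha> A x" for x
    using G A by (auto simp: Gaussian_density_def)
  show "Gaussian_density \<alpha> A \<in> borel_measurable borel" "Gaussian_density \<alpha> A x > 0" by (rule m p)+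
  have "(\<integral>\<^sup>+x. ennreal (Gaussian_density \<alpha> A x) \<partial>dunkl_measure \<alpha>) = (\<integral>\<^sup>+x. ennreal (A powr (\<alpha> + 1) / Gamma (\<alpha> + 1)) * ennreal (exp (- A * x\<^sup>2)) \<partial>dunkl_measure \<alpha>)"
    using G by (intro nn_integral_cong) (simp add: Gaussian_density_def ennreal_mult'[symmetric])
  also have "\<dots> = ennreal (A powr (\<alpha> + 1) / Gamma (\<alpha> + 1)) * ennreal (Gamma (\<alpha> + 1) / A powr (\<alpha> + 1))"
    using nn_integral_exp_square[OF \<alpha> A] by (subst nn_integral_cmult) auto
  also have "\<dots> = 1" using G A by (simp add: ennreal_mult'[symmetric])
  finally show "even_density \<alpha> (Gaussian_density \<alpha> A)" using m p by (simp add: even_density_def less_imp_le)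
qed

text \<open>Both densities are Gaussians concentrated at the scale \<open>A\<^sup>-\<^sup>1\<^sup>/\<^sup>2\<close>. For times below \<open>1/A\<close> they hardly spread, so the form
  is at least of order \<open>A\<close> to the power \<open>(\<alpha>+1)(a+b-1) - \<sigma>\<close>.\<close>

lemma necessary_scaling:
  assumes \<alpha>: "\<alpha> > -1" and \<sigma>: "\<sigma> > 0" and ab: "0 < a" "a \<le> 1" "0 < b" "b \<le> 1" and bd: "even_form_bounded \<alpha> \<sigma> a b"
  shows "(\<alpha> + 1) * (a + b - 1) \<le> \<sigma>"
proof (rule ccontr)
  assume "\<not> ?thesis"
  hence \<epsilon>: "(\<alpha> + 1) * (a + b - 1) - \<sigma> > 0" by simp
  obtain C where C: "C \<ge> 0" "\<And>\<phi> \<psi>. even_density \<alpha> \<phi> \<Longrightarrow> even_density \<alpha> \<psi> \<Longrightarrow> power_form \<alpha> \<sigma> a b \<phi> \<psi> \<le> ennreal C"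
    using bd unfolding even_form_bounded_def by blast
  have G: "Gamma (\<alpha> + 1) > 0" using \<alpha> by simp
  define c where "c = Gaussian_constant \<alpha> * (1 / Gamma (\<alpha> + 1) powr (a + b)) * 4 powr (- \<alpha> - 1) / \<sigma>"
  have c: "c > 0" using Gaussian_constant_pos[OF \<alpha>] G \<sigma> by (simp add: c_def)
  obtain A where A: "A \<ge> 1" "c * A powr ((\<alpha> + 1) * (a + b - 1) - \<sigma>) > C"
    using powr_unbounded[OF \<epsilon> c, of 1 C] by blast
  hence A0: "A > 0" by simp
  define N where "N = A powr (\<alpha> + 1) / Gamma (\<alpha> + 1)"
  have N: "N > 0" using A0 G by (simp add: N_def)
  have Ngp: "Gaussian_density \<alpha> A x powr p = N powr p * exp (- (A * p) * x\<^sup>2)" for x p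
    using N by (simp add: Gaussian_density_def N_def[symmetric] powr_mult exp_powr_real mult_ac)
  define h where "h t = N powr (a + b) * (4 * A) powr (- \<alpha> - 1) * t powr (\<sigma> - 1)" for t
  have [measurable]: "h \<in> borel_measurable borel" unfolding h_def by measurable
  have "ennreal (Gaussian_constant \<alpha>) * (\<integral>\<^sup>+t. ennreal (h t) * indicator {0<..<1 / A} t \<partial>lborel) \<le> power_form \<alpha> \<sigma> a b (Gaussian_density \<alpha> A) (Gaussian_density \<alpha> A)"
  proof (rule potential_form_ge_Gaussians[OF \<alpha>, where A = "\<lambda>_. A * a" and B = "\<lambda>_. A * b" and u = "\<lambda>_. N powr a" and v = "\<lambda>_. N powr b"])
    fix t assume t: "0 < t" "t < 1 / A"
    hence tA: "t * A \<le> 1" using A0 by (simp add: field_simps)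
    have ab1: "a * b \<le> 1" using ab by (simp add: mult_le_one)
    have "t * (1 + A * a * (A * b)) + A * a + A * b = t + (t * A) * A * (a * b) + A * a + A * b" by (simp add: algebra_simps)
    also have "\<dots> \<le> 1 + 1 * A * 1 + A * 1 + A * 1"
    proof (intro add_mono mult_mono)
      show "t \<le> 1" using t A by (meson divide_le_eq_1_pos less_imp_le order.trans A0)
    qed (use t A ab ab1 tA in auto)
    also have "\<dots> \<le> 4 * A" using A by simp
    finally have b: "t * (1 + A * a * (A * b)) + A * a + A * b \<le> 4 * A" .
    have "0 < t * (1 + A * a * (A * b)) + A * a + A * b" using t A0 ab by (intro add_pos_pos mult_pos_pos) auto
    hence "(4 * A) powr (- \<alpha> - 1) \<le> (t * (1 + A * a * (A * b)) + A * a + A * b) powr (- \<alpha> - 1)"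
      using b \<alpha> by (intro powr_mono2') auto
    hence "(N powr (a + b) * t powr (\<sigma> - 1)) * (4 * A) powr (- \<alpha> - 1) \<le> (N powr (a + b) * t powr (\<sigma> - 1)) * (t * (1 + A * a * (A * b)) + A * a + A * b) powr (- \<alpha> - 1)"
      by (intro mult_left_mono) auto
    thus "h t \<le> N powr a * N powr b * t powr (\<sigma> - 1) * (t * (1 + A * a * (A * b)) + A * a + A * b) powr (- \<alpha> - 1)"
      by (simp add: h_def powr_add mult_ac)
  qed (use A0 A ab Gaussian_density[OF \<alpha> A0] in \<open>auto simp: Ngp h_def\<close>)
  also have "\<dots> \<le> ennreal C"
    by (intro C(2) Gaussian_density(3)[OF \<alpha> A0])
  also have "(\<integral>\<^sup>+t. ennreal (h t) * indicator {0<..<1 / A} t \<partial>lborel) = ennreal (N powr (a + b) * (4 * A) powr (- \<alpha> - 1)) * ennreal ((1 / A) powr \<sigma> / \<sigma>)"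
  proof -
    have "(\<integral>\<^sup>+t. ennreal (h t) * indicator {0<..<1 / A} t \<partial>lborel) = (\<integral>\<^sup>+t. ennreal (N powr (a + b) * (4 * A) powr (- \<alpha> - 1)) * (ennreal (t powr (\<sigma> - 1)) * indicator {0<..<1 / A} t) \<partial>lborel)"
      by (intro nn_integral_cong) (simp add: h_def ennreal_mult'[symmetric] mult.assoc[symmetric])
    thus ?thesis using nn_integral_powr_interval[of "1 / A" \<sigma>] A0 \<sigma> by (simp add: nn_integral_cmult)
  qed
  finally have le': "ennreal (Gaussian_constant \<alpha>) * (ennreal (N powr (a + b) * (4 * A) powr (- \<alpha> - 1)) * ennreal ((1 / A) powr \<sigma> / \<sigma>)) \<le> ennreal C" .
  have "0 \<le> N powr (a + b) * (4 * A) powr (- \<alpha> - 1)" by simp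
  from le' have "ennreal (Gaussian_constant \<alpha> * (N powr (a + b) * (4 * A) powr (- \<alpha> - 1) * ((1 / A) powr \<sigma> / \<sigma>))) \<le> ennreal C"
    by (simp only: ennreal_mult'[OF \<open>0 \<le> N powr (a + b) * (4 * A) powr (- \<alpha> - 1)\<close>] ennreal_mult'[OF less_imp_le[OF Gaussian_constant_pos[OF \<alpha>]]])
  hence le: "Gaussian_constant \<alpha> * (N powr (a + b) * (4 * A) powr (- \<alpha> - 1) * ((1 / A) powr \<sigma> / \<sigma>)) \<le> C" using C(1) by simp
  have "Gaussian_constant \<alpha> * (N powr (a + b) * (4 * A) powr (- \<alpha> - 1) * ((1 / A) powr \<sigma> / \<sigma>)) = c * A powr ((\<alpha> + 1) * (a + b - 1) - \<sigma>)"
  proof -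
    have "N powr (a + b) = A powr ((\<alpha> + 1) * (a + b)) / Gamma (\<alpha> + 1) powr (a + b)" using A0 G by (simp add: N_def powr_divide powr_powr)
    moreover have "(4 * A) powr (- \<alpha> - 1) = 4 powr (- \<alpha> - 1) * A powr (- \<alpha> - 1)" using A0 by (simp add: powr_mult)
    moreover have "(1 / A) powr \<sigma> = A powr (- \<sigma>)" using A0 by (simp add: powr_divide powr_minus_divide)
    moreover have "A powr ((\<alpha> + 1) * (a + b)) * A powr (- \<alpha> - 1) * A powr (- \<sigma>) = A powr ((\<alpha> + 1) * (a + b - 1) - \<sigma>)"
      by (simp add: powr_add[symmetric] algebra_simps)
    ultimately show ?thesis by (simp add: c_def mult_ac) 
  qed
  with le A show False by linarith
qed

text \<open>For two concentrated Gaussians of mass \<open>1\<close>, every time between \<open>1/A\<close> and \<open>1\<close> contributes the on-diagonal value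
  \<open>t\<^sup>-\<^sup>\<alpha>\<^sup>-\<^sup>1\<close> of the kernel. The integral over \<open>dt/t\<close> is then of order \<open>ln A\<close>.\<close>

lemma necessary_corner:
  assumes \<alpha>: "\<alpha> > -1" and \<sigma>: "\<sigma> = \<alpha> + 1"
  shows "\<not> even_form_bounded \<alpha> \<sigma> 1 1"
proof
  assume bd: "even_form_bounded \<alpha> \<sigma> 1 1"
  obtain C where C: "C \<ge> 0" "\<And>\<phi> \<psi>. even_density \<alpha> \<phi> \<Longrightarrow> even_density \<alpha> \<psi> \<Longrightarrow> power_form \<alpha> \<sigma> 1 1 \<phi> \<psi> \<le> ennreal C"
    using bd unfolding even_form_bounded_def by blast
  have G: "Gamma (\<alpha> + 1) > 0" using \<alpha> by simp
  define c where "c = Gaussian_constant \<alpha> * (4 powr (- \<alpha> - 1) / (Gamma (\<alpha> + 1))\<^sup>2)"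
  have c: "c > 0" using Gaussian_constant_pos[OF \<alpha>] G by (simp add: c_def)
  define A where "A = exp (C / c + 1)"
  have A: "A \<ge> 1" "A > 0" using C(1) c by (auto simp: A_def)
  define N where "N = A powr (\<alpha> + 1) / Gamma (\<alpha> + 1)"
  have N: "N > 0" using A G by (simp add: N_def)
  define K where "K = 4 powr (- \<alpha> - 1) / (Gamma (\<alpha> + 1))\<^sup>2"
  have K: "K > 0" using G by (simp add: K_def)
  have "ennreal (Gaussian_constant \<alpha>) * (\<integral>\<^sup>+t. ennreal (K * t powr (- 1)) * indicator {1 / A<..<1} t \<partial>lborel) \<le> power_form \<alpha> \<sigma> 1 1 (Gaussian_density \<alpha> A) (Gaussian_density \<alpha> A)"
  proof (rule potential_form_ge_Gaussians[OF \<alpha>, where A = "\<lambda>_. A" and B = "\<lambda>_. A" and u = "\<lambda>_. N" and v = "\<lambda>_. N"])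
    fix t assume t: "1 / A < t" "t < 1"
    have t0: "t > 0" using t A by (meson divide_pos_pos less_trans zero_less_one)
    have tA: "1 \<le> t * A" using t A by (simp add: field_simps)
    have "A * 1 \<le> A * (t * A)" using tA A by (intro mult_left_mono) auto
    moreover have "t * 1 \<le> t * (A * A)" using A t0 mult_mono[of 1 A 1 A] by (intro mult_left_mono) auto
    ultimately have b: "t * (1 + A * A) + A + A \<le> 4 * A\<^sup>2 * t" by (simp add: power2_eq_square algebra_simps)
    have "0 < t * (1 + A * A) + A + A" using t0 A by (intro add_pos_pos mult_pos_pos) auto
    hence "(4 * A\<^sup>2 * t) powr (- \<alpha> - 1) \<le> (t * (1 + A * A) + A + A) powr (- \<alpha> - 1)" using b \<alpha> by (intro powr_mono2') auto
    hence "(N * N * t powr (\<sigma> - 1)) * (4 * A\<^sup>2 * t) powr (- \<alpha> - 1) \<le> (N * N * t powr (\<sigma> - 1)) * (t * (1 + A * A) + A + A) powr (- \<alpha> - 1)"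
      using N by (intro mult_left_mono) auto
    also have "(N * N * t powr (\<sigma> - 1)) * (4 * A\<^sup>2 * t) powr (- \<alpha> - 1) = K * t powr (- 1)"
    proof -
      have "(4 * A\<^sup>2 * t) powr (- \<alpha> - 1) = 4 powr (- \<alpha> - 1) * (A powr (- \<alpha> - 1) * A powr (- \<alpha> - 1)) * t powr (- \<alpha> - 1)"
        using A t0 by (simp add: powr_mult power2_eq_square)
      moreover have PQ: "A powr (\<alpha> + 1) * A powr (- \<alpha> - 1) = 1" using A by (simp add: powr_add[symmetric])
      moreover have tt: "t powr (\<sigma> - 1) * t powr (- \<alpha> - 1) = t powr (- 1)" by (simp only: powr_add[symmetric]) (simp add: \<sigma>)
      moreover have "(P / g) * (P / g) * s * (F * (Q * Q) * r) = F / g\<^sup>2 * ((P * Q) * (P * Q)) * (s * r)" for P Q g s r F :: real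
        by (simp add: power2_eq_square)
      ultimately show ?thesis unfolding N_def by (simp only: K_def PQ tt mult_1_right)
    qed
    finally show "K * t powr (- 1) \<le> N * N * t powr (\<sigma> - 1) * (t * (1 + A * A) + A + A) powr (- \<alpha> - 1)" .
  qed (use A N K G Gaussian_density[OF \<alpha> A(2)] in \<open>auto simp: less_imp_le Gaussian_density_def N_def\<close>)
  also have "\<dots> \<le> ennreal C"
    by (intro C(2) Gaussian_density(3)[OF \<alpha> A(2)])
  also have "(\<integral>\<^sup>+t. ennreal (K * t powr (- 1)) * indicator {1 / A<..<1} t \<partial>lborel) = ennreal K * ennreal (ln A)"
  proof -
    have "(\<integral>\<^sup>+t. ennreal (K * t powr (- 1)) * indicator {1 / A<..<1} t \<partial>lborel) = (\<integral>\<^sup>+t. ennreal K * (ennreal (t powr (- 1)) * indicator {1 / A<..<1} t) \<partial>lborel)"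
      by (intro nn_integral_cong) (simp only: ennreal_mult'[OF less_imp_le[OF K]] mult.assoc)
    also have "\<dots> = ennreal K * (\<integral>\<^sup>+t. (ennreal (t powr (- 1)) * indicator {1 / A<..<1} t) \<partial>lborel)" by (rule nn_integral_cmult) measurable
    finally show ?thesis using nn_integral_inverse_interval[of "1 / A"] A by (simp add: ln_div)
  qed
  finally have "ennreal (Gaussian_constant \<alpha> * (K * ln A)) \<le> ennreal C"
    using Gaussian_constant_pos[OF \<alpha>] K by (simp add: ennreal_mult')
  hence "c * (C / c + 1) \<le> C" using C(1) by (simp add: c_def K_def A_def mult.assoc)
  thus False using c by (simp add: distrib_left)
qed

lemma powr_le_const_exp:
  assumes v: "(v::real) \<ge> 0" and g: "0 \<le> p" "p \<le> g" "g > 0"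
  shows "(1 + v) powr p \<le> ((4 * g) powr g * exp 1) * exp v"
proof -
  have "(1 + v) powr p \<le> (1 + v) powr g" using v g by (intro powr_mono) auto
  also have "\<dots> \<le> (4 * g) powr g * exp ((1 + v) / 4)" using v g by (intro powr_le_exp) auto
  also have "\<dots> \<le> (4 * g) powr g * exp (1 + v)" using v by (intro mult_left_mono) auto
  finally show ?thesis by (simp add: exp_add mult.assoc)
qed

text \<open>The integrand is at most \<open>1\<close> near the origin and comparable with a power at infinity, where the tail contributes
  \<open>1/\<delta>\<close>.\<close>

lemma nn_integral_decay_density_le:
  assumes \<alpha>: "\<alpha> > -1" and \<delta>: "0 < \<delta>" "\<delta> \<le> 1"
  shows "(\<integral>\<^sup>+x. ennreal ((1 + x\<^sup>2) powr (- (\<alpha> + 1 + \<delta>))) \<partial>dunkl_measure \<alpha>) \<le> ennreal ((1 / (\<alpha> + 1) + 1) / \<delta>)"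
proof -
  let ?W = "\<lambda>x::real. (1 + x\<^sup>2) powr (- (\<alpha> + 1 + \<delta>))"
  have i1: "((\<lambda>x. x powr (2 * \<alpha> + 1)) has_integral (1 powr (2 * \<alpha> + 1 + 1) / (2 * \<alpha> + 1 + 1))) {0..1}"
    using has_integral_powr_from_0[of "2 * \<alpha> + 1" 1] \<alpha> by simp
  have i2: "((\<lambda>x. x powr (- 1 - 2 * \<delta>)) has_integral (1 powr (- (2 * \<delta>)) / (2 * \<delta>))) {1..}"
    using has_integral_powr_to_inf[of "- 1 - 2 * \<delta>" 1] \<delta> by simp
  have n1: "(\<integral>\<^sup>+x. ennreal (x powr (2 * \<alpha> + 1)) * indicator {0..1} x \<partial>lborel) = ennreal (1 / (2 * (\<alpha> + 1)))"
    using nn_integral_has_integral_lebesgue'[OF _ i1] by (simp add: algebra_simps)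
  have n2: "(\<integral>\<^sup>+x. ennreal (x powr (- 1 - 2 * \<delta>)) * indicator {1..} x \<partial>lborel) = ennreal (1 / (2 * \<delta>))"
    using nn_integral_has_integral_lebesgue'[OF _ i2] by simp
  have "(\<integral>\<^sup>+x. ennreal (?W x) * indicator {0<..} x \<partial>dunkl_measure \<alpha>) = (\<integral>\<^sup>+x. ennreal (\<bar>x\<bar> powr (2 * \<alpha> + 1)) * (ennreal (?W x) * indicator {0<..} x) \<partial>lborel)"
    by (rule nn_integral_dunkl_measure) measurable
  also have "\<dots> \<le> (\<integral>\<^sup>+x. ennreal (x powr (2 * \<alpha> + 1)) * indicator {0..1} x + ennreal (x powr (- 1 - 2 * \<delta>)) * indicator {1..} x \<partial>lborel)"
  proof (rule nn_integral_mono)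
    fix x :: real
    show "ennreal (\<bar>x\<bar> powr (2 * \<alpha> + 1)) * (ennreal (?W x) * indicator {0<..} x) \<le> ennreal (x powr (2 * \<alpha> + 1)) * indicator {0..1} x + ennreal (x powr (- 1 - 2 * \<delta>)) * indicator {1..} x"
    proof (cases "x > 0")
      case x: True
      show ?thesis
      proof (cases "x \<le> 1")
        case True
        have "?W x \<le> (1 + x\<^sup>2) powr 0" using \<alpha> \<delta> by (intro powr_mono) auto
        hence W1: "?W x \<le> 1" using zero_le_power2[of x] by (simp add: add_nonneg_eq_0_iff)
        have "x powr (2 * \<alpha> + 1) * ?W x \<le> x powr (2 * \<alpha> + 1) * 1" using W1 by (intro mult_left_mono) auto
        hence "ennreal (x powr (2 * \<alpha> + 1)) * ennreal (?W x) \<le> ennreal (x powr (2 * \<alpha> + 1))"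
          by (simp add: ennreal_mult'[symmetric] ennreal_leI)
        thus ?thesis using x True by (simp add: add_increasing2)
      next
        case False
        have "?W x \<le> (x\<^sup>2) powr (- (\<alpha> + 1 + \<delta>))" using \<alpha> \<delta> x by (intro powr_mono2') auto
        also have "(x\<^sup>2) powr (- (\<alpha> + 1 + \<delta>)) = x powr (2 * (- (\<alpha> + 1 + \<delta>)))" using x powr_powr[of x 2 "- (\<alpha> + 1 + \<delta>)"] by simp
        finally have "x powr (2 * \<alpha> + 1) * ?W x \<le> x powr (2 * \<alpha> + 1) * x powr (2 * (- (\<alpha> + 1 + \<delta>)))" by (intro mult_left_mono) auto
        also have "\<dots> = x powr (- 1 - 2 * \<delta>)" by (simp add: powr_add[symmetric] algebra_simps)
        finally have "ennreal (x powr (2 * \<alpha> + 1)) * ennreal (?W x) \<le> ennreal (x powr (- 1 - 2 * \<delta>))"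
          by (simp add: ennreal_mult'[symmetric] ennreal_leI)
        thus ?thesis using x False by simp
      qed
    qed simp
  qed
  also have "\<dots> = ennreal (1 / (2 * (\<alpha> + 1))) + ennreal (1 / (2 * \<delta>))" by (simp add: nn_integral_add n1 n2)
  also have "\<dots> = ennreal (1 / (2 * (\<alpha> + 1)) + 1 / (2 * \<delta>))" using \<alpha> \<delta> by (intro ennreal_plus[symmetric]) auto
  finally have half: "(\<integral>\<^sup>+x. ennreal (?W x) * indicator {0<..} x \<partial>dunkl_measure \<alpha>) \<le> ennreal (1 / (2 * (\<alpha> + 1)) + 1 / (2 * \<delta>))" .
  have "(\<integral>\<^sup>+x. ennreal (?W x) \<partial>dunkl_measure \<alpha>) = 2 * (\<integral>\<^sup>+x. ennreal (?W x) * indicator {0<..} x \<partial>dunkl_measure \<alpha>)"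
    by (rule nn_integral_dunkl_even) auto
  also have "\<dots> \<le> 2 * ennreal (1 / (2 * (\<alpha> + 1)) + 1 / (2 * \<delta>))" by (intro mult_left_mono half) simp
  also have "\<dots> = ennreal (2 * (1 / (2 * (\<alpha> + 1)) + 1 / (2 * \<delta>)))" using ennreal_mult'[of 2 "1 / (2 * (\<alpha> + 1)) + 1 / (2 * \<delta>)"] by simp
  also have "\<dots> \<le> ennreal ((1 / (\<alpha> + 1) + 1) / \<delta>)"
  proof (rule ennreal_leI)
    have "1 / (\<alpha> + 1) * \<delta> \<le> 1 / (\<alpha> + 1) * 1" using \<alpha> \<delta> by (intro mult_left_mono) auto
    hence "1 / (\<alpha> + 1) \<le> 1 / (\<alpha> + 1) / \<delta>" using \<delta> by (simp only: pos_le_divide_eq mult_1_right)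
    moreover have "2 * (1 / (2 * c) + 1 / (2 * d)) = 1 / c + 1 / d" for c d :: real by (simp add: distrib_left)
    note this[of "\<alpha> + 1" \<delta>]
    moreover have "(1 / (\<alpha> + 1) + 1) / \<delta> = 1 / (\<alpha> + 1) / \<delta> + 1 / \<delta>" by (simp add: add_divide_distrib)
    ultimately show "2 * (1 / (2 * (\<alpha> + 1)) + 1 / (2 * \<delta>)) \<le> (1 / (\<alpha> + 1) + 1) / \<delta>" by linarith
  qed
  finally show ?thesis .
qed

text \<open>Densities that barely decay spread over the whole line while the mass stays at most \<open>1\<close>. At time \<open>t\<close> the function
  \<open>W\<^sup>p\<close> is minorized by \<open>t\<^sup>\<gamma>\<^sup>p exp(-ty\<^sup>2)\<close>, the Gaussian whose width is the distance up to which the kernel does not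
  yet decay. The normalization contributes \<open>\<delta>\<^sup>a\<^sup>+\<^sup>b\<close> and the time integral \<open>1/\<delta>\<close>, so the form grows like \<open>\<delta>\<^sup>a\<^sup>+\<^sup>b\<^sup>-\<^sup>1\<close>
  as \<open>\<delta> \<rightarrow> 0\<close>.\<close>

lemma necessary_decay:
  assumes \<alpha>: "\<alpha> > -1" and \<sigma>: "\<sigma> > 0" and ab: "0 \<le> a" "a \<le> 1" "0 \<le> b" "b \<le> 1" and bd: "even_form_bounded \<alpha> \<sigma> a b"
  shows "(\<alpha> + 1) * (1 - a - b) < \<sigma>"
proof (rule ccontr)
  assume "\<not> ?thesis"
  hence neg: "(\<alpha> + 1) * (1 - a - b) \<ge> \<sigma>" by simp
  hence "(\<alpha> + 1) * (1 - a - b) > 0" using \<sigma> by linarith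
  hence \<epsilon>: "1 - a - b > 0" using \<alpha> by (simp add: zero_less_mult_iff)
  obtain C where C: "C \<ge> 0" "\<And>\<phi> \<psi>. even_density \<alpha> \<phi> \<Longrightarrow> even_density \<alpha> \<psi> \<Longrightarrow> power_form \<alpha> \<sigma> a b \<phi> \<psi> \<le> ennreal C"
    using bd unfolding even_form_bounded_def by blast
  define m where "m = 1 / (\<alpha> + 1) + 1"
  have m: "m > 0" using \<alpha> by (simp add: m_def add_pos_pos)
  define g where "g = \<alpha> + 2"
  have g: "g > 0" using \<alpha> by (simp add: g_def)
  define k where "k = 1 / ((4 * g) powr g * exp 1)"
  have k: "k > 0" using g by (simp add: k_def)
  define c where "c = Gaussian_constant \<alpha> * (k * k * 4 powr (- \<alpha> - 1) * (1 / m) powr (a + b))"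
  have c: "c > 0" using Gaussian_constant_pos[OF \<alpha>] k m by (simp add: c_def)
  obtain R where R: "R \<ge> 1" "c * R powr (1 - a - b) > C"
    using powr_unbounded[OF \<epsilon> c, of 1 C] by blast
  define \<delta> where "\<delta> = 1 / R"
  have \<delta>: "0 < \<delta>" "\<delta> \<le> 1" using R by (auto simp: \<delta>_def)
  define \<gamma> where "\<gamma> = \<alpha> + 1 + \<delta>"
  have \<gamma>: "0 \<le> \<gamma>" "\<gamma> \<le> g" using \<alpha> \<delta> by (auto simp: \<gamma>_def g_def)
  define W where "W x = (\<delta> / m) * (1 + x\<^sup>2) powr (- \<gamma>)" for x :: real
  have W0: "W x \<ge> 0" for x using \<delta> m by (simp add: W_def)
  have Wm [measurable]: "W \<in> borel_measurable borel" unfolding W_def by measurable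
  have Wi: "(\<integral>\<^sup>+x. ennreal (W x) \<partial>dunkl_measure \<alpha>) \<le> 1"
  proof -
    have "(\<integral>\<^sup>+x. ennreal (W x) \<partial>dunkl_measure \<alpha>) = ennreal (\<delta> / m) * (\<integral>\<^sup>+x. ennreal ((1 + x\<^sup>2) powr (- \<gamma>)) \<partial>dunkl_measure \<alpha>)"
    proof -
      have "ennreal (W x) = ennreal (\<delta> / m) * ennreal ((1 + x\<^sup>2) powr (- \<gamma>))" for x
        unfolding W_def by (rule ennreal_mult') (use \<delta> m in simp)
      thus ?thesis by (simp only:) (rule nn_integral_cmult, measurable)
    qed
    also have "\<dots> \<le> ennreal (\<delta> / m) * ennreal (m / \<delta>)"
      by (rule mult_left_mono[OF nn_integral_decay_density_le[OF \<alpha> \<delta>, folded \<gamma>_def m_def]]) simp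
    also have "\<dots> = 1" using \<delta> m by (simp add: ennreal_mult'[symmetric])
    finally show ?thesis .
  qed
  have minor: "((\<delta> / m) powr p * k * t powr (\<gamma> * p)) * exp (- t * y\<^sup>2) \<le> W y powr p"
    if t: "0 < t" "t < 1" and p: "0 \<le> p" "p \<le> 1" for t y p
  proof -
    have y1: "1 + y\<^sup>2 > 0" by (simp add: add_pos_nonneg)
    have "\<gamma> * p \<le> g" using \<gamma> p mult_mono[of \<gamma> g p 1] by simp
    moreover have "t * (1 + y\<^sup>2) \<le> 1 + t * y\<^sup>2" using t by (simp add: distrib_left)
    ultimately have "(t * (1 + y\<^sup>2)) powr (\<gamma> * p) \<le> (1 + t * y\<^sup>2) powr (\<gamma> * p)" using t \<gamma> p by (intro powr_mono2) auto
    also have "\<dots> \<le> ((4 * g) powr g * exp 1) * exp (t * y\<^sup>2)"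
      using t \<gamma> p g \<open>\<gamma> * p \<le> g\<close> by (intro powr_le_const_exp) auto
    finally have "t powr (\<gamma> * p) * (1 + y\<^sup>2) powr (\<gamma> * p) \<le> exp (t * y\<^sup>2) / k"
      using t y1 by (simp add: powr_mult k_def mult.commute)
    hence "k * t powr (\<gamma> * p) * exp (- t * y\<^sup>2) \<le> (1 + y\<^sup>2) powr (- (\<gamma> * p))"
      using k y1 by (simp add: powr_minus exp_minus field_simps)
    hence "(\<delta> / m) powr p * (k * t powr (\<gamma> * p) * exp (- t * y\<^sup>2)) \<le> (\<delta> / m) powr p * (1 + y\<^sup>2) powr (- (\<gamma> * p))" by (intro mult_left_mono) auto
    also have "(1 + y\<^sup>2) powr (- (\<gamma> * p)) = ((1 + y\<^sup>2) powr (- \<gamma>)) powr p" by (simp add: powr_powr)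
    also have "(\<delta> / m) powr p * ((1 + y\<^sup>2) powr (- \<gamma>)) powr p = W y powr p" unfolding W_def by (rule powr_mult[symmetric])
    finally show ?thesis by (simp add: mult.assoc)
  qed
  define h where "h t = (\<delta> / m) powr (a + b) * (k * k * 4 powr (- \<alpha> - 1)) * t powr (\<delta> - 1)" for t
  have "ennreal (Gaussian_constant \<alpha>) * (\<integral>\<^sup>+t. ennreal (h t) * indicator {0<..<1} t \<partial>lborel) \<le> power_form \<alpha> \<sigma> a b W W"
  proof (rule potential_form_ge_Gaussians[OF \<alpha>, where A = "\<lambda>t. t" and B = "\<lambda>t. t" and u = "\<lambda>t. (\<delta> / m) powr a * k * t powr (\<gamma> * a)" and v = "\<lambda>t. (\<delta> / m) powr b * k * t powr (\<gamma> * b)"])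
    show "h \<in> borel_measurable borel" unfolding h_def by measurable
    fix t :: real assume t: "0 < t" "t < 1"
    show "0 < t \<and> 0 < t \<and> 0 \<le> (\<delta> / m) powr a * k * t powr (\<gamma> * a) \<and> 0 \<le> (\<delta> / m) powr b * k * t powr (\<gamma> * b)" using t k by simp
    show "((\<delta> / m) powr a * k * t powr (\<gamma> * a)) * exp (- t * y\<^sup>2) \<le> W y powr a" for y using minor[OF t] ab by simp
    show "((\<delta> / m) powr b * k * t powr (\<gamma> * b)) * exp (- t * y\<^sup>2) \<le> W y powr b" for y using minor[OF t] ab by simp
    have "t * t * t \<le> t * 1 * 1" using t by (intro mult_mono) auto
    hence base: "t * (1 + t * t) + t + t \<le> 4 * t" by (simp add: algebra_simps)
    have "(4 * t) powr (- \<alpha> - 1) \<le> (t * (1 + t * t) + t + t) powr (- \<alpha> - 1)"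
    proof (rule powr_mono2')
      show "0 < t * (1 + t * t) + t + t" using t by (intro add_pos_pos mult_pos_pos) auto
    qed (use base \<alpha> in auto)
    moreover have "t powr (\<delta> - 1) \<le> t powr (\<gamma> * a) * t powr (\<gamma> * b) * t powr (\<sigma> - 1) * t powr (- \<alpha> - 1)"
    proof -
      have "\<delta> * (a + b) \<le> \<delta> * 1" using \<delta> \<epsilon> by (intro mult_left_mono) auto
      hence "\<gamma> * a + \<gamma> * b + (\<sigma> - 1) + (- \<alpha> - 1) \<le> \<delta> - 1" using neg by (simp add: \<gamma>_def algebra_simps)
      hence "t powr (\<delta> - 1) \<le> t powr (\<gamma> * a + \<gamma> * b + (\<sigma> - 1) + (- \<alpha> - 1))" using t by (intro powr_mono') auto
      thus ?thesis by (simp only: powr_add)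
    qed
    ultimately have "(t powr (\<delta> - 1)) * (4 powr (- \<alpha> - 1) * t powr (- \<alpha> - 1)) \<le> (t powr (\<gamma> * a) * t powr (\<gamma> * b) * t powr (\<sigma> - 1) * t powr (- \<alpha> - 1)) * (t * (1 + t * t) + t + t) powr (- \<alpha> - 1)"
      using t by (intro mult_mono) (auto simp: powr_mult)
    hence "t powr (- \<alpha> - 1) * (t powr (\<delta> - 1) * 4 powr (- \<alpha> - 1)) \<le> t powr (- \<alpha> - 1) * (t powr (\<gamma> * a) * t powr (\<gamma> * b) * t powr (\<sigma> - 1) * (t * (1 + t * t) + t + t) powr (- \<alpha> - 1))"
      by (simp add: mult_ac)
    hence "t powr (\<delta> - 1) * 4 powr (- \<alpha> - 1) \<le> t powr (\<gamma> * a) * t powr (\<gamma> * b) * t powr (\<sigma> - 1) * (t * (1 + t * t) + t + t) powr (- \<alpha> - 1)"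
      using t by simp
    hence "((\<delta> / m) powr (a + b) * (k * k)) * (t powr (\<delta> - 1) * 4 powr (- \<alpha> - 1)) \<le> ((\<delta> / m) powr (a + b) * (k * k)) * (t powr (\<gamma> * a) * t powr (\<gamma> * b) * t powr (\<sigma> - 1) * (t * (1 + t * t) + t + t) powr (- \<alpha> - 1))"
      using k by (intro mult_left_mono) auto
    thus "h t \<le> ((\<delta> / m) powr a * k * t powr (\<gamma> * a)) * ((\<delta> / m) powr b * k * t powr (\<gamma> * b)) * t powr (\<sigma> - 1) * (t * (1 + t * t) + t + t) powr (- \<alpha> - 1)"
      by (simp add: h_def powr_add mult_ac)
  qed (use k in \<open>auto simp: h_def\<close>)
  also have "\<dots> \<le> ennreal C" using W0 Wi by (intro C(2)) (auto simp: even_density_def W_def)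
  also have "(\<integral>\<^sup>+t. ennreal (h t) * indicator {0<..<1} t \<partial>lborel) = ennreal ((\<delta> / m) powr (a + b) * (k * k * 4 powr (- \<alpha> - 1))) * ennreal (1 / \<delta>)"
  proof -
    have "(\<integral>\<^sup>+t. ennreal (h t) * indicator {0<..<1} t \<partial>lborel) = (\<integral>\<^sup>+t. ennreal ((\<delta> / m) powr (a + b) * (k * k * 4 powr (- \<alpha> - 1))) * (ennreal (t powr (\<delta> - 1)) * indicator {0<..<1} t) \<partial>lborel)"
      using k by (intro nn_integral_cong) (simp add: h_def ennreal_mult'[symmetric] mult.assoc[symmetric])
    thus ?thesis using nn_integral_powr_interval[of 1 \<delta>] \<delta> by (simp add: nn_integral_cmult)
  qed
  finally have "ennreal (Gaussian_constant \<alpha>) * (ennreal ((\<delta> / m) powr (a + b) * (k * k * 4 powr (- \<alpha> - 1))) * ennreal (1 / \<delta>)) \<le> ennreal C" .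
  moreover have "0 \<le> (\<delta> / m) powr (a + b) * (k * k * 4 powr (- \<alpha> - 1))" using k by simp
  ultimately have "ennreal (Gaussian_constant \<alpha> * ((\<delta> / m) powr (a + b) * (k * k * 4 powr (- \<alpha> - 1)) * (1 / \<delta>))) \<le> ennreal C"
    by (simp only: ennreal_mult'[of "(\<delta> / m) powr (a + b) * (k * k * 4 powr (- \<alpha> - 1))"] ennreal_mult'[OF less_imp_le[OF Gaussian_constant_pos[OF \<alpha>]]])
  hence "Gaussian_constant \<alpha> * ((\<delta> / m) powr (a + b) * (k * k * 4 powr (- \<alpha> - 1)) * (1 / \<delta>)) \<le> C" using C(1) by simp
  moreover have "Gaussian_constant \<alpha> * ((\<delta> / m) powr (a + b) * (k * k * 4 powr (- \<alpha> - 1)) * (1 / \<delta>)) = c * R powr (1 - a - b)"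
  proof -
    have R0: "R > 0" using R by simp
    have "(\<delta> / m) powr (a + b) = (1 / m) powr (a + b) * R powr (- (a + b))"
    proof -
      have "\<delta> / m = (1 / m) * (1 / R)" by (simp add: \<delta>_def)
      hence "(\<delta> / m) powr (a + b) = (1 / m) powr (a + b) * (1 / R) powr (a + b)" by (simp only: powr_mult)
      also have "(1 / R) powr (a + b) = R powr (- (a + b))" using R0 powr_minus_divide[of R "a + b"] by (simp add: powr_divide)
      finally show ?thesis .
    qed
    moreover have "1 / \<delta> = R powr 1" using R0 by (simp add: \<delta>_def)
    moreover have "R powr (- (a + b)) * R powr 1 = R powr (1 - a - b)"
    proof -
      have "1 - a - b = - (a + b) + 1" by simp
      thus ?thesis by (simp only: powr_add)
    qed
    ultimately show ?thesis by (simp add: c_def mult_ac del: powr_one)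
  qed
  ultimately show False using R by linarith
qed

text \<open>The density \<open>F\<close>, a power \<open>2(\<delta>-\<alpha>-1)\<close> of \<open>\<bar>y\<bar>\<close> times a Gaussian, is almost nonintegrable at the origin. The
  potential of \<open>F\<^sup>a\<close> at the origin is of the order of \<open>\<Gamma>(\<delta>)\<^sup>-\<^sup>a \<integral> t\<^sup>\<delta>\<^sup>a\<^sup>-\<^sup>1 dt\<close>, that is \<open>\<delta>\<^sup>a\<^sup>-\<^sup>1\<close>, which is unbounded as
  \<open>\<delta> \<rightarrow> 0\<close>. The dual density is a Gaussian concentrated at the origin.\<close>

lemma necessary_endpoint:
  assumes \<alpha>: "\<alpha> > -1" and a: "0 < a" "a < 1" and \<sigma>: "\<sigma> = (\<alpha> + 1) * a"
  shows "\<not> even_form_bounded \<alpha> \<sigma> a 1"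
proof
  assume bd: "even_form_bounded \<alpha> \<sigma> a 1"
  obtain C where C: "C \<ge> 0" "\<And>\<phi> \<psi>. even_density \<alpha> \<phi> \<Longrightarrow> even_density \<alpha> \<psi> \<Longrightarrow> power_form \<alpha> \<sigma> a 1 \<phi> \<psi> \<le> ennreal C"
    using bd unfolding even_form_bounded_def by blast
  have G: "Gamma (\<alpha> + 1) > 0" using \<alpha> by simp
  obtain G1 :: real where G1: "G1 > 0" "\<And>\<delta>. 0 < \<delta> \<Longrightarrow> \<delta> \<le> 1 \<Longrightarrow> Gamma (1 + \<delta>) \<le> G1"
  proof -
    have "continuous_on {1..2::real} Gamma" by (intro continuous_on_Gamma) (auto elim!: nonpos_Ints_cases)
    hence "bounded (Gamma ` {1..2::real})" by (intro compact_imp_bounded compact_continuous_image) auto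
    then obtain B where B: "B > 0" "\<And>x. x \<in> {1..2::real} \<Longrightarrow> norm (Gamma x) \<le> B" unfolding bounded_pos by auto
    show ?thesis by (rule that[of B]) (use B in \<open>force simp: abs_le_iff\<close>)+
  qed
  define g where "g = \<alpha> + 2"
  have g: "g > 0" using \<alpha> by (simp add: g_def)
  define k where "k = 1 / ((4 * g) powr g * exp 1)"
  have k: "k > 0" using g by (simp add: k_def)
  define c where "c = Gaussian_constant \<alpha> * ((1 / G1) powr a * k * 6 powr (- \<alpha> - 1) / Gamma (\<alpha> + 1) / (2 * a))"
  have c: "c > 0" using Gaussian_constant_pos[OF \<alpha>] k G G1 a by (simp add: c_def)
  have \<epsilon>: "1 - a > 0" using a by simp
  obtain R where R: "R \<ge> 1 / (\<alpha> + 1)" "R \<ge> 1" "c * R powr (1 - a) > C"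
    using powr_unbounded[OF \<epsilon> c, of "1 / (\<alpha> + 1)" C] by blast
  define \<delta> where "\<delta> = 1 / R"
  have \<delta>: "0 < \<delta>" "\<delta> \<le> 1" "\<delta> \<le> \<alpha> + 1" using R \<alpha> by (auto simp: \<delta>_def field_simps)
  define \<gamma> where "\<gamma> = (\<alpha> + 1 - \<delta>) * a"
  have \<gamma>: "0 \<le> \<gamma>" "\<gamma> \<le> g" using \<alpha> \<delta> a mult_mono[of "\<alpha> + 1 - \<delta>" g a 1] by (auto simp: \<gamma>_def g_def)
  define M where "M = Gamma \<delta>"
  have M: "M > 0" using \<delta> by (simp add: M_def)
  have M1: "M \<le> G1 / \<delta>"
    using Gamma_shift[OF \<delta>(1), of 1] G1(2)[OF \<delta>(1,2)] \<delta> by (simp add: M_def field_simps)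
  \<comment> \<open>The time integral is restricted to \<open>t > 1/B\<close>, where the dual Gaussian acts like a point mass. This choice
    makes \<open>(1/B)\<^sup>\<delta>\<^sup>a = 1/2\<close>, so half of the integral is retained.\<close>
  define B where "B = 2 powr (1 / (\<delta> * a))"
  have B: "B \<ge> 1" using \<delta> a by (auto simp: B_def intro!: ge_one_powr_ge_zero)
  hence B0: "B > 0" by simp
  define F where "F y = (1 / M) * (\<bar>y\<bar> powr (2 * (\<delta> - (\<alpha> + 1))) * exp (- 1 * y\<^sup>2))" for y :: real
  have Fm [measurable]: "F \<in> borel_measurable borel" unfolding F_def by measurable
  have F0: "F y \<ge> 0" for y using M by (simp add: F_def)
  have Fi: "(\<integral>\<^sup>+x. ennreal (F x) \<partial>dunkl_measure \<alpha>) \<le> 1"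
  proof -
    have "(\<integral>\<^sup>+x. ennreal (F x) \<partial>dunkl_measure \<alpha>) = (\<integral>\<^sup>+x. ennreal (1 / M) * ennreal (\<bar>x\<bar> powr (2 * (\<delta> - (\<alpha> + 1))) * exp (- 1 * x\<^sup>2)) \<partial>dunkl_measure \<alpha>)"
      unfolding F_def using M by (intro nn_integral_cong ennreal_mult') auto
    also have "\<dots> = ennreal (1 / M) * ennreal (Gamma (\<delta> - (\<alpha> + 1) + \<alpha> + 1) / 1 powr (\<delta> - (\<alpha> + 1) + \<alpha> + 1))"
      using nn_integral_dunkl_Gaussian_moment[OF \<alpha>, of 1 "\<delta> - (\<alpha> + 1)"] \<delta> by (subst nn_integral_cmult) auto
    also have "\<dots> = ennreal (1 / M) * ennreal M" by (simp add: M_def)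
    also have "\<dots> = 1" using M by (simp add: ennreal_mult'[symmetric])
    finally show ?thesis by simp
  qed
  have minor: "((1 / M) powr a * k * t powr (- \<gamma>)) * exp (- (2 / t) * y\<^sup>2) \<le> F y powr a"
    if t: "1 / B < t" "t < 1" and y: "y \<noteq> 0" for t y
  proof -
    have t0: "t > 0" using t B0 by (meson divide_pos_pos less_trans zero_less_one)
    \<comment> \<open>In the variable \<open>v = y\<^sup>2/t\<close> both factors of \<open>F\<^sup>a\<close> are at least a multiple of \<open>exp(-v)\<close>.\<close>
    define v where "v = y\<^sup>2 / t"
    have v: "v > 0" using t0 y by (simp add: v_def)
    have "v powr \<gamma> \<le> (1 + v) powr \<gamma>" using v \<gamma> by (intro powr_mono2) auto
    also have "\<dots> \<le> ((4 * g) powr g * exp 1) * exp v" using v \<gamma> g by (intro powr_le_const_exp) auto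
    finally have "v powr \<gamma> \<le> exp v / k" by (simp add: k_def mult.commute)
    hence 1: "k * exp (- v) \<le> v powr (- \<gamma>)" using k v by (simp add: powr_minus exp_minus field_simps)
    have "y\<^sup>2 \<le> v" using t t0 by (simp add: v_def field_simps mult_left_le_one_le)
    moreover have "a * y\<^sup>2 \<le> 1 * y\<^sup>2" using a by (intro mult_right_mono) auto
    ultimately have "exp (- v) \<le> exp (- (a * y\<^sup>2))" by simp
    hence "(k * exp (- v)) * exp (- v) \<le> v powr (- \<gamma>) * exp (- (a * y\<^sup>2))" using 1 by (intro mult_mono) auto
    hence "((1 / M) powr a * t powr (- \<gamma>)) * ((k * exp (- v)) * exp (- v)) \<le> ((1 / M) powr a * t powr (- \<gamma>)) * (v powr (- \<gamma>) * exp (- (a * y\<^sup>2)))"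
      by (intro mult_left_mono) auto
    moreover have "exp (- v) * exp (- v) = exp (- (2 / t) * y\<^sup>2)" by (simp add: exp_add[symmetric] v_def)
    moreover have "F y powr a = (1 / M) powr a * ((t powr (- \<gamma>) * v powr (- \<gamma>)) * exp (- (a * y\<^sup>2)))"
    proof -
      have "(\<bar>y\<bar> powr (2 * (\<delta> - (\<alpha> + 1)))) powr a = \<bar>y\<bar> powr (2 * (- \<gamma>))" by (simp add: powr_powr \<gamma>_def algebra_simps)
      also have "\<dots> = (\<bar>y\<bar> powr 2) powr (- \<gamma>)" by (simp only: powr_powr)
      also have "\<bar>y\<bar> powr 2 = t * v" using t0 y by (simp add: v_def)
      also have "(t * v) powr (- \<gamma>) = t powr (- \<gamma>) * v powr (- \<gamma>)" using t0 v by (intro powr_mult)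
      finally have "(\<bar>y\<bar> powr (2 * (\<delta> - (\<alpha> + 1)))) powr a = t powr (- \<gamma>) * v powr (- \<gamma>)" .
      moreover have "exp (- 1 * y\<^sup>2) powr a = exp (- (a * y\<^sup>2))" by (simp add: exp_powr_real mult.commute)
      moreover have "F y powr a = (1 / M) powr a * ((\<bar>y\<bar> powr (2 * (\<delta> - (\<alpha> + 1)))) powr a * exp (- 1 * y\<^sup>2) powr a)"
        unfolding F_def by (simp only: powr_mult)
      ultimately show ?thesis by (simp only:)
    qed
    ultimately show ?thesis by (simp add: mult_ac)
  qed
  define N where "N = B powr (\<alpha> + 1) / Gamma (\<alpha> + 1)"
  have N: "N > 0" using B0 G by (simp add: N_def)
  define K where "K = (1 / M) powr a * k * (6 powr (- \<alpha> - 1) / Gamma (\<alpha> + 1))"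
  have K: "K > 0" using k G M by (simp add: K_def)
  define h where "h t = K * t powr (\<delta> * a - 1)" for t
  have "ennreal (Gaussian_constant \<alpha>) * (\<integral>\<^sup>+t. ennreal (h t) * indicator {1 / B<..<1} t \<partial>lborel) \<le> power_form \<alpha> \<sigma> a 1 F (Gaussian_density \<alpha> B)"
  proof (rule potential_form_ge_Gaussians[OF \<alpha>, where A = "\<lambda>t. 2 / t" and B = "\<lambda>_. B" and u = "\<lambda>t. (1 / M) powr a * k * t powr (- \<gamma>)" and v = "\<lambda>_. N"])
    show "h \<in> borel_measurable borel" unfolding h_def by measurable
    show "(\<lambda>x. Gaussian_density \<alpha> B x powr 1) \<in> borel_measurable borel" using Gaussian_density(1)[OF \<alpha> B0] by measurable
    fix t :: real assume t: "1 / B < t" "t < 1"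
    have t0: "t > 0" using t B0 by (meson divide_pos_pos less_trans zero_less_one)
    show "0 < 2 / t \<and> 0 < B \<and> 0 \<le> (1 / M) powr a * k * t powr (- \<gamma>) \<and> 0 \<le> N" using t0 B0 k N by (simp add: less_imp_le)
    show "((1 / M) powr a * k * t powr (- \<gamma>)) * exp (- (2 / t) * y\<^sup>2) \<le> F y powr a" if "y \<noteq> 0" for y using minor[OF t that] .
    show "N * exp (- B * x\<^sup>2) \<le> Gaussian_density \<alpha> B x powr 1" for x
      using G B0 by (simp add: Gaussian_density_def N_def)
    have "1 / t \<le> B" using t t0 B0 by (simp add: field_simps)
    hence "t * (1 + 2 / t * B) + 2 / t + B \<le> 6 * B" using t t0 B by (simp add: distrib_left)
    hence base: "(6 * B) powr (- \<alpha> - 1) \<le> (t * (1 + 2 / t * B) + 2 / t + B) powr (- \<alpha> - 1)"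
      using t0 B0 \<alpha> by (intro powr_mono2') (auto intro!: add_pos_pos mult_pos_pos)
    have NB: "N * (6 * B) powr (- \<alpha> - 1) = 6 powr (- \<alpha> - 1) / Gamma (\<alpha> + 1)"
    proof -
      have "B powr (\<alpha> + 1) * B powr (- \<alpha> - 1) = 1" using B0 by (simp add: powr_add[symmetric])
      thus ?thesis using B0 by (simp add: N_def powr_mult mult_ac)
    qed
    have tt: "t powr (- \<gamma>) * t powr (\<sigma> - 1) = t powr (\<delta> * a - 1)" by (simp add: powr_add[symmetric] \<gamma>_def \<sigma> algebra_simps)
    have "h t = (1 / M) powr a * k * (t powr (- \<gamma>) * t powr (\<sigma> - 1)) * (N * (6 * B) powr (- \<alpha> - 1))"
      unfolding tt NB by (simp add: h_def K_def mult_ac)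
    also have "\<dots> \<le> (1 / M) powr a * k * (t powr (- \<gamma>) * t powr (\<sigma> - 1)) * (N * (t * (1 + 2 / t * B) + 2 / t + B) powr (- \<alpha> - 1))"
      using base N k by (intro mult_left_mono) auto
    finally show "h t \<le> ((1 / M) powr a * k * t powr (- \<gamma>)) * N * t powr (\<sigma> - 1) * (t * (1 + 2 / t * B) + 2 / t + B) powr (- \<alpha> - 1)"
      by (simp add: mult_ac)
  qed (use B B0 K in \<open>auto simp: h_def\<close>)
  also have "\<dots> \<le> ennreal C" using F0 Fi Gaussian_density(3)[OF \<alpha> B0] by (intro C(2)) (auto simp: even_density_def F_def)
  finally have le: "ennreal (Gaussian_constant \<alpha>) * (\<integral>\<^sup>+t. ennreal (h t) * indicator {1 / B<..<1} t \<partial>lborel) \<le> ennreal C" .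
  have "(1 / B) powr (\<delta> * a) = 1 / 2" using \<delta> a by (simp add: B_def powr_divide powr_powr)
  hence "ennreal (1 / (2 * (\<delta> * a))) \<le> (\<integral>\<^sup>+t. ennreal (t powr (\<delta> * a - 1)) * indicator {1 / B<..<1} t \<partial>lborel)"
  proof -
    assume h: "(1 / B) powr (\<delta> * a) = 1 / 2"
    have "ennreal ((1 - (1 / B) powr (\<delta> * a)) / (\<delta> * a)) \<le> (\<integral>\<^sup>+t. ennreal (t powr (\<delta> * a - 1)) * indicator {1 / B<..<1} t \<partial>lborel)"
      using B \<delta> a by (intro nn_integral_powr_interval_ge) auto
    moreover have "(1 - 1 / 2) / (\<delta> * a) = 1 / (2 * (\<delta> * a))" by simp
    ultimately show ?thesis by (simp only: h)
  qed
  hence "ennreal K * ennreal (1 / (2 * (\<delta> * a))) \<le> ennreal K * (\<integral>\<^sup>+t. ennreal (t powr (\<delta> * a - 1)) * indicator {1 / B<..<1} t \<partial>lborel)"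
    by (rule mult_left_mono) simp
  also have "\<dots> = (\<integral>\<^sup>+t. ennreal K * (ennreal (t powr (\<delta> * a - 1)) * indicator {1 / B<..<1} t) \<partial>lborel)"
    by (rule nn_integral_cmult[symmetric]) measurable
  also have "\<dots> = (\<integral>\<^sup>+t. ennreal (h t) * indicator {1 / B<..<1} t \<partial>lborel)"
    by (intro nn_integral_cong) (simp only: h_def ennreal_mult'[OF less_imp_le[OF K]] mult.assoc)
  finally have "ennreal (Gaussian_constant \<alpha>) * (ennreal K * ennreal (1 / (2 * (\<delta> * a)))) \<le> ennreal (Gaussian_constant \<alpha>) * (\<integral>\<^sup>+t. ennreal (h t) * indicator {1 / B<..<1} t \<partial>lborel)"
    by (rule mult_left_mono) simp
  hence "ennreal (Gaussian_constant \<alpha>) * (ennreal K * ennreal (1 / (2 * (\<delta> * a)))) \<le> ennreal C" using le by (rule order.trans)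
  hence "ennreal (Gaussian_constant \<alpha> * (K * (1 / (2 * (\<delta> * a))))) \<le> ennreal C"
    by (simp only: ennreal_mult'[OF less_imp_le[OF K]] ennreal_mult'[OF less_imp_le[OF Gaussian_constant_pos[OF \<alpha>]]])
  hence le2: "Gaussian_constant \<alpha> * (K * (1 / (2 * (\<delta> * a)))) \<le> C" using C(1) by simp
  have "c * R powr (1 - a) \<le> Gaussian_constant \<alpha> * (K * (1 / (2 * (\<delta> * a))))"
  proof -
    have R0: "R > 0" using R by simp
    have "\<delta> / G1 \<le> 1 / M" using M1 M G1 \<delta> by (simp add: field_simps)
    hence "(\<delta> / G1) powr a \<le> (1 / M) powr a" using \<delta> G1 a by (intro powr_mono2) auto
    hence "(\<delta> / G1) powr a * k * (6 powr (- \<alpha> - 1) / Gamma (\<alpha> + 1)) * (1 / (2 * (\<delta> * a))) \<le> K * (1 / (2 * (\<delta> * a)))"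
      unfolding K_def using k G \<delta> a by (intro mult_right_mono) auto
    moreover have "(\<delta> / G1) powr a * (1 / \<delta>) = (1 / G1) powr a * R powr (1 - a)"
      using R0 G1 by (simp add: \<delta>_def powr_divide powr_mult powr_diff field_simps)
    hence "(\<delta> / G1) powr a * k * (6 powr (- \<alpha> - 1) / Gamma (\<alpha> + 1)) * (1 / (2 * (\<delta> * a))) = (1 / G1) powr a * k * 6 powr (- \<alpha> - 1) / Gamma (\<alpha> + 1) / (2 * a) * R powr (1 - a)"
    proof -
      assume e: "(\<delta> / G1) powr a * (1 / \<delta>) = (1 / G1) powr a * R powr (1 - a)"
      have "(\<delta> / G1) powr a * k * (6 powr (- \<alpha> - 1) / Gamma (\<alpha> + 1)) * (1 / (2 * (\<delta> * a))) = ((\<delta> / G1) powr a * (1 / \<delta>)) * (k * (6 powr (- \<alpha> - 1) / Gamma (\<alpha> + 1)) * (1 / (2 * a)))" by (simp add: mult_ac)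
      also have "\<dots> = ((1 / G1) powr a * R powr (1 - a)) * (k * (6 powr (- \<alpha> - 1) / Gamma (\<alpha> + 1)) * (1 / (2 * a)))" by (simp only: e)
      finally show ?thesis by (simp add: mult_ac)
    qed
    ultimately have "(1 / G1) powr a * k * 6 powr (- \<alpha> - 1) / Gamma (\<alpha> + 1) / (2 * a) * R powr (1 - a) \<le> K * (1 / (2 * (\<delta> * a)))" by simp
    thus ?thesis unfolding c_def mult.assoc[of "Gaussian_constant \<alpha>"] using Gaussian_constant_pos[OF \<alpha>] by (intro mult_left_mono) auto
  qed
  with le2 R show False by linarith
qed

text \<open>Along the diagonal at distance \<open>R\<close> and at times of order \<open>R\<^sup>-\<^sup>2\<close> both exponents in \<open>laguerre_kernel_exponent\<close> are bounded,
  while \<open>xy / sinh(2t)\<close> is of order \<open>R\<^sup>4\<close>. The power of the Bessel factor then gives \<open>R\<^sup>-\<^sup>2\<^sup>\<alpha>\<close>. In the constants,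
  \<open>18 \<ge> R\<^sup>2 sinh(2t)\<close>, and \<open>13 = 1 + 12\<close> bounds the two exponents.\<close>

lemma laguerre_kernel_ge_small_order:
  assumes \<alpha>: "\<alpha> > -1" "\<alpha> < -1/2"
  obtains c where "c > 0" "\<And>R t x y. R \<ge> 5 \<Longrightarrow> 1 / (2 * R\<^sup>2) \<le> t \<Longrightarrow> t \<le> 1 / R\<^sup>2 \<Longrightarrow> R \<le> x \<Longrightarrow> x \<le> R + 1 / R \<Longrightarrow> R \<le> y \<Longrightarrow> y \<le> R + 1 / R
     \<Longrightarrow> laguerre_kernel \<alpha> t x y \<ge> c * R powr (- 2 * \<alpha>)"
proof -
  obtain c0 where c0: "c0 > 0" "\<And>u. u \<ge> 1 \<Longrightarrow> bessel_even \<alpha> u \<ge> c0 * (1 + u) powr (-\<alpha> - 1/2) * exp u"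
    using bessel_even_ge_powr_exp[OF \<alpha>] by blast
  define e where "e = - \<alpha> - 1/2"
  have e: "e > 0" using \<alpha> by (simp add: e_def)
  define c where "c = c0 * exp (- 13) * 18 powr (- 1/2)"
  have main: "laguerre_kernel \<alpha> t x y \<ge> c * R powr (- 2 * \<alpha>)"
    if R: "R \<ge> 5" and t: "1 / (2 * R\<^sup>2) \<le> t" "t \<le> 1 / R\<^sup>2" and x: "R \<le> x" "x \<le> R + 1 / R" and y: "R \<le> y" "y \<le> R + 1 / R" for R t x y :: real
  proof -
    have R2: "R\<^sup>2 \<ge> 25" using R power_mono[of 5 R 2] by simp
    have R0: "R > 0" using R by simp
    have t0: "t > 0" using t R0 by (meson divide_pos_pos less_le_trans mult_pos_pos zero_less_numeral zero_less_one zero_less_power)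
    have tR: "t * R\<^sup>2 \<le> 1" "t * R\<^sup>2 \<ge> 1/2" using t R0 by (simp_all add: pos_le_divide_eq pos_divide_le_eq)
    have t1: "t \<le> 1" using tR R2 mult_left_mono[of 1 "R\<^sup>2" t] t0 by linarith
    define s where "s = sinh (2 * t)"
    have st: "s \<ge> t" using sinh_double_ge(2)[OF t0] by (simp add: s_def)
    hence s0: "s > 0" using t0 by linarith
    have e1: "exp (1::real) \<le> 3" by (rule exp_le)
    have "exp (2::real) = exp 1 * exp 1" by (simp add: exp_add[symmetric])
    hence e2: "exp (2::real) \<le> 9" using mult_mono[OF e1 e1] by simp
    have "s \<le> 2 * t * exp (2 * t)" using sinh_le_exp[of "2 * t"] t0 by (simp add: s_def)
    also have "\<dots> \<le> 2 * t * 9" using t0 t1 e2 order.trans[of "exp (2 * t)" "exp 2" 9] by (intro mult_left_mono) auto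
    finally have s18: "s * R\<^sup>2 \<le> 18" using tR R2 mult_right_mono[of s "18 * t" "R\<^sup>2"] by (simp add: mult.assoc)
    have xy: "x * y \<ge> R\<^sup>2" using x y R0 by (simp add: power2_eq_square mult_mono)
    define u where "u = x * y / s"
    have uR: "u \<ge> R\<^sup>2 / s" using xy s0 by (simp add: u_def divide_right_mono)
    have "R\<^sup>2 / s \<ge> 1"
    proof -
      have "s * 25 \<le> s * R\<^sup>2" using s0 R2 by (intro mult_left_mono) auto
      hence "s \<le> R\<^sup>2" using s18 R2 by linarith
      thus ?thesis using s0 by simp
    qed
    hence u1: "u \<ge> 1" using uR by linarith
    have "1 / R \<le> 1" using R by simp
    hence xR: "x \<le> 2 * R" "y \<le> 2 * R" using x y R by linarith+
    have absxy: "\<bar>x * y\<bar> = x * y" "\<bar>x\<bar> = x" "\<bar>y\<bar> = y" using x y R0 by auto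
    have ex: "- (1 / 2) * (cosh (2 * t) / s) * (x\<^sup>2 + y\<^sup>2) + u \<ge> - 13"
    proof -
      have "\<bar>x - y\<bar> \<le> 1 / R" using x y by auto
      hence "(x - y)\<^sup>2 \<le> (1 / R)\<^sup>2" using power_mono[of "\<bar>x - y\<bar>" "1 / R" 2] by simp
      also have "(1 / R)\<^sup>2 \<le> 2 * s"
      proof -
        have "t * R\<^sup>2 \<le> s * R\<^sup>2" using st by (rule mult_right_mono) simp
        hence "1 \<le> 2 * s * R\<^sup>2" using tR by linarith
        thus ?thesis using R0 by (simp add: power_divide pos_divide_le_eq)
      qed
      finally have 1: "(x - y)\<^sup>2 / (2 * s) \<le> 1" using s0 by simp
      have "tanh t \<le> 3 * t"
      proof -
        have "tanh t \<le> sinh t" using t0 cosh_real_ge_1[of t] by (simp add: tanh_def divide_le_eq mult_le_cancel_left1)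
        also have "\<dots> \<le> t * exp t" using t0 by (intro sinh_le_exp) simp
        also have "\<dots> \<le> t * 3" using t0 t1 e1 order.trans[of "exp t" "exp 1" 3] by (intro mult_left_mono) auto
        finally show ?thesis by simp
      qed
      moreover have "x\<^sup>2 + y\<^sup>2 \<le> 8 * R\<^sup>2" using power_mono[OF xR(1), of 2] power_mono[OF xR(2), of 2] x y R0 by (simp add: power_mult_distrib)
      ultimately have "tanh t / 2 * (x\<^sup>2 + y\<^sup>2) \<le> (3 * t) / 2 * (8 * R\<^sup>2)" using t0 by (intro mult_mono divide_right_mono) auto
      also have "\<dots> \<le> 12" using tR by simp
      finally have 2: "tanh t / 2 * (x\<^sup>2 + y\<^sup>2) \<le> 12" .
      have "- (1 / 2) * (cosh (2 * t) / s) * (x\<^sup>2 + y\<^sup>2) + u = - (x - y)\<^sup>2 / (2 * s) - tanh t / 2 * (x\<^sup>2 + y\<^sup>2)"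
        using laguerre_kernel_exponent[OF t0, of x y] unfolding absxy s_def u_def .
      thus ?thesis using 1 2 by simp
    qed
    have "c * R powr (- 2 * \<alpha>) \<le> c0 * (s powr (- \<alpha> - 1) * ((R\<^sup>2 / s) powr e)) * exp (- 13)"
    proof -
      have eS: "s powr (- \<alpha> - 1) * ((R\<^sup>2 / s) powr e) = R powr (2 * e) * s powr (- 1/2)"
      proof -
        have "(R\<^sup>2 / s) powr e = R powr (2 * e) * s powr (- e)" 
        proof -
          have "(R\<^sup>2 / s) powr e = (R\<^sup>2) powr e / s powr e" using s0 by (simp add: powr_divide)
          thus ?thesis using R0 powr_powr[of R 2 e] by (simp add: powr_minus_divide)
        qed
        moreover have "s powr (- \<alpha> - 1) * s powr (- e) = s powr (- 1/2)" by (simp add: powr_add[symmetric] e_def)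
        ultimately show ?thesis by (simp add: mult_ac)
      qed
      have "18 powr (- 1/2) * R \<le> s powr (- 1/2)"
      proof -
        have "s \<le> 18 / R\<^sup>2" using s18 R0 by (simp add: field_simps)
        hence "(18 / R\<^sup>2) powr (- 1/2) \<le> s powr (- 1/2)" using s0 by (intro powr_mono2') auto
        moreover have "(18 / R\<^sup>2) powr (- 1/2) = 18 powr (- 1/2) * R"
        proof -
          have "(R\<^sup>2) powr (- 1/2) = 1 / R" using R0 powr_powr[of R 2 "- 1/2"] by (simp add: powr_minus_divide)
          thus ?thesis using R0 by (simp add: powr_divide)
        qed
        ultimately show ?thesis by simp
      qed
      hence le: "R powr (2 * e) * (18 powr (- 1/2) * R) \<le> R powr (2 * e) * s powr (- 1/2)" by (rule mult_left_mono) simp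
      have eR: "R powr (2 * e) * R = R powr (- 2 * \<alpha>)" using R0 powr_add[of R "2 * e" 1] by (simp add: e_def)
      have "18 powr (- 1/2) * R powr (- 2 * \<alpha>) = R powr (2 * e) * (18 powr (- 1/2) * R)" unfolding eR[symmetric] by (simp only: mult.left_commute)
      also note le
      also note eS[symmetric]
      finally have "18 powr (- 1/2) * R powr (- 2 * \<alpha>) \<le> s powr (- \<alpha> - 1) * ((R\<^sup>2 / s) powr e)" .
      hence "(c0 * exp (- 13)) * (18 powr (- 1/2) * R powr (- 2 * \<alpha>)) \<le> (c0 * exp (- 13)) * (s powr (- \<alpha> - 1) * ((R\<^sup>2 / s) powr e))"
        using c0 by (intro mult_left_mono) auto
      thus ?thesis by (simp add: c_def mult_ac)
    qed
    also have "\<dots> \<le> c0 * (s powr (- \<alpha> - 1) * (1 + u) powr e) * exp (- (1 / 2) * (cosh (2 * t) / s) * (x\<^sup>2 + y\<^sup>2) + u)"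
      using c0 uR ex e s0 u1 by (intro mult_mono mult_left_mono powr_mono2) auto
    also have "\<dots> = s powr (- \<alpha> - 1) * exp (- (1 / 2) * (cosh (2 * t) / s) * (x\<^sup>2 + y\<^sup>2)) * (c0 * (1 + u) powr e * exp u)"
      by (simp only: exp_add mult_ac)
    also have "\<dots> \<le> s powr (- \<alpha> - 1) * exp (- (1 / 2) * (cosh (2 * t) / s) * (x\<^sup>2 + y\<^sup>2)) * bessel_even \<alpha> u"
      using c0(2)[OF u1] by (intro mult_left_mono) (auto simp: e_def)
    also have "\<dots> = laguerre_kernel \<alpha> t x y" by (simp add: laguerre_kernel_def s_def u_def)
    finally show ?thesis .
  qed
  have "c > 0" using c0 by (simp add: c_def)
  thus ?thesis by (rule that[OF _ main])
qed

text \<open>The set \<open>R \<le> \<bar>x\<bar> \<le> R + 1/R\<close> has measure of order \<open>R\<^sup>2\<^sup>\<alpha>\<close>, which tends to \<open>0\<close> although the set moves to infinity. At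
  times of order \<open>R\<^sup>-\<^sup>2\<close> the kernel is of order \<open>R\<^sup>-\<^sup>2\<^sup>\<alpha>\<close> on it, so the form of the normalized indicators grows like
  \<open>R\<close> to the power \<open>2((a+b-1)(-\<alpha>) - \<sigma>)\<close>.\<close>

lemma necessary_small_order:
  assumes \<alpha>: "\<alpha> > -1" "\<alpha> < -1/2" and ab: "0 \<le> a" "0 \<le> b" and bd: "even_form_bounded \<alpha> \<sigma> a b"
  shows "(a + b - 1) * (- \<alpha>) \<le> \<sigma>"
proof (rule ccontr)
  assume "\<not> ?thesis"
  hence "(a + b - 1) * (- \<alpha>) - \<sigma> > 0" by (simp only: not_le diff_gt_0_iff_gt)
  hence \<epsilon>: "2 * ((a + b - 1) * (- \<alpha>) - \<sigma>) > 0" by (rule mult_pos_pos[OF zero_less_numeral])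
  obtain C where C: "C \<ge> 0" "\<And>\<phi> \<psi>. even_density \<alpha> \<phi> \<Longrightarrow> even_density \<alpha> \<psi> \<Longrightarrow> power_form \<alpha> \<sigma> a b \<phi> \<psi> \<le> ennreal C"
    using bd unfolding even_form_bounded_def by blast
  obtain c1 where c1: "c1 > 0" "\<And>R t x y. R \<ge> 5 \<Longrightarrow> 1 / (2 * R\<^sup>2) \<le> t \<Longrightarrow> t \<le> 1 / R\<^sup>2 \<Longrightarrow> R \<le> x \<Longrightarrow> x \<le> R + 1 / R \<Longrightarrow> R \<le> y \<Longrightarrow> y \<le> R + 1 / R
     \<Longrightarrow> laguerre_kernel \<alpha> t x y \<ge> c1 * R powr (- 2 * \<alpha>)"
    using laguerre_kernel_ge_small_order[OF \<alpha>] by blast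
  \<comment> \<open>Lower bound of \<open>(t R\<^sup>2)\<^sup>\<sigma>\<^sup>-\<^sup>1\<close> for \<open>1/2 \<le> t R\<^sup>2 \<le> 1\<close>, whatever the sign of \<open>\<sigma> - 1\<close>.\<close>
  define c2 where "c2 = (1 / 2) powr \<bar>\<sigma> - 1\<bar>"
  define c where "c = c1 * c2 * (1 / 2) powr (a + b) * (1 / 2) * (2 powr (2 * \<alpha> + 1))\<^sup>2"
  have c: "c > 0" using c1 by (simp add: c_def c2_def)
  obtain R where R: "R \<ge> 5" "c * R powr (2 * ((a + b - 1) * (- \<alpha>) - \<sigma>)) > C"
    using powr_unbounded[OF \<epsilon> c, of 5 C] by blast
  have R0: "R > 0" using R by simp
  define I where "I = {R..R + 1 / R}"
  define P where "P = 1 / (2 * R powr (2 * \<alpha>))"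
  have P: "P > 0" using R0 by (simp add: P_def)
  define \<phi> where "\<phi> x = P * indicator I \<bar>x\<bar>" for x
  have Im [measurable]: "I \<in> sets borel" by (simp add: I_def)
  have \<phi>m [measurable]: "\<phi> \<in> borel_measurable borel" unfolding \<phi>_def by measurable
  have \<phi>0: "\<phi> x \<ge> 0" for x using P by (simp add: \<phi>_def)
  have wI: "emeasure (dunkl_measure \<alpha>) I = (\<integral>\<^sup>+x. ennreal (\<bar>x\<bar> powr (2 * \<alpha> + 1)) * indicator I x \<partial>lborel)"
    using nn_integral_dunkl_measure[of "indicator I" \<alpha>] by simp
  have lenI: "emeasure lborel I = ennreal (1 / R)" using R0 by (simp add: I_def)
  have wI_le: "emeasure (dunkl_measure \<alpha>) I \<le> ennreal (R powr (2 * \<alpha>))"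
  proof -
    have "emeasure (dunkl_measure \<alpha>) I \<le> (\<integral>\<^sup>+x. ennreal (R powr (2 * \<alpha> + 1)) * indicator I x \<partial>lborel)"
      unfolding wI using \<alpha> R0 by (intro nn_integral_mono) (auto simp: I_def indicator_def intro!: ennreal_leI powr_mono2')
    also have "\<dots> = ennreal (R powr (2 * \<alpha> + 1)) * ennreal (1 / R)" by (simp add: nn_integral_cmult lenI)
    also have "\<dots> = ennreal (R powr (2 * \<alpha>))" using R0 by (simp add: ennreal_mult'[symmetric] powr_add)
    finally show ?thesis .
  qed
  have wI_ge: "ennreal (2 powr (2 * \<alpha> + 1) * R powr (2 * \<alpha>)) \<le> emeasure (dunkl_measure \<alpha>) I"
  proof -
    have "1 / R \<le> 1" using R by simp
    hence "1 / R \<le> R" using R by linarith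
    hence x2: "x \<le> 2 * R" if "x \<in> I" for x using that by (simp add: I_def)
    have "ennreal (2 powr (2 * \<alpha> + 1) * R powr (2 * \<alpha>)) = ennreal ((2 * R) powr (2 * \<alpha> + 1)) * ennreal (1 / R)"
      using R0 by (simp add: ennreal_mult'[symmetric] powr_add powr_mult)
    also have "\<dots> = (\<integral>\<^sup>+x. ennreal ((2 * R) powr (2 * \<alpha> + 1)) * indicator I x \<partial>lborel)" by (simp add: nn_integral_cmult lenI)
    also have "\<dots> \<le> emeasure (dunkl_measure \<alpha>) I"
      unfolding wI
    proof (rule nn_integral_mono)
      fix x :: real
      show "ennreal ((2 * R) powr (2 * \<alpha> + 1)) * indicator I x \<le> ennreal (\<bar>x\<bar> powr (2 * \<alpha> + 1)) * indicator I x"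
        using x2[of x] \<alpha> R0 by (cases "x \<in> I") (auto simp: I_def intro!: ennreal_leI powr_mono2')
    qed
    finally show ?thesis .
  qed
  have \<phi>i: "(\<integral>\<^sup>+x. ennreal (\<phi> x) \<partial>dunkl_measure \<alpha>) \<le> 1"
  proof -
    have "(\<integral>\<^sup>+x. ennreal (\<phi> x) \<partial>dunkl_measure \<alpha>) = 2 * (\<integral>\<^sup>+x. ennreal (\<phi> x) * indicator {0<..} x \<partial>dunkl_measure \<alpha>)"
      by (rule nn_integral_dunkl_even) (auto simp: \<phi>_def)
    also have "(\<integral>\<^sup>+x. ennreal (\<phi> x) * indicator {0<..} x \<partial>dunkl_measure \<alpha>) = (\<integral>\<^sup>+x. ennreal P * indicator I x \<partial>dunkl_measure \<alpha>)"
      using R0 by (intro nn_integral_cong) (auto simp: \<phi>_def indicator_def I_def)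
    also have "\<dots> = ennreal P * emeasure (dunkl_measure \<alpha>) I" by (simp add: nn_integral_cmult)
    also have "2 * (ennreal P * emeasure (dunkl_measure \<alpha>) I) \<le> 2 * (ennreal P * ennreal (R powr (2 * \<alpha>)))" by (intro mult_left_mono wI_le) auto
    also have "\<dots> = ennreal (2 * (P * R powr (2 * \<alpha>)))" using ennreal_mult'[of 2 "P * R powr (2 * \<alpha>)"] P by (simp add: ennreal_mult')
    also have "\<dots> = 1" using R0 by (simp add: P_def)
    finally show ?thesis .
  qed
  define J where "J = {1 / (2 * R\<^sup>2)..1 / R\<^sup>2}"
  have [measurable]: "J \<in> sets borel" by (simp add: J_def)
  have lenJ: "emeasure lborel J = ennreal (1 / (2 * R\<^sup>2))" using R0 by (simp add: J_def field_simps)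
  define Q where "Q = c2 * R powr (2 - 2 * \<sigma>) * (c1 * R powr (- 2 * \<alpha>)) * P powr (a + b)"
  have Q: "Q > 0" using c1 R0 P by (simp add: Q_def c2_def)
  have "ennreal (Q * (1 / (2 * R\<^sup>2)) * (2 powr (2 * \<alpha> + 1) * R powr (2 * \<alpha>)) * (2 powr (2 * \<alpha> + 1) * R powr (2 * \<alpha>)))
     = ennreal Q * ennreal (1 / (2 * R\<^sup>2)) * ennreal (2 powr (2 * \<alpha> + 1) * R powr (2 * \<alpha>)) * ennreal (2 powr (2 * \<alpha> + 1) * R powr (2 * \<alpha>))"
  proof -
    have n1: "0 \<le> 1 / (2 * R\<^sup>2)" and n2: "0 \<le> 2 powr (2 * \<alpha> + 1) * R powr (2 * \<alpha>)" by simp_all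
    show ?thesis by (simp only: ennreal_mult''[OF n1] ennreal_mult''[OF n2])
  qed
  also have "\<dots> \<le> ennreal Q * ennreal (1 / (2 * R\<^sup>2)) * emeasure (dunkl_measure \<alpha>) I * emeasure (dunkl_measure \<alpha>) I"
    by (intro mult_mono wI_ge) auto
  also have "\<dots> = (\<integral>\<^sup>+t. \<integral>\<^sup>+x. \<integral>\<^sup>+y. ennreal Q * indicator J t * indicator I x * indicator I y \<partial>dunkl_measure \<alpha> \<partial>dunkl_measure \<alpha> \<partial>lborel)"
    by (simp add: nn_integral_cmult nn_integral_multc lenJ mult_ac)
  also have "\<dots> \<le> power_form \<alpha> \<sigma> a b \<phi> \<phi>"
    unfolding potential_form_def
  proof (intro nn_integral_mono)
    fix t x y :: real
    show "ennreal Q * indicator J t * indicator I x * indicator I y \<le> potential_weight \<alpha> \<sigma> t x y * (ennreal (\<phi> y powr a) * ennreal (\<phi> x powr b))"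
    proof (cases "t \<in> J \<and> x \<in> I \<and> y \<in> I")
      case True
      have t: "1 / (2 * R\<^sup>2) \<le> t" "t \<le> 1 / R\<^sup>2" and xy: "R \<le> x" "x \<le> R + 1 / R" "R \<le> y" "y \<le> R + 1 / R" using True by (auto simp: J_def I_def)
      have t0: "t > 0" using t R0 by (meson divide_pos_pos less_le_trans mult_pos_pos zero_less_numeral zero_less_one zero_less_power)
      define z where "z = t * R\<^sup>2"
      have z: "1/2 \<le> z" "z \<le> 1" using t R0 by (auto simp: z_def field_simps)
      have "c2 \<le> z powr (\<sigma> - 1)"
      proof (cases "\<sigma> \<ge> 1")
        case True
        thus ?thesis using z by (auto simp: c2_def intro!: powr_mono2)
      next
        case False
        have "c2 \<le> 1" by (simp add: c2_def powr_le1)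
        also have "1 \<le> z powr (\<sigma> - 1)" using powr_mono2'[of "\<sigma> - 1" z 1] z False by simp
        finally show ?thesis .
      qed
      moreover have "t powr (\<sigma> - 1) = z powr (\<sigma> - 1) * R powr (2 - 2 * \<sigma>)"
      proof -
        have "t = z * R powr (- 2)" using R0 by (simp add: z_def powr_minus)
        hence "t powr (\<sigma> - 1) = z powr (\<sigma> - 1) * (R powr (- 2)) powr (\<sigma> - 1)" using z by (simp add: powr_mult)
        also have "(R powr (- 2)) powr (\<sigma> - 1) = R powr (2 - 2 * \<sigma>)" by (simp add: powr_powr algebra_simps)
        finally show ?thesis .
      qed
      ultimately have 1: "c2 * R powr (2 - 2 * \<sigma>) \<le> t powr (\<sigma> - 1)" by (simp add: mult_right_mono)
      have 2: "c1 * R powr (- 2 * \<alpha>) \<le> laguerre_kernel \<alpha> t x y" by (rule c1(2)[OF R(1) t xy])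
      have "(c2 * R powr (2 - 2 * \<sigma>)) * (c1 * R powr (- 2 * \<alpha>)) \<le> t powr (\<sigma> - 1) * laguerre_kernel \<alpha> t x y"
        using 1 2 c1 by (intro mult_mono) (auto simp: c2_def)
      hence "Q \<le> t powr (\<sigma> - 1) * laguerre_kernel \<alpha> t x y * P powr (a + b)" unfolding Q_def by (intro mult_right_mono) auto
      also have "\<dots> = t powr (\<sigma> - 1) * laguerre_kernel \<alpha> t x y * (\<phi> y powr a * \<phi> x powr b)"
        using True xy R0 by (simp add: \<phi>_def powr_add)
      finally have "ennreal Q \<le> ennreal (t powr (\<sigma> - 1) * laguerre_kernel \<alpha> t x y * (\<phi> y powr a * \<phi> x powr b))" by (rule ennreal_leI)
      also have "\<dots> = potential_weight \<alpha> \<sigma> t x y * (ennreal (\<phi> y powr a) * ennreal (\<phi> x powr b))"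
        using t0 by (simp add: potential_weight_def ennreal_mult'')
      finally show ?thesis using True by simp
    qed auto
  qed
  also have "\<dots> \<le> ennreal C" using \<phi>0 \<phi>i by (intro C(2)) (auto simp: even_density_def \<phi>_def)
  finally have "Q * (1 / (2 * R\<^sup>2)) * (2 powr (2 * \<alpha> + 1) * R powr (2 * \<alpha>)) * (2 powr (2 * \<alpha> + 1) * R powr (2 * \<alpha>)) \<le> C" using C(1) by simp
  moreover have "Q * (1 / (2 * R\<^sup>2)) * (2 powr (2 * \<alpha> + 1) * R powr (2 * \<alpha>)) * (2 powr (2 * \<alpha> + 1) * R powr (2 * \<alpha>)) = c * R powr (2 * ((a + b - 1) * (- \<alpha>) - \<sigma>))"
  proof -
    have Pp: "P powr (a + b) = (1 / 2) powr (a + b) * R powr (- 2 * \<alpha> * (a + b))"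
      using R0 by (simp add: P_def powr_divide powr_mult powr_powr powr_minus_divide)
    have R2: "1 / (2 * R\<^sup>2) = (1 / 2) * R powr (- 2)" using R0 by (simp add: powr_minus_divide)
    have "R powr (2 - 2 * \<sigma>) * R powr (- 2 * \<alpha>) * R powr (- 2 * \<alpha> * (a + b)) * R powr (- 2) * R powr (2 * \<alpha>) * R powr (2 * \<alpha>) = R powr (2 * ((a + b - 1) * (- \<alpha>) - \<sigma>))"
      by (simp only: powr_add[symmetric]) (simp add: algebra_simps)
    moreover have "x2 * r1 * (x1 * r2) * (h * r3) * (1 / 2 * r4) * (d * r5) * (d * r5) = x1 * x2 * h * (1 / 2) * d\<^sup>2 * (r1 * r2 * r3 * r4 * r5 * r5)"
      for x1 x2 h d r1 r2 r3 r4 r5 :: real by (simp add: power2_eq_square)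
    ultimately show ?thesis unfolding Q_def Pp R2 c_def by (simp only:)
  qed
  ultimately show False using R by linarith
qed

section \<open>The boundedness theorem\<close>

lemma dunkl_potential_bounded_iff_large_order:
  assumes \<alpha>: "\<alpha> \<ge> -1/2" and \<sigma>: "\<sigma> > 0" and a: "0 \<le> a" "a \<le> 1" and b: "0 \<le> b" "b \<le> 1"
  shows "dunkl_potential_bounded \<alpha> \<sigma> (Lebesgue_exponent a) (Lebesgue_exponent (1 - b)) \<longleftrightarrow>
    (\<alpha> + 1) * (a + b - 1) \<le> \<sigma> \<and> (\<alpha> + 1) * (1 - a - b) < \<sigma> \<and> \<not> (b = 1 \<and> \<sigma> = (\<alpha> + 1) * a) \<and> \<not> (a = 1 \<and> \<sigma> = (\<alpha> + 1) * b)"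
    (is "?B \<longleftrightarrow> ?C")
proof
  have \<alpha>1: "\<alpha> > -1" using \<alpha> by linarith
  assume ?B
  hence E: "even_form_bounded \<alpha> \<sigma> a b" by (rule even_form_bounded_if_dunkl_potential_bounded[OF \<alpha>1 \<sigma> a(1) b])
  have "\<not> (\<sigma> = (\<alpha> + 1) * c)" if "even_form_bounded \<alpha> \<sigma> c 1" "0 \<le> c" "c \<le> 1" for c
  proof
    assume s: "\<sigma> = (\<alpha> + 1) * c"
    show False
    proof (cases "c = 1")
      case True
      thus False using necessary_corner[OF \<alpha>1, of \<sigma>] s that by simp
    next
      case False
      moreover have "c \<noteq> 0" using s \<sigma> by auto
      ultimately show False using necessary_endpoint[OF \<alpha>1 _ _ s] that by simp
    qed
  qed
  hence e: "\<not> (b = 1 \<and> \<sigma> = (\<alpha> + 1) * a)" "\<not> (a = 1 \<and> \<sigma> = (\<alpha> + 1) * b)"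
    using E even_form_bounded_commute[OF E] a b by auto
  have "(\<alpha> + 1) * (a + b - 1) \<le> \<sigma>"
  proof (cases "a + b > 1")
    case True
    hence "a > 0" "b > 0" using a b by linarith+
    thus ?thesis using necessary_scaling[OF \<alpha>1 \<sigma>] a b E by blast
  next
    case False
    hence "(\<alpha> + 1) * (a + b - 1) \<le> 0" using \<alpha>1 by (intro mult_nonneg_nonpos) auto
    thus ?thesis using \<sigma> by linarith
  qed
  thus ?C using e necessary_decay[OF \<alpha>1 \<sigma> a b E] by blast
next
  have \<alpha>1: "\<alpha> > -1" using \<alpha> by linarith
  assume C: ?C
  have "form_bounded \<alpha> \<sigma> a b"
  proof (cases "a + b \<le> 1")
    case True
    thus ?thesis using C by (intro form_bounded_if_q_le_p[OF \<alpha>1 \<sigma> a(1) b(1)]) auto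
  next
    case False
    hence ab: "a + b > 1" by simp
    show ?thesis
    proof (cases "(\<alpha> + 1) * (a + b - 1) < \<sigma>")
      case True
      thus ?thesis using form_bounded_subcritical[OF \<alpha> a(2) b(2) ab] by blast
    next
      case False
      hence s: "\<sigma> = (\<alpha> + 1) * (a + b - 1)" using C by linarith
      have "a \<noteq> 1" "b \<noteq> 1" using C s by auto
      thus ?thesis using a b ab s by (intro form_bounded_critical[OF \<alpha>]) auto
    qed
  qed
  thus ?B by (rule dunkl_potential_bounded_if_form_bounded[OF \<alpha>1 \<sigma> a(1) b])
qed

lemma dunkl_potential_bounded_iff_small_order:
  assumes \<alpha>: "\<alpha> > -1" "\<alpha> < -1/2" and \<sigma>: "\<sigma> > 0" and a: "0 \<le> a" "a \<le> 1" and b: "0 \<le> b" "b \<le> 1"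
  shows "dunkl_potential_bounded \<alpha> \<sigma> (Lebesgue_exponent a) (Lebesgue_exponent (1 - b)) \<longleftrightarrow>
    (a + b - 1) * (- \<alpha>) \<le> \<sigma> \<and> (\<alpha> + 1) * (1 - a - b) < \<sigma>"
    (is "?B \<longleftrightarrow> ?C")
proof
  assume ?B
  hence E: "even_form_bounded \<alpha> \<sigma> a b" by (rule even_form_bounded_if_dunkl_potential_bounded[OF \<alpha>(1) \<sigma> a(1) b])
  show ?C using necessary_small_order[OF \<alpha> a(1) b(1) E] necessary_decay[OF \<alpha>(1) \<sigma> a b E] by blast
next
  assume C: ?C
  have "form_bounded \<alpha> \<sigma> a b"
  proof (cases "a + b \<le> 1")
    case True
    thus ?thesis using C by (intro form_bounded_if_q_le_p[OF \<alpha>(1) \<sigma> a(1) b(1)]) auto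
  next
    case False
    thus ?thesis using C form_bounded_small_order[OF \<alpha> a(2) b(2)] by auto
  qed
  thus ?B by (rule dunkl_potential_bounded_if_form_bounded[OF \<alpha>(1) \<sigma> a(1) b])
qed

lemma Lebesgue_exponent_cases:
  assumes "1 \<le> p"
  obtains a where "0 \<le> a" "a \<le> 1" "p = Lebesgue_exponent a" "1 / p = ereal a"
proof (cases p)
  case (real r)
  hence "r \<ge> 1" using assms by simp
  thus ?thesis using that[of "1 / r"] real by (simp add: Lebesgue_exponent_def one_ereal_def)
next
  case PInf
  thus ?thesis using that[of 0] by (simp add: Lebesgue_exponent_def zero_ereal_def)
qed (use assms in auto)

theorem theorem2p6:
  fixes \<alpha> \<sigma> :: real and p q :: ereal
  assumes "\<alpha> > -1" and "\<sigma> > 0" and "1 \<le> p" and "1 \<le> q"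
  shows "(\<alpha> \<ge> -1/2 \<longrightarrow>
            (dunkl_potential_bounded \<alpha> \<sigma> p q \<longleftrightarrow>
               1/p - ereal (\<sigma> / (\<alpha> + 1)) \<le> 1/q \<and> 1/q < 1/p + ereal (\<sigma> / (\<alpha> + 1)) \<and>
               (1/p, 1/q) \<notin> {(ereal (\<sigma> / (\<alpha> + 1)), 0), (1, 1 - ereal (\<sigma> / (\<alpha> + 1)))})) \<and>
         (\<alpha> < -1/2 \<longrightarrow>
            (dunkl_potential_bounded \<alpha> \<sigma> p q \<longleftrightarrow>
               1/p + ereal (\<sigma> / \<alpha>) \<le> 1/q \<and> 1/q < 1/p + ereal (\<sigma> / (\<alpha> + 1))))"
proof -
  obtain a where a: "0 \<le> a" "a \<le> 1" "p = Lebesgue_exponent a" "1 / p = ereal a"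
    using Lebesgue_exponent_cases[OF assms(3)] .
  obtain c where c: "0 \<le> c" "c \<le> 1" "q = Lebesgue_exponent c" "1 / q = ereal c"
    using Lebesgue_exponent_cases[OF assms(4)] .
  define b where "b = 1 - c"
  have b: "0 \<le> b" "b \<le> 1" "c = 1 - b" using c by (auto simp: b_def)
  have \<alpha>0: "\<alpha> + 1 > 0" using assms(1) by simp
  have upper: "1/q < 1/p + ereal (\<sigma> / (\<alpha> + 1)) \<longleftrightarrow> (\<alpha> + 1) * (1 - a - b) < \<sigma>"
    using \<alpha>0 unfolding a(4) c(4) b(3) by (simp add: field_simps)
  have lower: "1/p - ereal (\<sigma> / (\<alpha> + 1)) \<le> 1/q \<longleftrightarrow> (\<alpha> + 1) * (a + b - 1) \<le> \<sigma>"
    using \<alpha>0 unfolding a(4) c(4) b(3) by (simp add: field_simps)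
  have corners: "(1/p, 1/q) \<notin> {(ereal (\<sigma> / (\<alpha> + 1)), 0), (1, 1 - ereal (\<sigma> / (\<alpha> + 1)))}
     \<longleftrightarrow> \<not> (b = 1 \<and> \<sigma> = (\<alpha> + 1) * a) \<and> \<not> (a = 1 \<and> \<sigma> = (\<alpha> + 1) * b)"
    using \<alpha>0 unfolding a(4) c(4) b(3) by (auto simp: one_ereal_def zero_ereal_def field_simps)
  have lower': "1/p + ereal (\<sigma> / \<alpha>) \<le> 1/q \<longleftrightarrow> (a + b - 1) * (- \<alpha>) \<le> \<sigma>" if "\<alpha> < -1/2"
  proof -
    have "a + \<sigma> / \<alpha> \<le> 1 - b \<longleftrightarrow> (a + b - 1) * (- \<alpha>) \<le> \<sigma>" using that by (simp add: field_simps)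
    thus ?thesis unfolding a(4) c(4) b(3) by simp
  qed
  show ?thesis
    using dunkl_potential_bounded_iff_large_order[OF _ assms(2) a(1,2) b(1,2)]
      dunkl_potential_bounded_iff_small_order[OF assms(1) _ assms(2) a(1,2) b(1,2)]
      upper lower corners lower'
    unfolding a(3) c(3) b(3) by blast
qed

end
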